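(* Let $(c_L,c_M,h_L,h_M)\in\mathbb C^4$ with $c_M\ne0$ be such that $2h_M+\frac{p^2-1}{12}c_M=0$ for some $p\in\mathbb Z_+$ and $h_L=h'_{p,r}$ for some $r\in\mathbb Z_+$. Then there are $v_i\in U(\mathcal M_-)_{ip}$ ($1\le i\le r$) such that $$u'_{p,r}=\left(\mathrm T^r+v_1\mathrm T^{r-1}+\cdots+v_{r-1}\mathrm T+v_r\right)\mathbf 1$$ is a subsingular vector of the Verma module $V_{W(2,2)}(h_L,h_M,c_L,c_M)$ over $W(2,2)$, and it is the unique one up to a scalar multiple (uniqueness being understood modulo the submodule $J'$).
   Context: $W(2,2)$ is the complex Lie algebra with basis $L_n,M_n$ ($n\in\mathbb Z$), $\mathbf c_L,\mathbf c_M$ and brackets $[L_m,L_n]=(m-n)L_{m+n}+\frac1{12}\delta_{m+n,0}(m^3-m)\mathbf c_L$, $[L_m,M_n]=(m-n)M_{m+n}+\frac1{12}\delta_{m+n,0}(m^3-m)\mathbf c_M$, $[M_m,M_n]=0$, with $\mathbf c_L,\mathbf c_M$ central. $V_{W(2,2)}(h_L,h_M,c_L,c_M)$ is the Verma module generated freely over the negative part by a highest weight vector $\mathbf 1$ annihilated by all $L_n,M_n$ with $n>0$, on which $\mathbf c_L,\mathbf c_M,L_0,M_0$ act by $c_L,c_M,h_L,h_M$. A singular vector (in a highest weight module) is a nonzero common eigenvector of $L_0,M_0,\mathbf c_L,\mathbf c_M$ annihilated by all $L_n,M_n$ with $n>0$. Let $J'$ be the submodule of the Verma module generated by all singular vectors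 not in $\mathbb C\mathbf 1$. A subsingular vector is an $L_0$-eigenvector $u'$ of the Verma module whose image modulo $J'$ is a singular vector not proportional to the image of $\mathbf 1$. $\mathbb Z_+=\{1,2,\dots\}$. $U(\mathcal M_-)$ is the polynomial algebra in the $M_{-i}$, $i\ge1$, and $U(\mathcal M_-)_n$ is the span of the monomials $M_{-\lambda}=M_{-\lambda_1}\cdots M_{-\lambda_k}$ with $\lambda$ a partition of $n$. $\mathcal P(p)$ is the set of partitions of $p$, and $\ell(\nu)$ is the number of parts of $\nu$. For $r\in\mathbb Z_+$: $h'_{p,r}=-\frac{p^2-1}{24}c_L+\frac{(13p+1)(p-1)}{12}+\frac{(1-r)p}{2}$. The element $\mathrm T$ (depending only on $p,c_L,c_M$) is $$\mathrm T=L_{-p}+\sum_{i=1}^{p-1}g_{p-i}(M)L_{-i}+\sum_{\nu\in\mathcal P(p),\,\ell(\nu)\ge2}d_\nu M_{-\nu},$$ where, with $k_i=\frac{12}{i(p-i)c_M}$, $g_1(M)=k_1M_{-1}$ and $g_i(M)=k_iM_{-i}+k_i\sum_{j=1}^{i-1}\left(1-\frac{j}{2p-i}\right)g_j(M)M_{-(i-j)}$ for $2\le i\le p-1$, and the $d_\nu\in\mathbb C$ are the coefficients determined by the conditions $L_i\mathrm T\mathbf 1=0$, $i=p-1,p-2,\dots,1$, in the Verma module with $h_L=h'_{p,1}$ and $h_M=-\frac{p^2-1}{24}c_M$. *)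

theory Defs
  imports Complex_Main "HOL-Library.Poly_Mapping"
begin

subsection \<open>Left and two-sided ideals\<close>

definition left_ideal :: "'a::ring_1 set \<Rightarrow> bool" where
  "left_ideal I \<longleftrightarrow>
     0 \<in> I \<and> (\<forall>x\<in>I. \<forall>y\<in>I. x + y \<in> I) \<and> (\<forall>a. \<forall>x\<in>I. a * x \<in> I)"

definition two_sided_ideal :: "'a::ring_1 set \<Rightarrow> bool" where
  "two_sided_ideal I \<longleftrightarrow> left_ideal I \<and> (\<forall>a. \<forall>x\<in>I. x * a \<in> I)"

lemma left_ideal_hull: "left_ideal (left_ideal hull S)"
  by (rule hull_in) (auto simp: left_ideal_def)

lemma two_sided_ideal_hull: "two_sided_ideal (two_sided_ideal hull S)"
  by (rule hull_in) (auto simp: two_sided_ideal_def left_ideal_def)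

subsection \<open>The Lie algebra \<open>W(2,2)\<close> and its universal enveloping algebra\<close>

datatype w22_basis = Lg int | Mg int | CLg | CMg

text \<open>
  The free associative algebra on the basis is the monoid algebra of the free monoid of words.
  Words are wrapped in a datatype because \<^class>\<open>monoid_add\<close>, which the convolution product
  of \<^type>\<open>poly_mapping\<close> is built on, has no instance for lists.
\<close>

datatype w22_word = Word "w22_basis list"

instantiation w22_word :: monoid_add
begin

definition zero_w22_word :: w22_word where
  "0 = Word []"

fun plus_w22_word :: "w22_word \<Rightarrow> w22_word \<Rightarrow> w22_word" where
  "Word xs + Word ys = Word (xs @ ys)"

instance
proof
  fix a b c :: w22_word
  show "a + b + c = a + (b + c)" by (cases a; cases b; cases c) simp
  show "0 + a = a" by (cases a) (simp add: zero_w22_word_def)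
  show "a + 0 = a" by (cases a) (simp add: zero_w22_word_def)
qed

end

type_synonym w22_free = "w22_word \<Rightarrow>\<^sub>0 complex"

definition fgen :: "w22_basis \<Rightarrow> w22_free" where
  "fgen x = Poly_Mapping.single (Word [x]) 1"

definition fconst :: "complex \<Rightarrow> w22_free" where
  "fconst c = Poly_Mapping.single 0 c"

fun w22_bracket :: "w22_basis \<Rightarrow> w22_basis \<Rightarrow> w22_free" where
  "w22_bracket (Lg m) (Lg n) = fconst (of_int (m - n)) * fgen (Lg (m + n))
     + (if m + n = 0 then fconst (of_int (m ^ 3 - m) / 12) * fgen CLg else 0)"
| "w22_bracket (Lg m) (Mg n) = fconst (of_int (m - n)) * fgen (Mg (m + n))
     + (if m + n = 0 then fconst (of_int (m ^ 3 - m) / 12) * fgen CMg else 0)"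
| "w22_bracket (Mg m) (Lg n) = - (fconst (of_int (n - m)) * fgen (Mg (n + m))
     + (if n + m = 0 then fconst (of_int (n ^ 3 - n) / 12) * fgen CMg else 0))"
| "w22_bracket _ _ = 0"

definition w22_relators :: "w22_free set" where
  "w22_relators = {fgen x * fgen y - fgen y * fgen x - w22_bracket x y | x y. True}"

definition w22_ideal :: "w22_free set" where
  "w22_ideal = two_sided_ideal hull w22_relators"

definition w22_eq :: "w22_free \<Rightarrow> w22_free \<Rightarrow> bool" where
  "w22_eq x y \<longleftrightarrow> x - y \<in> w22_ideal"

lemma w22_ideal_zero: "0 \<in> w22_ideal"
  and w22_ideal_add: "x \<in> w22_ideal \<Longrightarrow> y \<in> w22_ideal \<Longrightarrow> x + y \<in> w22_ideal"
  and w22_ideal_mult_left: "x \<in> w22_ideal \<Longrightarrow> a * x \<in> w22_ideal"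
  and w22_ideal_mult_right: "x \<in> w22_ideal \<Longrightarrow> x * a \<in> w22_ideal"
  using two_sided_ideal_hull[of w22_relators]
  unfolding w22_ideal_def two_sided_ideal_def left_ideal_def by blast+

lemma w22_ideal_uminus: "x \<in> w22_ideal \<Longrightarrow> - x \<in> w22_ideal"
  using w22_ideal_mult_left[of x "- 1"] by simp

lemma w22_ideal_diff: "x \<in> w22_ideal \<Longrightarrow> y \<in> w22_ideal \<Longrightarrow> x - y \<in> w22_ideal"
  using w22_ideal_add[of x "- y"] w22_ideal_uminus[of y] by simp

lemma w22_word_add_eq_0: "0 = a + b \<longleftrightarrow> a = 0 \<and> b = (0::w22_word)"
  by (cases a; cases b) (auto simp: zero_w22_word_def)

lemma lookup_mult_0:
  "Poly_Mapping.lookup (f * g) 0 = Poly_Mapping.lookup f 0 * Poly_Mapping.lookup (g :: w22_free) 0"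
proof -
  have "(\<Sum>q. Poly_Mapping.lookup g q when 0 = l + q) = (Poly_Mapping.lookup g 0 when l = 0)" for l
  proof -
    have "(\<lambda>q. Poly_Mapping.lookup g q when 0 = l + q)
        = (\<lambda>q. (Poly_Mapping.lookup g 0 when l = 0) when q = 0)"
      by (auto simp: fun_eq_iff when_def w22_word_add_eq_0)
    then show ?thesis by (simp only: Sum_any_when_equal)
  qed
  then have "Poly_Mapping.lookup (f * g) 0
      = (\<Sum>l. Poly_Mapping.lookup f l * (Poly_Mapping.lookup g 0 when l = 0))"
    by (simp add: lookup_mult)
  also have "(\<lambda>l. Poly_Mapping.lookup f l * (Poly_Mapping.lookup g 0 when l = 0))
      = (\<lambda>l. (Poly_Mapping.lookup f 0 * Poly_Mapping.lookup g 0) when l = 0)"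
    by (auto simp: fun_eq_iff when_def)
  finally show ?thesis by simp
qed

lemma lookup_fgen_0: "Poly_Mapping.lookup (fgen x) 0 = 0"
  by (simp add: fgen_def zero_w22_word_def lookup_single when_def)

lemma lookup_w22_bracket_0: "Poly_Mapping.lookup (w22_bracket x y) 0 = 0"
  by (induction x y rule: w22_bracket.induct)
     (auto simp: lookup_add lookup_minus lookup_mult_0 lookup_fgen_0)

lemma one_notin_w22_ideal: "1 \<notin> w22_ideal"
proof
  let ?A = "{x :: w22_free. Poly_Mapping.lookup x 0 = 0}"
  have "two_sided_ideal ?A"
    by (auto simp: two_sided_ideal_def left_ideal_def lookup_add lookup_mult_0)
  moreover have "w22_relators \<subseteq> ?A"
    by (auto simp: w22_relators_def lookup_minus lookup_mult_0 lookup_fgen_0 lookup_w22_bracket_0)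
  ultimately have "w22_ideal \<subseteq> ?A"
    unfolding w22_ideal_def by (intro hull_minimal)
  moreover assume "1 \<in> w22_ideal"
  ultimately show False by (auto simp: lookup_one)
qed

text \<open>The universal enveloping algebra of \<open>W(2,2)\<close>.\<close>

quotient_type U22 = w22_free / w22_eq
proof (rule equivpI)
  show "reflp w22_eq"
    by (rule reflpI) (simp add: w22_eq_def w22_ideal_zero)
  show "symp w22_eq"
  proof (rule sympI)
    fix x y assume "w22_eq x y"
    then show "w22_eq y x"
      using w22_ideal_uminus[of "x - y"] by (simp add: w22_eq_def)
  qed
  show "transp w22_eq"
  proof (rule transpI)
    fix x y z assume "w22_eq x y" "w22_eq y z"
    then show "w22_eq x z"
      using w22_ideal_add[of "x - y" "y - z"] by (simp add: w22_eq_def)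
  qed
qed

instantiation U22 :: ring_1
begin

lift_definition zero_U22 :: U22 is 0 .

lift_definition one_U22 :: U22 is 1 .

lift_definition plus_U22 :: "U22 \<Rightarrow> U22 \<Rightarrow> U22" is "(+)"
  unfolding w22_eq_def
  subgoal for x x' y y'
    using w22_ideal_add[of "x - x'" "y - y'"] by (simp add: algebra_simps)
  done

lift_definition minus_U22 :: "U22 \<Rightarrow> U22 \<Rightarrow> U22" is "(-)"
  unfolding w22_eq_def
  subgoal for x x' y y'
    using w22_ideal_diff[of "x - x'" "y - y'"] by (simp add: algebra_simps)
  done

lift_definition uminus_U22 :: "U22 \<Rightarrow> U22" is "uminus"
  unfolding w22_eq_def
  subgoal for x x'
    using w22_ideal_uminus[of "x - x'"] by simp
  done

lift_definition times_U22 :: "U22 \<Rightarrow> U22 \<Rightarrow> U22" is "(*)"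
  unfolding w22_eq_def
  subgoal for x x' y y'
    using w22_ideal_add[OF w22_ideal_mult_right[of "x - x'" y] w22_ideal_mult_left[of "y - y'" x']]
    by (simp add: algebra_simps)
  done

instance
proof
  fix a b c :: U22
  show "a + b + c = a + (b + c)"
    by transfer (simp add: w22_eq_def w22_ideal_zero algebra_simps)
  show "a + b = b + a"
    by transfer (simp add: w22_eq_def w22_ideal_zero algebra_simps)
  show "0 + a = a"
    by transfer (simp add: w22_eq_def w22_ideal_zero)
  show "- a + a = 0"
    by transfer (simp add: w22_eq_def w22_ideal_zero)
  show "a - b = a + - b"
    by transfer (simp add: w22_eq_def w22_ideal_zero)
  show "a * b * c = a * (b * c)"
    by transfer (simp add: w22_eq_def w22_ideal_zero mult.assoc)
  show "(a + b) * c = a * c + b * c"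
    by transfer (simp add: w22_eq_def w22_ideal_zero distrib_right)
  show "a * (b + c) = a * b + a * c"
    by transfer (simp add: w22_eq_def w22_ideal_zero distrib_left)
  show "1 * a = a"
    by transfer (simp add: w22_eq_def w22_ideal_zero)
  show "a * 1 = a"
    by transfer (simp add: w22_eq_def w22_ideal_zero)
  show "(0::U22) \<noteq> 1"
    by transfer (use w22_ideal_uminus[of "- 1"] one_notin_w22_ideal in \<open>auto simp: w22_eq_def\<close>)
qed

end

lift_definition L :: "int \<Rightarrow> U22" is "\<lambda>n. fgen (Lg n)" .
lift_definition M :: "int \<Rightarrow> U22" is "\<lambda>n. fgen (Mg n)" .
lift_definition CL :: U22 is "fgen CLg" .
lift_definition CM :: U22 is "fgen CMg" .

text \<open>Multiplication by the central element \<open>scal c\<close> is scalar multiplication by \<open>c\<close>.\<close>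

lift_definition scal :: "complex \<Rightarrow> U22" is fconst .

subsection \<open>Verma modules, singular and subsingular vectors\<close>

text \<open>
  The Verma module is the induced module \<open>U/I\<close> with \<open>I = verma_ideal h\<^sub>L h\<^sub>M c\<^sub>L c\<^sub>M\<close>, and
  the highest weight vector is the class of \<open>1\<close>.  Vectors of a cyclic module \<open>U/N\<close> are given by
  representatives: \<open>u\<close> stands for \<open>u + N\<close>, that is, for \<open>u\<close> applied to the highest weight vector.
  Submodules of \<open>U/N\<close> correspond to left ideals containing \<open>N\<close>.
\<close>

definition verma_ideal :: "complex \<Rightarrow> complex \<Rightarrow> complex \<Rightarrow> complex \<Rightarrow> U22 set" where
  "verma_ideal hL hM cL cM = left_ideal hull
     ({L n | n. n > 0} \<union> {M n | n. n > 0}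
      \<union> {L 0 - scal hL, M 0 - scal hM, CL - scal cL, CM - scal cM})"

definition eigenvector_mod :: "U22 set \<Rightarrow> U22 \<Rightarrow> U22 \<Rightarrow> bool" where
  "eigenvector_mod N x u \<longleftrightarrow> u \<notin> N \<and> (\<exists>a. x * u - scal a * u \<in> N)"

definition singular_mod :: "U22 set \<Rightarrow> U22 \<Rightarrow> bool" where
  "singular_mod N u \<longleftrightarrow>
     eigenvector_mod N (L 0) u \<and> eigenvector_mod N (M 0) u
     \<and> eigenvector_mod N CL u \<and> eigenvector_mod N CM u
     \<and> (\<forall>n>0. L n * u \<in> N \<and> M n * u \<in> N)"

text \<open>The class of \<open>u\<close> in \<open>U/N\<close> lies on the line spanned by the class of \<open>1\<close>.\<close>

definition in_vacuum_line :: "U22 set \<Rightarrow> U22 \<Rightarrow> bool" where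
  "in_vacuum_line N u \<longleftrightarrow> (\<exists>a. u - scal a \<in> N)"

text \<open>The full preimage in \<open>U\<close> of the submodule \<open>J'\<close> of the Verma module.\<close>

definition J' :: "complex \<Rightarrow> complex \<Rightarrow> complex \<Rightarrow> complex \<Rightarrow> U22 set" where
  "J' hL hM cL cM = (let I = verma_ideal hL hM cL cM in
     left_ideal hull (I \<union> {u. singular_mod I u \<and> \<not> in_vacuum_line I u}))"

definition subsingular :: "complex \<Rightarrow> complex \<Rightarrow> complex \<Rightarrow> complex \<Rightarrow> U22 \<Rightarrow> bool" where
  "subsingular hL hM cL cM u \<longleftrightarrow>
     eigenvector_mod (verma_ideal hL hM cL cM) (L 0) u
     \<and> singular_mod (J' hL hM cL cM) u
     \<and> \<not> in_vacuum_line (J' hL hM cL cM) u"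

subsection \<open>The element \<open>T\<close>\<close>

definition partitions_of :: "nat \<Rightarrow> nat list set" where
  "partitions_of n = {\<nu>. sorted_wrt (\<ge>) \<nu> \<and> (\<forall>i\<in>set \<nu>. i \<ge> 1) \<and> sum_list \<nu> = n}"

definition M_part :: "nat list \<Rightarrow> U22" where
  "M_part \<nu> = prod_list (map (\<lambda>i. M (- int i)) \<nu>)"

definition UM :: "nat \<Rightarrow> U22 set" where
  "UM n = {\<Sum>\<nu>\<in>partitions_of n. scal (c \<nu>) * M_part \<nu> | c. True}"

definition kcoef :: "nat \<Rightarrow> complex \<Rightarrow> nat \<Rightarrow> complex" where
  "kcoef p cM i = 12 / (of_nat i * (of_nat p - of_nat i) * cM)"

text \<open>Only used for \<open>1 \<le> i \<le> p - 1\<close>; for \<open>i = 1\<close> the inner sum is empty.\<close>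

fun gM :: "nat \<Rightarrow> complex \<Rightarrow> nat \<Rightarrow> U22" where
  "gM p cM i = scal (kcoef p cM i) * M (- int i)
     + scal (kcoef p cM i) * (\<Sum>j\<in>{1..<i}.
         scal (1 - of_nat j / (2 * of_nat p - of_nat i)) * gM p cM j * M (- int (i - j)))"

declare gM.simps [simp del]

definition h' :: "nat \<Rightarrow> nat \<Rightarrow> complex \<Rightarrow> complex" where
  "h' p r cL = - ((of_nat p ^ 2 - 1) / 24) * cL
     + (13 * of_nat p + 1) * (of_nat p - 1) / 12 + (1 - of_nat r) * of_nat p / 2"

definition T_with :: "nat \<Rightarrow> complex \<Rightarrow> (nat list \<Rightarrow> complex) \<Rightarrow> U22" where
  "T_with p cM d = L (- int p) + (\<Sum>i=1..p-1. gM p cM (p - i) * L (- int i))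
     + (\<Sum>\<nu> | \<nu> \<in> partitions_of p \<and> length \<nu> \<ge> 2. scal (d \<nu>) * M_part \<nu>)"

text \<open>The support condition only normalizes the function off the index set of the \<open>d\<^sub>\<nu>\<close>.\<close>

definition d_coeffs :: "nat \<Rightarrow> complex \<Rightarrow> complex \<Rightarrow> nat list \<Rightarrow> complex" where
  "d_coeffs p cL cM = (THE d.
     (\<forall>\<nu>. \<not> (\<nu> \<in> partitions_of p \<and> length \<nu> \<ge> 2) \<longrightarrow> d \<nu> = 0)
     \<and> (\<forall>i\<in>{1..p-1}. L (int i) * T_with p cM d
          \<in> verma_ideal (h' p 1 cL) (- ((of_nat p ^ 2 - 1) / 24) * cM) cL cM))"

definition T :: "nat \<Rightarrow> complex \<Rightarrow> complex \<Rightarrow> U22" where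
  "T p cL cM = T_with p cM (d_coeffs p cL cM)"

end

theory Submission
  imports Defs "HOL-Library.Multiset" "HOL-Library.Countable"
begin

text \<open>
  Everything about the action of the \<open>M\<^sub>n\<close> is governed by the scalars
  \<open>phi n = 2 n h\<^sub>M + (n^3 - n) c\<^sub>M / 12 = n c\<^sub>M (n^2 - p^2) / 12\<close>, by which the commutator of \<open>L\<^sub>n\<close> with
  \<open>M\<^sub>-\<^sub>n\<close> acts on the highest weight vector. For \<open>n \<ge> 1\<close> they vanish exactly at \<open>n = p\<close>. So
  products of \<open>L\<^sub>n\<close> pair with monomials in the \<open>M\<^sub>-\<^sub>n\<close>, and products of \<open>M\<^sub>n\<close> with monomials in the
  \<open>L\<^sub>-\<^sub>n\<close>, in a triangular and nondegenerate way as long as the index \<open>p\<close> is avoided, and the two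
  exceptional directions are taken by a singular vector and by \<open>T\<close>.

  The direction \<open>M\<^sub>-\<^sub>p\<close>. The coefficients \<open>g\<^sub>i\<close> of \<open>T\<close> satisfy
  \<open>[L\<^sub>n, g\<^sub>m] = - (2 n + p - m) g\<^bsub>m-n\<^esub>\<close> on highest weight vectors for the \<open>M\<^sub>n\<close> (lemma \<open>Ed_G\<close>). It
  follows that \<open>Sv = (\<Sum>i=1..p. i M\<^sub>-\<^sub>i g\<^bsub>p-i\<^esub>)\<close>, whose leading term is \<open>p M\<^sub>-\<^sub>p\<close>, is singular, and that
  \<open>T = (\<Sum>i=1..p. L\<^sub>-\<^sub>i g\<^bsub>p-i\<^esub>) + b (\<Sum>i=1..p. M\<^sub>-\<^sub>i g\<^bsub>p-i\<^esub>) + s Sv\<close> with \<open>b = (26 - c\<^sub>L) / c\<^sub>M\<close> and some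
  scalar \<open>s\<close>. Let \<open>I\<close> be the left ideal that defines the Verma module and \<open>N\<close> the left ideal
  generated by \<open>I\<close> and \<open>Sv\<close>. Modulo \<open>N\<close> one may replace \<open>M\<^sub>-\<^sub>p\<close> by a polynomial in the other \<open>M\<^sub>-\<^sub>i\<close>.

  The direction \<open>L\<^sub>-\<^sub>p\<close>. Modulo \<open>N\<close> the commutators of \<open>T\<close> with \<open>M\<^sub>n\<close>, \<open>n \<ge> 0\<close>, vanish on the powers of \<open>T\<close>, so the vectors
  \<open>a T^j\<close> with \<open>a\<close> in \<open>U(M\<^sub>-)\<close> are annihilated by all \<open>M\<^sub>n\<close>, \<open>n > 0\<close>; the pairing with the \<open>L\<^sub>-\<^sub>n\<close>,
  \<open>n \<noteq> p\<close>, shows that there are no others (lemma \<open>M_singular\<close>). They are filtered by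
  the subspaces \<open>K k\<close> spanned by \<open>N\<close> and the \<open>a T^j\<close> with \<open>j < k\<close>, which are stable under the \<open>L\<^sub>n\<close>,
  \<open>n > 0\<close>. On the quotient \<open>K (k+1) / K k\<close> the pairing of the \<open>L\<^sub>n\<close>, \<open>n \<noteq> p\<close>, with the monomials
  \<open>M\<^sub>-\<^sub>\<nu>\<close>, \<open>p \<notin> \<nu>\<close>, is nondegenerate, so only the multiples of \<open>T^k\<close> there are
  annihilated by all these products. What is left is the scalar in \<open>L\<^sub>p T^k = p^2 k (k - r) T^(k-1)\<close> modulo
  \<open>K (k-1)\<close>, where \<open>h\<^sub>L = h'\<^bsub>p,r\<^esub>\<close> enters (lemmas \<open>Lp_Tpow\<close> and \<open>Lpc_zero\<close>).

  Hence a nonzero weight vector modulo \<open>N\<close> that is annihilated by all \<open>L\<^sub>n\<close> and \<open>M\<^sub>n\<close> with \<open>n > 0\<close> has the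
  form \<open>c T^j\<close> plus terms \<open>a T^i\<close> with \<open>i < j\<close>, and \<open>j (j - r) = 0\<close>. So \<open>j = 0\<close>, the highest weight vector,
  or \<open>j = r\<close>, and two vectors with \<open>j = r\<close> are proportional modulo \<open>N\<close>: this is uniqueness. For existence one starts
  with \<open>T^r\<close> and removes the images under the \<open>L\<^sub>n\<close> layer by layer, from \<open>K r\<close> down to \<open>K 0 = N\<close>; the pairing
  supplies the corrections, and the single obstruction, the scalar in \<open>L\<^sub>p T^r\<close>, is zero
  (lemma \<open>ex_subsingular\<close>).

  Finally \<open>J' = N\<close> (lemma \<open>J_eq_N\<close>). A singular vector of the Verma module outside \<open>N\<close> has, by the
  above, a leading term \<open>c T^j\<close>, and \<open>j \<ge> 1\<close> if it is not the highest weight vector. But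
  \<open>[M\<^sub>0, L\<^sub>-\<^sub>p] = p M\<^sub>-\<^sub>p\<close>, so \<open>M\<^sub>0 - h\<^sub>M\<close> maps it to a vector in which \<open>L\<^sub>-\<^sub>p^(j-1) M\<^sub>-\<^sub>p\<close> has the coefficient
  \<open>c j p \<noteq> 0\<close>, and it is not an eigenvector of \<open>M\<^sub>0\<close> (lemma \<open>M0_not_semisimple\<close>). Statements that
  something is nonzero rest on the Poincare-Birkhoff-Witt theorem for the negative part, in the form of
  an action of the enveloping algebra on polynomials in the negative generators.
\<close>

section \<open>Computing in the enveloping algebra\<close>

lemma scal_0 [simp]: "scal 0 = 0"
  by transfer (simp add: fconst_def w22_eq_def w22_ideal_zero)

lemma scal_1 [simp]: "scal 1 = 1"
  by transfer (simp add: fconst_def w22_eq_def w22_ideal_zero)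

lemma scal_add: "scal (a + b) = scal a + scal b"
  by transfer (simp add: fconst_def w22_eq_def w22_ideal_zero single_add)

lemma scal_mult: "scal (a * b) = scal a * scal b"
  by transfer (simp add: fconst_def w22_eq_def w22_ideal_zero mult_single)

lemma scal_uminus: "scal (- a) = - scal a"
  using scal_add[of a "-a"] by (simp add: add_eq_0_iff)

lemma scal_diff: "scal (a - b) = scal a - scal b"
  using scal_add[of a "-b"] by (simp add: scal_uminus)

lemma free_induct [case_names zero add word]:
  fixes x :: w22_free
  assumes "P 0" "\<And>x y. P x \<Longrightarrow> P y \<Longrightarrow> P (x + y)"
    and "\<And>c w. P (Poly_Mapping.single (Word w) c)"
  shows "P x"
proof (induction x rule: update_induct)
  case (const)
  then show ?case by (rule assms(1))
next
  case (update f a b)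
  have "Poly_Mapping.update a b f = f + Poly_Mapping.single a b"
    using update(1) by (intro poly_mapping_eqI) (auto simp: lookup_update lookup_add lookup_single when_def in_keys_iff)
  then show ?case using update assms(2) assms(3) by (metis w22_word.exhaust)
qed

lemma fconst_commute: "fconst c * x = x * fconst c"
  by (induction x rule: free_induct) (simp_all add: algebra_simps fconst_def mult_single)

lemma scal_commute: "x * scal c = scal c * x"
  by transfer (simp add: fconst_commute w22_eq_def w22_ideal_zero)

lemma scal_left_commute: "x * (scal c * y) = scal c * (x * y)"
  by (metis mult.assoc scal_commute)

definition gen :: "w22_basis \<Rightarrow> U22" where
  "gen x = (case x of Lg n \<Rightarrow> L n | Mg n \<Rightarrow> M n | CLg \<Rightarrow> CL | CMg \<Rightarrow> CM)"

lemma abs_fgen: "abs_U22 (fgen x) = gen x"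
  by (cases x) (simp_all add: gen_def L_def M_def CL_def CM_def)

lemma abs_mult: "abs_U22 (x * y) = abs_U22 x * abs_U22 y" by (simp add: times_U22.abs_eq)
lemma abs_add: "abs_U22 (x + y) = abs_U22 x + abs_U22 y" by (simp add: plus_U22.abs_eq)
lemma abs_diff: "abs_U22 (x - y) = abs_U22 x - abs_U22 y" by (simp add: minus_U22.abs_eq)
lemma abs_uminus: "abs_U22 (- y) = - abs_U22 y" by (simp add: uminus_U22.abs_eq)
lemma abs_0: "abs_U22 0 = 0" by (simp add: zero_U22.abs_eq)
lemma abs_fconst: "abs_U22 (fconst c) = scal c" by (simp add: scal_def)

text \<open>
  Every element is a linear combination of words, so it suffices to be able to multiply by a generator from the left.
\<close>

lemma U22_induct [case_names zero add scal gen]: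
  fixes u :: U22
  assumes "P 0" and add: "\<And>x y. P x \<Longrightarrow> P y \<Longrightarrow> P (x + y)"
    and "\<And>c. P (scal c)" and gen: "\<And>g x. P x \<Longrightarrow> P (gen g * x)"
  shows "P u"
proof -
  have w: "P (abs_U22 (Poly_Mapping.single (Word w) c))" for w c
  proof (induction w)
    case Nil
    then show ?case using assms(3)[of c] by (simp add: abs_fconst[symmetric] fconst_def zero_w22_word_def)
  next
    case (Cons a w)
    have "Poly_Mapping.single (Word (a # w)) c = fgen a * Poly_Mapping.single (Word w) c"
      by (simp add: fgen_def mult_single)
    then show ?case using gen[OF Cons] by (simp add: abs_mult abs_fgen)
  qed
  have "P (abs_U22 x)" for x
    by (induction x rule: free_induct) (auto simp: abs_0 abs_add assms(1) add w)
  then show ?thesis by (metis U22.abs_induct)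
qed

lemma gen_bracket: "gen x * gen y - gen y * gen x = abs_U22 (w22_bracket x y)"
proof -
  have "fgen x * fgen y - fgen y * fgen x - w22_bracket x y \<in> w22_ideal"
    unfolding w22_ideal_def by (rule hull_inc) (auto simp: w22_relators_def)
  then have "abs_U22 (fgen x * fgen y - fgen y * fgen x) = abs_U22 (w22_bracket x y)"
    by (simp add: U22.abs_eq_iff w22_eq_def)
  then show ?thesis by (simp add: abs_diff abs_mult abs_fgen)
qed

text \<open>
  The cocycle with which the central elements enter the brackets.
\<close>

definition cocyc :: "int \<Rightarrow> complex" where "cocyc m = of_int (m ^ 3 - m) / 12"

lemmas abs_simps = abs_mult abs_add abs_uminus abs_0 abs_fgen abs_fconst

lemma LL: "L m * L n = L n * L m + scal (of_int (m - n)) * L (m + n)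
    + (if m + n = 0 then scal (cocyc m) * CL else 0)"
  using gen_bracket[of "Lg m" "Lg n"]
  by (simp add: gen_def abs_simps cocyc_def algebra_simps split: if_splits)

lemma LM: "L m * M n = M n * L m + scal (of_int (m - n)) * M (m + n)
    + (if m + n = 0 then scal (cocyc m) * CM else 0)"
  using gen_bracket[of "Lg m" "Mg n"]
  by (simp add: gen_def abs_simps cocyc_def algebra_simps split: if_splits)

lemma M_L: "M m * L n = L n * M m + scal (of_int (m - n)) * M (m + n)
    + (if m + n = 0 then scal (cocyc m) * CM else 0)"
proof -
  have e: "n + m = 0 \<Longrightarrow> cocyc n = - cocyc m"
    by (auto simp: cocyc_def add_eq_0_iff field_simps power3_eq_cube)
  have "scal (of_int (m - n)) = - scal (of_int (n - m))" by (simp add: scal_uminus[symmetric])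
  then show ?thesis using LM[of n m] e by (auto simp: algebra_simps scal_uminus)
qed

lemma MM: "M m * M n = M n * M m"
  using gen_bracket[of "Mg m" "Mg n"] by (simp add: gen_def abs_simps)

lemma CL_comm: "x * CL = CL * x"
proof (induction x rule: U22_induct)
  case (gen g x)
  have "gen g * CL = CL * gen g"
    using gen_bracket[of g CLg] by (cases g) (simp_all add: gen_def abs_simps)
  then show ?case using gen by (metis mult.assoc)
qed (simp_all add: algebra_simps scal_commute)

lemma CM_comm: "x * CM = CM * x"
proof (induction x rule: U22_induct)
  case (gen g x)
  have "gen g * CM = CM * gen g"
    using gen_bracket[of g CMg] by (cases g) (simp_all add: gen_def abs_simps)
  then show ?case using gen by (metis mult.assoc)
qed (simp_all add: algebra_simps scal_commute)

section \<open>The Verma module on multisets of negative generators\<close>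

text \<open>
  The straightening procedure needs some total order on the basis, and any one will do: here the order of an enumeration.
\<close>

instance w22_basis :: countable by countable_datatype

instantiation w22_basis :: linorder
begin
definition less_eq_w22_basis :: "w22_basis \<Rightarrow> w22_basis \<Rightarrow> bool" where
  "less_eq_w22_basis x y \<longleftrightarrow> to_nat x \<le> to_nat y"
definition less_w22_basis :: "w22_basis \<Rightarrow> w22_basis \<Rightarrow> bool" where
  "less_w22_basis x y \<longleftrightarrow> to_nat x < to_nat y"
instance
  by standard (auto simp: less_eq_w22_basis_def less_w22_basis_def)
end

text \<open>
  The underlying space of the Verma module: polynomials in the negative generators. Products of monomials are
  sums of multisets, and the multiplication of polynomials is used only with a scalar as first factor.
\<close>

type_synonym negpoly = "w22_basis multiset \<Rightarrow>\<^sub>0 complex"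

definition cst :: "complex \<Rightarrow> negpoly" where "cst c = Poly_Mapping.single {#} c"
definition mon :: "w22_basis multiset \<Rightarrow> negpoly" where "mon m = Poly_Mapping.single m 1"

lemma lookup_cst_mult [simp]: "Poly_Mapping.lookup (cst c * v) m = c * Poly_Mapping.lookup v m"
proof (induction v rule: update_induct)
  case const
  then show ?case by simp
next
  case (update f a b)
  have e: "Poly_Mapping.update a b f = f + Poly_Mapping.single a b"
    using update(1) by (intro poly_mapping_eqI) (auto simp: lookup_update lookup_add lookup_single when_def in_keys_iff)
  have "cst c * Poly_Mapping.single a b = Poly_Mapping.single a (c * b)"
    unfolding cst_def mult_single by simp
  then show ?case using update by (simp add: e algebra_simps lookup_add lookup_single when_def)
qed

lemma cst_simps: "cst 0 = 0" "cst 1 = 1" "cst (a + b) = cst a + cst b" "cst (a * b) = cst a * cst b"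
  "cst (a - b) = cst a - cst b" "cst (- a) = - cst a"
  by (simp_all add: cst_def single_add mult_single single_diff single_uminus flip: zero_multiset_def)

definition lin :: "('k \<Rightarrow> negpoly) \<Rightarrow> ('k \<Rightarrow>\<^sub>0 complex) \<Rightarrow> negpoly" where
  "lin f v = (\<Sum>k\<in>Poly_Mapping.keys v. cst (Poly_Mapping.lookup v k) * f k)"

lemma lin_superset:
  assumes "finite A" "Poly_Mapping.keys v \<subseteq> A"
  shows "lin f v = (\<Sum>k\<in>A. cst (Poly_Mapping.lookup v k) * f k)"
  unfolding lin_def using assms
  by (intro sum.mono_neutral_left) (auto simp: in_keys_iff cst_simps)

lemma lin_add: "lin f (v + w) = lin f v + lin f w"
proof -
  let ?A = "Poly_Mapping.keys v \<union> Poly_Mapping.keys w"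
  have "Poly_Mapping.keys (v + w) \<subseteq> ?A" by (rule keys_add)
  then show ?thesis
    by (simp add: lin_superset[of ?A] lookup_add cst_simps distrib_right sum.distrib)
qed

lemma lin_single: "lin f (Poly_Mapping.single k c) = cst c * f k"
  by (simp add: lin_superset[of "{k}"])

lemma lin_0 [simp]: "lin f 0 = 0" by (simp add: lin_def)

lemma lin_fun_add: "lin (\<lambda>k. f k + g k) v = lin f v + lin g v"
  by (simp add: lin_def distrib_left sum.distrib)

lemma lin_fun_0 [simp]: "lin (\<lambda>k. 0) v = 0" by (simp add: lin_def)

lemma lin_cong: "(\<And>k. k \<in> Poly_Mapping.keys v \<Longrightarrow> f k = g k) \<Longrightarrow> lin f v = lin g v"
  by (simp add: lin_def)

text \<open>
  Linearity over the complex numbers, which are embedded by \<open>cst\<close>.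
\<close>

definition clin :: "(negpoly \<Rightarrow> negpoly) \<Rightarrow> bool" where
  "clin \<phi> \<longleftrightarrow> (\<forall>v w. \<phi> (v + w) = \<phi> v + \<phi> w) \<and> (\<forall>c v. \<phi> (cst c * v) = cst c * \<phi> v)"

lemma clin_add: "clin \<phi> \<Longrightarrow> \<phi> (v + w) = \<phi> v + \<phi> w"
  and clin_cst: "clin \<phi> \<Longrightarrow> \<phi> (cst c * v) = cst c * \<phi> v"
  by (auto simp: clin_def)

lemma clin_0: "clin \<phi> \<Longrightarrow> \<phi> 0 = 0" using clin_cst[of \<phi> 0 0] by (simp add: cst_simps)

lemma clin_uminus: "clin \<phi> \<Longrightarrow> \<phi> (- v) = - \<phi> v"
  using clin_cst[of \<phi> "-1" v] by (simp add: cst_simps)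

lemma clin_diff: "clin \<phi> \<Longrightarrow> \<phi> (v - w) = \<phi> v - \<phi> w"
  using clin_add[of \<phi> v "- w"] by (simp add: clin_uminus)

lemma clin_sum: "clin \<phi> \<Longrightarrow> \<phi> (sum f A) = (\<Sum>a\<in>A. \<phi> (f a))"
  by (induction A rule: infinite_finite_induct) (auto simp: clin_0 clin_add)

lemma clin_lin_comp: "clin \<phi> \<Longrightarrow> \<phi> (lin f v) = lin (\<lambda>k. \<phi> (f k)) v"
  by (simp add: lin_def clin_sum clin_cst)

lemma negpoly_expand: "v = lin mon (v :: negpoly)"
proof (rule poly_mapping_eqI)
  fix m
  have "Poly_Mapping.lookup (lin mon v) m
      = (\<Sum>k\<in>Poly_Mapping.keys v. Poly_Mapping.lookup (cst (Poly_Mapping.lookup v k) * mon k) m)"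
    by (simp add: lin_def lookup_sum)
  also have "\<dots> = (\<Sum>k\<in>Poly_Mapping.keys v. if k = m then Poly_Mapping.lookup v m else 0)"
    by (intro sum.cong) (auto simp: mon_def lookup_single)
  finally show "Poly_Mapping.lookup v m = Poly_Mapping.lookup (lin mon v) m"
    by (auto simp: in_keys_iff)
qed

lemma clin_lin: "clin (lin f)"
proof -
  have "lin f (cst c * v) = cst c * lin f v" for c v
  proof -
    have "Poly_Mapping.keys (cst c * v) \<subseteq> Poly_Mapping.keys v" by (auto simp: in_keys_iff)
    then have "lin f (cst c * v) = (\<Sum>k\<in>Poly_Mapping.keys v. cst (Poly_Mapping.lookup (cst c * v) k) * f k)"
      by (intro lin_superset) auto
    then show ?thesis by (simp add: lin_def cst_simps sum_distrib_left mult.assoc)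
  qed
  then show ?thesis by (simp add: clin_def lin_add)
qed

lemma clin_ext:
  assumes "clin \<phi>" "clin \<psi>" "\<And>m. m \<in> Poly_Mapping.keys v \<Longrightarrow> \<phi> (mon m) = \<psi> (mon m)"
  shows "\<phi> v = \<psi> v"
proof -
  have "\<phi> (lin mon v) = \<psi> (lin mon v)"
    using assms by (simp add: clin_lin_comp cong: lin_cong)
  then show ?thesis by (simp flip: negpoly_expand)
qed

lemma lin_mon [simp]: "lin f (mon m) = f m"
  by (simp add: mon_def lin_single cst_simps)

lemma cst_mon: "cst c * mon {#} = cst c"
  by (simp add: cst_def mon_def mult_single)

lemma clin_comp: "clin \<phi> \<Longrightarrow> clin \<psi> \<Longrightarrow> clin (\<lambda>v. \<phi> (\<psi> v))"
  by (simp add: clin_def)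

lemma clin_plus: "clin \<phi> \<Longrightarrow> clin \<psi> \<Longrightarrow> clin (\<lambda>v. \<phi> v + \<psi> v)"
  by (simp add: clin_def algebra_simps)

text \<open>
  The value on the Lie bracket of two generators of the linear extension of \<open>F\<close>. Taking \<open>F\<close> to be the
  action of the generators on a fixed vector, this is the action of the bracket.
\<close>

fun bra :: "(w22_basis \<Rightarrow> negpoly) \<Rightarrow> w22_basis \<Rightarrow> w22_basis \<Rightarrow> negpoly" where
  "bra F (Lg m) (Lg n) = cst (of_int (m - n)) * F (Lg (m + n)) + (if m + n = 0 then cst (cocyc m) * F CLg else 0)"
| "bra F (Lg m) (Mg n) = cst (of_int (m - n)) * F (Mg (m + n)) + (if m + n = 0 then cst (cocyc m) * F CMg else 0)"
| "bra F (Mg m) (Lg n) = - (cst (of_int (n - m)) * F (Mg (n + m)) + (if n + m = 0 then cst (cocyc n) * F CMg else 0))"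
| "bra F _ _ = 0"

lemma bra_cong [fundef_cong]: "(\<And>z. F z = G z) \<Longrightarrow> x = x' \<Longrightarrow> y = y' \<Longrightarrow> bra F x y = bra G x' y'"
  by (metis ext)

lemma bra_add: "bra (\<lambda>z. F z + G z) x y = bra F x y + bra G x y"
  by (cases x; cases y) (simp_all add: algebra_simps)

lemma clin_bra_comp: "clin \<phi> \<Longrightarrow> \<phi> (bra F x y) = bra (\<lambda>z. \<phi> (F z)) x y"
  by (cases x; cases y) (simp_all add: clin_add clin_cst clin_0 clin_uminus clin_diff)

lemma clin_bra: "(\<And>z. clin (F z)) \<Longrightarrow> clin (\<lambda>v. bra (\<lambda>z. F z v) x y)"
  by (cases x; cases y) (simp_all add: clin_def algebra_simps)

lemma cocyc_minus: "cocyc (- m) = - cocyc m"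
  by (simp add: cocyc_def field_simps)

lemma bra_antisym: "bra F x y = - bra F y x"
proof -
  have e: "n + m = 0 \<Longrightarrow> cst (cocyc m) = - cst (cocyc n)" for m n
    by (metis add_eq_0_iff cocyc_minus cst_simps(6))
  show ?thesis
    by (cases x; cases y) (auto simp: e add.commute cst_simps algebra_simps)
qed

lemma bra_self: "bra F x x = 0"
  by (cases x) (auto simp: cst_simps cocyc_def)

lemma bra_central:
  "G CLg = 0 \<Longrightarrow> bra G (Lg m) (Lg n) = cst (of_int (m - n)) * G (Lg (m + n))"
  "G CMg = 0 \<Longrightarrow> bra G (Lg m) (Mg n) = cst (of_int (m - n)) * G (Mg (m + n))"
  "G CMg = 0 \<Longrightarrow> bra G (Mg m) (Lg n) = - cst (of_int (n - m)) * G (Mg (n + m))"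
  by simp_all

text \<open>
  The Jacobi identity. The cocycle terms contribute only for \<open>a + b + c = 0\<close>, where \<open>c\<close> is eliminated and
  the identity becomes polynomial in \<open>a\<close> and \<open>b\<close>.
\<close>

lemma bra_jacobi:
  "bra (\<lambda>w. bra F x w) y z - bra (\<lambda>w. bra F y w) x z = bra (\<lambda>w. bra F w z) x y"
proof -
  have zero: "m + n = 0 \<longleftrightarrow> n = - m" for m n :: int by auto
  define k :: complex where "k = 1 / 12"
  have coc: "cocyc m = k * (of_int m * of_int m * of_int m - of_int m)" for m
    by (simp add: cocyc_def k_def power3_eq_cube)
  note s = lookup_add lookup_minus coc
  have LLL: "bra (\<lambda>w. bra F (Lg a) w) (Lg b) (Lg c) - bra (\<lambda>w. bra F (Lg b) w) (Lg a) (Lg c)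
      = bra (\<lambda>w. bra F w (Lg c)) (Lg a) (Lg b)" for a b c
  proof (cases "a + b + c = 0")
    case True
    then have c: "c = - a - b" by simp
    show ?thesis unfolding c
      by (intro poly_mapping_eqI) (simp add: s bra_central del: bra.simps(1-3); simp add: s; (simp add: algebra_simps)?)
  next
    case False
    then have "a + (b + c) \<noteq> 0" "b + (a + c) \<noteq> 0" "c + (a + b) \<noteq> 0" "(a + c) + b \<noteq> 0" by simp_all
    with False show ?thesis
      by (intro poly_mapping_eqI) (simp add: s bra_central del: bra.simps(1-3); simp add: s; (simp add: algebra_simps)?)
  qed
  have LLM: "bra (\<lambda>w. bra F (Lg a) w) (Lg b) (Mg c) - bra (\<lambda>w. bra F (Lg b) w) (Lg a) (Mg c)
      = bra (\<lambda>w. bra F w (Mg c)) (Lg a) (Lg b)" for a b c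
  proof (cases "a + b + c = 0")
    case True
    then have c: "c = - a - b" by simp
    show ?thesis unfolding c
      by (intro poly_mapping_eqI) (simp add: s bra_central del: bra.simps(1-3); simp add: s; (simp add: algebra_simps)?)
  next
    case False
    then have "a + (b + c) \<noteq> 0" "b + (a + c) \<noteq> 0" "c + (a + b) \<noteq> 0" "(a + c) + b \<noteq> 0" by simp_all
    with False show ?thesis
      by (intro poly_mapping_eqI) (simp add: s bra_central del: bra.simps(1-3); simp add: s; (simp add: algebra_simps)?)
  qed
  have LML: "bra (\<lambda>w. bra F (Lg a) w) (Mg b) (Lg c) - bra (\<lambda>w. bra F (Mg b) w) (Lg a) (Lg c)
      = bra (\<lambda>w. bra F w (Lg c)) (Lg a) (Mg b)" for a b c
  proof (cases "a + b + c = 0")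
    case True
    then have c: "c = - a - b" by simp
    show ?thesis unfolding c
      by (intro poly_mapping_eqI) (simp add: s bra_central del: bra.simps(1-3); simp add: s; (simp add: algebra_simps)?)
  next
    case False
    then have "a + (b + c) \<noteq> 0" "b + (a + c) \<noteq> 0" "c + (a + b) \<noteq> 0" "(a + c) + b \<noteq> 0" by simp_all
    with False show ?thesis
      by (intro poly_mapping_eqI) (simp add: s bra_central del: bra.simps(1-3); simp add: s; (simp add: algebra_simps)?)
  qed
  have MLL: "bra (\<lambda>w. bra F (Mg a) w) (Lg b) (Lg c) - bra (\<lambda>w. bra F (Lg b) w) (Mg a) (Lg c)
      = bra (\<lambda>w. bra F w (Lg c)) (Mg a) (Lg b)" for a b c
    using LML[of b a c] bra_antisym[of "\<lambda>w. bra F w (Lg c)" "Mg a" "Lg b"]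
    by (metis minus_diff_eq)
  show ?thesis
    by (cases x; cases y; cases z) (simp_all only: LLL LLM LML MLL, simp_all)
qed

abbreviation neg :: "w22_basis \<Rightarrow> bool" where
  "neg x \<equiv> (case x of Lg n \<Rightarrow> n < 0 | Mg n \<Rightarrow> n < 0 | _ \<Rightarrow> False)"

context
  fixes hL hM cL cM :: complex
begin

text \<open>
  The character of the non-negative part by which it acts on the highest weight vector.
\<close>

definition chi :: "w22_basis \<Rightarrow> complex" where
  "chi x = (case x of Lg n \<Rightarrow> if n = 0 then hL else 0 | Mg n \<Rightarrow> if n = 0 then hM else 0
     | CLg \<Rightarrow> cL | CMg \<Rightarrow> cM)"

text \<open>
  \<open>R x m\<close> is the correction in \<open>x m = add_mset x m + R x m\<close>, where the first term is present only for negative \<open>x\<close>. It is found by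
  straightening: if \<open>y\<close> is the smallest element of \<open>m = y m'\<close> and \<open>x\<close> has to be moved past it, then
  \<open>x (y m') = y (x m') + [x, y] m'\<close>. The restriction to monomials \<open>z\<close> with \<open>size z \<le> size m'\<close> serves
  termination; it excludes nothing by lemma \<open>R_supp\<close>.
\<close>

function R :: "w22_basis \<Rightarrow> w22_basis multiset \<Rightarrow> negpoly" where
  "R x m = (if m = {#} then (if neg x then 0 else cst (chi x)) else
     (let y = Min (set_mset m); m' = m - {#y#} in
      if neg x \<and> x \<le> y then 0
      else (\<Sum>z\<in>{z \<in> Poly_Mapping.keys (R x m'). size z \<le> size m'}.
              cst (Poly_Mapping.lookup (R x m') z) * (mon (add_mset y z) + R y z))
         + bra (\<lambda>z. (if neg z then mon (add_mset z m') else 0) + R z m') x y))"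
  by pat_completeness auto
termination
proof (relation "measure (\<lambda>(x, m). size m)", goal_cases)
  case 1
  then show ?case by simp
next
  case (2 x m y m')
  then have "y \<in># m" by (simp add: Min_in)
  then show ?case using 2 by (simp add: size_Diff_singleton nonempty_has_size)
next
  case (3 x m y m')
  then have "y \<in># m" by (simp add: Min_in)
  then show ?case using 3 by (simp add: size_Diff_singleton nonempty_has_size)
next
  case (4 x m y m' z)
  then have "y \<in># m" by (simp add: Min_in)
  then have "size m' < size m" using 4 by (simp add: size_Diff_singleton nonempty_has_size)
  then show ?case using 4 by simp
next
  case (5 x m y m' z)
  then have "y \<in># m" by (simp add: Min_in)
  then show ?case using 5 by (simp add: size_Diff_singleton nonempty_has_size)
qed

declare R.simps [simp del]

definition act :: "w22_basis \<Rightarrow> w22_basis multiset \<Rightarrow> negpoly" where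
  "act x m = (if neg x then mon (add_mset x m) else 0) + R x m"

definition Act :: "w22_basis \<Rightarrow> negpoly \<Rightarrow> negpoly" where "Act x = lin (act x)"

definition negms :: "w22_basis multiset \<Rightarrow> bool" where "negms m \<longleftrightarrow> (\<forall>z\<in>#m. neg z)"

lemma negms_simps [simp]: "negms {#}" "negms (add_mset x m) \<longleftrightarrow> neg x \<and> negms m"
  by (auto simp: negms_def)

lemma clin_Act: "clin (Act x)" by (simp add: Act_def clin_lin)

lemma Act_mon [simp]: "Act x (mon m) = act x m" by (simp add: Act_def)

lemma R_min:
  assumes "neg x" "\<forall>z\<in>#m. x \<le> z" shows "R x m = 0"
proof (cases "m = {#}")
  case False
  then have "x \<le> Min (set_mset m)" using assms(2) by (simp add: Min_in)
  then show ?thesis using False assms(1) by (subst R.simps) (simp add: Let_def)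
qed (use assms in \<open>simp add: R.simps\<close>)

lemma act_min: "neg x \<Longrightarrow> \<forall>z\<in>#m. x \<le> z \<Longrightarrow> act x m = mon (add_mset x m)"
  by (simp add: act_def R_min)

lemma act_empty: "\<not> neg x \<Longrightarrow> act x {#} = cst (chi x)"
  by (simp add: act_def R.simps)

lemma R_unfold:
  assumes "\<forall>z\<in>#m. y \<le> z" "\<not> (neg x \<and> x \<le> y)"
  shows "R x (add_mset y m) =
      (\<Sum>z\<in>{z \<in> Poly_Mapping.keys (R x m). size z \<le> size m}.
              cst (Poly_Mapping.lookup (R x m) z) * (mon (add_mset y z) + R y z))
         + bra (\<lambda>z. (if neg z then mon (add_mset z m) else 0) + R z m) x y"
proof -
  have "Min (set_mset (add_mset y m)) = y" using assms(1) by (intro Min_eqI) auto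
  then show ?thesis using assms(2) by (subst R.simps) (auto simp: Let_def cong: if_cong)
qed

text \<open>
  Tracks the sizes, signs and degrees of monomials through the action.
\<close>

definition supp :: "(w22_basis multiset \<Rightarrow> bool) \<Rightarrow> negpoly \<Rightarrow> bool" where
  "supp Q v \<longleftrightarrow> (\<forall>m\<in>Poly_Mapping.keys v. Q m)"

lemma supp_0 [simp]: "supp Q 0" by (simp add: supp_def)

lemma supp_add: "supp Q v \<Longrightarrow> supp Q w \<Longrightarrow> supp Q (v + w)"
  using keys_add[of v w] by (auto simp: supp_def)

lemma supp_cst: "supp Q v \<Longrightarrow> supp Q (cst c * v)"
  by (auto simp: supp_def in_keys_iff)

lemma supp_uminus: "supp Q v \<Longrightarrow> supp Q (- v)"
  by (simp add: supp_def)

lemma supp_sum: "(\<And>a. a \<in> A \<Longrightarrow> supp Q (f a)) \<Longrightarrow> supp Q (sum f A)"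
  by (induction A rule: infinite_finite_induct) (auto simp: supp_add)

lemma supp_mon [simp]: "supp Q (mon m) \<longleftrightarrow> Q m"
  by (simp add: supp_def mon_def)

lemma supp_cst_const: "Q {#} \<Longrightarrow> supp Q (cst c)"
  by (simp add: supp_def cst_def)

lemma supp_mono: "supp Q v \<Longrightarrow> (\<And>m. Q m \<Longrightarrow> Q' m) \<Longrightarrow> supp Q' v"
  by (auto simp: supp_def)

lemma supp_lin: "supp Q v \<Longrightarrow> (\<And>m. Q m \<Longrightarrow> supp Q' (f m)) \<Longrightarrow> supp Q' (lin f v)"
  unfolding lin_def by (auto intro!: supp_sum supp_cst simp: supp_def[of Q])

lemma supp_bra: "(\<And>z. supp Q (F z)) \<Longrightarrow> supp Q (bra F x y)"
  by (cases x; cases y) (simp_all only: bra.simps, auto intro!: supp_add supp_cst supp_uminus simp del: minus_add_distrib)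

lemma min_decomp:
  fixes m :: "'a::linorder multiset"
  assumes "m \<noteq> {#}"
  obtains y m' where "m = add_mset y m'" "\<forall>z\<in>#m'. y \<le> z"
proof
  let ?y = "Min (set_mset m)"
  have "?y \<in># m" using assms by simp
  then show "m = add_mset ?y (m - {#?y#})" by simp
  show "\<forall>z\<in>#m - {#?y#}. ?y \<le> z" by (auto dest: in_diffD)
qed

text \<open>
  The correction terms are shorter than the product of \<open>x\<close> and \<open>m\<close>, because every commutator merges two generators into one.
\<close>

lemma R_supp:
  "negms m \<Longrightarrow> supp (\<lambda>z. size z \<le> size m \<and> negms z) (R x m)"
proof (induction "size m" arbitrary: m x rule: less_induct)
  case less
  show ?case
  proof (cases "m = {#}")
    case True
    then show ?thesis by (simp add: R.simps supp_cst_const)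
  next
    case False
    then obtain y m' where m: "m = add_mset y m'" "\<forall>z\<in>#m'. y \<le> z" by (rule min_decomp)
    show ?thesis
    proof (cases "neg x \<and> x \<le> y")
      case True
      then have "R x m = 0" using m by (intro R_min) auto
      then show ?thesis by simp
    next
      case nx: False
      have neg: "neg y" "negms m'" using less.prems m by auto
      have IH: "supp (\<lambda>z. size z \<le> size m' \<and> negms z) (R w m')" for w
        using less.hyps[of m'] m neg by simp
      let ?Q = "\<lambda>z. size z \<le> Suc (size m') \<and> negms z"
      have 1: "supp ?Q (R y z)" if "z \<in> Poly_Mapping.keys (R x m')" for z
      proof -
        have z: "negms z" "size z \<le> size m'" using IH[of x] that by (auto simp: supp_def)
        then have "supp (\<lambda>u. size u \<le> size z \<and> negms u) (R y z)"
          using m by (intro less.hyps) auto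
        then show ?thesis using z by (elim supp_mono) auto
      qed
      have 2: "supp ?Q (R w m')" for w
        using IH[of w] by (elim supp_mono) auto
      have 3: "?Q (add_mset y z)" if "z \<in> Poly_Mapping.keys (R x m')" for z
        using IH[of x] that neg by (auto simp: supp_def)
      have "supp ?Q (R x (add_mset y m'))"
        unfolding R_unfold[OF m(2) nx]
        by (intro supp_add supp_sum supp_cst supp_bra 1 2) (use 3 neg in auto)
      then show ?thesis using m by simp
    qed
  qed
qed

lemma act_supp: "negms m \<Longrightarrow> supp (\<lambda>z. size z \<le> Suc (size m) \<and> negms z) (act x m)"
  unfolding act_def using R_supp[of m x] by (intro supp_add) (auto elim: supp_mono)

lemma act_unfold:
  assumes "\<forall>z\<in>#m. y \<le> z" "\<not> (neg x \<and> x \<le> y)" "neg y" "negms m"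
  shows "act x (add_mset y m) = Act y (act x m) + bra (\<lambda>z. act z m) x y"
proof -
  have sz: "{z \<in> Poly_Mapping.keys (R x m). size z \<le> size m} = Poly_Mapping.keys (R x m)"
    using R_supp[OF assms(4), of x] by (auto simp: supp_def)
  have R: "R x (add_mset y m) = Act y (R x m) + bra (\<lambda>z. act z m) x y"
    unfolding R_unfold[OF assms(1,2)] sz Act_def lin_def by (simp add: act_def assms(3))
  show ?thesis
  proof (cases "neg x")
    case True
    then have "y \<le> x" using assms(2) by auto
    then have "act y (add_mset x m) = mon (add_mset y (add_mset x m))"
      using assms by (intro act_min) auto
    then show ?thesis using True R by (simp add: act_def[of x] clin_add[OF clin_Act] add_mset_commute)
  next
    case False
    then show ?thesis using R by (simp add: act_def[of x])
  qed
qed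

text \<open>
  This is the defining equation of the action: \<open>y\<close> goes to the front of \<open>m\<close> without correction, and \<open>x\<close> is then moved past it.
\<close>

lemma comm_min:
  assumes "\<forall>z\<in>#m. y \<le> z" "\<not> (neg x \<and> x \<le> y)" "neg y" "negms m"
  shows "Act x (act y m) = Act y (act x m) + bra (\<lambda>z. act z m) x y"
  unfolding act_min[OF assms(3,1)] Act_mon by (rule act_unfold[OF assms])

lemma Act_comm_lin:
  assumes "\<And>m. m \<in> Poly_Mapping.keys v \<Longrightarrow> Act x (act y m) = Act y (act x m) + bra (\<lambda>z. act z m) x y"
  shows "Act x (Act y v) = Act y (Act x v) + bra (\<lambda>z. Act z v) x y"
proof (rule clin_ext[where \<phi> = "\<lambda>v. Act x (Act y v)" and \<psi> = "\<lambda>v. Act y (Act x v) + bra (\<lambda>z. Act z v) x y"])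
  show "clin (\<lambda>v. Act x (Act y v))" by (rule clin_comp[OF clin_Act clin_Act])
  show "clin (\<lambda>v. Act y (Act x v) + bra (\<lambda>z. Act z v) x y)"
    by (rule clin_plus[OF clin_comp[OF clin_Act clin_Act] clin_bra[OF clin_Act]])
qed (simp add: assms)

lemma bra_empty: "\<not> neg x \<Longrightarrow> \<not> neg y \<Longrightarrow> bra (\<lambda>z. act z {#}) x y = 0"
proof (cases x; cases y)
  fix m n assume n: "\<not> neg x" "\<not> neg y" "x = Lg m" "y = Lg n"
  then have "\<not> m < 0" "\<not> n < 0" by simp_all
  then consider "m = 0 \<and> n = 0" | "m + n \<noteq> 0" "n + m \<noteq> 0" "m > 0 \<or> n > 0" by linarith
  then show "bra (\<lambda>z. act z {#}) x y = 0"
    using n by cases (auto simp: act_empty chi_def cst_simps cocyc_def)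
next
  fix m n assume n: "\<not> neg x" "\<not> neg y" "x = Lg m" "y = Mg n"
  then have "\<not> m < 0" "\<not> n < 0" by simp_all
  then consider "m = 0 \<and> n = 0" | "m + n \<noteq> 0" "n + m \<noteq> 0" "m > 0 \<or> n > 0" by linarith
  then show "bra (\<lambda>z. act z {#}) x y = 0"
    using n by cases (auto simp: act_empty chi_def cst_simps cocyc_def)
next
  fix m n assume n: "\<not> neg x" "\<not> neg y" "x = Mg m" "y = Lg n"
  then have "\<not> m < 0" "\<not> n < 0" by simp_all
  then consider "m = 0 \<and> n = 0" | "m + n \<noteq> 0" "n + m \<noteq> 0" "m > 0 \<or> n > 0" by linarith
  then show "bra (\<lambda>z. act z {#}) x y = 0"
    using n by cases (auto simp: act_empty chi_def cst_simps cocyc_def)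
qed simp_all

text \<open>
  The representation property. If neither \<open>x\<close> nor \<open>y\<close> can be placed at the front of \<open>m\<close>, let \<open>z\<close> be the
  smallest generator in \<open>m = z m'\<close>; both sides are expanded by moving \<open>x\<close> and \<open>y\<close> past \<open>z\<close>, and the
  difference is the Jacobi identity for \<open>x\<close>, \<open>y\<close>, \<open>z\<close>.
\<close>

lemma Act_comm_mon:
  "negms m \<Longrightarrow> Act x (act y m) = Act y (act x m) + bra (\<lambda>z. act z m) x y"
proof (induction "size m" arbitrary: m x y rule: less_induct)
  case less
  have sym: "Act x (act y m) = Act y (act x m) + bra (\<lambda>z. act z m) x y"
    if "Act y (act x m) = Act x (act y m) + bra (\<lambda>z. act z m) y x" for x y
    using that bra_antisym[of "\<lambda>z. act z m" x y] by simp
  have "x = y \<or> (neg y \<and> (\<forall>z\<in>#m. y \<le> z) \<and> \<not> (neg x \<and> x \<le> y))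
    \<or> (neg x \<and> (\<forall>z\<in>#m. x \<le> z) \<and> \<not> (neg y \<and> y \<le> x))
    \<or> (\<not> (neg x \<and> (\<forall>z\<in>#m. x \<le> z)) \<and> \<not> (neg y \<and> (\<forall>z\<in>#m. y \<le> z)))"
  proof (cases "x \<le> y")
    case True
    then have "(\<forall>z\<in>#m. y \<le> z) \<Longrightarrow> (\<forall>z\<in>#m. x \<le> z)" "x = y \<or> \<not> y \<le> x"
      using order_trans order_antisym by blast+
    then show ?thesis by argo
  next
    case False
    then have "y \<le> x" by simp
    then have "(\<forall>z\<in>#m. x \<le> z) \<Longrightarrow> (\<forall>z\<in>#m. y \<le> z)" using order_trans by blast
    then show ?thesis using False by argo
  qed
  \<comment> \<open>By symmetry in \<open>x\<close> and \<open>y\<close>, the only case that is not immediate is \<open>nomin\<close>.\<close>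
  then consider (xy) "x = y" | (ymin) "neg y" "\<forall>z\<in>#m. y \<le> z" "\<not> (neg x \<and> x \<le> y)"
    | (xmin) "neg x" "\<forall>z\<in>#m. x \<le> z" "\<not> (neg y \<and> y \<le> x)"
    | (nomin) "\<not> (neg x \<and> (\<forall>z\<in>#m. x \<le> z))" "\<not> (neg y \<and> (\<forall>z\<in>#m. y \<le> z))"
    by argo
  then show ?case
  proof cases
    case xy
    then show ?thesis by (simp add: bra_self)
  next
    case ymin
    show ?thesis by (rule comm_min[OF ymin(2,3,1) less.prems])
  next
    case xmin
    show ?thesis by (rule sym[OF comm_min[OF xmin(2,3,1) less.prems]])
  next
    case nomin
    show ?thesis
    proof (cases "m = {#}")
      case True
      with nomin have n: "\<not> neg x" "\<not> neg y" by auto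
      have "bra (\<lambda>z. act z {#}) x y = 0"
        using n True by (simp add: bra_empty)
      moreover have "Act u (cst c) = cst c * act u {#}" for u c
        using clin_cst[OF clin_Act, of u c "mon {#}"] by (simp add: cst_mon)
      ultimately show ?thesis unfolding True using n by (simp add: act_empty[OF n(1)] act_empty[OF n(2)] mult.commute)
    next
      case False
      then obtain z m' where m: "m = add_mset z m'" "\<forall>u\<in>#m'. z \<le> u" by (rule min_decomp)
      have neg: "neg z" "negms m'" using less.prems m by auto
      have IH: "Act x (act y u) = Act y (act x u) + bra (\<lambda>z. act z u) x y"
        if "size u \<le> size m'" "negms u" for x y u
        by (rule less.hyps[OF _ that(2)]) (use that(1) m(1) in simp)
      have nx: "\<not> (neg x \<and> x \<le> z)" and ny: "\<not> (neg y \<and> y \<le> z)" 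
        using nomin m by auto
      have swap: "Act x (Act z (act y m')) = Act z (Act x (act y m')) + bra (\<lambda>w. Act w (act y m')) x z"
        if nx: "\<not> (neg x \<and> x \<le> z)" and ny: "\<not> (neg y \<and> y \<le> z)" for x y
      proof (rule Act_comm_lin)
        fix k assume k: "k \<in> Poly_Mapping.keys (act y m')"
        have "Poly_Mapping.keys (act y m') \<subseteq> (if neg y then {add_mset y m'} else {}) \<union> Poly_Mapping.keys (R y m')"
          unfolding act_def using keys_add[of "if neg y then mon (add_mset y m') else 0" "R y m'"]
          by (auto simp: mon_def split: if_splits)
        then consider "neg y" "k = add_mset y m'" | "k \<in> Poly_Mapping.keys (R y m')"
          using k by (auto split: if_splits)
        then show "Act x (act z k) = Act z (act x k) + bra (\<lambda>w. act w k) x z"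
        proof cases
          case 1
          then show ?thesis using m neg nx ny by (intro comm_min) auto
        next
          case 2
          then show ?thesis using R_supp[OF neg(2), of y] by (intro IH) (auto simp: supp_def)
        qed
      qed
      have expand: "Act x (act y m) = Act z (Act x (act y m')) + bra (\<lambda>w. Act w (act y m')) x z
          + bra (\<lambda>w. Act w (act x m')) y z + bra (\<lambda>w. bra (\<lambda>u. act u m') x w) y z"
        if nx: "\<not> (neg x \<and> x \<le> z)" and ny: "\<not> (neg y \<and> y \<le> z)" for x y
      proof -
        have "Act x (act y m) = Act x (Act z (act y m')) + bra (\<lambda>w. Act x (act w m')) y z"
          unfolding m act_unfold[OF m(2) ny neg]
          by (simp add: clin_add[OF clin_Act] clin_bra_comp[OF clin_Act])
        also have "(\<lambda>w. Act x (act w m')) = (\<lambda>w. Act w (act x m') + bra (\<lambda>u. act u m') x w)"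
          by (intro ext IH) (use neg in auto)
        finally show ?thesis by (simp add: swap[OF nx ny] bra_add add.assoc)
      qed
      have actm: "act w m = Act z (act w m') + bra (\<lambda>u. act u m') w z" for w
      proof -
        have "Act w (act z m') = Act z (act w m') + bra (\<lambda>u. act u m') w z"
          by (rule IH[OF order_refl neg(2)])
        then show ?thesis unfolding act_min[OF neg(1) m(2)] Act_mon m(1) .
      qed
      have "Act x (act y m) - Act y (act x m)
          = Act z (Act x (act y m')) - Act z (Act y (act x m'))
            + (bra (\<lambda>w. bra (\<lambda>u. act u m') x w) y z - bra (\<lambda>w. bra (\<lambda>u. act u m') y w) x z)"
        unfolding expand[OF nx ny] expand[OF ny nx] by simp
      also have "\<dots> = Act z (bra (\<lambda>u. act u m') x y) + bra (\<lambda>w. bra (\<lambda>u. act u m') w z) x y"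
        unfolding bra_jacobi IH[OF order_refl neg(2), of x y] by (simp add: clin_add[OF clin_Act])
      also have "\<dots> = bra (\<lambda>w. act w m) x y"
        unfolding actm by (simp add: bra_add clin_bra_comp[OF clin_Act])
      finally show ?thesis by (simp add: algebra_simps)
    qed
  qed
qed

lemma Act_comm:
  "supp negms v \<Longrightarrow> Act x (Act y v) = Act y (Act x v) + bra (\<lambda>z. Act z v) x y"
  by (rule Act_comm_lin, rule Act_comm_mon) (simp add: supp_def)

subsection \<open>Degrees\<close>

definition isM :: "w22_basis \<Rightarrow> bool" where "isM x = (case x of Mg _ \<Rightarrow> True | _ \<Rightarrow> False)"

text \<open>
  The number of \<open>M\<close>-factors. It is not lowered by straightening products of negative generators, since \<open>[L, M]\<close> lies in the \<open>M\<close> and \<open>[M, M] = 0\<close>.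
\<close>

definition mdeg :: "w22_basis multiset \<Rightarrow> nat" where "mdeg m = size (filter_mset isM m)"

lemma mdeg_simps [simp]: "mdeg {#} = 0" "mdeg (add_mset x m) = of_bool (isM x) + mdeg m"
  by (simp_all add: mdeg_def)

lemma supp_bra_neg:
  assumes "neg x" "neg y"
    and "\<And>z. neg z \<Longrightarrow> of_bool (isM z) = of_bool (isM x) + (of_bool (isM y) :: nat) \<Longrightarrow> supp Q (F z)"
  shows "supp Q (bra F x y)"
  using assms by (cases x; cases y) (auto simp: isM_def intro!: supp_cst supp_uminus)

lemma R_mdeg:
  "neg x \<Longrightarrow> negms m \<Longrightarrow> supp (\<lambda>z. mdeg z = of_bool (isM x) + mdeg m) (R x m)"
proof (induction "size m" arbitrary: m x rule: less_induct)
  case less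
  show ?case
  proof (cases "m = {#}")
    case True
    then show ?thesis using less.prems by (simp add: R.simps)
  next
    case False
    then obtain y m' where m: "m = add_mset y m'" "\<forall>z\<in>#m'. y \<le> z" by (rule min_decomp)
    have neg: "neg y" "negms m'" using less.prems m by auto
    show ?thesis
    proof (cases "x \<le> y")
      case True
      then have "R x m = 0" using m less.prems by (intro R_min) auto
      then show ?thesis by simp
    next
      case nx: False
      let ?Q = "\<lambda>z. mdeg z = of_bool (isM x) + mdeg m"
      have IH: "supp (\<lambda>z. mdeg z = of_bool (isM w) + mdeg m') (R w m')" if "neg w" for w
        using less.hyps[of m' w] m neg that by simp
      have z: "negms z \<and> size z \<le> size m' \<and> mdeg z = of_bool (isM x) + mdeg m'"
        if "z \<in> Poly_Mapping.keys (R x m')" for z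
        using IH[of x] that R_supp[of m' x] neg less.prems by (auto simp: supp_def)
      have 1: "supp ?Q (R y z)" if "z \<in> Poly_Mapping.keys (R x m')" for z
      proof -
        have "supp (\<lambda>u. mdeg u = of_bool (isM y) + mdeg z) (R y z)"
          using m neg z[OF that] by (intro less.hyps) auto
        then show ?thesis using z[OF that] m by (elim supp_mono) auto
      qed
      have 2: "supp ?Q ((if neg w then mon (add_mset w m') else 0) + R w m')"
        if "neg w" "of_bool (isM w) = of_bool (isM x) + (of_bool (isM y) :: nat)" for w
        using IH[of w] m that by (intro supp_add) (auto elim: supp_mono)
      have nx': "\<not> (neg x \<and> x \<le> y)" using nx by simp
      have "supp ?Q (R x (add_mset y m'))"
        unfolding R_unfold[OF m(2) nx']
        by (intro supp_add supp_sum supp_cst supp_bra_neg 1 2) (use z neg less.prems m in auto)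
      then show ?thesis using m by simp
    qed
  qed
qed

lemma Act_mdeg:
  assumes "neg x" "supp (\<lambda>z. negms z \<and> d \<le> mdeg z) v"
  shows "supp (\<lambda>z. negms z \<and> d + of_bool (isM x) \<le> mdeg z) (Act x v)"
  unfolding Act_def
proof (rule supp_lin[OF assms(2)])
  fix m assume m: "negms m \<and> d \<le> mdeg m"
  show "supp (\<lambda>z. negms z \<and> d + of_bool (isM x) \<le> mdeg z) (act x m)"
    unfolding act_def using R_mdeg[of x m] R_supp[of m x] assms(1) m
    by (intro supp_add) (auto simp: supp_def mon_def split: if_splits)
qed

lemma Act_negms: "supp negms v \<Longrightarrow> supp negms (Act x v)"
  unfolding Act_def by (erule supp_lin, erule supp_mono[OF act_supp]) simp

lemma Act_size:
  assumes "supp (\<lambda>z. negms z \<and> size z \<le> n) v"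
  shows "supp (\<lambda>z. negms z \<and> size z \<le> Suc n) (Act x v)"
  unfolding Act_def
  by (rule supp_lin[OF assms], rule supp_mono[OF act_supp]) auto

text \<open>
  In the top degree, a negative generator acts as the multiplication of commuting variables.
\<close>

lemma lookup_Act_top:
  assumes "neg x" "supp (\<lambda>z. negms z \<and> size z \<le> size m) v"
  shows "Poly_Mapping.lookup (Act x v) (add_mset x m) = Poly_Mapping.lookup v m"
proof -
  have "Poly_Mapping.lookup (Act x v) (add_mset x m)
      = (\<Sum>k\<in>Poly_Mapping.keys v. Poly_Mapping.lookup v k * Poly_Mapping.lookup (act x k) (add_mset x m))"
    by (simp add: Act_def lin_def lookup_sum)
  also have "\<dots> = (\<Sum>k\<in>Poly_Mapping.keys v. if k = m then Poly_Mapping.lookup v m else 0)"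
  proof (rule sum.cong[OF refl])
    fix k assume "k \<in> Poly_Mapping.keys v"
    then have "negms k" "size k \<le> size m" using assms(2) by (auto simp: supp_def)
    then have "add_mset x m \<notin> Poly_Mapping.keys (R x k)"
      using R_supp[of k x] by (auto simp: supp_def)
    then show "Poly_Mapping.lookup v k * Poly_Mapping.lookup (act x k) (add_mset x m)
        = (if k = m then Poly_Mapping.lookup v m else 0)"
      using assms(1) by (auto simp: act_def lookup_add in_keys_iff mon_def lookup_single when_def)
  qed
  finally show ?thesis by (auto simp: in_keys_iff)
qed

subsection \<open>The action of the enveloping algebra on the vacuum\<close>

definition word_act :: "w22_word \<Rightarrow> negpoly \<Rightarrow> negpoly" where
  "word_act w v = (case w of Word xs \<Rightarrow> foldr Act xs v)"

definition free_act :: "w22_free \<Rightarrow> negpoly \<Rightarrow> negpoly" where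
  "free_act f v = lin (\<lambda>w. word_act w v) f"

lemma clin_foldr: "clin (foldr Act xs)"
proof (induction xs)
  case (Cons a xs)
  then show ?case using clin_comp[OF clin_Act Cons.IH, of a] by (simp add: comp_def)
qed (simp add: clin_def)

lemma clin_word_act: "clin (word_act w)"
  using clin_foldr by (cases w) (simp add: word_act_def clin_def)

lemma clin_free_act: "clin (free_act f)"
proof -
  have "free_act f (v + w) = free_act f v + free_act f w" for v w
    by (simp add: free_act_def lin_def clin_add[OF clin_word_act] sum.distrib distrib_left)
  moreover have "free_act f (cst c * v) = cst c * free_act f v" for c v
    by (simp add: free_act_def lin_def clin_cst[OF clin_word_act] sum_distrib_left mult.left_commute)
  ultimately show ?thesis by (simp add: clin_def)
qed

lemma free_act_add: "free_act (f + g) v = free_act f v + free_act g v"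
  by (simp add: free_act_def lin_add)

lemma free_act_0: "free_act 0 v = 0" by (simp add: free_act_def)

lemma free_act_diff: "free_act (f - g) v = free_act f v - free_act g v"
  using free_act_add[of "f - g" g v] by simp

lemma free_act_uminus: "free_act (- g) v = - free_act g v"
  using free_act_diff[of 0 g v] by (simp add: free_act_0)

lemma free_act_mult: "free_act (f * g) v = free_act f (free_act g v)"
proof (induction f rule: free_induct)
  case (word c w)
  show ?case
  proof (induction g rule: free_induct)
    case (word d u)
    have "word_act (Word w) (cst d * foldr Act u v) = cst d * word_act (Word w) (foldr Act u v)"
      by (rule clin_cst[OF clin_word_act])
    then show ?case
      by (simp add: mult_single free_act_def lin_single cst_simps word_act_def mult.assoc)
  qed (simp_all add: algebra_simps free_act_add free_act_0 clin_add[OF clin_free_act] clin_0[OF clin_free_act])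
qed (simp_all add: algebra_simps free_act_add free_act_0)

lemma free_act_fgen: "free_act (fgen x) v = Act x v"
  by (simp add: free_act_def fgen_def lin_single cst_simps word_act_def)

lemma free_act_fconst: "free_act (fconst c) v = cst c * v"
  by (simp add: free_act_def fconst_def lin_single word_act_def zero_w22_word_def)

lemma free_act_bracket: "free_act (w22_bracket x y) v = bra (\<lambda>z. Act z v) x y"
  by (cases x; cases y)
     (simp_all add: free_act_add free_act_mult free_act_fgen free_act_fconst free_act_0 free_act_uminus free_act_diff cocyc_def)

lemma free_act_negms: "supp negms v \<Longrightarrow> supp negms (free_act f v)"
proof (induction f rule: free_induct)
  case (word c w)
  have "supp negms (foldr Act w v)" using word by (induction w) (auto intro: Act_negms)
  then show ?case by (simp add: free_act_def lin_single word_act_def supp_cst)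
qed (simp_all add: free_act_0 free_act_add supp_add)

lemma free_act_ideal:
  assumes "f \<in> w22_ideal" "supp negms v"
  shows "free_act f v = 0"
proof -
  let ?A = "{f. \<forall>v. supp negms v \<longrightarrow> free_act f v = 0}"
  have "two_sided_ideal ?A"
    by (auto simp: two_sided_ideal_def left_ideal_def free_act_0 free_act_add free_act_mult
        clin_0[OF clin_free_act] free_act_negms)
  moreover have "free_act (fgen x * fgen y - fgen y * fgen x - w22_bracket x y) v = 0"
    if v: "supp negms v" for x y v
  proof -
    have "free_act (fgen x * fgen y - fgen y * fgen x - w22_bracket x y) v
        = Act x (Act y v) - Act y (Act x v) - bra (\<lambda>z. Act z v) x y"
      by (simp add: free_act_diff free_act_mult free_act_fgen free_act_bracket)
    also have "\<dots> = 0" unfolding Act_comm[OF v, of x y] by simp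
    finally show ?thesis .
  qed
  then have "w22_relators \<subseteq> ?A" by (auto simp: w22_relators_def)
  ultimately have "w22_ideal \<subseteq> ?A" unfolding w22_ideal_def by (intro hull_minimal)
  then show ?thesis using assms by auto
qed

text \<open>
  The image of the highest weight vector under \<open>u\<close>. The value does not depend on the representative of \<open>u\<close> because the relators act as zero.
\<close>

definition vac :: "U22 \<Rightarrow> negpoly" where "vac u = free_act (rep_U22 u) (mon {#})"

lemma vac_abs: "vac (abs_U22 f) = free_act f (mon {#})"
proof -
  have "w22_eq (rep_U22 (abs_U22 f)) f"
    by (simp add: Quotient3_abs_rep[OF Quotient3_U22] flip: U22.abs_eq_iff)
  then have "free_act (rep_U22 (abs_U22 f) - f) (mon {#}) = 0"
    by (intro free_act_ideal) (auto simp: w22_eq_def)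
  then show ?thesis by (simp add: vac_def free_act_diff)
qed

lemma vac_add: "vac (u + v) = vac u + vac v"
  by (induction u rule: U22.abs_induct, induction v rule: U22.abs_induct) (simp add: plus_U22.abs_eq vac_abs free_act_add)

lemma vac_scal: "vac (scal c * u) = cst c * vac u"
  by (induction u rule: U22.abs_induct) (simp add: scal_def times_U22.abs_eq vac_abs free_act_mult free_act_fconst)

lemma vac_gen: "vac (gen x * u) = Act x (vac u)"
  by (induction u rule: U22.abs_induct) (simp add: abs_fgen[symmetric] times_U22.abs_eq vac_abs free_act_mult free_act_fgen)

lemma vac_1: "vac 1 = mon {#}"
proof -
  have "vac (abs_U22 (fconst 1)) = mon {#}"
    unfolding vac_abs free_act_fconst by (simp add: cst_simps)
  then show ?thesis by (simp add: abs_fconst)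
qed

lemma vac_0: "vac 0 = 0" by (simp add: zero_U22.abs_eq vac_abs free_act_0)

lemma vac_uminus: "vac (- u) = - vac u"
  using vac_add[of u "- u"] by (simp add: vac_0 add_eq_0_iff)

lemma vac_diff: "vac (u - v) = vac u - vac v"
  using vac_add[of u "- v"] by (simp add: vac_uminus)

text \<open>
  This makes \<open>vac\<close> a map on the Verma module, and hence a test for vectors being nonzero there.
\<close>

lemma vac_verma_ideal: "u \<in> verma_ideal hL hM cL cM \<Longrightarrow> vac u = 0"
proof -
  let ?A = "{u. vac u = 0}"
  have "vac (a * u) = 0" if "vac u = 0" for a u
    using that by (induction a rule: U22_induct)
      (simp_all add: distrib_right vac_0 vac_add vac_scal mult.assoc vac_gen clin_0[OF clin_Act])
  then have "left_ideal ?A" by (auto simp: left_ideal_def vac_0 vac_add)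
  moreover have g: "vac (gen x - scal (chi x)) = 0" if "\<not> neg x" for x
    using vac_gen[of x 1] vac_scal[of "chi x" 1] that
    by (simp add: vac_diff vac_1 act_empty cst_mon)
  have "{L n | n. n > 0} \<union> {M n | n. n > 0} \<union> {L 0 - scal hL, M 0 - scal hM, CL - scal cL, CM - scal cM} \<subseteq> ?A"
  proof -
    have "vac (L n) = 0" "vac (M n) = 0" if "n > 0" for n
      using g[of "Lg n"] g[of "Mg n"] that by (simp_all add: gen_def chi_def)
    moreover have "vac (L 0 - scal hL) = 0" "vac (M 0 - scal hM) = 0" "vac (CL - scal cL) = 0" "vac (CM - scal cM) = 0"
      using g[of "Lg 0"] g[of "Mg 0"] g[of CLg] g[of CMg] by (simp_all add: gen_def chi_def)
    ultimately show ?thesis by auto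
  qed
  ultimately have "verma_ideal hL hM cL cM \<subseteq> ?A" unfolding verma_ideal_def by (intro hull_minimal)
  then show "u \<in> verma_ideal hL hM cL cM \<Longrightarrow> vac u = 0" by auto
qed

end

section \<open>Congruences modulo a subspace\<close>

interpretation U: vector_space "\<lambda>c x. scal c * x :: U22"
  by standard (simp_all add: distrib_left distrib_right scal_add scal_mult mult.assoc)

text \<open>
  Equality modulo the subspace spanned by \<open>X\<close>. The span makes this a congruence for the vector space
  structure whatever \<open>X\<close> is.
\<close>

definition eqm :: "U22 \<Rightarrow> U22 set \<Rightarrow> U22 \<Rightarrow> bool" ("(_/ \<approx>\<^bsub>_\<^esub> _)" [51,0,51] 50) where
  "x \<approx>\<^bsub>X\<^esub> y \<longleftrightarrow> x - y \<in> U.span X"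

lemma eqm_refl [simp, intro]: "x \<approx>\<^bsub>X\<^esub> x" by (simp add: eqm_def U.span_zero)

lemma eqm_sym: "x \<approx>\<^bsub>X\<^esub> y \<Longrightarrow> y \<approx>\<^bsub>X\<^esub> x"
  unfolding eqm_def using U.span_neg[of "x - y" X] by simp

lemma eqm_trans [trans]: "x \<approx>\<^bsub>X\<^esub> y \<Longrightarrow> y \<approx>\<^bsub>X\<^esub> z \<Longrightarrow> x \<approx>\<^bsub>X\<^esub> z"
  unfolding eqm_def using U.span_add[of "x - y" X "y - z"] by simp

lemma eqm_add: "x \<approx>\<^bsub>X\<^esub> y \<Longrightarrow> x' \<approx>\<^bsub>X\<^esub> y' \<Longrightarrow> x + x' \<approx>\<^bsub>X\<^esub> y + y'"
  unfolding eqm_def using U.span_add[of "x - y" X "x' - y'"] by (simp add: algebra_simps)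

lemma eqm_diff: "x \<approx>\<^bsub>X\<^esub> y \<Longrightarrow> x' \<approx>\<^bsub>X\<^esub> y' \<Longrightarrow> x - x' \<approx>\<^bsub>X\<^esub> y - y'"
  unfolding eqm_def using U.span_diff[of "x - y" X "x' - y'"] by (simp add: algebra_simps)

lemma eqm_scal: "x \<approx>\<^bsub>X\<^esub> y \<Longrightarrow> scal c * x \<approx>\<^bsub>X\<^esub> scal c * y"
  unfolding eqm_def using U.span_scale[of "x - y" X c] by (simp add: algebra_simps)

lemma eqm_sum: "(\<And>i. i \<in> A \<Longrightarrow> f i \<approx>\<^bsub>X\<^esub> g i) \<Longrightarrow> sum f A \<approx>\<^bsub>X\<^esub> sum g A"
  unfolding eqm_def by (simp add: U.span_sum flip: sum_subtractf)

lemma eqm_mult: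
  assumes "x \<approx>\<^bsub>X\<^esub> y" "\<And>z. z \<in> X \<Longrightarrow> u * z \<in> X"
  shows "u * x \<approx>\<^bsub>X\<^esub> u * y"
proof -
  have "u * z \<in> U.span X" if "z \<in> U.span X" for z
    using that
  proof (induction rule: U.span_induct_alt)
    case (step c z y)
    then show ?case
      by (simp add: distrib_left scal_left_commute[of u] assms(2) U.span_add U.span_scale U.span_base)
  qed (simp add: U.span_zero)
  from this[of "x - y"] assms(1) show ?thesis by (simp add: eqm_def right_diff_distrib)
qed

lemma eqm_0_iff: "U.subspace X \<Longrightarrow> x \<approx>\<^bsub>X\<^esub> 0 \<longleftrightarrow> x \<in> X"
  by (simp add: eqm_def U.span_eq_iff[THEN iffD2])

lemma eqm_iff: "U.subspace X \<Longrightarrow> x \<approx>\<^bsub>X\<^esub> y \<longleftrightarrow> x - y \<in> X"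
  by (simp add: eqm_def U.span_eq_iff[THEN iffD2])

lemma eqm_mono: "x \<approx>\<^bsub>X\<^esub> y \<Longrightarrow> X \<subseteq> Y \<Longrightarrow> x \<approx>\<^bsub>Y\<^esub> y"
  unfolding eqm_def using U.span_mono by blast

lemma eqm_base: "x - y \<in> X \<Longrightarrow> x \<approx>\<^bsub>X\<^esub> y"
  by (simp add: eqm_def U.span_base)

lemma eqm_base0: "x \<in> X \<Longrightarrow> x \<approx>\<^bsub>X\<^esub> 0"
  by (simp add: eqm_def U.span_base)

lemma eqm_mem: "U.subspace X \<Longrightarrow> x \<approx>\<^bsub>X\<^esub> y \<Longrightarrow> y \<in> X \<Longrightarrow> x \<in> X"
  using U.subspace_add[of X "x - y" y] by (simp add: eqm_iff)

lemma left_ideal_subspace: "left_ideal X \<Longrightarrow> U.subspace X"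
  by (simp add: left_ideal_def U.subspace_def)

lemma left_ideal_mult: "left_ideal X \<Longrightarrow> x \<in> X \<Longrightarrow> u * x \<in> X"
  by (simp add: left_ideal_def)

lemma eqm_lmult: "left_ideal X \<Longrightarrow> x \<approx>\<^bsub>X\<^esub> y \<Longrightarrow> u * x \<approx>\<^bsub>X\<^esub> u * y"
  by (rule eqm_mult) (auto simp: left_ideal_mult)

section \<open>The commutative algebra of the negative \<open>M\<close>\<close>

text \<open>
  Spans of monomials in the negative \<open>M\<close>. The index lists need not be sorted, since the \<open>M\<close> commute; this keeps
  products of monomials as concatenations of lists.
\<close>

definition MS :: "(nat list \<Rightarrow> bool) \<Rightarrow> U22 set" where
  "MS Q = U.span {M_part \<nu> | \<nu>. (\<forall>i\<in>set \<nu>. 1 \<le> i) \<and> Q \<nu>}"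

lemma MS_subspace: "U.subspace (MS Q)" by (simp add: MS_def)

lemmas MS_add = U.subspace_add[OF MS_subspace]
lemmas MS_scal = U.subspace_scale[OF MS_subspace]
lemmas MS_0 = U.subspace_0[OF MS_subspace]
lemmas MS_sum = U.subspace_sum[OF MS_subspace]

lemma MS_part: "\<forall>i\<in>set \<nu>. 1 \<le> i \<Longrightarrow> Q \<nu> \<Longrightarrow> M_part \<nu> \<in> MS Q"
  unfolding MS_def by (rule U.span_base) auto

lemma MS_induct [consumes 1, case_names zero add scal part]:
  assumes "a \<in> MS Q" "P 0" "\<And>x y. P x \<Longrightarrow> P y \<Longrightarrow> P (x + y)" "\<And>c x. P x \<Longrightarrow> P (scal c * x)"
    and "\<And>\<nu>. (\<forall>i\<in>set \<nu>. 1 \<le> i) \<Longrightarrow> Q \<nu> \<Longrightarrow> P (M_part \<nu>)"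
  shows "P a"
  using assms(1) unfolding MS_def
  by (induction rule: U.span_induct_alt) (use assms(2-5) in auto)

lemma MS_mono: "(\<And>\<nu>. Q \<nu> \<Longrightarrow> Q' \<nu>) \<Longrightarrow> MS Q \<subseteq> MS Q'"
  unfolding MS_def by (rule U.span_mono) auto

lemma M_part_simps [simp]: "M_part [] = 1" "M_part (i # \<nu>) = M (- int i) * M_part \<nu>"
  "M_part (\<nu> @ \<mu>) = M_part \<nu> * M_part \<mu>"
  by (simp_all add: M_part_def)

lemma M_M_part: "M k * M_part \<nu> = M_part \<nu> * M k"
  by (induction \<nu>) (simp_all, metis MM mult.assoc)

lemma M_part_perm: "mset \<nu> = mset \<mu> \<Longrightarrow> M_part \<nu> = M_part \<mu>"
proof (induction \<nu> arbitrary: \<mu>)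
  case (Cons i \<nu>)
  then have "i \<in> set \<mu>" by (metis list.set_intros(1) set_mset_mset)
  then obtain xs ys where m: "\<mu> = xs @ i # ys" by (meson split_list)
  have "M_part \<nu> = M_part (xs @ ys)" by (rule Cons.IH) (use Cons.prems m in simp)
  then have "M_part (i # \<nu>) = M (- int i) * M_part xs * M_part ys" by (simp add: mult.assoc)
  also have "\<dots> = M_part \<mu>" unfolding m by (simp only: M_M_part M_part_simps mult.assoc)
  finally show ?case .
qed simp

lemma M_MS: "a \<in> MS Q \<Longrightarrow> M k * a = a * M k"
  by (induction rule: MS_induct) (simp_all add: algebra_simps M_M_part scal_left_commute[of "M k"])

lemma MS_commute: "a \<in> MS Q \<Longrightarrow> b \<in> MS Q' \<Longrightarrow> a * b = b * a"
proof (induction rule: MS_induct)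
  case (scal c x)
  then show ?case by (simp add: mult.assoc scal_left_commute[of b])
next
  case (part \<nu>)
  from part(3) have "M_part \<nu> * b = b * M_part \<nu>"
  proof (induction \<nu>)
    case (Cons i \<nu>)
    have "M_part (i # \<nu>) * b = M (- int i) * b * M_part \<nu>" using Cons by (simp add: mult.assoc)
    also have "\<dots> = b * M_part (i # \<nu>)" using M_MS[OF Cons.prems] by (simp add: mult.assoc)
    finally show ?case .
  qed simp
  then show ?case .
qed (simp_all add: algebra_simps)

lemma MS_mult:
  assumes "a \<in> MS Q" "b \<in> MS Q'" "\<And>\<nu> \<mu>. Q \<nu> \<Longrightarrow> Q' \<mu> \<Longrightarrow> Q'' (\<nu> @ \<mu>)"
  shows "a * b \<in> MS Q''"
  using assms(1)
proof (induction rule: MS_induct)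
  case (part \<nu>)
  from assms(2) show ?case
  proof (induction rule: MS_induct)
    case (part \<mu>)
    then show ?case using MS_part[of "\<nu> @ \<mu>" Q''] assms(3) \<open>Q \<nu>\<close> \<open>\<forall>i\<in>set \<nu>. 1 \<le> i\<close> by auto
  qed (simp_all add: MS_0 MS_add MS_scal distrib_left scal_left_commute[of "M_part \<nu>"])
qed (simp_all add: MS_0 MS_add MS_scal distrib_right mult.assoc)

lemma MS_1: "Q [] \<Longrightarrow> 1 \<in> MS Q" using MS_part[of "[]" Q] by simp

lemma MS_M: "i \<ge> 1 \<Longrightarrow> Q [i] \<Longrightarrow> M (- int i) \<in> MS Q" using MS_part[of "[i]" Q] by simp

lemma MS_mult_closed:
  assumes "a \<in> MS Q" "U.subspace X" "\<And>i x. 1 \<le> i \<Longrightarrow> x \<in> X \<Longrightarrow> M (- int i) * x \<in> X" "x \<in> X"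
  shows "a * x \<in> X"
  using assms(1)
proof (induction rule: MS_induct)
  case (part \<nu>)
  from part(1) show ?case by (induction \<nu>) (simp_all add: mult.assoc assms(3,4))
qed (simp_all add: U.subspace_0 U.subspace_add U.subspace_scale assms distrib_right mult.assoc)

lemma finite_partitions: "finite (partitions_of n)"
proof (rule finite_subset)
  have "length \<nu> \<le> sum_list \<nu>" if "\<forall>i\<in>set \<nu>. 1 \<le> i" for \<nu> :: "nat list"
    using that by (induction \<nu>) auto
  then show "partitions_of n \<subseteq> {xs. set xs \<subseteq> {..n} \<and> length xs \<le> n}"
    by (auto simp: partitions_of_def intro: member_le_sum_list)
qed (rule finite_lists_length_le, simp)

lemma ex_partition:
  assumes "\<forall>i\<in>set \<nu>. 1 \<le> i"
  shows "\<exists>\<mu>\<in>partitions_of (sum_list \<nu>). mset \<mu> = mset \<nu>"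
proof
  show "mset (rev (sort \<nu>)) = mset \<nu>" by simp
  have "sorted_wrt (\<ge>) (rev (sort \<nu>))" by (simp add: sorted_wrt_rev)
  moreover have "sum_list (rev (sort \<nu>)) = sum_list \<nu>" by (metis mset_rev mset_sort sum_mset_sum_list)
  ultimately show "rev (sort \<nu>) \<in> partitions_of (sum_list \<nu>)"
    using assms by (auto simp: partitions_of_def)
qed

text \<open>
  Every condition on lists that is invariant under permutation can be tested on partitions.
\<close>

lemma MS_eq_sums:
  assumes Q: "\<And>\<nu>. Q \<nu> \<Longrightarrow> sum_list \<nu> = n" "\<And>\<nu> \<mu>. mset \<nu> = mset \<mu> \<Longrightarrow> Q \<nu> \<Longrightarrow> Q \<mu>"
  shows "MS Q = {\<Sum>\<nu> | \<nu> \<in> partitions_of n \<and> Q \<nu>. scal (c \<nu>) * M_part \<nu> | c. True}"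
    (is "_ = ?S")
proof
  have fin: "finite {\<nu>. \<nu> \<in> partitions_of n \<and> Q \<nu>}" using finite_partitions by simp
  show "?S \<subseteq> MS Q"
    by (auto intro!: MS_sum MS_scal MS_part simp: partitions_of_def)
  have "U.subspace ?S"
  proof (rule U.subspaceI)
    show "0 \<in> ?S" by (rule CollectI, rule exI[of _ "\<lambda>_. 0"]) simp
    fix x y assume "x \<in> ?S" "y \<in> ?S"
    then obtain c d where "x = (\<Sum>\<nu> | \<nu> \<in> partitions_of n \<and> Q \<nu>. scal (c \<nu>) * M_part \<nu>)"
      "y = (\<Sum>\<nu> | \<nu> \<in> partitions_of n \<and> Q \<nu>. scal (d \<nu>) * M_part \<nu>)" by auto
    then have "x + y = (\<Sum>\<nu> | \<nu> \<in> partitions_of n \<and> Q \<nu>. scal (c \<nu> + d \<nu>) * M_part \<nu>)"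
      by (simp add: scal_add distrib_right sum.distrib)
    then show "x + y \<in> ?S" by (intro CollectI exI[of _ "\<lambda>\<nu>. c \<nu> + d \<nu>"]) simp
  next
    fix a x assume "x \<in> ?S"
    then obtain c where "x = (\<Sum>\<nu> | \<nu> \<in> partitions_of n \<and> Q \<nu>. scal (c \<nu>) * M_part \<nu>)" by auto
    then have "scal a * x = (\<Sum>\<nu> | \<nu> \<in> partitions_of n \<and> Q \<nu>. scal (a * c \<nu>) * M_part \<nu>)"
      by (simp add: sum_distrib_left)
    then show "scal a * x \<in> ?S" by (intro CollectI exI[of _ "\<lambda>\<nu>. a * c \<nu>"]) simp
  qed
  moreover have "M_part \<nu> \<in> ?S" if n: "\<forall>i\<in>set \<nu>. 1 \<le> i" "Q \<nu>" for \<nu>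
  proof -
    obtain \<mu> where m: "\<mu> \<in> partitions_of n" "mset \<mu> = mset \<nu>" using ex_partition[OF n(1)] Q(1)[OF n(2)] by auto
    then have "Q \<mu>" using Q(2)[of \<nu> \<mu>] n by simp
    have "(\<Sum>\<nu> | \<nu> \<in> partitions_of n \<and> Q \<nu>. scal (if \<nu> = \<mu> then 1 else 0) * M_part \<nu>)
        = (\<Sum>\<nu> | \<nu> \<in> partitions_of n \<and> Q \<nu>. if \<nu> = \<mu> then M_part \<mu> else 0)"
      by (intro sum.cong) auto
    also have "\<dots> = M_part \<mu>" using fin m \<open>Q \<mu>\<close> by (simp add: sum.delta)
    also have "\<dots> = M_part \<nu>" using m by (intro M_part_perm)
    finally show ?thesis by (intro CollectI exI[of _ "\<lambda>\<nu>. if \<nu> = \<mu> then 1 else 0"]) simp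
  qed
  ultimately show "MS Q \<subseteq> ?S"
    unfolding MS_def by (intro U.span_minimal) auto
qed

lemma UM_eq_MS: "UM n = MS (\<lambda>\<nu>. sum_list \<nu> = n)"
proof -
  have perm: "sum_list \<mu> = n" if "mset \<nu> = mset \<mu>" "sum_list \<nu> = n" for \<nu> \<mu> :: "nat list"
    using that by (metis sum_mset_sum_list)
  have "MS (\<lambda>\<nu>. sum_list \<nu> = n) = {\<Sum>\<nu> | \<nu> \<in> partitions_of n \<and> sum_list \<nu> = n. scal (c \<nu>) * M_part \<nu> | c. True}"
    by (rule MS_eq_sums[OF _ perm])
  moreover have "{\<nu>. \<nu> \<in> partitions_of n \<and> sum_list \<nu> = n} = partitions_of n"
    by (auto simp: partitions_of_def)
  ultimately show ?thesis by (simp add: UM_def)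
qed

text \<open>
  The decomposable part of \<open>U(M\<^sub>-)\<^sub>n\<close>, complementary to the line of \<open>M\<^sub>-\<^sub>n\<close>.
\<close>

abbreviation UMt :: "nat \<Rightarrow> U22 set" where "UMt n \<equiv> MS (\<lambda>\<nu>. sum_list \<nu> = n \<and> 2 \<le> length \<nu>)"

lemma UM_mult: "a \<in> UM m \<Longrightarrow> b \<in> UM n \<Longrightarrow> a * b \<in> UM (m + n)"
  unfolding UM_eq_MS by (erule MS_mult) auto

lemma UM_0: "a \<in> UM 0 \<Longrightarrow> \<exists>c. a = scal c"
proof -
  have "partitions_of 0 = {[]}" 
    by (auto simp: partitions_of_def) (metis list.set_intros(1) neq_Nil_conv not_one_le_zero One_nat_def)
  then show "a \<in> UM 0 \<Longrightarrow> \<exists>c. a = scal c" by (auto simp: UM_def)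
qed

lemma UM_scal: "scal c \<in> UM 0"
  using MS_scal[OF MS_1, of "\<lambda>\<nu>. sum_list \<nu> = 0" c] by (simp add: UM_eq_MS)

lemma UM_M: "i \<ge> 1 \<Longrightarrow> M (- int i) \<in> UM i" by (simp add: UM_eq_MS MS_M)

lemma UMt_mult:
  assumes "a \<in> UM m" "b \<in> UM n" "m \<ge> 1" "n \<ge> 1" shows "a * b \<in> UMt (m + n)"
proof -
  have "sum_list (\<nu> @ \<mu>) = m + n \<and> 2 \<le> length (\<nu> @ \<mu>)" if "sum_list \<nu> = m" "sum_list \<mu> = n" for \<nu> \<mu>
    using that assms(3,4) by (cases \<nu>; cases \<mu>) auto
  then show ?thesis by (rule MS_mult[OF assms(1,2)[unfolded UM_eq_MS]])
qed

lemma UM_split: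
  assumes "a \<in> UM n" "n \<ge> 1" shows "\<exists>c. a - scal c * M (- int n) \<in> UMt n"
  using assms(1) unfolding UM_eq_MS
proof (induction rule: MS_induct)
  case zero show ?case by (rule exI[of _ 0]) (simp add: MS_0)
next
  case (add x y)
  then obtain c d where "x - scal c * M (- int n) \<in> UMt n" "y - scal d * M (- int n) \<in> UMt n" by auto
  then show ?case
    by (intro exI[of _ "c + d"]) (drule (1) MS_add, simp add: scal_add algebra_simps)
next
  case (scal a x)
  then obtain c where "x - scal c * M (- int n) \<in> UMt n" by auto
  then show ?case by (intro exI[of _ "a * c"]) (drule MS_scal[of _ _ a], simp add: right_diff_distrib)
next
  case (part \<nu>)
  show ?case
  proof (cases "2 \<le> length \<nu>")
    case True
    then show ?thesis using part by (intro exI[of _ 0]) (simp add: MS_part)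
  next
    case False
    then have "\<nu> = [n]" using part assms(2) by (cases \<nu>; cases "tl \<nu>") auto
    then show ?thesis by (intro exI[of _ 1]) (simp add: MS_0)
  qed
qed

section \<open>Positive modes on the commutative algebra\<close>

lemma M_scal: "M n * (scal c * y) = scal c * (M n * y)" by (rule scal_left_commute)
lemma L_scal: "L n * (scal c * y) = scal c * (L n * y)" by (rule scal_left_commute)

lemma LL_app: "L m * (L n * y) = L n * (L m * y) + scal (of_int (m - n)) * (L (m + n) * y)
    + (if m + n = 0 then scal (cocyc m) * (CL * y) else 0)"
  using arg_cong[OF LL[of m n], of "\<lambda>x. x * y"] by (simp add: distrib_right mult.assoc)

lemma LM_app: "L m * (M n * y) = M n * (L m * y) + scal (of_int (m - n)) * (M (m + n) * y)
    + (if m + n = 0 then scal (cocyc m) * (CM * y) else 0)"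
  using arg_cong[OF LM[of m n], of "\<lambda>x. x * y"] by (simp add: distrib_right mult.assoc)

lemma M_L_app: "M m * (L n * y) = L n * (M m * y) + scal (of_int (m - n)) * (M (m + n) * y)
    + (if m + n = 0 then scal (cocyc m) * (CM * y) else 0)"
  using arg_cong[OF M_L[of m n], of "\<lambda>x. x * y"] by (simp add: distrib_right mult.assoc)

lemma MM_app: "M m * (M n * y) = M n * (M m * y)"
  using arg_cong[OF MM[of m n], of "\<lambda>x. x * y"] by (simp add: mult.assoc)

text \<open>
  Subspaces modulo which negative \<open>M\<close> may be applied. Left ideals have this property, but the
  filtration pieces \<open>K k\<close> defined below are not left ideals.
\<close>

definition Mstable :: "U22 set \<Rightarrow> bool" where
  "Mstable X \<longleftrightarrow> U.subspace X \<and> (\<forall>i\<ge>1. \<forall>x\<in>X. M (- int i) * x \<in> X)"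

lemma left_ideal_Mstable: "left_ideal X \<Longrightarrow> Mstable X"
  by (auto simp: Mstable_def left_ideal_subspace left_ideal_mult)

lemma Mstable_MS: "Mstable X \<Longrightarrow> a \<in> MS Q \<Longrightarrow> x \<in> X \<Longrightarrow> a * x \<in> X"
  by (rule MS_mult_closed) (auto simp: Mstable_def)

locale w22_atypical =
  fixes p :: nat and cL cM hL :: complex
  assumes p1: "p \<ge> 1" and cM0: "cM \<noteq> 0"
begin

definition hM :: complex where "hM = - ((of_nat p ^ 2 - 1) / 24) * cM"

text \<open>
  To \<open>M\<^sub>n\<close>, \<open>n \<ge> 0\<close>, and the central element, \<open>y\<close> looks like the highest weight vector.
\<close>

definition mvac :: "U22 set \<Rightarrow> U22 \<Rightarrow> bool" where
  "mvac X y \<longleftrightarrow> (\<forall>n>0. M n * y \<approx>\<^bsub>X\<^esub> 0) \<and> M 0 * y \<approx>\<^bsub>X\<^esub> scal hM * y \<and> CM * y \<approx>\<^bsub>X\<^esub> scal cM * y"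

lemma mvac_MS:
  assumes "Mstable X" "mvac X y" "a \<in> MS Q"
  shows "mvac X (a * y)"
proof -
  have c: "\<And>z. z \<in> X \<Longrightarrow> a * z \<in> X" using assms Mstable_MS by blast
  have "M n * (a * y) = a * (M n * y)" for n using M_MS[OF assms(3)] by (simp flip: mult.assoc)
  moreover have "CM * (a * y) = a * (CM * y)" by (metis CM_comm mult.assoc)
  moreover have "scal h * (a * y) = a * (scal h * y)" for h by (simp add: scal_left_commute[of a])
  moreover have "a * u \<approx>\<^bsub>X\<^esub> a * v" if "u \<approx>\<^bsub>X\<^esub> v" for u v
    using that c by (rule eqm_mult)
  ultimately show ?thesis using assms(2) unfolding mvac_def by (metis mult_zero_right)
qed

text \<open>
  On vectors that look like a highest weight vector to the \<open>M\<close>, the commutator of \<open>L n\<close> with \<open>a\<close> acts as \<open>b\<close>.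
  The quantification over all such vectors makes \<open>a \<mapsto> b\<close> a derivation of \<open>U(M\<^sub>-)\<close> into itself, with positive and zero
  modes of \<open>M\<close> already evaluated.
\<close>

definition Ed :: "int \<Rightarrow> U22 \<Rightarrow> U22 \<Rightarrow> bool" where
  "Ed n a b \<longleftrightarrow> (\<forall>X y. Mstable X \<longrightarrow> mvac X y \<longrightarrow> L n * (a * y) \<approx>\<^bsub>X\<^esub> a * (L n * y) + b * y)"

lemma EdD: "Ed n a b \<Longrightarrow> Mstable X \<Longrightarrow> mvac X y \<Longrightarrow> L n * (a * y) \<approx>\<^bsub>X\<^esub> a * (L n * y) + b * y"
  by (simp add: Ed_def)

lemma Ed_0: "Ed n 0 0" by (simp add: Ed_def)
lemma Ed_1: "Ed n 1 0" by (simp add: Ed_def)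

lemma Ed_add: "Ed n a b \<Longrightarrow> Ed n a' b' \<Longrightarrow> Ed n (a + a') (b + b')"
  unfolding Ed_def
proof (intro allI impI)
  fix X y assume h: "\<forall>X y. Mstable X \<longrightarrow> mvac X y \<longrightarrow> L n * (a * y) \<approx>\<^bsub>X\<^esub> a * (L n * y) + b * y"
    "\<forall>X y. Mstable X \<longrightarrow> mvac X y \<longrightarrow> L n * (a' * y) \<approx>\<^bsub>X\<^esub> a' * (L n * y) + b' * y" "Mstable X" "mvac X y"
  then have "L n * (a * y) + L n * (a' * y) \<approx>\<^bsub>X\<^esub> a * (L n * y) + b * y + (a' * (L n * y) + b' * y)"
    by (intro eqm_add) auto
  then show "L n * ((a + a') * y) \<approx>\<^bsub>X\<^esub> (a + a') * (L n * y) + (b + b') * y"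
    by (simp add: algebra_simps)
qed

lemma Ed_scal: "Ed n a b \<Longrightarrow> Ed n (scal c * a) (scal c * b)"
  unfolding Ed_def
proof (intro allI impI)
  fix X y assume h: "\<forall>X y. Mstable X \<longrightarrow> mvac X y \<longrightarrow> L n * (a * y) \<approx>\<^bsub>X\<^esub> a * (L n * y) + b * y"
    "Mstable X" "mvac X y"
  then have "scal c * (L n * (a * y)) \<approx>\<^bsub>X\<^esub> scal c * (a * (L n * y) + b * y)"
    by (intro eqm_scal) auto
  then show "L n * (scal c * a * y) \<approx>\<^bsub>X\<^esub> scal c * a * (L n * y) + scal c * b * y"
    by (simp add: algebra_simps L_scal)
qed

lemma Ed_sum: "(\<And>i. i \<in> A \<Longrightarrow> Ed n (f i) (g i)) \<Longrightarrow> Ed n (sum f A) (sum g A)"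
  by (induction A rule: infinite_finite_induct) (auto simp: Ed_0 Ed_add)

text \<open>
  The Leibniz rule: elements of \<open>U(M\<^sub>-)\<close> preserve \<open>mvac\<close>, so \<open>a' y\<close> is again an admissible vector.
\<close>

lemma Ed_mult:
  assumes "Ed n a b" "Ed n a' b'" "a \<in> MS Q" "a' \<in> MS Q'"
  shows "Ed n (a * a') (a * b' + b * a')"
  unfolding Ed_def
proof (intro allI impI)
  fix X y assume X: "Mstable X" "mvac X y"
  have c: "\<And>z. z \<in> X \<Longrightarrow> a * z \<in> X" using X(1) assms(3) Mstable_MS by blast
  have "L n * (a * (a' * y)) \<approx>\<^bsub>X\<^esub> a * (L n * (a' * y)) + b * (a' * y)"
    using assms(1) X mvac_MS[OF X assms(4)] by (simp add: Ed_def)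
  also have "\<dots> \<approx>\<^bsub>X\<^esub> a * (a' * (L n * y) + b' * y) + b * (a' * y)"
    using assms(2) X by (intro eqm_add eqm_mult[OF _ c]) (auto simp: Ed_def)
  finally show "L n * (a * a' * y) \<approx>\<^bsub>X\<^esub> a * a' * (L n * y) + (a * b' + b * a') * y"
    by (simp add: algebra_simps)
qed

text \<open>
  The commutator of \<open>L\<^sub>n\<close> with \<open>M\<^sub>-\<^sub>n\<close> acts by this scalar; its zero at \<open>n = p\<close> is what makes the case special.
\<close>

definition phi :: "int \<Rightarrow> complex" where "phi n = of_int n * cM / 12 * (of_int n ^ 2 - of_nat p ^ 2)"

lemma phi_eq: "phi n = 2 * of_int n * hM + cocyc n * cM"
  by (simp add: phi_def hM_def cocyc_def field_simps power2_eq_square power3_eq_cube)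

text \<open>
  The commutator of \<open>L\<^sub>n\<close> with \<open>M\<^sub>-\<^sub>i\<close> on such vectors: positive modes vanish and \<open>M\<^sub>0\<close> is a scalar.
\<close>

definition EM :: "int \<Rightarrow> int \<Rightarrow> U22" where
  "EM n i = (if n < i then scal (of_int (n + i)) * M (n - i) else if n = i then scal (phi n) else 0)"

lemma commute_M_mvac:
  assumes "U.subspace X" "mvac X y" "i > 0"
  shows "scal (of_int (n + i)) * (M (n - i) * y) + (if n = i then scal (cocyc n) * (CM * y) else 0)
      \<approx>\<^bsub>X\<^esub> EM n i * y"
proof -
  consider "n < i" | "n = i" | "n > i" by linarith
  then show ?thesis
  proof cases
    case 2
    have "scal (of_int (n + i)) * (M 0 * y) + scal (cocyc n) * (CM * y)
       \<approx>\<^bsub>X\<^esub> scal (of_int (n + i)) * (scal hM * y) + scal (cocyc n) * (scal cM * y)"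
      using assms(2) by (intro eqm_add eqm_scal) (auto simp: mvac_def)
    also have "\<dots> = scal (phi n) * y"
      using 2 by (simp add: phi_eq U.scale_left_distrib)
    finally show ?thesis using 2 by (simp add: EM_def)
  next
    case 3
    have "scal (of_int (n + i)) * (M (n - i) * y) \<approx>\<^bsub>X\<^esub> scal (of_int (n + i)) * 0"
      using assms(2) 3 by (intro eqm_scal) (auto simp: mvac_def)
    then show ?thesis using 3 by (simp add: EM_def)
  qed (simp add: EM_def mult.assoc)
qed

lemma Ed_M: assumes "i > 0" shows "Ed n (M (- i)) (EM n i)"
  unfolding Ed_def
proof (intro allI impI)
  fix X y assume X: "Mstable X" "mvac X y"
  have "L n * (M (- i) * y) = M (- i) * (L n * y) + (scal (of_int (n + i)) * (M (n - i) * y)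
      + (if n = i then scal (cocyc n) * (CM * y) else 0))"
    using LM_app[of n "- i" y] by simp
  also have "\<dots> \<approx>\<^bsub>X\<^esub> M (- i) * (L n * y) + EM n i * y"
    using X assms by (intro eqm_add eqm_refl commute_M_mvac) (auto simp: Mstable_def)
  finally show "L n * (M (- i) * y) \<approx>\<^bsub>X\<^esub> M (- i) * (L n * y) + EM n i * y" .
qed

section \<open>The coefficients of \<open>T\<close>\<close>

text \<open>
  The coefficients \<open>g\<^sub>i\<close> of \<open>T\<close>, completed by \<open>g\<^sub>0 = 1\<close> and zero for negative indices, so that all formulas hold without case distinctions.
\<close>

definition G :: "int \<Rightarrow> U22" where
  "G i = (if i < 0 then 0 else if i = 0 then 1 else gM p cM (nat i))"

lemma gM_UM: "1 \<le> i \<Longrightarrow> gM p cM i \<in> UM i"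
proof (induction i rule: less_induct)
  case (less i)
  have "scal a * gM p cM j * M (- int (i - j)) \<in> UM i" if "j \<in> {1..<i}" for j a
  proof -
    have "gM p cM j * M (- int (i - j)) \<in> UM (j + (i - j))"
      using that less.IH[of j] by (intro UM_mult UM_M) auto
    then show ?thesis using that MS_scal by (simp add: UM_eq_MS mult.assoc)
  qed
  then have "(\<Sum>j\<in>{1..<i}. scal (1 - of_nat j / (2 * of_nat p - of_nat i)) * gM p cM j * M (- int (i - j))) \<in> UM i"
    unfolding UM_eq_MS by (intro MS_sum) auto
  then show ?case
    using UM_M[OF less.prems] unfolding UM_eq_MS by (subst gM.simps) (intro MS_add MS_scal)
qed

lemma G_UM: "0 \<le> i \<Longrightarrow> G i \<in> UM (nat i)"
  using UM_scal[of 1] gM_UM[of "nat i"] by (auto simp: G_def)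

lemma G_MS: "G i \<in> MS (\<lambda>_. True)"
proof (cases "i < 0")
  case False
  then show ?thesis using G_UM[of i] MS_mono[of "\<lambda>\<nu>. sum_list \<nu> = nat i" "\<lambda>_. True"] by (auto simp: UM_eq_MS)
qed (simp add: G_def MS_0)

lemma M_in_MS: "i > 0 \<Longrightarrow> M (- i) \<in> MS (\<lambda>_. True)"
  using MS_M[of "nat i" "\<lambda>_. True"] by simp

text \<open>
  The factor \<open>(2 p - m) / k\<^sub>m\<close> by which the recursion of \<open>g\<^sub>m\<close> becomes free of denominators.
\<close>

definition gc :: "int \<Rightarrow> complex" where
  "gc m = of_int m * (of_nat p - of_int m) * (2 * of_nat p - of_int m) * cM / 12"

text \<open>
  With \<open>g\<^sub>0 = 1\<close> the separate first term of the recursion becomes the summand \<open>j = 0\<close>.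
\<close>

lemma G_rec:
  assumes "m < int p"
  shows "scal (gc m) * G m = (\<Sum>j\<in>{0..<m}. scal (2 * of_nat p - of_int m - of_int j) * (G j * M (j - m)))"
proof -
  consider "m < 0" | "m = 0" | "m > 0" by linarith
  then show ?thesis
  proof cases
    case 3
    define i where "i = nat m"
    have m: "m = int i" "i \<ge> 1" using 3 by (auto simp: i_def)
    have "of_int (int i) \<noteq> (0::complex)" "of_int (int p - int i) \<noteq> (0::complex)" "of_int (2 * int p - int i) \<noteq> (0::complex)"
      using m assms by (simp_all only: of_int_eq_0_iff)
    then have nz: "of_nat i \<noteq> (0::complex)" "of_nat p - of_nat i \<noteq> (0::complex)" "2 * of_nat p - of_nat i \<noteq> (0::complex)"
      by simp_all
    have k: "gc m * kcoef p cM i = 2 * of_nat p - of_nat i"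
      using nz cM0 by (simp add: gc_def kcoef_def m field_simps)
    have "scal (gc m) * G m = scal (gc m) * gM p cM i" using m by (simp add: G_def)
    also have "\<dots> = scal (gc m * kcoef p cM i) * M (- int i)
        + scal (gc m * kcoef p cM i) * (\<Sum>j\<in>{1..<i}.
         scal (1 - of_nat j / (2 * of_nat p - of_nat i)) * gM p cM j * M (- int (i - j)))"
      by (subst gM.simps) (simp add: distrib_left)
    also have "\<dots> = scal (2 * of_nat p - of_nat i) * M (- int i)
        + (\<Sum>j\<in>{1..<i}. scal (2 * of_nat p - of_nat i - of_nat j) * (gM p cM j * M (- int (i - j))))"
    proof -
      have "(2 * of_nat p - of_nat i) * (1 - of_nat j / (2 * of_nat p - of_nat i)) = 2 * of_nat p - of_nat i - (of_nat j :: complex)" for j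
        using nz by (simp add: field_simps)
      then show ?thesis unfolding k by (simp add: sum_distrib_left mult.assoc)
    qed
    also have "\<dots> = (\<Sum>j\<in>{0..<i}. scal (2 * of_nat p - of_nat i - of_nat j) * (G (int j) * M (- int (i - j))))"
    proof -
      have "{0..<i} = insert 0 {1..<i}" using m by auto
      then show ?thesis by (simp add: G_def)
    qed
    also have "\<dots> = (\<Sum>j\<in>{0..<m}. scal (2 * of_nat p - of_int m - of_int j) * (G j * M (j - m)))"
      by (rule sum.reindex_bij_witness[of _ nat int]) (auto simp: m of_nat_diff)
    finally show ?thesis .
  qed (simp_all add: G_def gc_def)
qed

lemma sum_shift:
  fixes f :: "int \<Rightarrow> U22"
  assumes "n \<ge> 0" "\<And>k. k > b - n \<Longrightarrow> f (k + n) = 0"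
  shows "(\<Sum>i\<in>{1..b}. if n < i then f i else 0) = (\<Sum>k\<in>{1..b}. f (k + n))"
proof -
  have "(\<Sum>i\<in>{1..b}. if n < i then f i else 0) = (\<Sum>i\<in>{n+1..b}. f i)"
    using assms by (intro sum.mono_neutral_cong_right) auto
  also have "\<dots> = (\<Sum>k\<in>{1..b-n}. f (k + n))"
    by (rule sum.reindex_bij_witness[of _ "\<lambda>k. k + n" "\<lambda>i. i - n"]) auto
  also have "\<dots> = (\<Sum>k\<in>{1..b}. f (k + n))"
    using assms by (intro sum.mono_neutral_left) auto
  finally show ?thesis .
qed

text \<open>
  By induction along the recursion. Applying the derivation to \<open>G_rec\<close> and inserting the induction hypothesis gives the
  recursion for \<open>G (m - n)\<close>, up to a factor: a polynomial identity in \<open>m\<close>, \<open>n\<close>, \<open>p\<close> and the summation index.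
\<close>

lemma Ed_G: "n \<ge> 1 \<Longrightarrow> m < int p \<Longrightarrow> Ed n (G m) (scal (- (2 * of_int n + of_nat p - of_int m)) * G (m - n))"
proof (induction "nat m" arbitrary: m rule: less_induct)
  case less
  show ?case
  proof (cases "m > 0")
    case False
    then have "G (m - n) = 0" "G m = 0 \<or> G m = 1" using less.prems by (auto simp: G_def)
    then show ?thesis using Ed_0 Ed_1 by auto
  next
    case True
    let ?m' = "m - n"
    define N P' K :: complex where "N = of_int n" and "P' = of_nat p" and "K = of_int m"
    have IH: "Ed n (G j) (scal (- (2 * N + P' - of_int j)) * G (j - n))" if "j \<in> {0..<m}" for j
      unfolding N_def P'_def using that less.prems by (intro less.hyps) auto
    have "Ed n (G j * M (- (m - j))) (G j * EM n (m - j) + scal (- (2 * N + P' - of_int j)) * G (j - n) * M (- (m - j)))"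
      if "j \<in> {0..<m}" for j
      using that IH[OF that] by (intro Ed_mult[OF _ _ G_MS M_in_MS] Ed_M) auto
    then have 1: "Ed n (scal (gc m) * G m) (\<Sum>j\<in>{0..<m}. scal (2 * P' - K - of_int j) *
        (G j * EM n (m - j) + scal (- (2 * N + P' - of_int j)) * G (j - n) * M (- (m - j))))"
      unfolding G_rec[OF less.prems(2)] P'_def K_def by (intro Ed_sum Ed_scal) simp
    have "(\<Sum>j\<in>{0..<m}. scal (2 * P' - K - of_int j) * (G j * EM n (m - j)))
        = (\<Sum>j\<in>{0..<m}. (if j < ?m' then scal ((2 * P' - K - of_int j) * (N + K - of_int j)) * (G j * M (j - ?m')) else 0)
            + (if j = ?m' then scal ((2 * P' - 2 * K + N) * phi n) * G ?m' else 0))"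
    proof (intro sum.cong refl)
      fix j assume "j \<in> {0..<m}"
      consider "j < ?m'" | "j = ?m'" | "j > ?m'" by linarith
      then show "scal (2 * P' - K - of_int j) * (G j * EM n (m - j))
          = (if j < ?m' then scal ((2 * P' - K - of_int j) * (N + K - of_int j)) * (G j * M (j - ?m')) else 0)
            + (if j = ?m' then scal ((2 * P' - 2 * K + N) * phi n) * G ?m' else 0)"
      proof cases
        case 1
        have "EM n (m - j) = scal (of_int (n + (m - j))) * M (n - (m - j))" using 1 by (simp add: EM_def)
        also have "of_int (n + (m - j)) = N + K - of_int j" by (simp add: N_def K_def)
        also have "n - (m - j) = j - ?m'" by simp
        finally show ?thesis using 1 by (simp add: scal_left_commute[of "G j"])
      next
        case 2
        have "2 * P' - K - of_int j = 2 * P' - 2 * K + N" by (simp add: N_def K_def 2)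
        then show ?thesis using 2 by (simp add: EM_def scal_commute)
      qed (simp add: EM_def)
    qed
    also have "\<dots> = (\<Sum>j\<in>{0..<?m'}. scal ((2 * P' - K - of_int j) * (N + K - of_int j)) * (G j * M (j - ?m')))
        + scal ((2 * P' - 2 * K + N) * phi n) * G ?m'"
    proof -
      have "(\<Sum>j\<in>{0..<m}. if j < ?m' then scal ((2 * P' - K - of_int j) * (N + K - of_int j)) * (G j * M (j - ?m')) else 0)
        = (\<Sum>j\<in>{0..<?m'}. scal ((2 * P' - K - of_int j) * (N + K - of_int j)) * (G j * M (j - ?m')))"
        using less.prems by (intro sum.mono_neutral_cong_right) auto
      moreover have "(\<Sum>j\<in>{0..<m}. if j = ?m' then scal ((2 * P' - 2 * K + N) * phi n) * G ?m' else 0)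
        = scal ((2 * P' - 2 * K + N) * phi n) * G ?m'"
        using less.prems by (auto simp: G_def)
      ultimately show ?thesis by (simp add: sum.distrib)
    qed
    finally have s1: "(\<Sum>j\<in>{0..<m}. scal (2 * P' - K - of_int j) * (G j * EM n (m - j))) = \<dots>" .
    have "(\<Sum>j\<in>{0..<m}. scal (2 * P' - K - of_int j) * (scal (- (2 * N + P' - of_int j)) * G (j - n) * M (- (m - j))))
       = (\<Sum>j\<in>{n..<m}. scal ((2 * P' - K - of_int j) * (- (2 * N + P' - of_int j))) * (G (j - n) * M (j - m)))"
    proof (intro sum.mono_neutral_cong_right ballI)
      fix j assume "j \<in> {0..<m} - {n..<m}"
      then have "j < n" by auto
      then have "G (j - n) = 0" by (simp add: G_def)
      then show "scal (2 * P' - K - of_int j) * (scal (- (2 * N + P' - of_int j)) * G (j - n) * M (- (m - j))) = 0" by simp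
    next
      fix j
      have "- (m - j) = j - m" by simp
      then show "scal (2 * P' - K - of_int j) * (scal (- (2 * N + P' - of_int j)) * G (j - n) * M (- (m - j)))
         = scal ((2 * P' - K - of_int j) * (- (2 * N + P' - of_int j))) * (G (j - n) * M (j - m))"
        by (simp only: mult.assoc U.scale_scale)
    qed (use less.prems in auto)
    also have "\<dots> = (\<Sum>k\<in>{0..<?m'}. scal (- (2 * P' - K - N - of_int k) * (N + P' - of_int k)) * (G k * M (k - ?m')))"
    proof (rule sum.reindex_bij_witness[of _ "\<lambda>k. k + n" "\<lambda>j. j - n"])
      fix j
      have "- (2 * P' - K - N - of_int (j - n)) * (N + P' - of_int (j - n)) = (2 * P' - K - of_int j) * (- (2 * N + P' - of_int j))"
        "j - n - ?m' = j - m"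
        by (simp_all add: N_def algebra_simps)
      then show "scal (- (2 * P' - K - N - of_int (j - n)) * (N + P' - of_int (j - n))) * (G (j - n) * M (j - n - ?m'))
        = scal ((2 * P' - K - of_int j) * (- (2 * N + P' - of_int j))) * (G (j - n) * M (j - m))" by metis
    qed auto
    finally have s2: "(\<Sum>j\<in>{0..<m}. scal (2 * P' - K - of_int j) * (scal (- (2 * N + P' - of_int j)) * G (j - n) * M (- (m - j)))) = \<dots>" .
    have "(\<Sum>j\<in>{0..<m}. scal (2 * P' - K - of_int j) *
        (G j * EM n (m - j) + scal (- (2 * N + P' - of_int j)) * G (j - n) * M (- (m - j))))
      = (\<Sum>j\<in>{0..<?m'}. scal ((2 * P' - K - of_int j) * (N + K - of_int j)) * (G j * M (j - ?m'))
           + scal (- (2 * P' - K - N - of_int j) * (N + P' - of_int j)) * (G j * M (j - ?m')))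
         + scal ((2 * P' - 2 * K + N) * phi n) * G ?m'"
      unfolding distrib_left[where 'a=U22] sum.distrib s1 s2 by (simp only: ac_simps)
    also have "(\<Sum>j\<in>{0..<?m'}. scal ((2 * P' - K - of_int j) * (N + K - of_int j)) * (G j * M (j - ?m'))
           + scal (- (2 * P' - K - N - of_int j) * (N + P' - of_int j)) * (G j * M (j - ?m')))
        = scal (N - P' + K) * (\<Sum>j\<in>{0..<?m'}. scal (2 * P' - of_int ?m' - of_int j) * (G j * M (j - ?m')))"
      unfolding sum_distrib_left
    proof (intro sum.cong refl)
      fix j
      have "(2 * P' - K - of_int j) * (N + K - of_int j) + (- (2 * P' - K - N - of_int j) * (N + P' - of_int j))
          = (N - P' + K) * (2 * P' - of_int ?m' - of_int j)"
        by (simp add: K_def N_def algebra_simps)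
      then show "scal ((2 * P' - K - of_int j) * (N + K - of_int j)) * (G j * M (j - ?m'))
           + scal (- (2 * P' - K - N - of_int j) * (N + P' - of_int j)) * (G j * M (j - ?m'))
         = scal (N - P' + K) * (scal (2 * P' - of_int ?m' - of_int j) * (G j * M (j - ?m')))"
        by (metis U.scale_left_distrib U.scale_scale)
    qed
    also have "\<dots> = scal (N - P' + K) * (scal (gc ?m') * G ?m')"
      using G_rec[of ?m'] less.prems by (simp add: P'_def)
    also have "\<dots> + scal ((2 * P' - 2 * K + N) * phi n) * G ?m'
        = scal ((N - P' + K) * gc ?m' + (2 * P' - 2 * K + N) * phi n) * G ?m'"
      by (simp add: scal_add distrib_right scal_mult mult.assoc del: U.scale_scale)
    also have "(N - P' + K) * gc ?m' + (2 * P' - 2 * K + N) * phi n = gc m * (- (2 * N + P' - K))"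
      unfolding gc_def phi_def by (simp add: K_def N_def P'_def field_simps power2_eq_square power3_eq_cube)
    finally have 2: "(\<Sum>j\<in>{0..<m}. scal (2 * P' - K - of_int j) *
        (G j * EM n (m - j) + scal (- (2 * N + P' - of_int j)) * G (j - n) * M (- (m - j))))
        = scal (gc m * (- (2 * N + P' - K))) * G ?m'" .
    have "of_nat p - of_int m \<noteq> (0::complex)" "2 * of_nat p - of_int m \<noteq> (0::complex)" "of_int m \<noteq> (0::complex)"
    proof -
      have "of_int (int p - m) \<noteq> (0::complex)" "of_int (2 * int p - m) \<noteq> (0::complex)"
        using less.prems True by (simp_all only: of_int_eq_0_iff)
      then show "of_nat p - of_int m \<noteq> (0::complex)" "2 * of_nat p - of_int m \<noteq> (0::complex)" by simp_all
    qed (use True in simp)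
    then have nz: "gc m \<noteq> 0" using cM0 by (simp add: gc_def)
    have "Ed n (scal (inverse (gc m)) * (scal (gc m) * G m)) (scal (inverse (gc m)) * (scal (gc m * (- (2 * N + P' - K))) * G ?m'))"
      using 1 unfolding 2 by (rule Ed_scal)
    moreover have "inverse (gc m) * (gc m * z) = z" for z using nz by simp
    ultimately show ?thesis using nz unfolding U.scale_scale N_def P'_def K_def by simp
  qed
qed

text \<open>
  The recursion read at \<open>m = p - n\<close>, where \<open>gc (p - n) = - phi n\<close>.
\<close>

lemma phi_G_sum:
  assumes "n \<ge> 1"
  shows "scal (phi n) * G (int p - n) + (\<Sum>k\<in>{1..int p}. scal (2 * of_int n + of_int k) * (M (- k) * G (int p - n - k))) = 0"
proof -
  let ?m = "int p - n"
  have "(\<Sum>k\<in>{1..int p}. scal (2 * of_int n + of_int k) * (M (- k) * G (?m - k)))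
      = (\<Sum>k\<in>{1..?m}. scal (2 * of_int n + of_int k) * (G (?m - k) * M (- k)))"
    using assms by (intro sum.mono_neutral_cong_right) (auto simp: G_def M_MS[OF G_MS[unfolded G_def]] M_MS[OF gM_UM[unfolded UM_eq_MS]])
  also have "\<dots> = (\<Sum>j\<in>{0..<?m}. scal (2 * of_nat p - of_int ?m - of_int j) * (G j * M (j - ?m)))"
    by (rule sum.reindex_bij_witness[of _ "\<lambda>j. ?m - j" "\<lambda>k. ?m - k"]) (auto simp: algebra_simps)
  also have "\<dots> = scal (gc ?m) * G ?m" using assms by (intro G_rec[symmetric]) auto
  finally have "(\<Sum>k\<in>{1..int p}. scal (2 * of_int n + of_int k) * (M (- k) * G (?m - k))) = scal (gc ?m) * G ?m" .
  moreover have "phi n + gc ?m = 0"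
    unfolding gc_def phi_def by (simp add: field_simps power2_eq_square)
  ultimately show ?thesis by (metis U.scale_left_distrib U.scale_zero_left)
qed

section \<open>The singular vector and the operator \<open>T\<close>\<close>

text \<open>
  The singular vector; its term \<open>i = p\<close> is \<open>p M\<^sub>-\<^sub>p\<close>.
\<close>

definition Sv :: U22 where "Sv = (\<Sum>i\<in>{1..int p}. scal (of_int i) * (M (- i) * G (int p - i)))"

text \<open>
  The companion of \<open>Sv\<close> that absorbs the central charge in \<open>L\<^sub>n T\<close>.
\<close>

definition Qv :: U22 where "Qv = (\<Sum>i\<in>{1..int p}. M (- i) * G (int p - i))"

lemma MG_UM: "i \<in> {1..int p} \<Longrightarrow> M (- i) * G (int p - i) \<in> UM p"
proof -
  assume i: "i \<in> {1..int p}"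
  then have "1 \<le> nat i" "nat i + nat (int p - i) = p" by auto
  then show ?thesis using i UM_mult[OF UM_M[of "nat i"] G_UM[of "int p - i"]] by simp
qed

lemma Sv_UM: "Sv \<in> UM p" and Qv_UM: "Qv \<in> UM p"
  using MG_UM unfolding Sv_def Qv_def UM_eq_MS by (auto intro!: MS_sum MS_scal)

lemma Ed_MG: "n \<ge> 1 \<Longrightarrow> i > 0 \<Longrightarrow> Ed n (M (- i) * G (int p - i))
    (- (scal (2 * of_int n + of_int i) * (M (- i) * G (int p - n - i))) + EM n i * G (int p - i))"
proof -
  assume n: "n \<ge> 1" "i > 0"
  have "Ed n (M (- i) * G (int p - i)) (M (- i) * (scal (- (2 * of_int n + of_nat p - of_int (int p - i))) * G (int p - i - n)) + EM n i * G (int p - i))"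
    using n by (intro Ed_mult[OF _ _ M_in_MS G_MS] Ed_M Ed_G) auto
  then show ?thesis by (simp add: M_scal scal_uminus algebra_simps)
qed

lemma sum_EM:
  assumes "n \<ge> 1"
  shows "(\<Sum>i\<in>{1..int p}. scal (c i) * (EM n i * G (int p - i)))
     = (\<Sum>k\<in>{1..int p}. scal (c (k + n) * (2 * of_int n + of_int k)) * (M (- k) * G (int p - n - k)))
       + scal (c n * phi n) * G (int p - n)"
proof -
  have "(\<Sum>i\<in>{1..int p}. scal (c i) * (EM n i * G (int p - i)))
     = (\<Sum>i\<in>{1..int p}. (if n < i then scal (c i * (of_int (n + i))) * (M (n - i) * G (int p - i)) else 0)
          + (if i = n then scal (c n * phi n) * G (int p - n) else 0))"
    by (intro sum.cong) (auto simp: EM_def mult.assoc)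
  also have "\<dots> = (\<Sum>k\<in>{1..int p}. scal (c (k + n) * (of_int (n + (k + n)))) * (M (n - (k + n)) * G (int p - (k + n))))
     + (\<Sum>i\<in>{1..int p}. if i = n then scal (c n * phi n) * G (int p - n) else 0)"
    unfolding sum.distrib using assms by (subst sum_shift) (auto simp: G_def)
  also have "(\<Sum>i\<in>{1..int p}. if i = n then scal (c n * phi n) * G (int p - n) else 0) = scal (c n * phi n) * G (int p - n)"
    using assms by (auto simp: G_def)
  also have "(\<Sum>k\<in>{1..int p}. scal (c (k + n) * (of_int (n + (k + n)))) * (M (n - (k + n)) * G (int p - (k + n))))
     = (\<Sum>k\<in>{1..int p}. scal (c (k + n) * (2 * of_int n + of_int k)) * (M (- k) * G (int p - n - k)))"
  proof (intro sum.cong refl)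
    fix k
    have "of_int (n + (k + n)) = 2 * of_int n + (of_int k :: complex)" "n - (k + n) = - k" "int p - (k + n) = int p - n - k"
      by simp_all
    then show "scal (c (k + n) * (of_int (n + (k + n)))) * (M (n - (k + n)) * G (int p - (k + n)))
      = scal (c (k + n) * (2 * of_int n + of_int k)) * (M (- k) * G (int p - n - k))" by metis
  qed
  finally show ?thesis .
qed

text \<open>
  The terms \<open>M\<^sub>-\<^sub>k g\<^bsub>p-n-k\<^esub>\<close> that arise from the two factors of the summands cancel after a shift of the summation index; this leaves the scalar commutator.
\<close>

lemma Ed_Qv: assumes "n \<ge> 1" shows "Ed n Qv (scal (phi n) * G (int p - n))"
proof -
  have "Ed n Qv (\<Sum>i\<in>{1..int p}. - (scal (2 * of_int n + of_int i) * (M (- i) * G (int p - n - i))) + EM n i * G (int p - i))"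
    unfolding Qv_def using assms by (intro Ed_sum Ed_MG) auto
  also have "(\<Sum>i\<in>{1..int p}. - (scal (2 * of_int n + of_int i) * (M (- i) * G (int p - n - i))) + EM n i * G (int p - i))
     = scal (phi n) * G (int p - n)"
    using sum_EM[OF assms, of "\<lambda>_. 1"] by (simp add: sum.distrib sum_negf sum_subtractf)
  finally show ?thesis .
qed

text \<open>
  Here what remains is \<open>n\<close> times the left-hand side of \<open>phi_G_sum\<close>. So \<open>Sv\<close> commutes with every \<open>L\<^sub>n\<close>, \<open>n \<ge> 1\<close>.
\<close>

lemma Ed_Sv: assumes "n \<ge> 1" shows "Ed n Sv 0"
proof -
  let ?W = "\<lambda>c. \<Sum>k\<in>{1..int p}. scal (c k * (2 * of_int n + of_int k)) * (M (- k) * G (int p - n - k))"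
  have "Ed n Sv (\<Sum>i\<in>{1..int p}. scal (of_int i) * (- (scal (2 * of_int n + of_int i) * (M (- i) * G (int p - n - i))) + EM n i * G (int p - i)))"
    unfolding Sv_def using assms by (intro Ed_sum Ed_scal Ed_MG) auto
  also have "(\<Sum>i\<in>{1..int p}. scal (of_int i) * (- (scal (2 * of_int n + of_int i) * (M (- i) * G (int p - n - i))) + EM n i * G (int p - i)))
     = - ?W of_int + (?W (\<lambda>k. of_int (k + n)) + scal (of_int n * phi n) * G (int p - n))"
    unfolding distrib_left[where 'a=U22] mult_minus_right[where 'a=U22] U.scale_scale sum.distrib sum_negf
      sum_EM[OF assms, of of_int] by simp
  also have "?W (\<lambda>k. of_int (k + n)) = ?W of_int + ?W (\<lambda>k. of_int n)"
    by (simp add: sum.distrib[symmetric] scal_add[symmetric] distrib_right[symmetric])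
  also have "?W (\<lambda>k. of_int n) = scal (of_int n) * (\<Sum>k\<in>{1..int p}. scal (2 * of_int n + of_int k) * (M (- k) * G (int p - n - k)))"
    by (simp add: sum_distrib_left)
  also have "(\<Sum>k\<in>{1..int p}. scal (2 * of_int n + of_int k) * (M (- k) * G (int p - n - k))) = - (scal (phi n) * G (int p - n))"
    using phi_G_sum[OF assms] by (metis add_eq_0_iff)
  finally show ?thesis by simp
qed

text \<open>
  \<open>x\<close> raises the eigenvalue of \<open>L\<^sub>0\<close> by \<open>n\<close>; thus \<open>L\<^sub>-\<^sub>n\<close> and \<open>M\<^sub>-\<^sub>n\<close> have weight \<open>n\<close>.
\<close>

definition wt :: "int \<Rightarrow> U22 \<Rightarrow> bool" where
  "wt n x \<longleftrightarrow> L 0 * x = x * L 0 + scal (of_int n) * x"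

lemma wt_mult: "wt m x \<Longrightarrow> wt n y \<Longrightarrow> wt (m + n) (x * y)"
proof -
  assume x: "wt m x" and y: "wt n y"
  have "L 0 * (x * y) = (x * L 0 + scal (of_int m) * x) * y" using x by (simp add: wt_def flip: mult.assoc)
  also have "\<dots> = x * (y * L 0 + scal (of_int n) * y) + scal (of_int m) * (x * y)" using y by (simp add: wt_def algebra_simps)
  finally show ?thesis by (simp add: wt_def algebra_simps scal_left_commute[of x] scal_add)
qed

lemma wt_add: "wt m x \<Longrightarrow> wt m y \<Longrightarrow> wt m (x + y)" by (simp add: wt_def algebra_simps)
lemma wt_0: "wt m 0" by (simp add: wt_def)
lemma wt_scal1: "wt 0 (scal c)" by (simp add: wt_def scal_commute)
lemma wt_1: "wt 0 1" by (simp add: wt_def)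
lemma wt_scal: "wt m x \<Longrightarrow> wt m (scal c * x)" using wt_mult[OF wt_scal1] by fastforce
lemma wt_sum: "(\<And>i. i \<in> A \<Longrightarrow> wt m (f i)) \<Longrightarrow> wt m (sum f A)"
  by (induction A rule: infinite_finite_induct) (auto intro: wt_0 wt_add)
lemma wt_M: "wt (- n) (M n)" using LM[of 0 n] by (simp add: wt_def cocyc_def)
lemma wt_L: "wt (- n) (L n)" using LL[of 0 n] by (simp add: wt_def cocyc_def)

lemma wt_M_part: "wt (int (sum_list \<nu>)) (M_part \<nu>)"
proof (induction \<nu>)
  case (Cons i \<nu>)
  then show ?case using wt_mult[OF wt_M[of "- int i"]] by simp
qed (simp add: wt_1)

lemma wt_UM: "a \<in> UM n \<Longrightarrow> wt (int n) a"
  unfolding UM_eq_MS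
  by (induction rule: MS_induct) (auto intro: wt_0 wt_add wt_scal wt_M_part)

lemma wt_G: "0 \<le> i \<Longrightarrow> wt i (G i)" using wt_UM[OF G_UM] by fastforce

lemma wt_eigen:
  assumes "left_ideal X" "wt n x" "L 0 * y \<approx>\<^bsub>X\<^esub> scal \<mu> * y"
  shows "L 0 * (x * y) \<approx>\<^bsub>X\<^esub> scal (\<mu> + of_int n) * (x * y)"
proof -
  have "L 0 * (x * y) = x * (L 0 * y) + scal (of_int n) * (x * y)"
    using arg_cong[OF assms(2)[unfolded wt_def], of "\<lambda>x. x * y"] by (simp add: distrib_right mult.assoc)
  also have "\<dots> \<approx>\<^bsub>X\<^esub> x * (scal \<mu> * y) + scal (of_int n) * (x * y)"
    by (intro eqm_add eqm_lmult assms eqm_refl)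
  finally show ?thesis by (simp add: scal_left_commute[of x] scal_add distrib_right)
qed

text \<open>
  The value for which the terms of \<open>L\<^sub>n T\<close> that are cubic in \<open>n\<close> cancel: they come from the central charge and from reordering, which contributes the \<open>26\<close>.
\<close>

definition bT :: complex where "bT = (26 - cL) / cM"

text \<open>
  A closed form of \<open>T\<close> with the \<open>L\<close> to the left, which is the order in which \<open>L\<^sub>n\<close> is moved through it.
  The parameter \<open>s\<close> is left open here, since \<open>Sv\<close> commutes with the \<open>L\<^sub>n\<close>.
\<close>

definition TT :: "complex \<Rightarrow> U22" where
  "TT s = (\<Sum>i\<in>{1..int p}. L (- i) * G (int p - i)) + scal bT * Qv + scal s * Sv"

abbreviation hp :: complex where "hp \<equiv> h' p 1 cL"

text \<open>
  The commutator of \<open>L\<^sub>n\<close> with \<open>T\<close> on a weight vector that looks like a highest weight vector to the \<open>M\<close>. All terms of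
  the form \<open>L\<^sub>-\<^sub>i g\<close> cancel by \<open>Ed_G\<close>, and of the scalar multiples of \<open>g\<^bsub>p-n\<^esub>\<close> only the part linear in \<open>n\<close> survives,
  by the choice of \<open>bT\<close>. The remaining sum involves only \<open>L\<^sub>k y\<close> with \<open>0 < k < n\<close>.
\<close>

lemma L_TT:
  assumes X: "left_ideal X" and y: "mvac X y" "L 0 * y \<approx>\<^bsub>X\<^esub> scal \<mu> * y" "CL * y \<approx>\<^bsub>X\<^esub> scal cL * y" and n: "n \<ge> 1"
  shows "L n * (TT s * y) \<approx>\<^bsub>X\<^esub> TT s * (L n * y) + scal (2 * of_int n * (\<mu> - hp)) * (G (int p - n) * y)
     + (\<Sum>i\<in>{1..int p}. if i < n then scal (of_int (n + i)) * (G (int p - i) * (L (n - i) * y)) else 0)"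
proof -
  note st = left_ideal_Mstable[OF X]
  let ?P = "int p"
  let ?g = "G (?P - n) * y"
  define \<rho> where "\<rho> = 2 * of_int n * (\<mu> + of_nat p - of_int n) + cocyc n * cL"
  define A where "A i = L (- i) * (G (?P - i) * (L n * y))" for i
  define B where "B i = scal (2 * of_int n + of_int i) * (L (- i) * (G (?P - n - i) * y))" for i
  define C where "C i = (if n < i then scal (of_int (n + i)) * (L (n - i) * (G (?P - i) * y)) else 0)" for i
  define D where "D i = (if i = n then scal \<rho> * ?g else 0)" for i
  define E where "E i = (if i < n then scal (of_int (n + i)) * (G (?P - i) * (L (n - i) * y)) else 0)" for i
  define F where "F i = (if i < n then scal (- (of_int (n + i) * (2 * of_int n - of_int i))) * ?g else 0)" for i
  have summand: "L n * (L (- i) * (G (?P - i) * y)) \<approx>\<^bsub>X\<^esub> (A i - B i + C i + D i + F i) + E i"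
    if i: "i \<in> {1..?P}" for i
  proof -
    have "L n * (L (- i) * (G (?P - i) * y)) = L (- i) * (L n * (G (?P - i) * y))
        + scal (of_int (n + i)) * (L (n - i) * (G (?P - i) * y)) + (if n = i then scal (cocyc n) * (CL * (G (?P - i) * y)) else 0)"
      using LL_app[of n "- i" "G (?P - i) * y"] by simp
    moreover have "L (- i) * (L n * (G (?P - i) * y)) \<approx>\<^bsub>X\<^esub> A i - B i"
    proof -
      have "L n * (G (?P - i) * y) \<approx>\<^bsub>X\<^esub> G (?P - i) * (L n * y)
          + (scal (- (2 * of_int n + of_nat p - of_int (?P - i))) * G (?P - i - n)) * y"
        using i n by (intro EdD[OF Ed_G st y(1)]) auto
      also have "\<dots> = G (?P - i) * (L n * y) - scal (2 * of_int n + of_int i) * (G (?P - n - i) * y)"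
        by (simp add: scal_uminus mult.assoc algebra_simps)
      finally have "L (- i) * (L n * (G (?P - i) * y)) \<approx>\<^bsub>X\<^esub>
          L (- i) * (G (?P - i) * (L n * y) - scal (2 * of_int n + of_int i) * (G (?P - n - i) * y))"
        by (rule eqm_lmult[OF X])
      then show ?thesis by (simp add: A_def B_def right_diff_distrib L_scal)
    qed
    moreover have "scal (of_int (n + i)) * (L (n - i) * (G (?P - i) * y)) + (if n = i then scal (cocyc n) * (CL * (G (?P - i) * y)) else 0)
        \<approx>\<^bsub>X\<^esub> C i + D i + F i + E i"
    proof -
      consider "n < i" | "n = i" | "i < n" by linarith
      then show ?thesis
      proof cases
        case 1 then show ?thesis by (simp add: C_def D_def E_def F_def)
      next
        case 2
        have 1: "L 0 * ?g \<approx>\<^bsub>X\<^esub> scal (\<mu> + of_int (?P - n)) * ?g"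
          using 2 i by (intro wt_eigen[OF X wt_G y(2)]) auto
        have "CL * ?g = G (?P - n) * (CL * y)" by (metis CL_comm mult.assoc)
        also have "\<dots> \<approx>\<^bsub>X\<^esub> G (?P - n) * (scal cL * y)" by (intro eqm_lmult X y)
        finally have 3: "CL * ?g \<approx>\<^bsub>X\<^esub> scal cL * ?g" by (simp add: scal_left_commute[of "G (?P - n)"])
        have "scal (of_int (n + n)) * (L 0 * ?g) + scal (cocyc n) * (CL * ?g)
          \<approx>\<^bsub>X\<^esub> scal (of_int (n + n)) * (scal (\<mu> + of_int (?P - n)) * ?g) + scal (cocyc n) * (scal cL * ?g)"
          by (intro eqm_add eqm_scal 1 3)
        also have "\<dots> = scal \<rho> * ?g"
        proof -
          have "of_int (n + n) * (\<mu> + of_int (?P - n)) + cocyc n * cL = \<rho>" by (simp add: \<rho>_def algebra_simps)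
          then show ?thesis by (metis U.scale_left_distrib U.scale_scale)
        qed
        finally show ?thesis using 2 by (simp add: C_def D_def E_def F_def)
      next
        case 3
        have "L (n - i) * (G (?P - i) * y) \<approx>\<^bsub>X\<^esub> G (?P - i) * (L (n - i) * y)
            + (scal (- (2 * of_int (n - i) + of_nat p - of_int (?P - i))) * G (?P - i - (n - i))) * y"
          using i 3 by (intro EdD[OF Ed_G st y(1)]) auto
        also have "\<dots> = G (?P - i) * (L (n - i) * y) + scal (- (2 * of_int n - of_int i)) * ?g"
          by (simp add: mult.assoc algebra_simps)
        finally have "scal (of_int (n + i)) * (L (n - i) * (G (?P - i) * y)) \<approx>\<^bsub>X\<^esub>
           scal (of_int (n + i)) * (G (?P - i) * (L (n - i) * y) + scal (- (2 * of_int n - of_int i)) * ?g)"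
          by (rule eqm_scal)
        also have "\<dots> = E i + F i" using 3
          unfolding E_def F_def distrib_left U.scale_scale mult_minus_right by simp
        finally show ?thesis using 3 by (simp add: C_def D_def add.commute)
      qed
    qed
    ultimately show ?thesis
      using eqm_add[of "L (- i) * (L n * (G (?P - i) * y))" X "A i - B i"] by (simp add: add.assoc)
  qed
  have BC: "sum B {1..?P} = sum C {1..?P}"
  proof -
    have "sum C {1..?P} = (\<Sum>k\<in>{1..?P}. scal (of_int (n + (k + n))) * (L (n - (k + n)) * (G (?P - (k + n)) * y)))"
      unfolding C_def using n by (intro sum_shift) (auto simp: G_def)
    also have "\<dots> = sum B {1..?P}"
    proof (intro sum.cong refl)
      fix k
      have "of_int (n + (k + n)) = 2 * of_int n + (of_int k :: complex)" "n - (k + n) = - k" "?P - (k + n) = ?P - n - k"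
        by simp_all
      then show "scal (of_int (n + (k + n))) * (L (n - (k + n)) * (G (?P - (k + n)) * y)) = B k"
        unfolding B_def by metis
    qed
    finally show ?thesis by simp
  qed
  have DF: "sum D {1..?P} + sum F {1..?P} + scal bT * (scal (phi n) * ?g) = scal (2 * of_int n * (\<mu> - hp)) * ?g"
  proof (cases "n \<le> ?P")
    case False
    then show ?thesis by (simp add: D_def F_def G_def)
  next
    case True
    have sq: "(\<Sum>i\<in>{1..<k}. of_int ((k + i) * (2 * k - i))) = (of_int (k * (k - 1) * (13 * k + 1)) / 6 :: complex)" if "k \<ge> 1" for k :: int
    proof -
      have "(\<Sum>i\<in>{1..<int m}. (of_int ((c + i) * (2 * c - i)) :: complex)) = of_nat (m - 1) * 2 * of_int c ^ 2 + of_int c * (of_nat (m - 1) * of_nat m / 2) - of_nat (m - 1) * of_nat m * (2 * of_nat m - 1) / 6" if "m \<ge> 1" for m c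
        using that
      proof (induction m rule: nat_induct_at_least)
        case (Suc m)
        have "{1..<int (Suc m)} = insert (int m) {1..<int m}" using Suc.hyps by auto
        then show ?case using Suc by (simp add: of_nat_diff field_simps power2_eq_square)
      qed simp
      note sums = this
      have ik: "int (nat k) = k" and e: "of_nat (nat k - 1) = of_int k - (1::complex)" "of_nat (nat k) = (of_int k::complex)"
        and k1: "1 \<le> nat k"
        using that by (simp_all add: of_nat_diff of_nat_nat)
      show ?thesis unfolding sums[OF k1, of k, unfolded ik e] by (simp add: field_simps power2_eq_square)
    qed
    have "sum D {1..?P} = scal \<rho> * ?g" using n True by (simp add: D_def)
    moreover have "sum F {1..?P} = (\<Sum>i\<in>{1..<n}. scal (- (of_int (n + i) * (2 * of_int n - of_int i))) * ?g)"
      unfolding F_def using True by (intro sum.mono_neutral_cong_right) auto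
    moreover have "\<dots> = scal (\<Sum>i\<in>{1..<n}. - (of_int (n + i) * (2 * of_int n - of_int i))) * ?g"
      by (rule U.scale_sum_left[symmetric])
    moreover have "(\<Sum>i\<in>{1..<n}. - (of_int (n + i) * (2 * of_int n - of_int i))) = - (of_int (n * (n - 1) * (13 * n + 1)) / 6 :: complex)"
      using sq[OF n] by (simp add: sum_negf)
    moreover have "\<rho> - of_int (n * (n - 1) * (13 * n + 1)) / 6 + bT * phi n = 2 * of_int n * (\<mu> - hp)"
      using cM0 by (simp add: \<rho>_def cocyc_def bT_def phi_def h'_def field_simps power2_eq_square power3_eq_cube)
    ultimately show ?thesis
      by (metis (no_types, lifting) U.scale_left_distrib U.scale_scale diff_conv_add_uminus)
  qed
  have "L n * (TT s * y) = (\<Sum>i\<in>{1..?P}. L n * (L (- i) * (G (?P - i) * y)))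
      + scal bT * (L n * (Qv * y)) + scal s * (L n * (Sv * y))"
    by (simp add: TT_def algebra_simps sum_distrib_right sum_distrib_left L_scal)
  also have "\<dots> \<approx>\<^bsub>X\<^esub> (\<Sum>i\<in>{1..?P}. (A i - B i + C i + D i + F i) + E i)
      + scal bT * (Qv * (L n * y) + scal (phi n) * G (?P - n) * y) + scal s * (Sv * (L n * y) + 0 * y)"
    using n by (intro eqm_add eqm_sum eqm_scal summand EdD[OF Ed_Qv st y(1)] EdD[OF Ed_Sv st y(1)]) auto
  also have "\<dots> = sum A {1..?P} + scal bT * (Qv * (L n * y)) + scal s * (Sv * (L n * y))
      + (sum D {1..?P} + sum F {1..?P} + scal bT * (scal (phi n) * ?g)) + sum E {1..?P}"
    using BC by (simp add: sum.distrib sum_subtractf distrib_left algebra_simps)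
  also have "\<dots> = TT s * (L n * y) + scal (2 * of_int n * (\<mu> - hp)) * ?g + sum E {1..?P}"
    unfolding DF by (simp add: TT_def A_def algebra_simps sum_distrib_right)
  finally show ?thesis by (simp add: E_def)
qed

text \<open>
  For \<open>n > 0\<close> the commutators produce \<open>phi_G_sum\<close>; for \<open>n = 0\<close> they produce \<open>Sv\<close>, since \<open>[M\<^sub>0, L\<^sub>-\<^sub>i] = i M\<^sub>-\<^sub>i\<close>.
\<close>

lemma M_TT:
  assumes X: "left_ideal X" and y: "mvac X y" and n: "n \<ge> 0"
  shows "M n * (TT s * y) \<approx>\<^bsub>X\<^esub> TT s * (M n * y) + (if n = 0 then Sv * y else 0)"
proof -
  note st = left_ideal_Mstable[OF X]
  let ?P = "int p"
  have MQ: "M n * (a * y) = a * (M n * y)" if "a \<in> MS Q" for a Q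
    using M_MS[OF that] by (simp flip: mult.assoc)
  have summand: "M n * (L (- i) * (G (?P - i) * y)) \<approx>\<^bsub>X\<^esub> L (- i) * (G (?P - i) * (M n * y)) + EM n i * (G (?P - i) * y)"
    if i: "i \<in> {1..?P}" for i
  proof -
    have "M n * (L (- i) * (G (?P - i) * y)) = L (- i) * (M n * (G (?P - i) * y)) + (scal (of_int (n + i)) * (M (n - i) * (G (?P - i) * y))
      + (if n = i then scal (cocyc n) * (CM * (G (?P - i) * y)) else 0))"
      using M_L_app[of n "- i" "G (?P - i) * y"] by simp
    also have "\<dots> \<approx>\<^bsub>X\<^esub> L (- i) * (G (?P - i) * (M n * y)) + EM n i * (G (?P - i) * y)"
      unfolding MQ[OF G_MS]
      using i by (intro eqm_add eqm_refl commute_M_mvac mvac_MS[OF st y G_MS] left_ideal_subspace X) auto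
    finally show ?thesis .
  qed
  have E: "(\<Sum>i\<in>{1..?P}. EM n i * (G (?P - i) * y)) = (if n = 0 then Sv * y else 0)"
  proof (cases "n = 0")
    case True
    then show ?thesis by (simp add: EM_def Sv_def sum_distrib_right mult.assoc)
  next
    case False
    then have "n \<ge> 1" using n by simp
    from sum_EM[OF this, of "\<lambda>_. 1"] phi_G_sum[OF this]
    have "(\<Sum>i\<in>{1..?P}. EM n i * G (?P - i)) = 0" by (simp add: add.commute)
    then have "(\<Sum>i\<in>{1..?P}. EM n i * G (?P - i)) * y = 0" by simp
    then show ?thesis using False by (simp add: sum_distrib_right mult.assoc)
  qed
  have "M n * (TT s * y) = (\<Sum>i\<in>{1..?P}. M n * (L (- i) * (G (?P - i) * y)))
      + scal bT * (Qv * (M n * y)) + scal s * (Sv * (M n * y))"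
    using MQ[OF Qv_UM[unfolded UM_eq_MS]] MQ[OF Sv_UM[unfolded UM_eq_MS]]
    by (simp add: TT_def distrib_left distrib_right sum_distrib_right sum_distrib_left M_scal mult.assoc)
  also have "\<dots> \<approx>\<^bsub>X\<^esub> (\<Sum>i\<in>{1..?P}. L (- i) * (G (?P - i) * (M n * y)) + EM n i * (G (?P - i) * y))
      + scal bT * (Qv * (M n * y)) + scal s * (Sv * (M n * y))"
    by (intro eqm_add eqm_sum summand eqm_refl)
  also have "\<dots> = TT s * (M n * y) + (if n = 0 then Sv * y else 0)"
    unfolding sum.distrib E by (simp add: TT_def sum_distrib_right algebra_simps)
  finally show ?thesis .
qed

end

section \<open>Pairing products of \<open>L\<^sub>n\<close> with monomials in the \<open>M\<^sub>-\<^sub>n\<close>\<close>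

text \<open>
  Products of positive modes in which the head of the list is applied first.
\<close>

fun Lr :: "nat list \<Rightarrow> U22" where
  "Lr [] = 1"
| "Lr (n # \<alpha>) = Lr \<alpha> * L (int n)"

lemma Lr_append: "Lr (xs @ ys) = Lr ys * Lr xs"
  by (induction xs) (simp_all add: mult.assoc)

abbreviation pos :: "nat list \<Rightarrow> bool" where "pos \<alpha> \<equiv> (\<forall>i\<in>set \<alpha>. 1 \<le> i)"

abbreviation MSl :: "nat \<Rightarrow> nat \<Rightarrow> U22 set" where
  "MSl w j \<equiv> MS (\<lambda>\<nu>. sum_list \<nu> = w \<and> j \<le> length \<nu>)"

lemma MSl_M: "i \<ge> 1 \<Longrightarrow> a \<in> MSl w j \<Longrightarrow> M (- int i) * a \<in> MSl (i + w) (Suc j)"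
  by (rule MS_mult[OF MS_M[of i "\<lambda>\<nu>. \<nu> = [i]"]]) auto

lemma MSl_part: "pos \<nu> \<Longrightarrow> M_part \<nu> \<in> MSl (sum_list \<nu>) (length \<nu>)"
  by (rule MS_part) auto

lemma MSl_zero: "a \<in> MSl 0 (Suc j) \<Longrightarrow> a = 0"
proof (induction rule: MS_induct)
  case (part \<nu>)
  then show ?case by (cases \<nu>) auto
qed auto

lemma perm_swap_induct:
  assumes swap: "\<And>xs i j ys. P (xs @ i # j # ys) \<Longrightarrow> P (xs @ j # i # ys)"
    and "P l" "mset l = mset l'"
  shows "P l'"
proof -
  have front: "P (pre @ a # xs @ ys)" if "P (pre @ xs @ a # ys)" for pre xs ys a
    using that
  proof (induction xs arbitrary: ys rule: rev_induct)
    case (snoc b xs)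
    then have "P ((pre @ xs) @ b # a # ys)" by simp
    then have "P ((pre @ xs) @ a # b # ys)" by (rule swap)
    then show ?case using snoc.IH[of "b # ys"] by simp
  qed simp
  have "P (pre @ l')" if "P (pre @ l)" "mset l = mset l'" for pre l
    using that
  proof (induction l' arbitrary: pre l)
    case (Cons a t)
    then have "a \<in> set l" by (metis list.set_intros(1) set_mset_mset)
    then obtain xs ys where l: "l = xs @ a # ys" by (meson split_list)
    then have "P (pre @ a # xs @ ys)" using Cons.prems(1) by (intro front) simp
    then have "P ((pre @ [a]) @ xs @ ys)" by simp
    then have "P ((pre @ [a]) @ t)" by (rule Cons.IH) (use Cons.prems(2) l in simp)
    then show ?case by simp
  qed simp
  from this[of "[]"] assms show ?thesis by simp
qed

context w22_atypical
begin

text \<open>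
  The stability that is needed to compute the pairing modulo \<open>X\<close>.
\<close>

definition Pstable :: "U22 set \<Rightarrow> bool" where
  "Pstable X \<longleftrightarrow> Mstable X \<and> (\<forall>n>0. \<forall>x\<in>X. L n * x \<in> X)"

text \<open>
  \<open>y\<close> is a highest weight vector modulo \<open>X\<close>, apart from the action of \<open>L\<^sub>0\<close> and \<open>c\<^sub>L\<close>.
\<close>

definition pvac :: "U22 set \<Rightarrow> U22 \<Rightarrow> bool" where
  "pvac X y \<longleftrightarrow> mvac X y \<and> (\<forall>n>0. L n * y \<approx>\<^bsub>X\<^esub> 0)"

lemma Pstable_sub: "Pstable X \<Longrightarrow> U.subspace X" by (simp add: Pstable_def Mstable_def)

lemma Pstable_M: "Pstable X \<Longrightarrow> i > 0 \<Longrightarrow> x \<approx>\<^bsub>X\<^esub> y \<Longrightarrow> M (- int i) * x \<approx>\<^bsub>X\<^esub> M (- int i) * y"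
  by (rule eqm_mult) (auto simp: Pstable_def Mstable_def)

lemma Pstable_Lr: "Pstable X \<Longrightarrow> pos \<alpha> \<Longrightarrow> x \<in> X \<Longrightarrow> Lr \<alpha> * x \<in> X"
  by (induction \<alpha> arbitrary: x) (auto simp: Pstable_def mult.assoc)

lemma Pstable_Lr_eqm: "Pstable X \<Longrightarrow> pos \<alpha> \<Longrightarrow> x \<approx>\<^bsub>X\<^esub> y \<Longrightarrow> Lr \<alpha> * x \<approx>\<^bsub>X\<^esub> Lr \<alpha> * y"
  by (rule eqm_mult) (auto simp: Pstable_Lr)

lemma left_ideal_Pstable: "left_ideal X \<Longrightarrow> Pstable X"
  by (auto simp: Pstable_def left_ideal_Mstable left_ideal_mult)

lemma Ed_M_nat: assumes "Pstable X" "mvac X y" "i \<ge> 1"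
  shows "L n * (M (- int i) * y) \<approx>\<^bsub>X\<^esub> M (- int i) * (L n * y) + EM n (int i) * y"
  using assms by (intro EdD[OF Ed_M]) (auto simp: Pstable_def)

text \<open>
  \<open>L\<^sub>n\<close> either removes a factor \<open>M\<^sub>-\<^sub>n\<close>, at the price of \<open>phi n\<close>, or merges into another factor and keeps the number of
  factors. Only the former shortens a monomial; this is the source of triangularity.
\<close>

lemma L_M_part:
  assumes X: "Pstable X" "pvac X y" and n: "n \<ge> 1" and "pos \<nu>"
  shows "\<exists>b. L (int n) * (M_part \<nu> * y) \<approx>\<^bsub>X\<^esub> scal (of_nat (count_list \<nu> n) * phi (int n)) * (M_part (remove1 n \<nu>) * y) + b * y
     \<and> (if n \<le> sum_list \<nu> then b \<in> MSl (sum_list \<nu> - n) (length \<nu>) else b = 0)"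
  using assms(4)
proof (induction \<nu>)
  case Nil
  have "L (int n) * y \<approx>\<^bsub>X\<^esub> 0" using X(2) n by (simp add: pvac_def)
  then show ?case using n by auto
next
  case (Cons i \<nu>)
  let ?Q = "\<lambda>b. if n \<le> sum_list \<nu> then b \<in> MSl (sum_list \<nu> - n) (length \<nu>) else b = 0"
  have i: "i \<ge> 1" "pos \<nu>" using Cons.prems by auto
  from Cons.IH[OF i(2)] obtain b where
    b: "L (int n) * (M_part \<nu> * y) \<approx>\<^bsub>X\<^esub> scal (of_nat (count_list \<nu> n) * phi (int n)) * (M_part (remove1 n \<nu>) * y) + b * y" "?Q b"
    by auto
  have mv: "mvac X (M_part \<nu> * y)"
    using X i by (intro mvac_MS[OF _ _ MSl_part]) (auto simp: Pstable_def pvac_def)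
  have "L (int n) * (M_part (i # \<nu>) * y) = L (int n) * (M (- int i) * (M_part \<nu> * y))" by (simp add: mult.assoc)
  also have "\<dots> \<approx>\<^bsub>X\<^esub> M (- int i) * (L (int n) * (M_part \<nu> * y)) + EM (int n) (int i) * (M_part \<nu> * y)"
    using X i mv by (intro Ed_M_nat) auto
  also have "\<dots> \<approx>\<^bsub>X\<^esub> M (- int i) * (scal (of_nat (count_list \<nu> n) * phi (int n)) * (M_part (remove1 n \<nu>) * y) + b * y) + EM (int n) (int i) * (M_part \<nu> * y)"
    using X i b by (intro eqm_add Pstable_M eqm_refl) auto
  also have "\<dots> = scal (of_nat (count_list \<nu> n) * phi (int n)) * (M_part (i # remove1 n \<nu>) * y) + M (- int i) * b * y + EM (int n) (int i) * (M_part \<nu> * y)"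
    by (simp add: distrib_left M_scal mult.assoc)
  finally have main: "L (int n) * (M_part (i # \<nu>) * y) \<approx>\<^bsub>X\<^esub> \<dots>" .
  have b': "n \<le> i + sum_list \<nu> \<Longrightarrow> M (- int i) * b \<in> MSl (i + sum_list \<nu> - n) (Suc (length \<nu>))"
    using b(2) MSl_M[OF i(1), of b "sum_list \<nu> - n" "length \<nu>"] by (auto split: if_splits simp: MS_0)
  have b0: "\<not> n \<le> sum_list \<nu> \<Longrightarrow> M (- int i) * b = 0" using b(2) by auto
  consider "n = i" | "n < i" | "n > i" by linarith
  then show ?case
  proof cases
    case 1
    have e: "scal (of_nat (count_list \<nu> n) * phi (int n)) * (M_part (i # remove1 n \<nu>) * y)
        = scal (of_nat (count_list \<nu> n) * phi (int n)) * (M_part \<nu> * y)"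
    proof (cases "n \<in> set \<nu>")
      case True
      then have "M_part (i # remove1 n \<nu>) = M_part \<nu>" using 1 by (intro M_part_perm) simp
      then show ?thesis by simp
    qed simp
    note main[unfolded e]
    also have "scal (of_nat (count_list \<nu> n) * phi (int n)) * (M_part \<nu> * y) + M (- int i) * b * y + EM (int n) (int i) * (M_part \<nu> * y)
      = scal (of_nat (count_list (i # \<nu>) n) * phi (int n)) * (M_part (remove1 n (i # \<nu>)) * y) + M (- int i) * b * y"
      using 1 by (simp add: EM_def algebra_simps scal_add)
    finally have "L (int n) * (M_part (i # \<nu>) * y) \<approx>\<^bsub>X\<^esub> scal (of_nat (count_list (i # \<nu>) n) * phi (int n)) * (M_part (remove1 n (i # \<nu>)) * y) + M (- int i) * b * y" .
    then show ?thesis using b' 1 by (intro exI[of _ "M (- int i) * b"]) simp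
  next
    case 2
    let ?b = "M (- int i) * b + scal (of_int (int n + int i)) * (M (- int (i - n)) * M_part \<nu>)"
    have "M (- int (i - n)) * M_part \<nu> \<in> MSl (i - n + sum_list \<nu>) (Suc (length \<nu>))"
      using 2 i by (intro MSl_M MSl_part) auto
    moreover have "i - n + sum_list \<nu> = i + sum_list \<nu> - n" using 2 by simp
    ultimately have "?b \<in> MSl (i + sum_list \<nu> - n) (Suc (length \<nu>))"
      using 2 b' by (intro MS_add MS_scal) auto
    moreover have "int n - int i = - int (i - n)" using 2 by simp
    then have "L (int n) * (M_part (i # \<nu>) * y) \<approx>\<^bsub>X\<^esub> scal (of_nat (count_list (i # \<nu>) n) * phi (int n)) * (M_part (remove1 n (i # \<nu>)) * y) + ?b * y"
      using main 2 by (simp add: EM_def algebra_simps)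
    ultimately show ?thesis using 2 by (intro exI[of _ ?b]) simp
  next
    case 3
    then have "L (int n) * (M_part (i # \<nu>) * y) \<approx>\<^bsub>X\<^esub> scal (of_nat (count_list (i # \<nu>) n) * phi (int n)) * (M_part (remove1 n (i # \<nu>)) * y) + M (- int i) * b * y"
      using main by (simp add: EM_def)
    then show ?thesis using 3 b' b0 by (intro exI[of _ "M (- int i) * b"]) auto
  qed
qed

lemma L_MSl:
  assumes X: "Pstable X" "pvac X y" and n: "n \<ge> 1" and "a \<in> MSl w j"
  shows "\<exists>b. L (int n) * (a * y) \<approx>\<^bsub>X\<^esub> b * y \<and> (if n \<le> w then b \<in> MSl (w - n) (j - 1) else b = 0)"
  using assms(4)
proof (induction rule: MS_induct)
  case zero
  show ?case by (rule exI[of _ 0]) (simp add: MS_0)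
next
  case (add a a')
  then obtain b b' where "L (int n) * (a * y) \<approx>\<^bsub>X\<^esub> b * y" "if n \<le> w then b \<in> MSl (w - n) (j - 1) else b = 0"
    "L (int n) * (a' * y) \<approx>\<^bsub>X\<^esub> b' * y" "if n \<le> w then b' \<in> MSl (w - n) (j - 1) else b' = 0" by blast
  then show ?case using eqm_add[of "L (int n) * (a * y)" X "b * y" "L (int n) * (a' * y)" "b' * y"]
    by (intro exI[of _ "b + b'"]) (auto simp: distrib_left distrib_right MS_add split: if_splits)
next
  case (scal c a)
  then obtain b where "L (int n) * (a * y) \<approx>\<^bsub>X\<^esub> b * y" "if n \<le> w then b \<in> MSl (w - n) (j - 1) else b = 0" by blast
  then show ?case using eqm_scal[of "L (int n) * (a * y)" X "b * y" c]
    by (intro exI[of _ "scal c * b"]) (auto simp: mult.assoc L_scal MS_scal split: if_splits)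
next
  case (part \<nu>)
  from L_M_part[OF X n part(1)] part(2) obtain b where
    b: "L (int n) * (M_part \<nu> * y) \<approx>\<^bsub>X\<^esub> scal (of_nat (count_list \<nu> n) * phi (int n)) * (M_part (remove1 n \<nu>) * y) + b * y"
     "if n \<le> w then b \<in> MSl (w - n) (length \<nu>) else b = 0" by auto
  let ?c = "scal (of_nat (count_list \<nu> n) * phi (int n)) * M_part (remove1 n \<nu>)"
  have 1: "b \<in> MSl (w - n) (j - 1)" if "n \<le> w"
  proof -
    have "MSl (w - n) (length \<nu>) \<subseteq> MSl (w - n) (j - 1)" by (rule MS_mono) (use part(2) in auto)
    then show ?thesis using b(2) that by auto
  qed
  have 2: "?c \<in> MSl (w - n) (j - 1) \<and> n \<le> w" if "n \<in> set \<nu>"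
  proof -
    have "M_part (remove1 n \<nu>) \<in> MSl (w - n) (j - 1)"
      using part that sum_list_map_remove1[of n \<nu> "\<lambda>x. x"]
      by (intro MS_part) (auto simp: length_remove1 dest: notin_set_remove1[rotated])
    moreover have "n \<le> w" using part(2) that member_le_sum_list by blast
    ultimately show ?thesis by (simp add: MS_scal)
  qed
  have 3: "?c = 0" if "n \<notin> set \<nu>" using that by simp
  have eq: "L (int n) * (M_part \<nu> * y) \<approx>\<^bsub>X\<^esub> (?c + b) * y"
    using b(1) by (simp add: distrib_right mult.assoc)
  show ?case
  proof (cases "n \<in> set \<nu>")
    case True
    then show ?thesis using eq 1 2 by (intro exI[of _ "?c + b"]) (simp add: MS_add)
  next
    case False
    then have "?c + b = b" using 3 by simp
    then show ?thesis using eq 1 b(2) by (intro exI[of _ b]) (auto split: if_splits)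
  qed
qed

text \<open>
  A product of fewer \<open>L\<^sub>n\<close> than there are factors cannot reduce the monomial to a scalar.
\<close>

lemma Lr_short:
  assumes X: "Pstable X" "pvac X y"
  shows "pos \<alpha> \<Longrightarrow> sum_list \<alpha> = w \<Longrightarrow> length \<alpha> < j \<Longrightarrow> a \<in> MSl w j \<Longrightarrow> Lr \<alpha> * (a * y) \<approx>\<^bsub>X\<^esub> 0"
proof (induction \<alpha> arbitrary: a w j)
  case Nil
  then show ?case using MSl_zero[of a "j - 1"] by simp
next
  case (Cons n \<alpha>)
  then have n: "n \<ge> 1" "n \<le> w" "pos \<alpha>" by auto
  from L_MSl[OF X n(1) Cons.prems(4)] n obtain b where b: "L (int n) * (a * y) \<approx>\<^bsub>X\<^esub> b * y" "b \<in> MSl (w - n) (j - 1)" by auto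
  have "Lr (n # \<alpha>) * (a * y) = Lr \<alpha> * (L (int n) * (a * y))" by (simp add: mult.assoc)
  also have "\<dots> \<approx>\<^bsub>X\<^esub> Lr \<alpha> * (b * y)" by (rule Pstable_Lr_eqm[OF X(1) n(3) b(1)])
  also have "\<dots> \<approx>\<^bsub>X\<^esub> 0" by (rule Cons.IH[OF n(3) _ _ b(2)]) (use Cons.prems in auto)
  finally show ?case .
qed

lemma Lr_scalar:
  assumes X: "Pstable X" "pvac X y"
  shows "pos \<alpha> \<Longrightarrow> sum_list \<alpha> = w \<Longrightarrow> a \<in> MSl w 0 \<Longrightarrow> \<exists>s. Lr \<alpha> * (a * y) \<approx>\<^bsub>X\<^esub> scal s * y"
proof (induction \<alpha> arbitrary: a w)
  case Nil
  then show ?case using UM_0[of a] by (auto simp: UM_eq_MS)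
next
  case (Cons n \<alpha>)
  then have n: "n \<ge> 1" "n \<le> w" "pos \<alpha>" by auto
  from L_MSl[OF X n(1) Cons.prems(3)] n obtain b where b: "L (int n) * (a * y) \<approx>\<^bsub>X\<^esub> b * y" "b \<in> MSl (w - n) 0" by auto
  from Cons.IH[OF n(3) _ b(2)] Cons.prems obtain s where "Lr \<alpha> * (b * y) \<approx>\<^bsub>X\<^esub> scal s * y" by auto
  with Pstable_Lr_eqm[OF X(1) n(3) b(1)] show ?case by (auto simp: mult.assoc intro: eqm_trans)
qed

text \<open>
  The diagonal value of the pairing: each \<open>L\<^sub>n\<close> removes one of the factors \<open>M\<^sub>-\<^sub>n\<close> and contributes \<open>phi n\<close>.
\<close>

fun Pc :: "nat list \<Rightarrow> nat list \<Rightarrow> complex" where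
  "Pc [] \<nu> = 1"
| "Pc (n # \<alpha>) \<nu> = of_nat (count_list \<nu> n) * phi (int n) * Pc \<alpha> (remove1 n \<nu>)"

lemma Lr_diag:
  assumes X: "Pstable X" "pvac X y"
  shows "pos \<alpha> \<Longrightarrow> pos \<nu> \<Longrightarrow> sum_list \<alpha> = sum_list \<nu> \<Longrightarrow> length \<alpha> = length \<nu> \<Longrightarrow> Lr \<alpha> * (M_part \<nu> * y) \<approx>\<^bsub>X\<^esub> scal (Pc \<alpha> \<nu>) * y"
proof (induction \<alpha> arbitrary: \<nu>)
  case (Cons n \<alpha>)
  then have n: "n \<ge> 1" "n \<le> sum_list \<nu>" "pos \<alpha>" by auto
  let ?c = "of_nat (count_list \<nu> n) * phi (int n)"
  from L_M_part[OF X n(1) Cons.prems(2)] n obtain b where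
    b: "L (int n) * (M_part \<nu> * y) \<approx>\<^bsub>X\<^esub> scal ?c * (M_part (remove1 n \<nu>) * y) + b * y" "b \<in> MSl (sum_list \<nu> - n) (length \<nu>)" by auto
  have 1: "Lr \<alpha> * (b * y) \<approx>\<^bsub>X\<^esub> 0"
    by (rule Lr_short[OF X n(3) _ _ b(2)]) (use Cons.prems in auto)
  have 2: "scal ?c * (Lr \<alpha> * (M_part (remove1 n \<nu>) * y)) \<approx>\<^bsub>X\<^esub> scal ?c * (scal (Pc \<alpha> (remove1 n \<nu>)) * y)"
  proof (cases "n \<in> set \<nu>")
    case True
    have "sum_list \<alpha> = sum_list (remove1 n \<nu>)" "length \<alpha> = length (remove1 n \<nu>)" "pos (remove1 n \<nu>)"
      using Cons.prems True sum_list_map_remove1[of n \<nu> "\<lambda>x. x"]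
      by (auto simp: length_remove1 dest: notin_set_remove1[rotated])
    then show ?thesis using n by (intro eqm_scal Cons.IH)
  qed simp
  have "Lr (n # \<alpha>) * (M_part \<nu> * y) = Lr \<alpha> * (L (int n) * (M_part \<nu> * y))" by (simp add: mult.assoc)
  also have "\<dots> \<approx>\<^bsub>X\<^esub> Lr \<alpha> * (scal ?c * (M_part (remove1 n \<nu>) * y) + b * y)" by (rule Pstable_Lr_eqm[OF X(1) n(3) b(1)])
  also have "\<dots> = scal ?c * (Lr \<alpha> * (M_part (remove1 n \<nu>) * y)) + Lr \<alpha> * (b * y)"
    by (simp add: distrib_left scal_left_commute[of "Lr \<alpha>"])
  also have "\<dots> \<approx>\<^bsub>X\<^esub> scal ?c * (scal (Pc \<alpha> (remove1 n \<nu>)) * y) + 0" by (intro eqm_add 1 2)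
  finally show ?case by simp
qed simp

lemma phi_nz: "n \<ge> 1 \<Longrightarrow> n \<noteq> p \<Longrightarrow> phi (int n) \<noteq> 0"
proof -
  assume n: "n \<ge> 1" "n \<noteq> p"
  have "(of_nat n ^ 2 :: complex) \<noteq> of_nat p ^ 2"
  proof
    assume "(of_nat n ^ 2 :: complex) = of_nat p ^ 2"
    then have "(of_nat (n ^ 2) :: complex) = of_nat (p ^ 2)" by simp
    then have "n ^ 2 = p ^ 2" using of_nat_eq_iff by blast
    then show False using n by (simp add: power2_eq_iff_nonneg)
  qed
  then show ?thesis using n cM0 by (simp add: phi_def)
qed

lemma Pc_nz: "pos \<alpha> \<Longrightarrow> p \<notin> set \<alpha> \<Longrightarrow> mset \<alpha> = mset \<nu> \<Longrightarrow> Pc \<alpha> \<nu> \<noteq> 0"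
proof (induction \<alpha> arbitrary: \<nu>)
  case (Cons n \<alpha>)
  have n: "n \<in> set \<nu>" using Cons.prems(3) by (metis list.set_intros(1) set_mset_mset)
  then have "count_list \<nu> n \<noteq> 0" by (simp add: count_list_0_iff)
  moreover have "Pc \<alpha> (remove1 n \<nu>) \<noteq> 0" 
    using Cons.prems by (intro Cons.IH) (auto simp flip: Cons.prems(3))
  moreover have "phi (int n) \<noteq> 0" using Cons.prems by (intro phi_nz) auto
  ultimately show ?case by simp
qed simp

lemma Pc_0: "length \<alpha> = length \<nu> \<Longrightarrow> mset \<alpha> \<noteq> mset \<nu> \<Longrightarrow> Pc \<alpha> \<nu> = 0"
proof (induction \<alpha> arbitrary: \<nu>)
  case (Cons n \<alpha>)
  show ?case
  proof (cases "n \<in> set \<nu>")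
    case True
    have "mset \<alpha> \<noteq> mset (remove1 n \<nu>)" using Cons.prems(2) True by (metis in_multiset_in_set insert_DiffM mset.simps(2) mset_remove1)
    moreover have "length \<alpha> = length (remove1 n \<nu>)" using Cons.prems(1) True by (simp add: length_remove1)
    ultimately show ?thesis using Cons.IH by simp
  next
    case False
    then show ?thesis by simp
  qed
qed simp

text \<open>
  The index set on which the pairing is nondegenerate.
\<close>

definition pfree :: "nat \<Rightarrow> nat list set" where "pfree w = {\<nu> \<in> partitions_of w. p \<notin> set \<nu>}"

text \<open>
  The element of \<open>U(M\<^sub>-)\<^sub>w\<close> without \<open>M\<^sub>-\<^sub>p\<close> that has the given coefficients.
\<close>

definition ev :: "nat \<Rightarrow> (nat list \<Rightarrow> complex) \<Rightarrow> U22" where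
  "ev w c = (\<Sum>\<nu>\<in>pfree w. scal (c \<nu>) * M_part \<nu>)"

lemma finite_pfree: "finite (pfree w)" by (simp add: pfree_def finite_partitions)

lemma pfreeD: "\<nu> \<in> pfree w \<Longrightarrow> pos \<nu> \<and> sum_list \<nu> = w \<and> p \<notin> set \<nu>"
  by (auto simp: pfree_def partitions_of_def)

lemma pfree_mset: "\<nu> \<in> pfree w \<Longrightarrow> \<mu> \<in> pfree w' \<Longrightarrow> mset \<nu> = mset \<mu> \<Longrightarrow> \<nu> = \<mu>"
proof -
  assume a: "\<nu> \<in> pfree w" "\<mu> \<in> pfree w'" "mset \<nu> = mset \<mu>"
  then have "sorted (rev \<nu>)" "sorted (rev \<mu>)" by (auto simp: pfree_def partitions_of_def sorted_wrt_rev)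
  then have "rev \<nu> = rev \<mu>" using a(3) by (metis mset_rev properties_for_sort)
  then show ?thesis by simp
qed

lemma ev_MS: "ev w c \<in> MS (\<lambda>\<nu>. sum_list \<nu> = w \<and> p \<notin> set \<nu>)"
  unfolding ev_def by (intro MS_sum MS_scal MS_part) (auto dest: pfreeD)

lemma ev_UM: "ev w c \<in> UM w"
  using ev_MS MS_mono[of "\<lambda>\<nu>. sum_list \<nu> = w \<and> p \<notin> set \<nu>" "\<lambda>\<nu>. sum_list \<nu> = w"] by (auto simp: UM_eq_MS)

lemma MS_ev: "a \<in> MS (\<lambda>\<nu>. sum_list \<nu> = w \<and> p \<notin> set \<nu>) \<Longrightarrow> \<exists>c. a = ev w c"
proof -
  have perm: "sum_list \<mu> = w \<and> p \<notin> set \<mu>" if "mset \<nu> = mset \<mu>" "sum_list \<nu> = w \<and> p \<notin> set \<nu>" for \<nu> \<mu> :: "nat list"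
    using that by (metis sum_mset_sum_list set_mset_mset)
  have "MS (\<lambda>\<nu>. sum_list \<nu> = w \<and> p \<notin> set \<nu>) = {\<Sum>\<nu> | \<nu> \<in> partitions_of w \<and> (sum_list \<nu> = w \<and> p \<notin> set \<nu>). scal (c \<nu>) * M_part \<nu> | c. True}"
    by (rule MS_eq_sums[OF _ perm]) auto
  moreover have "{\<nu>. \<nu> \<in> partitions_of w \<and> (sum_list \<nu> = w \<and> p \<notin> set \<nu>)} = pfree w"
    by (auto simp: pfree_def partitions_of_def)
  ultimately show "a \<in> MS (\<lambda>\<nu>. sum_list \<nu> = w \<and> p \<notin> set \<nu>) \<Longrightarrow> \<exists>c. a = ev w c"
    unfolding ev_def by auto
qed

lemma Lr_ev: "Lr \<alpha> * (ev w c * y) = (\<Sum>\<nu>\<in>pfree w. scal (c \<nu>) * (Lr \<alpha> * (M_part \<nu> * y)))"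
  by (simp add: ev_def sum_distrib_left sum_distrib_right mult.assoc scal_left_commute[of "Lr \<alpha>"])

lemma Lr_pair:
  assumes X: "Pstable X" "pvac X y" and "\<alpha> \<in> pfree w" "\<nu> \<in> pfree w" "length \<alpha> \<le> length \<nu>"
  shows "Lr \<alpha> * (M_part \<nu> * y) \<approx>\<^bsub>X\<^esub> (if \<nu> = \<alpha> then scal (Pc \<alpha> \<alpha>) * y else 0)"
proof (cases "length \<alpha> = length \<nu>")
  case True
  have "Lr \<alpha> * (M_part \<nu> * y) \<approx>\<^bsub>X\<^esub> scal (Pc \<alpha> \<nu>) * y"
    using assms pfreeD True by (intro Lr_diag) auto
  moreover have "Pc \<alpha> \<nu> = 0" if "\<nu> \<noteq> \<alpha>"
    using that pfree_mset[OF assms(3,4)] True by (intro Pc_0) auto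
  ultimately show ?thesis by auto
next
  case False
  have "Lr \<alpha> * (M_part \<nu> * y) \<approx>\<^bsub>X\<^esub> 0"
    using assms pfreeD False MSl_part[of \<nu>] by (intro Lr_short[OF X, of _ w "length \<nu>"]) auto
  then show ?thesis using False by auto
qed

text \<open>
  If a coefficient is nonzero, pair with an index list of minimal length among those with nonzero coefficient.
\<close>

lemma ev_zero:
  assumes X: "Pstable X" "pvac X y" and y: "y \<notin> X" and h: "\<And>\<alpha>. \<alpha> \<in> pfree w \<Longrightarrow> Lr \<alpha> * (ev w c * y) \<approx>\<^bsub>X\<^esub> 0"
  shows "\<forall>\<nu>\<in>pfree w. c \<nu> = 0"
proof (rule ccontr)
  assume "\<not> (\<forall>\<nu>\<in>pfree w. c \<nu> = 0)"
  then obtain \<alpha> where l: "\<alpha> \<in> pfree w" "c \<alpha> \<noteq> 0" "\<And>\<nu>. \<nu> \<in> pfree w \<Longrightarrow> c \<nu> \<noteq> 0 \<Longrightarrow> length \<alpha> \<le> length \<nu>"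
    using ex_has_least_nat[of "\<lambda>\<nu>. \<nu> \<in> pfree w \<and> c \<nu> \<noteq> 0" _ length] by blast
  have "scal (c \<nu>) * (Lr \<alpha> * (M_part \<nu> * y)) \<approx>\<^bsub>X\<^esub> (if \<nu> = \<alpha> then scal (c \<alpha> * Pc \<alpha> \<alpha>) * y else 0)" if "\<nu> \<in> pfree w" for \<nu>
  proof (cases "c \<nu> = 0")
    case True
    then show ?thesis using l by auto
  next
    case False
    have "scal (c \<nu>) * (Lr \<alpha> * (M_part \<nu> * y)) \<approx>\<^bsub>X\<^esub> scal (c \<nu>) * (if \<nu> = \<alpha> then scal (Pc \<alpha> \<alpha>) * y else 0)"
      using l that False by (intro eqm_scal Lr_pair[OF X, of _ w]) auto
    then show ?thesis by (cases "\<nu> = \<alpha>") auto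
  qed
  then have "Lr \<alpha> * (ev w c * y) \<approx>\<^bsub>X\<^esub> (\<Sum>\<nu>\<in>pfree w. if \<nu> = \<alpha> then scal (c \<alpha> * Pc \<alpha> \<alpha>) * y else 0)"
    unfolding Lr_ev by (rule eqm_sum)
  also have "\<dots> = scal (c \<alpha> * Pc \<alpha> \<alpha>) * y" using finite_pfree l by (simp add: sum.delta)
  finally have "Lr \<alpha> * (ev w c * y) \<approx>\<^bsub>X\<^esub> scal (c \<alpha> * Pc \<alpha> \<alpha>) * y" .
  then have "scal (c \<alpha> * Pc \<alpha> \<alpha>) * y \<approx>\<^bsub>X\<^esub> 0" using h[OF l(1)] eqm_sym eqm_trans by blast
  then have in_X: "scal (c \<alpha> * Pc \<alpha> \<alpha>) * y \<in> X" using eqm_0_iff[OF Pstable_sub[OF X(1)]] by simp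
  define q where "q = c \<alpha> * Pc \<alpha> \<alpha>"
  have "q \<noteq> 0" using l pfreeD[OF l(1)] Pc_nz by (auto simp: q_def)
  moreover have "scal (inverse q) * (scal q * y) \<in> X"
    using U.subspace_scale[OF Pstable_sub[OF X(1)]] in_X unfolding q_def by blast
  ultimately show False using y by simp
qed

lemma ev_zero_eq: "\<forall>\<nu>\<in>pfree w. c \<nu> = 0 \<Longrightarrow> ev w c = 0" by (simp add: ev_def)

lemma length_le_sum: "pos \<nu> \<Longrightarrow> length \<nu> \<le> sum_list \<nu>" by (induction \<nu>) auto

text \<open>
  The triangular system is solved by increasing length: a correction of length \<open>J\<close> does not affect the equations of smaller length.
\<close>

lemma ev_solve:
  assumes X: "Pstable X" "pvac X y"
  shows "\<exists>c. \<forall>\<alpha>\<in>pfree w. Lr \<alpha> * (ev w c * y) \<approx>\<^bsub>X\<^esub> scal (f \<alpha>) * y"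
proof -
  have "\<exists>c. \<forall>\<alpha>\<in>pfree w. length \<alpha> < J \<longrightarrow> Lr \<alpha> * (ev w c * y) \<approx>\<^bsub>X\<^esub> scal (f \<alpha>) * y" for J
  proof (induction J)
    case (Suc J)
    then obtain c where c: "\<And>\<alpha>. \<alpha> \<in> pfree w \<Longrightarrow> length \<alpha> < J \<Longrightarrow> Lr \<alpha> * (ev w c * y) \<approx>\<^bsub>X\<^esub> scal (f \<alpha>) * y" by auto
    have "\<forall>\<alpha>\<in>pfree w. \<exists>s. Lr \<alpha> * (ev w c * y) \<approx>\<^bsub>X\<^esub> scal s * y"
      using pfreeD ev_UM by (intro ballI Lr_scalar[OF X, of _ w]) (auto simp: UM_eq_MS)
    then obtain g where g: "\<And>\<alpha>. \<alpha> \<in> pfree w \<Longrightarrow> Lr \<alpha> * (ev w c * y) \<approx>\<^bsub>X\<^esub> scal (g \<alpha>) * y" by metis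
    define e where "e \<nu> = (if length \<nu> = J then (f \<nu> - g \<nu>) / Pc \<nu> \<nu> else 0)" for \<nu>
    have ev: "ev w (\<lambda>\<nu>. c \<nu> + e \<nu>) = ev w c + ev w e"
      by (simp add: ev_def scal_add distrib_right sum.distrib)
    have corr: "Lr \<alpha> * (ev w e * y) \<approx>\<^bsub>X\<^esub> scal (if length \<alpha> = J then f \<alpha> - g \<alpha> else 0) * y"
      if l: "\<alpha> \<in> pfree w" "length \<alpha> < Suc J" for \<alpha>
    proof -
      have "scal (e \<nu>) * (Lr \<alpha> * (M_part \<nu> * y)) \<approx>\<^bsub>X\<^esub> (if \<nu> = \<alpha> then scal (e \<alpha> * Pc \<alpha> \<alpha>) * y else 0)" if "\<nu> \<in> pfree w" for \<nu>
      proof (cases "length \<nu> = J")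
        case False
        then show ?thesis by (auto simp: e_def)
      next
        case True
        have "scal (e \<nu>) * (Lr \<alpha> * (M_part \<nu> * y)) \<approx>\<^bsub>X\<^esub> scal (e \<nu>) * (if \<nu> = \<alpha> then scal (Pc \<alpha> \<alpha>) * y else 0)"
          using l that True by (intro eqm_scal Lr_pair[OF X, of _ w]) auto
        then show ?thesis by (cases "\<nu> = \<alpha>") auto
      qed
      then have "Lr \<alpha> * (ev w e * y) \<approx>\<^bsub>X\<^esub> (\<Sum>\<nu>\<in>pfree w. if \<nu> = \<alpha> then scal (e \<alpha> * Pc \<alpha> \<alpha>) * y else 0)"
        unfolding Lr_ev by (rule eqm_sum)
      also have "\<dots> = scal (e \<alpha> * Pc \<alpha> \<alpha>) * y" using finite_pfree l by (simp add: sum.delta)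
      also have "e \<alpha> * Pc \<alpha> \<alpha> = (if length \<alpha> = J then f \<alpha> - g \<alpha> else 0)"
        using Pc_nz[of \<alpha> \<alpha>] pfreeD[OF l(1)] by (simp add: e_def)
      finally show ?thesis .
    qed
    have "Lr \<alpha> * (ev w (\<lambda>\<nu>. c \<nu> + e \<nu>) * y) \<approx>\<^bsub>X\<^esub> scal (f \<alpha>) * y" if l: "\<alpha> \<in> pfree w" "length \<alpha> < Suc J" for \<alpha>
    proof -
      have "Lr \<alpha> * (ev w (\<lambda>\<nu>. c \<nu> + e \<nu>) * y) = Lr \<alpha> * (ev w c * y) + Lr \<alpha> * (ev w e * y)"
        by (simp add: ev distrib_left distrib_right)
      also have "\<dots> \<approx>\<^bsub>X\<^esub> scal (if length \<alpha> = J then g \<alpha> else f \<alpha>) * y + scal (if length \<alpha> = J then f \<alpha> - g \<alpha> else 0) * y"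
        using l g[OF l(1)] c[OF l(1)] by (intro eqm_add corr) auto
      also have "\<dots> = scal (f \<alpha>) * y" by (simp add: distrib_right[symmetric] scal_add[symmetric])
      finally show ?thesis .
    qed
    then show ?case by blast
  qed simp
  from this[of "Suc w"] obtain c where c: "\<And>\<alpha>. \<alpha> \<in> pfree w \<Longrightarrow> length \<alpha> < Suc w \<Longrightarrow> Lr \<alpha> * (ev w c * y) \<approx>\<^bsub>X\<^esub> scal (f \<alpha>) * y" by auto
  have "length \<alpha> < Suc w" if "\<alpha> \<in> pfree w" for \<alpha> using length_le_sum[of \<alpha>] pfreeD[OF that] by auto
  with c show ?thesis by blast
qed

text \<open>
  Reordering a product of \<open>L\<^sub>n\<close> changes it by shorter products of the same weight. So one may sort the indices, or, if \<open>p\<close>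
  occurs, apply \<open>L\<^sub>p\<close> last.
\<close>

lemma Lr_generated:
  assumes Y: "U.subspace Y" and 1: "\<And>\<alpha>. \<alpha> \<in> pfree w \<Longrightarrow> Lr \<alpha> * x \<in> Y"
    and 2: "\<And>\<mu>. pos \<mu> \<Longrightarrow> sum_list \<mu> + p = w \<Longrightarrow> L (int p) * (Lr \<mu> * x) \<in> Y"
  shows "pos \<alpha> \<Longrightarrow> sum_list \<alpha> = w \<Longrightarrow> Lr \<alpha> * x \<in> Y"
proof (induction "length \<alpha>" arbitrary: \<alpha> rule: less_induct)
  case less
  have swap: "(pos (xs @ j # i # ys) \<and> sum_list (xs @ j # i # ys) = w \<and> length (xs @ j # i # ys) = length \<alpha>) \<and>
        (Lr (xs @ j # i # ys) * x \<in> Y \<longrightarrow> Lr \<alpha> * x \<in> Y)"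
    if h: "(pos (xs @ i # j # ys) \<and> sum_list (xs @ i # j # ys) = w \<and> length (xs @ i # j # ys) = length \<alpha>) \<and>
        (Lr (xs @ i # j # ys) * x \<in> Y \<longrightarrow> Lr \<alpha> * x \<in> Y)" for xs i j ys
  proof -
    let ?u = "Lr xs * x"
    have "L (int j) * (L (int i) * ?u) = L (int i) * (L (int j) * ?u) + scal (of_int (int j - int i)) * (L (int j + int i) * ?u)"
      using LL_app[of "int j" "int i" ?u] h by auto
    then have "Lr (xs @ i # j # ys) * x = Lr (xs @ j # i # ys) * x + scal (of_int (int j - int i)) * (Lr (xs @ (j + i) # ys) * x)"
      by (simp add: Lr_append mult.assoc distrib_left scal_left_commute[of "Lr ys"])
    moreover have "Lr (xs @ (j + i) # ys) * x \<in> Y" using h by (intro less.hyps) auto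
    ultimately show ?thesis using h Y by (auto simp: U.subspace_add U.subspace_scale)
  qed
  have perm: "Lr \<mu> * x \<in> Y \<longrightarrow> Lr \<alpha> * x \<in> Y" if "mset \<alpha> = mset \<mu>" for \<mu>
    using perm_swap_induct[of "\<lambda>\<mu>. (pos \<mu> \<and> sum_list \<mu> = w \<and> length \<mu> = length \<alpha>) \<and> (Lr \<mu> * x \<in> Y \<longrightarrow> Lr \<alpha> * x \<in> Y)", OF swap _ that]
      less.prems by blast
  show ?case
  proof (cases "p \<in> set \<alpha>")
    case True
    have "L (int p) * (Lr (remove1 p \<alpha>) * x) \<in> Y"
      using less.prems True sum_list_map_remove1[of p \<alpha> "\<lambda>x. x"] by (intro 2) (auto dest: notin_set_remove1[rotated])
    then have "Lr (remove1 p \<alpha> @ [p]) * x \<in> Y" by (simp add: Lr_append mult.assoc)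
    moreover have "mset \<alpha> = mset (remove1 p \<alpha> @ [p])" using True by simp
    ultimately show ?thesis using perm by blast
  next
    case False
    obtain \<mu> where m: "\<mu> \<in> partitions_of w" "mset \<mu> = mset \<alpha>" using ex_partition[of \<alpha>] less.prems by auto
    then have "set \<mu> = set \<alpha>" by (metis set_mset_mset)
    then have "\<mu> \<in> pfree w" using m False by (simp add: pfree_def)
    then show ?thesis using 1[of \<mu>] perm[of \<mu>] m by simp
  qed
qed

section \<open>Existence and uniqueness of \<open>T\<close>\<close>

abbreviation VI :: "complex \<Rightarrow> U22 set" where "VI h \<equiv> verma_ideal h hM cL cM"

lemma VI_left: "left_ideal (VI h)"
  unfolding verma_ideal_def by (rule left_ideal_hull)

lemma VI_gens: "n > 0 \<Longrightarrow> L n \<in> VI h" "n > 0 \<Longrightarrow> M n \<in> VI h" "L 0 - scal h \<in> VI h" "M 0 - scal hM \<in> VI h"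
  "CL - scal cL \<in> VI h" "CM - scal cM \<in> VI h"
  unfolding verma_ideal_def by (auto intro!: hull_inc)

lemma VI_1: "1 \<notin> VI h"
proof
  assume "1 \<in> VI h"
  then have "vac h hM cL cM 1 = 0" by (rule vac_verma_ideal)
  then have "Poly_Mapping.lookup (mon {#}) {#} = 0" by (simp add: vac_1)
  then show False by (simp add: mon_def)
qed

lemma central_eqm:
  assumes "VI h \<subseteq> X" "left_ideal X"
  shows "CL * x \<approx>\<^bsub>X\<^esub> scal cL * x" "CM * x \<approx>\<^bsub>X\<^esub> scal cM * x"
proof -
  have "x * (CL - scal cL) \<in> X" "x * (CM - scal cM) \<in> X"
    using VI_gens assms by (auto intro!: left_ideal_mult)
  then show "CL * x \<approx>\<^bsub>X\<^esub> scal cL * x" "CM * x \<approx>\<^bsub>X\<^esub> scal cM * x"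
    by (auto intro!: eqm_base simp: right_diff_distrib CL_comm CM_comm scal_commute)
qed

lemma VI_mvac: "mvac (VI h) 1" "L 0 * 1 \<approx>\<^bsub>VI h\<^esub> scal h * 1" "CL * 1 \<approx>\<^bsub>VI h\<^esub> scal cL * 1"
  using VI_gens[where h=h] by (auto simp: mvac_def intro: eqm_base eqm_base0)

lemma VI_pvac: "pvac (VI h) 1"
  using VI_mvac VI_gens by (auto simp: pvac_def intro: eqm_base0)

lemma ad_L: "a \<in> UM n \<Longrightarrow> i \<ge> 1 \<Longrightarrow> L (- int i) * a - a * L (- int i) \<in> UM (n + i)"
  unfolding UM_eq_MS
proof (induction rule: MS_induct)
  case (add x y)
  then show ?case using MS_add by (fastforce simp: algebra_simps)
next
  case (scal c x)
  then have "scal c * (L (- int i) * x - x * L (- int i)) \<in> MS (\<lambda>\<nu>. sum_list \<nu> = n + i)" by (intro MS_scal) auto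
  then show ?case by (simp add: right_diff_distrib L_scal mult.assoc)
next
  case (part \<nu>)
  have "L (- int i) * M_part \<mu> - M_part \<mu> * L (- int i) \<in> MS (\<lambda>\<nu>. sum_list \<nu> = sum_list \<mu> + i)" if "pos \<mu>" for \<mu>
    using that
  proof (induction \<mu>)
    case (Cons j \<mu>)
    have 1: "M (- int j) * (L (- int i) * M_part \<mu> - M_part \<mu> * L (- int i)) \<in> UM (j + (sum_list \<mu> + i))"
      using Cons by (intro UM_mult UM_M) (auto simp: UM_eq_MS)
    have 2: "M (- int (i + j)) * M_part \<mu> \<in> UM ((i + j) + sum_list \<mu>)"
      using Cons.prems part.prems by (intro UM_mult UM_M) (auto simp: UM_eq_MS intro!: MS_part)
    have "L (- int i) * M_part (j # \<mu>) - M_part (j # \<mu>) * L (- int i)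
       = M (- int j) * (L (- int i) * M_part \<mu> - M_part \<mu> * L (- int i)) + scal (of_int (- int i - - int j)) * (M (- int (i + j)) * M_part \<mu>)"
      using LM_app[of "- int i" "- int j" "M_part \<mu>"] part.prems Cons.prems by (simp add: right_diff_distrib mult.assoc)
    moreover have "j + (sum_list \<mu> + i) = sum_list (j # \<mu>) + i" "(i + j) + sum_list \<mu> = sum_list (j # \<mu>) + i" by simp_all
    ultimately show ?case using 1 2 unfolding UM_eq_MS by (metis MS_add MS_scal)
  qed (simp add: MS_0)
  then show ?case using part by auto
qed (simp add: MS_0)

lemma sum_GL: "(\<Sum>i\<in>{1..int p}. f i) = f (int p) + (\<Sum>i=1..p-1. f (int i))" for f :: "int \<Rightarrow> U22"
proof -
  have "(\<Sum>i\<in>{1..int p}. f i) = (\<Sum>i=1..p. f (int i))"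
    by (rule sum.reindex_bij_witness[of _ int nat]) auto
  also have "{1..p} = insert p {1..p-1}" using p1 by auto
  finally show ?thesis using p1 by simp
qed

text \<open>
  The other summands of \<open>Sv\<close> are products of two elements of positive weight.
\<close>

lemma Sv_lead: "Sv - scal (of_nat p) * M (- int p) \<in> UMt p"
proof -
  have "Sv = scal (of_nat p) * M (- int p) + (\<Sum>i=1..p-1. scal (of_nat i) * (M (- int i) * G (int p - int i)))"
    unfolding Sv_def sum_GL by (simp add: G_def)
  moreover have "M (- int i) * G (int p - int i) \<in> UMt p" if "i \<in> {1..p-1}" for i
  proof -
    have "M (- int i) * G (int (p - i)) \<in> UMt (i + (p - i))"
      using that p1 G_UM[of "int (p - i)"] by (intro UMt_mult UM_M) auto
    moreover have "int (p - i) = int p - int i" "i + (p - i) = p" using that p1 by auto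
    ultimately show ?thesis by simp
  qed
  ultimately show ?thesis by (auto intro!: MS_sum MS_scal)
qed

text \<open>
  Moving the \<open>L\<close> in \<open>TT s\<close> to the right changes it by an element of \<open>U(M\<^sub>-)\<^sub>p\<close>. Since \<open>M\<^sub>-\<^sub>p\<close> does not
  occur in \<open>T_with\<close>, its coefficient fixes \<open>s\<close>, through the leading term of \<open>Sv\<close>.
\<close>

lemma T_with_TT: "\<exists>s d. (\<forall>\<nu>. \<not> (\<nu> \<in> partitions_of p \<and> length \<nu> \<ge> 2) \<longrightarrow> d \<nu> = 0) \<and> T_with p cM d = TT s"
proof -
  let ?GL = "\<Sum>i\<in>{1..int p}. G (int p - i) * L (- i)"
  define R where "R = (\<Sum>i\<in>{1..int p}. L (- i) * G (int p - i) - G (int p - i) * L (- i))"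
  have "L (- i) * G (int p - i) - G (int p - i) * L (- i) \<in> UM p" if "i \<in> {1..int p}" for i
  proof -
    have "nat (int p - i) + nat i = p" using that by auto
    then show ?thesis using ad_L[OF G_UM[of "int p - i"], of "nat i"] that by auto
  qed
  then have "R + scal bT * Qv \<in> UM p"
    using Qv_UM unfolding R_def UM_eq_MS by (intro MS_add MS_scal MS_sum) auto
  then obtain c where c: "R + scal bT * Qv - scal c * M (- int p) \<in> UMt p" using UM_split p1 by blast
  define s where "s = - c / of_nat p"
  define D where "D = R + scal bT * Qv + scal s * Sv"
  have "D = (R + scal bT * Qv - scal c * M (- int p)) + scal s * (Sv - scal (of_nat p) * M (- int p))"
  proof -
    have "scal s * (scal (of_nat p) * M (- int p)) = - (scal c * M (- int p))"
      using p1 by (simp add: s_def scal_uminus)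
    then show ?thesis by (simp add: D_def algebra_simps)
  qed
  then have "D \<in> UMt p" using c Sv_lead by (simp add: MS_add MS_scal)
  moreover have "MS (\<lambda>\<nu>. sum_list \<nu> = p \<and> 2 \<le> length \<nu>)
      = {\<Sum>\<nu> | \<nu> \<in> partitions_of p \<and> (sum_list \<nu> = p \<and> 2 \<le> length \<nu>). scal (c \<nu>) * M_part \<nu> | c. True}"
  proof (rule MS_eq_sums)
    fix \<nu> \<mu> :: "nat list" assume "mset \<nu> = mset \<mu>" "sum_list \<nu> = p \<and> 2 \<le> length \<nu>"
    then show "sum_list \<mu> = p \<and> 2 \<le> length \<mu>" by (metis size_mset sum_mset_sum_list)
  qed auto
  ultimately obtain e where e: "D = (\<Sum>\<nu> | \<nu> \<in> partitions_of p \<and> (sum_list \<nu> = p \<and> 2 \<le> length \<nu>). scal (e \<nu>) * M_part \<nu>)" by auto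
  define d where "d \<nu> = (if \<nu> \<in> partitions_of p \<and> length \<nu> \<ge> 2 then e \<nu> else 0)" for \<nu>
  have "D = (\<Sum>\<nu> | \<nu> \<in> partitions_of p \<and> length \<nu> \<ge> 2. scal (d \<nu>) * M_part \<nu>)"
    unfolding e by (rule sum.cong) (auto simp: d_def partitions_of_def)
  then have "T_with p cM d = L (- int p) + (\<Sum>i=1..p-1. gM p cM (p - i) * L (- int i)) + D"
    by (simp add: T_with_def)
  also have "L (- int p) + (\<Sum>i=1..p-1. gM p cM (p - i) * L (- int i)) = ?GL"
  proof -
    have "gM p cM (p - i) * L (- int i) = G (int p - int i) * L (- int i)" if "i \<in> {1..p-1}" for i
    proof -
      have "nat (int p - int i) = p - i" "int p - int i > 0" using that p1 by auto
      then show ?thesis by (simp add: G_def)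
    qed
    then show ?thesis unfolding sum_GL by (simp add: G_def)
  qed
  also have "?GL + D = TT s" by (simp add: D_def R_def TT_def sum_subtractf)
  finally have "T_with p cM d = TT s" .
  moreover have "\<forall>\<nu>. \<not> (\<nu> \<in> partitions_of p \<and> length \<nu> \<ge> 2) \<longrightarrow> d \<nu> = 0" by (simp add: d_def)
  ultimately show ?thesis by blast
qed

lemma TT_VI:
  assumes "1 \<le> n" "n < p" shows "L (int n) * TT s \<in> VI hp"
proof -
  have "L (int n) * (TT s * 1) \<approx>\<^bsub>VI hp\<^esub> TT s * (L (int n) * 1) + scal (2 * of_int (int n) * (hp - hp)) * (G (int p - int n) * 1)
     + (\<Sum>i\<in>{1..int p}. if i < int n then scal (of_int (int n + i)) * (G (int p - i) * (L (int n - i) * 1)) else 0)"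
    by (rule L_TT[OF VI_left VI_mvac]) (use assms in simp)
  also have "\<dots> \<approx>\<^bsub>VI hp\<^esub> 0 + 0 + (\<Sum>i\<in>{1..int p}. 0)"
  proof (intro eqm_add eqm_sum)
    have L: "u * (L k * 1) \<approx>\<^bsub>VI hp\<^esub> 0" if "k > 0" for u k
      using left_ideal_mult[OF VI_left VI_gens(1)[OF that]] by (simp add: eqm_base0)
    show "TT s * (L (int n) * 1) \<approx>\<^bsub>VI hp\<^esub> 0" using assms by (intro L) auto
    show "scal (2 * of_int (int n) * (hp - hp)) * (G (int p - int n) * 1) \<approx>\<^bsub>VI hp\<^esub> 0" by simp
    fix i
    show "(if i < int n then scal (of_int (int n + i)) * (G (int p - i) * (L (int n - i) * 1)) else 0) \<approx>\<^bsub>VI hp\<^esub> 0"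
      using L[of "int n - i" "scal (of_int (int n + i)) * G (int p - i)"] by (simp add: mult.assoc)
  qed
  finally show ?thesis by (simp add: eqm_0_iff[OF left_ideal_subspace[OF VI_left]])
qed

text \<open>
  The difference of two solutions lies in \<open>U(M\<^sub>-)\<^sub>p\<close> and involves partitions with at least two parts, hence without a part
  \<open>p\<close>, and it is annihilated by \<open>L\<^sub>1, \<dots>, L\<^bsub>p-1\<^esub>\<close>: the pairing shows that it vanishes.
\<close>

lemma T_with_unique:
  assumes d: "\<forall>\<nu>. \<not> (\<nu> \<in> partitions_of p \<and> length \<nu> \<ge> 2) \<longrightarrow> d \<nu> = 0"
    and d': "\<forall>\<nu>. \<not> (\<nu> \<in> partitions_of p \<and> length \<nu> \<ge> 2) \<longrightarrow> d' \<nu> = 0"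
    and h: "\<And>i. i \<in> {1..p-1} \<Longrightarrow> L (int i) * T_with p cM d \<in> VI hp" "\<And>i. i \<in> {1..p-1} \<Longrightarrow> L (int i) * T_with p cM d' \<in> VI hp"
  shows "d = d'"
proof -
  have pfree: "{\<nu>. \<nu> \<in> partitions_of p \<and> length \<nu> \<ge> 2} = pfree p"
  proof -
    have "length \<nu> \<ge> 2 \<longleftrightarrow> p \<notin> set \<nu>" if "\<nu> \<in> partitions_of p" for \<nu>
    proof -
      have nu: "pos \<nu>" "sum_list \<nu> = p" using that by (auto simp: partitions_of_def)
      show ?thesis
      proof
        assume "length \<nu> \<ge> 2"
        show "p \<notin> set \<nu>"
        proof
          assume "p \<in> set \<nu>"
          then have "sum_list (remove1 p \<nu>) = 0" using nu sum_list_map_remove1[of p \<nu> "\<lambda>x. x"] by simp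
          moreover have "pos (remove1 p \<nu>)" using nu set_remove1_subset[of p \<nu>] by blast
          moreover from this have "length (remove1 p \<nu>) \<le> sum_list (remove1 p \<nu>)" by (rule length_le_sum)
          ultimately have "length (remove1 p \<nu>) \<le> 0" by linarith
          then show False using \<open>length \<nu> \<ge> 2\<close> \<open>p \<in> set \<nu>\<close> by (simp add: length_remove1)
        qed
      next
        assume "p \<notin> set \<nu>"
        then show "length \<nu> \<ge> 2" using nu p1 by (cases \<nu>; cases "tl \<nu>") auto
      qed
    qed
    then show ?thesis by (auto simp: pfree_def)
  qed
  have diff: "T_with p cM d - T_with p cM d' = ev p (\<lambda>\<nu>. d \<nu> - d' \<nu>)"
    unfolding T_with_def pfree ev_def by (simp add: scal_diff left_diff_distrib sum_subtractf)
  have "\<forall>\<nu>\<in>pfree p. d \<nu> - d' \<nu> = 0"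
  proof (rule ev_zero[OF left_ideal_Pstable[OF VI_left] VI_pvac VI_1])
    fix \<alpha> assume a: "\<alpha> \<in> pfree p"
    then obtain i \<beta> where ab: "\<alpha> = i # \<beta>" using pfreeD[OF a] p1 by (cases \<alpha>) auto
    then have "i \<ge> 1" "i \<le> p" "i \<noteq> p" using pfreeD[OF a] by auto
    then have "i \<in> {1..p-1}" by auto
    then have "L (int i) * (T_with p cM d - T_with p cM d') \<in> VI hp"
      unfolding right_diff_distrib using h by (intro U.subspace_diff[OF left_ideal_subspace[OF VI_left]]) auto
    then have "Lr \<beta> * (L (int i) * (T_with p cM d - T_with p cM d')) \<in> VI hp" by (rule left_ideal_mult[OF VI_left])
    then have "Lr \<alpha> * (ev p (\<lambda>\<nu>. d \<nu> - d' \<nu>) * 1) \<in> VI hp"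
      unfolding diff ab Lr.simps mult.assoc mult_1_right .
    then show "Lr \<alpha> * (ev p (\<lambda>\<nu>. d \<nu> - d' \<nu>) * 1) \<approx>\<^bsub>VI hp\<^esub> 0" by (rule eqm_base0)
  qed
  then have "d \<nu> = d' \<nu>" if "\<nu> \<in> partitions_of p" "length \<nu> \<ge> 2" for \<nu> using that pfree by auto
  then have "d \<nu> = d' \<nu>" for \<nu> using d d' by (cases "\<nu> \<in> partitions_of p \<and> length \<nu> \<ge> 2") auto
  then show ?thesis by (rule ext)
qed

lemma T_eq_TT: "\<exists>s. T p cL cM = TT s"
proof -
  obtain s d where d: "\<forall>\<nu>. \<not> (\<nu> \<in> partitions_of p \<and> length \<nu> \<ge> 2) \<longrightarrow> d \<nu> = 0" "T_with p cM d = TT s"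
    using T_with_TT by blast
  have h: "L (int i) * T_with p cM d \<in> VI hp" if "i \<in> {1..p-1}" for i
    using TT_VI[of i s] that p1 d(2) by auto
  have "d_coeffs p cL cM = d"
    unfolding d_coeffs_def
  proof (rule the_equality)
    show "(\<forall>\<nu>. \<not> (\<nu> \<in> partitions_of p \<and> 2 \<le> length \<nu>) \<longrightarrow> d \<nu> = 0) \<and>
      (\<forall>i\<in>{1..p-1}. L (int i) * T_with p cM d \<in> verma_ideal (h' p 1 cL) (- ((of_nat p ^ 2 - 1) / 24) * cM) cL cM)"
      using d h by (simp add: hM_def)
    fix d'
    assume "(\<forall>\<nu>. \<not> (\<nu> \<in> partitions_of p \<and> 2 \<le> length \<nu>) \<longrightarrow> d' \<nu> = 0) \<and>
      (\<forall>i\<in>{1..p-1}. L (int i) * T_with p cM d' \<in> verma_ideal (h' p 1 cL) (- ((of_nat p ^ 2 - 1) / 24) * cM) cL cM)"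
    then show "d' = d" using d h by (intro T_with_unique) (auto simp: hM_def)
  qed
  then show ?thesis using d by (auto simp: T_def)
qed

definition sT :: complex where "sT = (SOME s. T p cL cM = TT s)"
definition TT0 :: U22 where "TT0 = TT sT"

lemma T_TT0: "T p cL cM = TT0"
  unfolding TT0_def sT_def by (rule someI_ex[OF T_eq_TT])

section \<open>The submodule generated by the singular vector\<close>

abbreviation I :: "U22 set" where "I \<equiv> VI hL"

text \<open>
  The left ideal that will turn out to be \<open>J'\<close>.
\<close>

definition N :: "U22 set" where "N = left_ideal hull (I \<union> {Sv})"

lemma N_left: "left_ideal N" unfolding N_def by (rule left_ideal_hull)
lemma N_sub: "U.subspace N" by (rule left_ideal_subspace[OF N_left])
lemma I_N: "I \<subseteq> N" using hull_subset[of "I \<union> {Sv}" left_ideal] by (auto simp: N_def)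
lemma Sv_N: "Sv \<in> N" unfolding N_def by (rule hull_inc) simp

lemma N_form: "n \<in> N \<Longrightarrow> \<exists>u. n - u * Sv \<in> I"
proof -
  let ?A = "{n. \<exists>u. n - u * Sv \<in> I}"
  have Is: "U.subspace I" by (rule left_ideal_subspace[OF VI_left])
  have "left_ideal ?A"
    unfolding left_ideal_def
  proof (intro conjI ballI allI)
    show "0 \<in> ?A" using U.subspace_0[OF Is] by (auto intro!: exI[of _ 0])
    fix x y assume "x \<in> ?A" "y \<in> ?A"
    then obtain u v where "x - u * Sv \<in> I" "y - v * Sv \<in> I" by auto
    then have "(x + y) - (u + v) * Sv \<in> I" using U.subspace_add[OF Is] by (fastforce simp: algebra_simps)
    then show "x + y \<in> ?A" by blast
  next
    fix a x assume "x \<in> ?A"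
    then obtain u where "x - u * Sv \<in> I" by auto
    then have "a * x - (a * u) * Sv \<in> I" using left_ideal_mult[OF VI_left, of "x - u * Sv" hL a] by (simp add: right_diff_distrib mult.assoc)
    then show "a * x \<in> ?A" by blast
  qed
  moreover have "I \<union> {Sv} \<subseteq> ?A"
    using U.subspace_0[OF Is] by (auto intro: exI[of _ 0] exI[of _ 1])
  ultimately have "N \<subseteq> ?A" unfolding N_def by (intro hull_minimal)
  then show "n \<in> N \<Longrightarrow> \<exists>u. n - u * Sv \<in> I" by auto
qed

section \<open>Filtration of the Verma module by the number of \<open>M\<close>\<close>

text \<open>
  A filtration of the enveloping algebra of the negative part by the number of letters \<open>M\<close>, which reordering does not lower.
\<close>

definition NW :: "nat \<Rightarrow> U22 set" where
  "NW d = U.span {prod_list (map gen ws) | ws. (\<forall>g\<in>set ws. neg g) \<and> d \<le> length (filter isM ws)}"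

lemma NW_sub: "U.subspace (NW d)" by (simp add: NW_def)

lemma NW_word: "\<forall>g\<in>set ws. neg g \<Longrightarrow> d \<le> length (filter isM ws) \<Longrightarrow> prod_list (map gen ws) \<in> NW d"
  unfolding NW_def by (rule U.span_base) auto

lemma NW_mono: "d \<le> e \<Longrightarrow> NW e \<subseteq> NW d"
  unfolding NW_def by (rule U.span_mono) auto

lemma NW_induct [consumes 1, case_names zero step]:
  assumes "x \<in> NW d" "P 0"
    "\<And>c ws y. \<forall>g\<in>set ws. neg g \<Longrightarrow> d \<le> length (filter isM ws) \<Longrightarrow> P y \<Longrightarrow> P (scal c * prod_list (map gen ws) + y)"
  shows "P x"
  using assms(1) unfolding NW_def by (induction rule: U.span_induct_alt) (use assms(2,3) in auto)

lemma NW_mult: "x \<in> NW d \<Longrightarrow> y \<in> NW e \<Longrightarrow> x * y \<in> NW (d + e)"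
proof (induction rule: NW_induct)
  case (step c ws x)
  from step(4) have "prod_list (map gen ws) * y \<in> NW (d + e)"
  proof (induction rule: NW_induct)
    case (step c us y)
    have "prod_list (map gen (ws @ us)) \<in> NW (d + e)"
      using step \<open>\<forall>g\<in>set ws. neg g\<close> \<open>d \<le> length (filter isM ws)\<close> by (intro NW_word) auto
    then show ?case
      using step by (simp add: distrib_left scal_left_commute[of "prod_list (map gen ws)"] U.subspace_add[OF NW_sub] U.subspace_scale[OF NW_sub])
  qed (simp add: U.subspace_0[OF NW_sub])
  then show ?case using step by (simp add: distrib_right mult.assoc U.subspace_add[OF NW_sub] U.subspace_scale[OF NW_sub])
qed (simp add: U.subspace_0[OF NW_sub])

lemma NW_1: "1 \<in> NW 0" using NW_word[of "[]" 0] by simp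
lemma NW_L: "i > 0 \<Longrightarrow> L (- i) \<in> NW 0" using NW_word[of "[Lg (- i)]" 0] by (simp add: gen_def)
lemma NW_M: "i > 0 \<Longrightarrow> M (- i) \<in> NW 1" using NW_word[of "[Mg (- i)]" 1] by (simp add: gen_def isM_def)

lemma NW_M_part: "pos \<nu> \<Longrightarrow> M_part \<nu> \<in> NW (length \<nu>)"
proof (induction \<nu>)
  case (Cons i \<nu>)
  then show ?case using NW_mult[OF NW_M[of "int i"], of "M_part \<nu>" "length \<nu>"] by simp
qed (simp add: NW_1)

lemma MS_NW: "a \<in> MS Q \<Longrightarrow> (\<And>\<nu>. Q \<nu> \<Longrightarrow> d \<le> length \<nu>) \<Longrightarrow> a \<in> NW d"
proof (induction rule: MS_induct)
  case (part \<nu>)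
  then show ?case using NW_M_part[of \<nu>] NW_mono[of d "length \<nu>"] by blast
qed (simp_all add: U.subspace_0[OF NW_sub] U.subspace_add[OF NW_sub] U.subspace_scale[OF NW_sub])

lemma UM_NW: "a \<in> UM n \<Longrightarrow> n \<ge> 1 \<Longrightarrow> a \<in> NW 1"
  unfolding UM_eq_MS by (erule MS_NW) (metis One_nat_def Suc_leI length_greater_0_conv not_one_le_zero sum_list.Nil)

lemma T_NW: "TT0 - L (- int p) \<in> NW 1"
proof -
  have "L (- int i) * G (int p - int i) \<in> NW 1" if "i \<in> {1..p-1}" for i
  proof -
    have "G (int p - int i) \<in> NW 1" by (rule UM_NW[OF G_UM]) (use that p1 in auto)
    then show ?thesis using NW_mult[OF NW_L[of "int i"], of _ 1] that by auto
  qed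
  then have "(\<Sum>i=1..p-1. L (- int i) * G (int p - int i)) + scal bT * Qv + scal sT * Sv \<in> NW 1"
    using UM_NW[OF Qv_UM p1] UM_NW[OF Sv_UM p1]
    by (intro U.subspace_add[OF NW_sub] U.subspace_scale[OF NW_sub] U.subspace_sum[OF NW_sub]) auto
  then show ?thesis unfolding TT0_def TT_def sum_GL by (simp add: G_def algebra_simps)
qed

lemma Tpow_NW: "TT0 ^ k - L (- int p) ^ k \<in> NW 1" "TT0 ^ k \<in> NW 0" "L (- int p) ^ k \<in> NW 0"
proof -
  have L: "L (- int p) \<in> NW 0" using NW_L[of "int p"] p1 by simp
  have T: "TT0 \<in> NW 0" using U.subspace_add[OF NW_sub L, of "TT0 - L (- int p)"] T_NW NW_mono[of 0 1] by auto
  show pw: "TT0 ^ k \<in> NW 0" for k using NW_mult[OF T, of _ 0] by (induction k) (auto simp: NW_1)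
  show pl: "L (- int p) ^ k \<in> NW 0" for k using NW_mult[OF L, of _ 0] by (induction k) (auto simp: NW_1)
  show "TT0 ^ k - L (- int p) ^ k \<in> NW 1"
  proof (induction k)
    case (Suc k)
    have "TT0 * (TT0 ^ k - L (- int p) ^ k) + (TT0 - L (- int p)) * L (- int p) ^ k \<in> NW 1"
      using NW_mult[OF T Suc] NW_mult[OF T_NW pl[of k]] by (intro U.subspace_add[OF NW_sub]) auto
    then show ?case by (simp add: algebra_simps)
  qed (simp add: U.subspace_0[OF NW_sub])
qed

abbreviation vc :: "U22 \<Rightarrow> negpoly" where "vc \<equiv> vac hL hM cL cM"

lemma supp_lookup: "supp Q v \<Longrightarrow> \<not> Q m \<Longrightarrow> Poly_Mapping.lookup v m = 0"
  by (auto simp: supp_def in_keys_iff)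

lemma vc_NW: "x \<in> NW d \<Longrightarrow> supp (\<lambda>z. negms z \<and> d \<le> mdeg z) (vc x)"
proof (induction rule: NW_induct)
  case (step c ws y)
  have "supp (\<lambda>z. negms z \<and> length (filter isM us) \<le> mdeg z) (vc (prod_list (map gen us)))" if "\<forall>g\<in>set us. neg g" for us
    using that
  proof (induction us)
    case (Cons g us)
    then have "supp (\<lambda>z. negms z \<and> length (filter isM us) + of_bool (isM g) \<le> mdeg z) (Act hL hM cL cM g (vc (prod_list (map gen us))))"
      by (intro Act_mdeg) auto
    then show ?case unfolding list.map prod_list.Cons vac_gen by (rule supp_mono) auto
  qed (simp add: vac_1)
  from supp_mono[OF this[OF step(1)]] step(2)
  have "supp (\<lambda>z. negms z \<and> d \<le> mdeg z) (vc (prod_list (map gen ws)))" by auto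
  then show ?case using step by (simp add: vac_add vac_scal supp_add supp_cst)
qed (simp add: vac_0)

abbreviation Lm :: w22_basis where "Lm \<equiv> Lg (- int p)"
abbreviation Mm :: w22_basis where "Mm \<equiv> Mg (- int p)"

lemma neg_p: "neg Lm" "neg Mm" using p1 by simp_all

lemma vc_gen_L: "vc (L n * u) = Act hL hM cL cM (Lg n) (vc u)" using vac_gen[of _ _ _ _ "Lg n"] by (simp add: gen_def)
lemma vc_gen_M: "vc (M n * u) = Act hL hM cL cM (Mg n) (vc u)" using vac_gen[of _ _ _ _ "Mg n"] by (simp add: gen_def)

lemma vc_Lpow_size: "supp (\<lambda>z. negms z \<and> size z \<le> k) (vc (L (- int p) ^ k))"
  by (induction k) (simp_all add: vac_1 vc_gen_L Act_size)

lemma vc_Lpow: "Poly_Mapping.lookup (vc (L (- int p) ^ k)) (replicate_mset k Lm) = 1"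
proof (induction k)
  case 0
  then show ?case by (simp add: vac_1 mon_def)
next
  case (Suc k)
  have "Poly_Mapping.lookup (Act hL hM cL cM Lm (vc (L (- int p) ^ k))) (add_mset Lm (replicate_mset k Lm))
     = Poly_Mapping.lookup (vc (L (- int p) ^ k)) (replicate_mset k Lm)"
    by (rule lookup_Act_top[OF neg_p(1)]) (use vc_Lpow_size[of k] in simp)
  then show ?case using Suc by (simp add: vc_gen_L)
qed

text \<open>
  The coefficient of \<open>L\<^sub>-\<^sub>p\<^sup>k\<close>. It vanishes on \<open>N\<close> and on every \<open>a T\<^sup>j\<close> with \<open>j < k\<close>, but not on \<open>T\<^sup>k\<close>, and so separates \<open>T\<^sup>k\<close> from
  the lower layers of the filtration.
\<close>

definition lead :: "nat \<Rightarrow> U22 \<Rightarrow> complex" where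
  "lead k u = Poly_Mapping.lookup (vc u) (replicate_mset k Lm)"

lemma lead_add: "lead k (u + v) = lead k u + lead k v"
  and lead_scal: "lead k (scal c * u) = c * lead k u"
  and lead_0: "lead k 0 = 0"
  by (simp_all add: lead_def vac_add vac_scal vac_0 lookup_add)

lemma lead_diff: "lead k (u - v) = lead k u - lead k v"
  by (simp add: lead_def vac_diff lookup_minus)

lemma lead_I: "u \<in> I \<Longrightarrow> lead k u = 0" by (simp add: lead_def vac_verma_ideal)

lemma lead_NW: "u \<in> NW 1 \<Longrightarrow> lead k u = 0"
proof -
  assume "u \<in> NW 1"
  then have "supp (\<lambda>z. negms z \<and> 1 \<le> mdeg z) (vc u)" by (rule vc_NW)
  moreover have "mdeg (replicate_mset k Lm) = 0" by (induction k) (simp_all add: isM_def)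
  ultimately show ?thesis unfolding lead_def by (intro supp_lookup[where Q = "\<lambda>z. negms z \<and> 1 \<le> mdeg z"]) auto
qed

lemma lead_Lpow: "j \<le> k \<Longrightarrow> lead k (L (- int p) ^ j) = (if j = k then 1 else 0)"
  using vc_Lpow[of k] supp_lookup[OF vc_Lpow_size[of j], of "replicate_mset k Lm"] by (auto simp: lead_def)

lemma lead_Tpow: "j \<le> k \<Longrightarrow> lead k (TT0 ^ j) = (if j = k then 1 else 0)"
  using lead_diff[of k "TT0 ^ j" "L (- int p) ^ j"] lead_NW[OF Tpow_NW(1)[of j]] lead_Lpow by fastforce

lemma lead_MST: "a \<in> MS Q \<Longrightarrow> j < k \<Longrightarrow> lead k (a * TT0 ^ j) = 0"
proof (induction rule: MS_induct)
  case (part \<nu>)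
  show ?case
  proof (cases \<nu>)
    case Nil
    then show ?thesis using part lead_Tpow[of j k] by simp
  next
    case (Cons i \<nu>')
    have "M_part \<nu> * TT0 ^ j \<in> NW (length \<nu> + 0)" by (rule NW_mult[OF NW_M_part[OF part(1)] Tpow_NW(2)])
    then show ?thesis using NW_mono[of 1 "length \<nu>"] Cons by (intro lead_NW) auto
  qed
qed (simp_all add: lead_0 distrib_right lead_add mult.assoc lead_scal)

lemma gen_simps: "gen (Lg n) = L n" "gen (Mg n) = M n" "gen CLg = CL" "gen CMg = CM"
  by (simp_all add: gen_def)

lemma isM_simps: "\<not> isM (Lg n)" "isM (Mg n)" by (simp_all add: isM_def)

subsection \<open>Highest weight vectors generate through the negative part\<close>

text \<open>
  Commutators of generators are combinations of at most two generators, in a form that rewrites without case distinctions.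
\<close>

lemma gen_comm: "\<exists>z c z' c'. \<forall>y. gen g * (gen h * y) = gen h * (gen g * y) + scal c * (gen z * y) + scal c' * (gen z' * y)"
proof -
  have triv: "\<exists>z c z' c'. \<forall>y. gen g * (gen h * y) = gen h * (gen g * y) + scal c * (gen z * y) + scal c' * (gen z' * y)"
    if "\<And>y. gen g * (gen h * y) = gen h * (gen g * y)"
    using that by (intro exI[of _ CLg] exI[of _ "0 :: complex"]) simp
  have CLl: "x * (CL * y) = CL * (x * y)" and CMl: "x * (CM * y) = CM * (x * y)" for x y
    by (simp_all only: CL_comm CM_comm flip: mult.assoc)
  have c1: "gen g * (gen h * y) = gen h * (gen g * y)" if "g = CLg" for y
    unfolding that gen_simps by (rule CLl[symmetric])
  have c2: "gen g * (gen h * y) = gen h * (gen g * y)" if "g = CMg" for y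
    unfolding that gen_simps by (rule CMl[symmetric])
  have c3: "gen g * (gen h * y) = gen h * (gen g * y)" if "h = CLg" for y
    unfolding that gen_simps by (rule CLl)
  have c4: "gen g * (gen h * y) = gen h * (gen g * y)" if "h = CMg" for y
    unfolding that gen_simps by (rule CMl)
  show ?thesis
proof (cases g; cases h)
  fix m n assume gh: "g = Lg m" "h = Lg n"
  show ?thesis using LL_app[of m n] unfolding gh gen_def
    by (intro exI[of _ "Lg (m + n)"] exI[of _ "of_int (m - n)"] exI[of _ CLg] exI[of _ "if m + n = 0 then cocyc m else 0"]) auto
next
  fix m n assume gh: "g = Lg m" "h = Mg n"
  show ?thesis using LM_app[of m n] unfolding gh gen_def
    by (intro exI[of _ "Mg (m + n)"] exI[of _ "of_int (m - n)"] exI[of _ CMg] exI[of _ "if m + n = 0 then cocyc m else 0"]) auto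
next
  fix m n assume gh: "g = Mg m" "h = Lg n"
  show ?thesis using M_L_app[of m n] unfolding gh gen_def
    by (intro exI[of _ "Mg (m + n)"] exI[of _ "of_int (m - n)"] exI[of _ CMg] exI[of _ "if m + n = 0 then cocyc m else 0"]) auto
next
  fix m n assume gh: "g = Mg m" "h = Mg n"
  show ?thesis using MM_app[of m n] unfolding gh gen_def
    by (intro exI[of _ CLg] exI[of _ 0] exI[of _ CLg] exI[of _ 0]) auto
qed (rule triv, ((rule c1, assumption) | (rule c2, assumption) | (rule c3, assumption) | (rule c4, assumption)))+
qed

text \<open>
  Any generator can be moved to the right through a word of negative generators; the commutators involve shorter words.
\<close>

lemma highest_weight_span:
  assumes X: "left_ideal X" and s: "\<And>g. \<not> neg g \<Longrightarrow> \<exists>c. gen g * s \<approx>\<^bsub>X\<^esub> scal c * s"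
  shows "\<exists>x\<in>NW 0. u * s \<approx>\<^bsub>X\<^esub> x * s"
proof -
  have word: "\<exists>x\<in>NW 0. gen g * (prod_list (map gen ws) * s) \<approx>\<^bsub>X\<^esub> x * s" if "\<forall>h\<in>set ws. neg h" for g ws
    using that
  proof (induction ws arbitrary: g)
    case Nil
    show ?case
    proof (cases "neg g")
      case True
      then show ?thesis using NW_word[of "[g]" 0] by (intro bexI[of _ "gen g"]) auto
    next
      case False
      then obtain c where "gen g * s \<approx>\<^bsub>X\<^esub> scal c * s" using s by blast
      then show ?thesis using U.subspace_scale[OF NW_sub NW_1, of c] by (intro bexI[of _ "scal c"]) auto
    qed
  next
    case (Cons h ws)
    let ?y = "prod_list (map gen ws) * s"
    obtain z c z' c' where e: "gen g * (gen h * ?y) = gen h * (gen g * ?y) + scal c * (gen z * ?y) + scal c' * (gen z' * ?y)"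
      using gen_comm by blast
    have ws: "\<forall>h\<in>set ws. neg h" using Cons.prems by simp
    obtain x1 where x1: "x1 \<in> NW 0" "gen g * ?y \<approx>\<^bsub>X\<^esub> x1 * s" using Cons.IH[OF ws] by blast
    obtain x2 where x2: "x2 \<in> NW 0" "gen z * ?y \<approx>\<^bsub>X\<^esub> x2 * s" using Cons.IH[OF ws] by blast
    obtain x3 where x3: "x3 \<in> NW 0" "gen z' * ?y \<approx>\<^bsub>X\<^esub> x3 * s" using Cons.IH[OF ws] by blast
    note x = x1 x2 x3
    have "gen h \<in> NW 0" using Cons.prems NW_word[of "[h]" 0] by simp
    then have "gen h * x1 + scal c * x2 + scal c' * x3 \<in> NW 0"
      using x NW_mult[of "gen h" 0 x1 0] by (intro U.subspace_add[OF NW_sub] U.subspace_scale[OF NW_sub]) auto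
    moreover have "gen g * (gen h * ?y) \<approx>\<^bsub>X\<^esub> gen h * (x1 * s) + scal c * (x2 * s) + scal c' * (x3 * s)"
      unfolding e using x by (intro eqm_add eqm_scal eqm_lmult[OF X])
    ultimately show ?case
      by (intro bexI[of _ "gen h * x1 + scal c * x2 + scal c' * x3"]) (simp_all add: distrib_right mult.assoc)
  qed
  have step: "\<exists>x'\<in>NW 0. gen g * (x * s) \<approx>\<^bsub>X\<^esub> x' * s" if "x \<in> NW 0" for g x
    using that
  proof (induction rule: NW_induct)
    case zero
    show ?case by (rule bexI[of _ 0]) (simp_all add: U.subspace_0[OF NW_sub])
  next
    case (step c ws y)
    from word[OF step(1)] obtain x1 where x1: "x1 \<in> NW 0" "gen g * (prod_list (map gen ws) * s) \<approx>\<^bsub>X\<^esub> x1 * s" by blast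
    from step(3) obtain x2 where x2: "x2 \<in> NW 0" "gen g * (y * s) \<approx>\<^bsub>X\<^esub> x2 * s" by blast
    have "scal c * (gen g * (prod_list (map gen ws) * s)) + gen g * (y * s) \<approx>\<^bsub>X\<^esub> scal c * (x1 * s) + x2 * s"
      using x1 x2 by (intro eqm_add eqm_scal)
    then show ?case using x1 x2 U.subspace_add[OF NW_sub U.subspace_scale[OF NW_sub x1(1)] x2(1)]
      by (intro bexI[of _ "scal c * x1 + x2"]) (simp_all add: distrib_right distrib_left mult.assoc scal_left_commute[of "gen g"])
  qed
  show ?thesis
  proof (induction u rule: U22_induct)
    case zero
    show ?case by (rule bexI[of _ 0]) (simp_all add: U.subspace_0[OF NW_sub])
  next
    case (add u v)
    then obtain x1 x2 where "x1 \<in> NW 0" "u * s \<approx>\<^bsub>X\<^esub> x1 * s" "x2 \<in> NW 0" "v * s \<approx>\<^bsub>X\<^esub> x2 * s" by blast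
    then show ?case using U.subspace_add[OF NW_sub] eqm_add by (intro bexI[of _ "x1 + x2"]) (auto simp: distrib_right)
  next
    case (scal c)
    show ?case using U.subspace_scale[OF NW_sub NW_1, of c] by (intro bexI[of _ "scal c"]) auto
  next
    case (gen g u)
    then obtain x where x: "x \<in> NW 0" "u * s \<approx>\<^bsub>X\<^esub> x * s" by blast
    from step[OF x(1)] obtain x' where "x' \<in> NW 0" "gen g * (x * s) \<approx>\<^bsub>X\<^esub> x' * s" by blast
    then show ?case using eqm_lmult[OF X x(2), of "gen g"] by (intro bexI[of _ x']) (auto simp: mult.assoc intro: eqm_trans)
  qed
qed

lemma highest_weight_span':
  assumes X: "left_ideal X" "I \<subseteq> X" and "\<And>n. n > 0 \<Longrightarrow> L n * s \<approx>\<^bsub>X\<^esub> 0" "L 0 * s \<approx>\<^bsub>X\<^esub> scal \<mu> * s" "mvac X s"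
  shows "\<exists>x\<in>NW 0. u * s \<approx>\<^bsub>X\<^esub> x * s"
proof (rule highest_weight_span[OF X(1)])
  fix g assume g: "\<not> neg g"
  show "\<exists>c. gen g * s \<approx>\<^bsub>X\<^esub> scal c * s"
  proof (cases g)
    case (Lg n)
    show ?thesis
    proof (cases "n = 0")
      case True
      then show ?thesis using assms Lg by (auto simp: gen_simps)
    next
      case False
      then show ?thesis using assms(3)[of n] Lg g by (intro exI[of _ 0]) (auto simp: gen_simps)
    qed
  next
    case (Mg n)
    show ?thesis
    proof (cases "n = 0")
      case True
      then show ?thesis using assms Mg by (auto simp: gen_simps mvac_def)
    next
      case False
      then show ?thesis using assms(5) Mg g by (intro exI[of _ 0]) (auto simp: gen_simps mvac_def)
    qed
  qed (use central_eqm[OF X(2,1)] in \<open>auto simp: gen_simps\<close>)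
qed

lemma Sv_hw: "n > 0 \<Longrightarrow> L n * Sv \<approx>\<^bsub>I\<^esub> 0" "L 0 * Sv \<approx>\<^bsub>I\<^esub> scal (hL + of_nat p) * Sv" "mvac I Sv"
proof -
  show "mvac I Sv" using mvac_MS[OF left_ideal_Mstable[OF VI_left] VI_mvac(1) Sv_UM[unfolded UM_eq_MS]] by simp
  show "L 0 * Sv \<approx>\<^bsub>I\<^esub> scal (hL + of_nat p) * Sv"
    using wt_eigen[OF VI_left wt_UM[OF Sv_UM] VI_mvac(2)] by simp
  assume n: "n > 0"
  have "L n * (Sv * 1) \<approx>\<^bsub>I\<^esub> Sv * (L n * 1) + 0 * 1"
    using n by (intro EdD[OF Ed_Sv] left_ideal_Mstable VI_left VI_mvac) auto
  also have "\<dots> \<approx>\<^bsub>I\<^esub> 0" using VI_gens(1)[OF n] by (auto intro!: eqm_base0 left_ideal_mult[OF VI_left])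
  finally show "L n * Sv \<approx>\<^bsub>I\<^esub> 0" by simp
qed

text \<open>
  \<open>Sv\<close> is a polynomial in the \<open>M\<^sub>-\<^sub>i\<close> without constant term, and \<open>u Sv\<close> may be written with \<open>u\<close> in the negative part because \<open>Sv\<close> is a highest weight vector.
\<close>

lemma N_NW: "n \<in> N \<Longrightarrow> \<exists>x\<in>NW 1. n \<approx>\<^bsub>I\<^esub> x"
proof -
  assume "n \<in> N"
  then obtain u where u: "n - u * Sv \<in> I" using N_form by blast
  obtain x where x: "x \<in> NW 0" "u * Sv \<approx>\<^bsub>I\<^esub> x * Sv"
    using highest_weight_span'[OF VI_left order_refl Sv_hw] by blast
  have "n \<approx>\<^bsub>I\<^esub> x * Sv" using eqm_base[OF u] x(2) eqm_trans by blast
  moreover have "x * Sv \<in> NW (0 + 1)" by (rule NW_mult[OF x(1) UM_NW[OF Sv_UM p1]])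
  ultimately show ?thesis by auto
qed

lemma lead_eqm: "u \<approx>\<^bsub>I\<^esub> v \<Longrightarrow> lead k u = lead k v"
  using lead_I[of "u - v" k] eqm_iff[OF left_ideal_subspace[OF VI_left]] by (simp add: lead_diff)

lemma lead_N: "n \<in> N \<Longrightarrow> lead k n = 0"
  using N_NW lead_eqm lead_NW by metis

subsection \<open>\<open>M\<^sub>0\<close> is not semisimple\<close>

text \<open>
  \<open>[M\<^sub>0, L\<^sub>-\<^sub>i] = i M\<^sub>-\<^sub>i\<close>: the operator \<open>M\<^sub>0 - h\<^sub>M\<close> turns an \<open>L\<close> into an \<open>M\<close>.
\<close>

lemma M0_NW: "x \<in> NW d \<Longrightarrow> \<exists>x'\<in>NW (d + 1). M 0 * x \<approx>\<^bsub>I\<^esub> scal hM * x + x'"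
proof (induction rule: NW_induct)
  case zero
  show ?case by (rule bexI[of _ 0]) (simp_all add: U.subspace_0[OF NW_sub])
next
  case (step c ws y)
  have "\<exists>x'\<in>NW (length (filter isM us) + 1). M 0 * prod_list (map gen us) \<approx>\<^bsub>I\<^esub> scal hM * prod_list (map gen us) + x'"
    if "\<forall>g\<in>set us. neg g" for us
    using that
  proof (induction us)
    case Nil
    have "M 0 * 1 \<approx>\<^bsub>I\<^esub> scal hM * 1" using VI_mvac by (simp add: mvac_def)
    then show ?case by (intro bexI[of _ 0]) (simp_all add: U.subspace_0[OF NW_sub])
  next
    case (Cons g us)
    let ?w = "prod_list (map gen us)" and ?e = "length (filter isM us)"
    from Cons obtain x' where x': "x' \<in> NW (?e + 1)" "M 0 * ?w \<approx>\<^bsub>I\<^esub> scal hM * ?w + x'" by auto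
    have w: "?w \<in> NW ?e" using Cons.prems by (intro NW_word) auto
    have m: "gen g * (M 0 * ?w) \<approx>\<^bsub>I\<^esub> gen g * (scal hM * ?w + x')" by (rule eqm_lmult[OF VI_left x'(2)])
    have g: "gen g \<in> NW (of_bool (isM g))" using Cons.prems NW_word[of "[g]"] by simp
    show ?case
    proof (cases g)
      case (Lg n)
      then have n: "n < 0" using Cons.prems by simp
      define q :: complex where "q = of_int (- n)"
      have "M 0 * (L n * ?w) = L n * (M 0 * ?w) + scal q * (M n * ?w)"
        using M_L_app[of 0 n ?w] n by (simp add: q_def)
      also have "\<dots> \<approx>\<^bsub>I\<^esub> L n * (scal hM * ?w + x') + scal q * (M n * ?w)"
        using m Lg by (intro eqm_add eqm_refl) (simp add: gen_simps)
      finally have "M 0 * (L n * ?w) \<approx>\<^bsub>I\<^esub> scal hM * (L n * ?w) + (L n * x' + scal q * (M n * ?w))"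
        by (simp add: distrib_left L_scal add.assoc)
      moreover have "L n * x' \<in> NW (0 + (?e + 1))" using NW_L[of "- n"] n x' by (intro NW_mult) auto
      moreover have "M n * ?w \<in> NW (1 + ?e)" using NW_M[of "- n"] n w by (intro NW_mult) auto
      ultimately show ?thesis using Lg
        by (intro bexI[of _ "L n * x' + scal q * (M n * ?w)"])
          (auto simp: gen_simps isM_simps intro!: U.subspace_add[OF NW_sub] U.subspace_scale[OF NW_sub])
    next
      case (Mg n)
      then have n: "n < 0" using Cons.prems by simp
      have "M 0 * (M n * ?w) = M n * (M 0 * ?w)" by (rule MM_app)
      also have "\<dots> \<approx>\<^bsub>I\<^esub> M n * (scal hM * ?w + x')" using m Mg by (simp add: gen_simps)
      finally have "M 0 * (M n * ?w) \<approx>\<^bsub>I\<^esub> scal hM * (M n * ?w) + M n * x'"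
        by (simp add: distrib_left M_scal)
      moreover have "M n * x' \<in> NW (1 + (?e + 1))" using NW_M[of "- n"] n x' by (intro NW_mult) auto
      ultimately show ?thesis using Mg by (intro bexI[of _ "M n * x'"]) (auto simp: gen_simps isM_simps)
    qed (use Cons.prems in auto)
  qed
  then obtain x1 where x1: "x1 \<in> NW (length (filter isM ws) + 1)" "M 0 * prod_list (map gen ws) \<approx>\<^bsub>I\<^esub> scal hM * prod_list (map gen ws) + x1"
    using step(1) by blast
  then have "x1 \<in> NW (d + 1)" using step(2) NW_mono[of "d + 1" "length (filter isM ws) + 1"] by auto
  moreover from step(3) obtain x2 where "x2 \<in> NW (d + 1)" "M 0 * y \<approx>\<^bsub>I\<^esub> scal hM * y + x2" by blast
  moreover from this x1 have "scal c * (M 0 * prod_list (map gen ws)) + M 0 * y \<approx>\<^bsub>I\<^esub> scal c * (scal hM * prod_list (map gen ws) + x1) + (scal hM * y + x2)"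
    by (intro eqm_add eqm_scal)
  ultimately show ?case
    by (intro bexI[of _ "scal c * x1 + x2"])
      (auto simp: distrib_left M_scal algebra_simps intro!: U.subspace_add[OF NW_sub] U.subspace_scale[OF NW_sub])
qed

fun M0L :: "nat \<Rightarrow> U22" where
  "M0L 0 = 0"
| "M0L (Suc k) = L (- int p) * M0L k + scal (of_nat p) * (M (- int p) * L (- int p) ^ k)"

lemma M0_Lpow: "M 0 * L (- int p) ^ k \<approx>\<^bsub>I\<^esub> scal hM * L (- int p) ^ k + M0L k"
proof (induction k)
  case 0
  then show ?case using VI_mvac by (simp add: mvac_def)
next
  case (Suc k)
  have "M 0 * L (- int p) ^ Suc k = L (- int p) * (M 0 * L (- int p) ^ k) + scal (of_nat p) * (M (- int p) * L (- int p) ^ k)"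
    using M_L_app[of 0 "- int p" "L (- int p) ^ k"] p1 by simp
  also have "\<dots> \<approx>\<^bsub>I\<^esub> L (- int p) * (scal hM * L (- int p) ^ k + M0L k) + scal (of_nat p) * (M (- int p) * L (- int p) ^ k)"
    by (intro eqm_add eqm_refl eqm_lmult[OF VI_left] Suc)
  finally show ?case by (simp add: distrib_left L_scal add.assoc)
qed

lemma M0L_NW: "M0L k \<in> NW 1"
proof (induction k)
  case (Suc k)
  then show ?case
    using NW_mult[OF NW_L[of "int p"] Suc] NW_mult[OF NW_M[of "int p"] Tpow_NW(3)[of k]] p1
    by (auto intro!: U.subspace_add[OF NW_sub] U.subspace_scale[OF NW_sub])
qed (simp add: U.subspace_0[OF NW_sub])

lemma vc_M0L_size: "supp (\<lambda>z. negms z \<and> size z \<le> k) (vc (M0L k))"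
proof (induction k)
  case (Suc k)
  then show ?case using vc_Lpow_size[of k]
    by (simp add: vac_add vac_scal vc_gen_L vc_gen_M supp_add supp_cst Act_size)
qed (simp add: vac_0)

lemma vc_M0L: "Poly_Mapping.lookup (vc (M0L (Suc k))) (add_mset Mm (replicate_mset k Lm)) = of_nat (Suc k) * of_nat p"
proof (induction k)
  case 0
  have "Poly_Mapping.lookup (Act hL hM cL cM Mm (vc 1)) {#Mm#} = Poly_Mapping.lookup (vc 1) {#}"
    by (rule lookup_Act_top[OF neg_p(2)]) (simp add: vac_1)
  then show ?case by (simp add: vac_scal vc_gen_M[of _ 1, simplified] vac_1 mon_def vac_add vac_0)
next
  case (Suc k)
  have "Poly_Mapping.lookup (Act hL hM cL cM Lm (vc (M0L (Suc k)))) (add_mset Lm (add_mset Mm (replicate_mset k Lm)))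
     = Poly_Mapping.lookup (vc (M0L (Suc k))) (add_mset Mm (replicate_mset k Lm))"
    by (rule lookup_Act_top[OF neg_p(1)]) (use vc_M0L_size[of "Suc k"] in simp)
  moreover have "Poly_Mapping.lookup (Act hL hM cL cM Mm (vc (L (- int p) ^ Suc k))) (add_mset Mm (replicate_mset (Suc k) Lm))
     = Poly_Mapping.lookup (vc (L (- int p) ^ Suc k)) (replicate_mset (Suc k) Lm)"
    by (rule lookup_Act_top[OF neg_p(2)]) (use vc_Lpow_size[of "Suc k"] in simp)
  moreover have "add_mset Mm (replicate_mset (Suc k) Lm) = add_mset Lm (add_mset Mm (replicate_mset k Lm))" by simp
  moreover have "vc (M0L (Suc (Suc k))) = Act hL hM cL cM Lm (vc (M0L (Suc k))) + cst (of_nat p) * Act hL hM cL cM Mm (vc (L (- int p) ^ Suc k))"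
    unfolding M0L.simps(2)[of "Suc k"] vac_add vac_scal vc_gen_L vc_gen_M ..
  ultimately show ?case using Suc vc_Lpow[of "Suc k"] by (simp only: lookup_add lookup_cst_mult) (simp add: algebra_simps)
qed

text \<open>
  Comparing the coefficients of \<open>L\<^sub>-\<^sub>p\<^sup>k\<close> forces the eigenvalue to be \<open>h\<^sub>M\<close>. In \<open>(M\<^sub>0 - h\<^sub>M) w\<close> the monomial
  \<open>L\<^sub>-\<^sub>p\<close> to the power \<open>k - 1\<close> times \<open>M\<^sub>-\<^sub>p\<close> then has coefficient \<open>c k p\<close>: the part coming from \<open>g\<close> contains two
  factors \<open>M\<close>.
\<close>

lemma M0_not_semisimple:
  assumes k: "k \<ge> 1" and c: "c \<noteq> 0" and g: "g \<in> NW 1"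
    and w: "w \<approx>\<^bsub>I\<^esub> scal c * L (- int p) ^ k + g" and M: "M 0 * w \<approx>\<^bsub>I\<^esub> scal a * w"
  shows False
proof -
  let ?L = "L (- int p) ^ k"
  obtain g' where g': "g' \<in> NW 2" "M 0 * g \<approx>\<^bsub>I\<^esub> scal hM * g + g'" using M0_NW[OF g] by (auto simp: numeral_2_eq_2)
  have "scal a * (scal c * ?L + g) \<approx>\<^bsub>I\<^esub> scal a * w" by (rule eqm_scal[OF eqm_sym[OF w]])
  also have "\<dots> \<approx>\<^bsub>I\<^esub> M 0 * w" by (rule eqm_sym[OF M])
  also have "\<dots> \<approx>\<^bsub>I\<^esub> M 0 * (scal c * ?L + g)" by (rule eqm_lmult[OF VI_left w])
  also have "\<dots> = scal c * (M 0 * ?L) + M 0 * g" by (simp add: distrib_left M_scal)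
  also have "\<dots> \<approx>\<^bsub>I\<^esub> scal c * (scal hM * ?L + M0L k) + (scal hM * g + g')"
    by (intro eqm_add eqm_scal M0_Lpow g')
  finally have main: "scal a * (scal c * ?L + g) \<approx>\<^bsub>I\<^esub> scal c * (scal hM * ?L + M0L k) + (scal hM * g + g')" .
  have "g' \<in> NW 1" using g' NW_mono[of 1 2] by auto
  then have "a * c = c * hM"
    using lead_eqm[OF main, of k] lead_NW[OF g] lead_NW[OF M0L_NW] lead_Lpow[of k k]
    by (simp add: lead_add lead_scal lead_NW del: U.scale_scale)
  then have a: "a = hM" using c by simp
  from main have "scal c * M0L k + g' \<in> I"
    unfolding a eqm_iff[OF left_ideal_subspace[OF VI_left]]
    using U.subspace_neg[OF left_ideal_subspace[OF VI_left], of _ hL] by (fastforce simp: algebra_simps)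
  then have "vc (scal c * M0L k + g') = 0" by (rule vac_verma_ideal)
  then have z: "Poly_Mapping.lookup (cst c * vc (M0L k) + vc g') (add_mset Mm (replicate_mset (k - 1) Lm)) = 0"
    by (simp add: vac_add vac_scal)
  have "mdeg (replicate_mset j Lm) = 0" for j by (induction j) (simp_all add: isM_def)
  then have "mdeg (add_mset Mm (replicate_mset (k - 1) Lm)) = 1" by (simp add: isM_def)
  then have "Poly_Mapping.lookup (vc g') (add_mset Mm (replicate_mset (k - 1) Lm)) = 0"
    by (intro supp_lookup[OF vc_NW[OF g'(1)]]) simp
  with z have "c * (of_nat k * of_nat p) = 0" using vc_M0L[of "k - 1"] k by (simp add: lookup_add)
  then show False using c k p1 by simp
qed

section \<open>The filtration by powers of \<open>T\<close>\<close>

abbreviation MT :: "U22 set" where "MT \<equiv> MS (\<lambda>_. True)"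

lemma MS_MT: "a \<in> MS Q \<Longrightarrow> a \<in> MT" using MS_mono[of Q "\<lambda>_. True"] by blast

text \<open>
  \<open>U(M\<^sub>-)\<^sub>w\<close> for integers \<open>w\<close>, zero for negative ones, so that the weights of lowered vectors need no case distinctions.
\<close>

definition UMi :: "int \<Rightarrow> U22 set" where "UMi w = (if w < 0 then {0} else UM (nat w))"

lemma UMi_sub: "U.subspace (UMi w)"
  by (simp add: UMi_def UM_eq_MS MS_subspace U.subspace_def[of "{0}"])

lemma UMi_MT: "a \<in> UMi w \<Longrightarrow> a \<in> MT"
  by (auto simp: UMi_def UM_eq_MS MS_0 MS_MT split: if_splits)

lemma UMi_mult: "a \<in> UMi v \<Longrightarrow> b \<in> UMi w \<Longrightarrow> a * b \<in> UMi (v + w)"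
proof -
  assume a: "a \<in> UMi v" and b: "b \<in> UMi w"
  show ?thesis
  proof (cases "v < 0 \<or> w < 0")
    case True
    then have "a * b = 0" using a b by (auto simp: UMi_def)
    then show ?thesis using U.subspace_0[OF UMi_sub] by simp
  next
    case False
    then show ?thesis using UM_mult[of a "nat v" b "nat w"] a b by (simp add: UMi_def nat_add_distrib)
  qed
qed

lemma G_UMi: "G i \<in> UMi i" using G_UM[of i] by (auto simp: UMi_def G_def)

lemma M_UMi: "i > 0 \<Longrightarrow> M (- i) \<in> UMi i" using UM_M[of "nat i"] by (simp add: UMi_def)

lemma scal_UMi: "scal c \<in> UMi 0" using UM_scal by (simp add: UMi_def)

lemma UMi_0: "a \<in> UMi 0 \<Longrightarrow> \<exists>c. a = scal c" using UM_0 by (simp add: UMi_def)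

lemma UM_UMi: "a \<in> UM n \<Longrightarrow> a \<in> UMi (int n)" by (simp add: UMi_def)

lemma EM_UMi: "EM n i \<in> UMi (i - n)"
proof -
  consider "n < i" | "n = i" | "n > i" by linarith
  then show ?thesis
  proof cases
    case 1
    then show ?thesis using M_UMi[of "i - n"] U.subspace_scale[OF UMi_sub] by (auto simp: EM_def)
  qed (auto simp: EM_def scal_UMi U.subspace_0[OF UMi_sub])
qed

lemma Ed_M_part: "pos \<nu> \<Longrightarrow> \<exists>b\<in>UMi (int (sum_list \<nu>) - n). Ed n (M_part \<nu>) b"
proof (induction \<nu>)
  case Nil
  show ?case by (rule bexI[of _ 0]) (simp_all add: Ed_1 U.subspace_0[OF UMi_sub])
next
  case (Cons i \<nu>)
  then obtain b where b: "b \<in> UMi (int (sum_list \<nu>) - n)" "Ed n (M_part \<nu>) b" by auto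
  have i: "i \<ge> 1" "pos \<nu>" using Cons.prems by auto
  have "Ed n (M (- int i) * M_part \<nu>) (M (- int i) * b + EM n (int i) * M_part \<nu>)"
    using i by (intro Ed_mult[OF Ed_M b(2) M_in_MS MS_part[of _ "\<lambda>_. True"]]) auto
  moreover have "M (- int i) * b \<in> UMi (int (sum_list (i # \<nu>)) - n)"
    using UMi_mult[OF M_UMi[of "int i"] b(1)] i by (simp add: algebra_simps)
  moreover have "EM n (int i) * M_part \<nu> \<in> UMi (int (sum_list (i # \<nu>)) - n)"
    using UMi_mult[OF EM_UMi[of n "int i"] UM_UMi[of "M_part \<nu>" "sum_list \<nu>"]] i
    by (simp add: UM_eq_MS MS_part algebra_simps)
  ultimately show ?case
    by (intro bexI[of _ "M (- int i) * b + EM n (int i) * M_part \<nu>"] U.subspace_add[OF UMi_sub]) simp_all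
qed

lemma Ed_UMi: "a \<in> UMi w \<Longrightarrow> \<exists>b\<in>UMi (w - n). Ed n a b"
proof -
  assume a: "a \<in> UMi w"
  show ?thesis
  proof (cases "w < 0")
    case True
    then have "a = 0" using a by (simp add: UMi_def)
    then show ?thesis by (intro bexI[of _ 0]) (simp_all add: Ed_0 U.subspace_0[OF UMi_sub])
  next
    case False
    then have "a \<in> MS (\<lambda>\<nu>. sum_list \<nu> = nat w)" using a by (simp add: UMi_def UM_eq_MS)
    then show ?thesis
    proof (induction rule: MS_induct)
      case zero
      show ?case by (rule bexI[of _ 0]) (simp_all add: Ed_0 U.subspace_0[OF UMi_sub])
    next
      case (add x y)
      then show ?case by (meson Ed_add U.subspace_add[OF UMi_sub])
    next
      case (scal c x)
      then show ?case by (meson Ed_scal U.subspace_scale[OF UMi_sub])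
    next
      case (part \<nu>)
      then show ?case using Ed_M_part[of \<nu> n] False by simp
    qed
  qed
qed

lemma Ed_MT: "a \<in> MT \<Longrightarrow> \<exists>b\<in>MT. Ed n a b"
proof (induction rule: MS_induct)
  case zero
  show ?case by (rule bexI[of _ 0]) (simp_all add: Ed_0 MS_0)
next
  case (add x y)
  then show ?case by (meson Ed_add MS_add)
next
  case (scal c x)
  then show ?case by (meson Ed_scal MS_scal)
next
  case (part \<nu>)
  then show ?case using Ed_M_part[of \<nu> n] UMi_MT by blast
qed

text \<open>
  \<open>ad L\<^sub>-\<^sub>i\<close> maps \<open>U(M\<^sub>-)\<close> to itself, and the coefficients of \<open>T\<close> commute with it.
\<close>

lemma T_comm: "a \<in> UMi w \<Longrightarrow> TT0 * a - a * TT0 \<in> UMi (w + int p)"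
proof -
  assume a: "a \<in> UMi w"
  show ?thesis
  proof (cases "w < 0")
    case True
    then have "a = 0" using a by (simp add: UMi_def)
    then show ?thesis by (simp add: U.subspace_0[OF UMi_sub])
  next
    case False
    have aM: "a \<in> MT" using a by (rule UMi_MT)
    have term1: "L (- i) * G (int p - i) * a - a * (L (- i) * G (int p - i)) \<in> UMi (w + int p)" if i: "i \<in> {1..int p}" for i
    proof -
      have "L (- i) * a - a * L (- i) \<in> UMi (w + i)"
      proof -
        have "1 \<le> nat i" using i by auto
        then show ?thesis using ad_L[of a "nat w" "nat i"] a i False by (simp add: UMi_def nat_add_distrib)
      qed
      then have "(L (- i) * a - a * L (- i)) * G (int p - i) \<in> UMi ((w + i) + (int p - i))"
        by (rule UMi_mult[OF _ G_UMi])
      moreover have "L (- i) * G (int p - i) * a = L (- i) * a * G (int p - i)"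
        unfolding mult.assoc MS_commute[OF G_MS aM] ..
      ultimately show ?thesis by (simp add: left_diff_distrib mult.assoc)
    qed
    have c: "Qv * a = a * Qv" "Sv * a = a * Sv"
      using MS_commute[OF _ aM] Qv_UM Sv_UM unfolding UM_eq_MS by blast+
    have "TT0 * a - a * TT0 = (\<Sum>i\<in>{1..int p}. L (- i) * G (int p - i) * a - a * (L (- i) * G (int p - i)))"
    proof -
      have "TT0 * a = (\<Sum>i\<in>{1..int p}. L (- i) * G (int p - i) * a) + (scal bT * (a * Qv) + scal sT * (a * Sv))"
        unfolding TT0_def TT_def distrib_right sum_distrib_right by (simp add: mult.assoc c)
      moreover have "a * TT0 = (\<Sum>i\<in>{1..int p}. a * (L (- i) * G (int p - i))) + (scal bT * (a * Qv) + scal sT * (a * Sv))"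
        unfolding TT0_def TT_def distrib_left sum_distrib_left by (simp add: scal_left_commute[of a])
      ultimately show ?thesis by (simp add: sum_subtractf)
    qed
    then show ?thesis using U.subspace_sum[OF UMi_sub term1] by (simp only:)
  qed
qed

lemma T_comm_MT: "a \<in> MT \<Longrightarrow> TT0 * a - a * TT0 \<in> MT"
proof (induction rule: MS_induct)
  case (add x y)
  then have "(TT0 * x - x * TT0) + (TT0 * y - y * TT0) \<in> MT" by (rule MS_add)
  then show ?case by (simp add: algebra_simps)
next
  case (scal c x)
  then have "scal c * (TT0 * x - x * TT0) \<in> MT" by (rule MS_scal)
  then show ?case by (simp add: right_diff_distrib scal_left_commute[of TT0] mult.assoc)
next
  case (part \<nu>)
  then have "M_part \<nu> \<in> UMi (int (sum_list \<nu>))" by (intro UM_UMi) (simp add: UM_eq_MS MS_part)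
  then show ?case using T_comm UMi_MT by blast
qed (simp add: MS_0)

lemma wt_T: "wt (int p) TT0"
proof -
  have "wt (int p) (L (- i) * G (int p - i))" if "i \<in> {1..int p}" for i
    using wt_mult[OF wt_L[of "- i"] wt_G[of "int p - i"]] that by simp
  then show ?thesis
    unfolding TT0_def TT_def using wt_UM[OF Qv_UM] wt_UM[OF Sv_UM] by (intro wt_add wt_sum wt_scal) auto
qed

lemma wt_Tpow: "wt (int k * int p) (TT0 ^ k)"
proof (induction k)
  case (Suc k)
  then show ?case using wt_mult[OF wt_T Suc] by (simp add: algebra_simps)
qed (simp add: wt_1)

lemma mvac_N1: "mvac N 1" "L 0 * 1 \<approx>\<^bsub>N\<^esub> scal hL * 1"
  using VI_mvac[of hL] eqm_mono[OF _ I_N] by (auto simp: mvac_def)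

lemma wt_eigen_N: "wt n x \<Longrightarrow> L 0 * x \<approx>\<^bsub>N\<^esub> scal (hL + of_int n) * x"
  using wt_eigen[OF N_left _ mvac_N1(2), of n x] by simp

lemma Tpow_L0: "L 0 * TT0 ^ k \<approx>\<^bsub>N\<^esub> scal (hL + of_nat k * of_nat p) * TT0 ^ k"
  using wt_eigen_N[OF wt_Tpow[of k]] by simp

lemma one_notin_N: "1 \<notin> N"
  using lead_N[of 1 0] lead_Tpow[of 0 0] by auto

lemma pvac_N1: "pvac N 1"
  using mvac_N1 VI_gens(1) I_N by (auto simp: pvac_def intro!: eqm_base0)

lemma ev_0 [simp]: "ev w (\<lambda>_. 0) = 0" by (simp add: ev_def)
lemma ev_add: "ev w c + ev w d = ev w (\<lambda>\<nu>. c \<nu> + d \<nu>)" by (simp add: ev_def scal_add distrib_right sum.distrib)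
lemma ev_scal: "scal a * ev w c = ev w (\<lambda>\<nu>. a * c \<nu>)" by (simp add: ev_def sum_distrib_left)

text \<open>
  The leading term of \<open>Sv\<close> is \<open>p M\<^sub>-\<^sub>p\<close>, so each factor \<open>M\<^sub>-\<^sub>p\<close> can be traded for \<open>Sv\<close> and monomials with fewer factors \<open>M\<^sub>-\<^sub>p\<close>.
\<close>

lemma reduce_Sv: "a \<in> UM w \<Longrightarrow> \<exists>x\<in>MT. \<exists>c. a = x * Sv + ev w c"
proof -
  obtain t where t: "t \<in> MS (\<lambda>\<nu>. sum_list \<nu> = p \<and> p \<notin> set \<nu>)" "M (- int p) = scal (1 / of_nat p) * Sv + t"
  proof -
    define t where "t = M (- int p) - scal (1 / of_nat p) * Sv"
    have "Sv - scal (of_nat p) * M (- int p) \<in> MS (\<lambda>\<nu>. sum_list \<nu> = p \<and> p \<notin> set \<nu>)"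
      using Sv_lead
    proof (induction rule: MS_induct)
      case (part \<nu>)
      have "p \<notin> set \<nu>"
      proof
        assume "p \<in> set \<nu>"
        then have l: "length (remove1 p \<nu>) \<ge> 1" "sum_list (remove1 p \<nu>) = 0"
          using part sum_list_map_remove1[of p \<nu> "\<lambda>x. x"] by (auto simp: length_remove1)
        moreover have "length (remove1 p \<nu>) \<le> sum_list (remove1 p \<nu>)"
          using part(1) set_remove1_subset[of p \<nu>] by (intro length_le_sum) blast
        ultimately show False by linarith
      qed
      then show ?case using part by (intro MS_part) auto
    qed (auto intro: MS_0 MS_add MS_scal)
    then have "scal (- 1 / of_nat p) * (Sv - scal (of_nat p) * M (- int p)) \<in> MS (\<lambda>\<nu>. sum_list \<nu> = p \<and> p \<notin> set \<nu>)" by (rule MS_scal)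
    moreover have "scal (- 1 / of_nat p) * (Sv - scal (of_nat p) * M (- int p)) = t"
      using p1 by (simp add: t_def right_diff_distrib scal_uminus)
    ultimately have "t \<in> MS (\<lambda>\<nu>. sum_list \<nu> = p \<and> p \<notin> set \<nu>)" by (simp only:)
    moreover have "M (- int p) = scal (1 / of_nat p) * Sv + t" by (simp add: t_def)
    ultimately show ?thesis by (rule that)
  qed
  have main: "a \<in> MS (\<lambda>\<nu>. sum_list \<nu> = w \<and> count_list \<nu> p \<le> k) \<Longrightarrow> \<exists>x\<in>MT. \<exists>c. a = x * Sv + ev w c" for k a
  proof (induction k arbitrary: a)
    case 0
    have "MS (\<lambda>\<nu>. sum_list \<nu> = w \<and> count_list \<nu> p \<le> 0) \<subseteq> MS (\<lambda>\<nu>. sum_list \<nu> = w \<and> p \<notin> set \<nu>)"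
      by (rule MS_mono) (simp add: count_list_0_iff)
    then obtain c where "a = ev w c" using 0 MS_ev by blast
    then show ?case by (intro bexI[of _ 0]) (auto simp: MS_0)
  next
    case (Suc k)
    from Suc.prems show ?case
    proof (induction rule: MS_induct)
      case zero
      show ?case by (rule bexI[of _ 0], rule exI[of _ "\<lambda>_. 0"]) (simp_all add: MS_0)
    next
      case (add a b)
      then obtain x c y d where "x \<in> MT" "a = x * Sv + ev w c" "y \<in> MT" "b = y * Sv + ev w d" by blast
      then show ?case
        by (intro bexI[of _ "x + y"] exI[of _ "\<lambda>\<nu>. c \<nu> + d \<nu>"]) (simp_all add: MS_add ev_add[symmetric] distrib_right)
    next
      case (scal s a)
      then obtain x c where "x \<in> MT" "a = x * Sv + ev w c" by blast
      then show ?case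
        by (intro bexI[of _ "scal s * x"] exI[of _ "\<lambda>\<nu>. s * c \<nu>"]) (simp_all add: MS_scal ev_scal[symmetric] distrib_left mult.assoc)
    next
      case (part \<nu>)
      show ?case
      proof (cases "count_list \<nu> p \<le> k")
        case True
        then show ?thesis using part by (intro Suc.IH MS_part) auto
      next
        case False
        then have pn: "p \<in> set \<nu>" using count_list_0_iff[of \<nu> p] by auto
        let ?m = "M_part (remove1 p \<nu>)"
        have cnt: "count_list (remove1 p \<nu>) p \<le> k"
        proof -
          have "count_list \<nu> p = Suc (count_list (remove1 p \<nu>) p)" using pn by (induction \<nu>) auto
          then show ?thesis using part(2) by simp
        qed
        have m: "?m \<in> MS (\<lambda>\<mu>. sum_list \<mu> + p = w \<and> count_list \<mu> p \<le> k)"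
          using part pn sum_list_map_remove1[of p \<nu> "\<lambda>x. x"] cnt set_remove1_subset[of p \<nu>]
          by (intro MS_part) auto
        have "M_part \<nu> = M_part (p # remove1 p \<nu>)" using pn by (intro M_part_perm) simp
        also have "\<dots> = scal (1 / of_nat p) * (Sv * ?m) + t * ?m" by (simp add: t(2) distrib_right mult.assoc)
        also have "Sv * ?m = ?m * Sv" by (rule MS_commute[OF Sv_UM[unfolded UM_eq_MS] m])
        finally have e: "M_part \<nu> = scal (1 / of_nat p) * ?m * Sv + t * ?m" by (simp add: mult.assoc)
        have "t * ?m \<in> MS (\<lambda>\<nu>. sum_list \<nu> = w \<and> count_list \<nu> p \<le> k)"
          by (rule MS_mult[OF t(1) m]) (auto simp: count_list_0_iff)
        then obtain x c where "x \<in> MT" "t * ?m = x * Sv + ev w c" using Suc.IH by blast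
        moreover have "scal (1 / of_nat p) * ?m \<in> MT" by (rule MS_scal[OF MS_MT[OF m]])
        ultimately show ?thesis unfolding e
          by (intro bexI[of _ "scal (1 / of_nat p) * ?m + x"] exI[of _ c]) (simp_all add: MS_add distrib_right)
      qed
    qed
  qed
  show "a \<in> UM w \<Longrightarrow> \<exists>x\<in>MT. \<exists>c. a = x * Sv + ev w c"
  proof -
    assume "a \<in> UM w"
    then have "a \<in> MS (\<lambda>\<nu>. sum_list \<nu> = w \<and> count_list \<nu> p \<le> w)"
      unfolding UM_eq_MS
    proof (induction rule: MS_induct)
      case (part \<nu>)
      have "count_list \<nu> p \<le> length \<nu>" by (rule count_le_length)
      then show ?case using part length_le_sum[OF part(1)] by (intro MS_part) auto
    qed (auto intro: MS_0 MS_add MS_scal)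
    then show ?thesis by (rule main)
  qed
qed

lemma L_T_N: "n \<ge> 1 \<Longrightarrow> mvac N TT0 \<Longrightarrow> \<exists>c. L n * TT0 \<approx>\<^bsub>N\<^esub> scal c * G (int p - n)"
proof -
  assume n: "n \<ge> 1"
  have "L n * (TT sT * 1) \<approx>\<^bsub>N\<^esub> TT sT * (L n * 1) + scal (2 * of_int n * (hL - hp)) * (G (int p - n) * 1)
     + (\<Sum>i\<in>{1..int p}. if i < n then scal (of_int (n + i)) * (G (int p - i) * (L (n - i) * 1)) else 0)"
    by (rule L_TT[OF N_left mvac_N1 central_eqm(1)[OF I_N N_left] n])
  also have "\<dots> \<approx>\<^bsub>N\<^esub> 0 + scal (2 * of_int n * (hL - hp)) * (G (int p - n) * 1) + (\<Sum>i\<in>{1..int p}. 0)"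
  proof (intro eqm_add eqm_sum eqm_refl)
    have L: "u * (L k * 1) \<approx>\<^bsub>N\<^esub> 0" if "k > 0" for u k
      using left_ideal_mult[OF N_left, of "L k" u] VI_gens(1)[OF that] I_N by (auto intro: eqm_base0)
    show "TT sT * (L n * 1) \<approx>\<^bsub>N\<^esub> 0" using n by (intro L) auto
    fix i
    show "(if i < n then scal (of_int (n + i)) * (G (int p - i) * (L (n - i) * 1)) else 0) \<approx>\<^bsub>N\<^esub> 0"
      using L[of "n - i" "scal (of_int (n + i)) * G (int p - i)"] by (simp add: mult.assoc)
  qed
  finally show ?thesis by (intro exI[of _ "2 * of_int n * (hL - hp)"]) (simp add: TT0_def)
qed

text \<open>
  By \<open>M_TT\<close> the only obstruction to passing from \<open>y\<close> to \<open>T y\<close> is the term \<open>Sv y\<close> produced by \<open>M\<^sub>0\<close>.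
\<close>

lemma mvac_T_step:
  assumes "mvac N y" "Sv * y \<in> N" shows "mvac N (TT0 * y)"
proof -
  have "M n * (TT0 * y) \<approx>\<^bsub>N\<^esub> 0" if "n > 0" for n
  proof -
    have "M n * (TT0 * y) \<approx>\<^bsub>N\<^esub> TT0 * (M n * y)"
      using M_TT[OF N_left assms(1), of n sT] that by (simp add: TT0_def)
    also have "\<dots> \<approx>\<^bsub>N\<^esub> TT0 * 0" using assms(1) that by (intro eqm_lmult[OF N_left]) (simp add: mvac_def)
    finally show ?thesis by simp
  qed
  moreover have "M 0 * (TT0 * y) \<approx>\<^bsub>N\<^esub> scal hM * (TT0 * y)"
  proof -
    have "M 0 * (TT0 * y) \<approx>\<^bsub>N\<^esub> TT0 * (M 0 * y) + Sv * y"
      using M_TT[OF N_left assms(1), of 0 sT] by (simp add: TT0_def)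
    also have "\<dots> \<approx>\<^bsub>N\<^esub> TT0 * (scal hM * y) + 0"
      using assms by (intro eqm_add eqm_lmult[OF N_left] eqm_base0) (auto simp: mvac_def)
    finally show ?thesis by (simp add: scal_left_commute[of TT0])
  qed
  ultimately show ?thesis using central_eqm(2)[OF I_N N_left] by (simp add: mvac_def)
qed

text \<open>
  The commutator lies in \<open>U(M\<^sub>-)\<close> and is annihilated modulo \<open>N\<close> by the \<open>L\<^sub>n\<close>, because \<open>Sv\<close> commutes with \<open>L\<^sub>n\<close> and
  \<open>L\<^sub>n T\<close> is a multiple of \<open>g\<^bsub>p-n\<^esub>\<close> there. By the pairing its part without \<open>M\<^sub>-\<^sub>p\<close> vanishes.
\<close>

lemma Sv_T_comm: "\<exists>x\<in>MT. Sv * TT0 - TT0 * Sv = x * Sv"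
proof -
  have T1: "mvac N TT0" using mvac_T_step[OF mvac_N1(1)] Sv_N by simp
  define \<beta> where "\<beta> = Sv * TT0 - TT0 * Sv"
  have "TT0 * Sv - Sv * TT0 \<in> UMi (int p + int p)" by (rule T_comm[OF UM_UMi[OF Sv_UM]])
  then have "\<beta> \<in> UMi (int p + int p)" unfolding \<beta>_def using U.subspace_neg[OF UMi_sub] by fastforce
  then have "\<beta> \<in> UMi (int (p + p))" by simp
  then have b: "\<beta> \<in> UM (p + p)" by (simp add: UMi_def del: of_nat_add)
  have Lb: "L n * \<beta> \<approx>\<^bsub>N\<^esub> 0" if n: "n \<ge> 1" for n
  proof -
    obtain c where c: "L n * TT0 \<approx>\<^bsub>N\<^esub> scal c * G (int p - n)" using L_T_N[OF n T1] by blast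
    have "L n * (Sv * TT0) \<approx>\<^bsub>N\<^esub> Sv * (L n * TT0) + 0 * TT0"
      by (rule EdD[OF Ed_Sv[OF n] left_ideal_Mstable[OF N_left] T1])
    also have "\<dots> \<approx>\<^bsub>N\<^esub> Sv * (scal c * G (int p - n)) + 0"
      using c by (intro eqm_add eqm_lmult[OF N_left]) auto
    also have "\<dots> = scal c * (G (int p - n) * Sv)"
      using MS_commute[OF Sv_UM[unfolded UM_eq_MS] G_MS] by (simp add: scal_left_commute[of Sv])
    also have "\<dots> \<approx>\<^bsub>N\<^esub> 0" using Sv_N by (intro eqm_base0 left_ideal_mult[OF N_left])
    finally have 1: "L n * (Sv * TT0) \<approx>\<^bsub>N\<^esub> 0" .
    have 2: "L n * (TT0 * Sv) \<approx>\<^bsub>N\<^esub> 0" using Sv_N by (intro eqm_base0 left_ideal_mult[OF N_left])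
    show ?thesis using eqm_diff[OF 1 2] by (simp add: \<beta>_def right_diff_distrib)
  qed
  obtain x c where xc: "x \<in> MT" "\<beta> = x * Sv + ev (p + p) c" using reduce_Sv[OF b] by blast
  have ev: "ev (p + p) c = \<beta> - x * Sv" using xc by simp
  \<comment> \<open>Both \<open>\<beta>\<close> and \<open>x Sv\<close> are annihilated by every nonempty product of \<open>L\<^sub>n\<close>, \<open>n \<ge> 1\<close>.\<close>
  have "\<forall>\<nu>\<in>pfree (p + p). c \<nu> = 0"
  proof (rule ev_zero[OF left_ideal_Pstable[OF N_left] pvac_N1 one_notin_N])
    fix \<alpha> assume a: "\<alpha> \<in> pfree (p + p)"
    then obtain n \<alpha>' where an: "\<alpha> = n # \<alpha>'" "n \<ge> 1" using pfreeD[OF a] p1 by (cases \<alpha>) auto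
    have "L (int n) * ev (p + p) c \<approx>\<^bsub>N\<^esub> 0"
    proof -
      have "L (int n) * (x * Sv) \<approx>\<^bsub>N\<^esub> 0" using Sv_N by (intro eqm_base0 left_ideal_mult[OF N_left])
      then show ?thesis using eqm_diff[OF Lb[of "int n"]] an unfolding ev right_diff_distrib by force
    qed
    then have "Lr \<alpha>' * (L (int n) * ev (p + p) c) \<approx>\<^bsub>N\<^esub> Lr \<alpha>' * 0" by (rule eqm_lmult[OF N_left])
    then show "Lr \<alpha> * (ev (p + p) c * 1) \<approx>\<^bsub>N\<^esub> 0" by (simp add: an mult.assoc)
  qed
  then have "ev (p + p) c = 0" by (rule ev_zero_eq)
  then show ?thesis using xc by (auto simp: \<beta>_def)
qed

lemma Sv_Tpow: "Sv * TT0 ^ k \<in> N"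
proof (induction k)
  case (Suc k)
  obtain x where x: "Sv * TT0 - TT0 * Sv = x * Sv" using Sv_T_comm by blast
  have "Sv * TT0 ^ Suc k = (Sv * TT0) * TT0 ^ k" by (simp add: mult.assoc)
  also have "Sv * TT0 = TT0 * Sv + x * Sv" using x by (simp add: algebra_simps)
  finally have "Sv * TT0 ^ Suc k = TT0 * (Sv * TT0 ^ k) + x * (Sv * TT0 ^ k)" by (simp add: distrib_right mult.assoc)
  then show ?case using Suc left_ideal_mult[OF N_left] U.subspace_add[OF N_sub] by simp
qed (simp add: Sv_N)

lemma mvac_Tpow: "mvac N (TT0 ^ k)"
  by (induction k) (simp_all add: mvac_N1 mvac_T_step Sv_Tpow)

text \<open>
  A common form for the two kinds of filtration pieces below, which differ only in the condition on the coefficients.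
\<close>

definition KS :: "(nat \<Rightarrow> U22 \<Rightarrow> bool) \<Rightarrow> U22 set" where
  "KS P = U.span ({a * TT0 ^ j | a j. P j a} \<union> N)"

lemma KS_sub: "U.subspace (KS P)" by (simp add: KS_def)
lemma KS_N: "N \<subseteq> KS P" unfolding KS_def using U.span_superset[of "{a * TT0 ^ j | a j. P j a} \<union> N"] by auto
lemma KS_base: "P j a \<Longrightarrow> a * TT0 ^ j \<in> KS P" unfolding KS_def by (rule U.span_base) auto
lemma KS_mono: "(\<And>j a. P j a \<Longrightarrow> P' j a) \<Longrightarrow> KS P \<subseteq> KS P'" unfolding KS_def by (rule U.span_mono) auto

lemma KS_induct [consumes 1, case_names N base add scal]:
  assumes "x \<in> KS P" and N: "\<And>n. n \<in> N \<Longrightarrow> Q n" and base: "\<And>j a. P j a \<Longrightarrow> Q (a * TT0 ^ j)"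
    and add: "\<And>x y. Q x \<Longrightarrow> Q y \<Longrightarrow> Q (x + y)" and scal: "\<And>c x. Q x \<Longrightarrow> Q (scal c * x)"
  shows "Q x"
  using assms(1) unfolding KS_def
proof (induction rule: U.span_induct_alt)
  case base
  show ?case using N[OF U.subspace_0[OF N_sub]] .
next
  case (step c x y)
  then show ?case using N assms(3) add scal by auto
qed

lemma KS_mult:
  assumes "x \<in> KS P" "U.subspace Y" "\<And>n. n \<in> N \<Longrightarrow> u * n \<in> Y" "\<And>j a. P j a \<Longrightarrow> u * (a * TT0 ^ j) \<in> Y"
  shows "u * x \<in> Y"
  using assms(1)
proof (induction rule: KS_induct)
  case (add x y)
  then show ?case using assms(2) by (simp add: distrib_left U.subspace_add)
next
  case (scal c x)
  then show ?case using assms(2) by (simp add: scal_left_commute[of u] U.subspace_scale)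
qed (use assms in auto)

text \<open>
  \<open>K k\<close> collects all weights, \<open>Kg k w\<close> is its part of weight \<open>w\<close> modulo \<open>N\<close>.
\<close>

definition K :: "nat \<Rightarrow> U22 set" where "K k = KS (\<lambda>j a. j < k \<and> a \<in> MT)"
definition Kg :: "nat \<Rightarrow> int \<Rightarrow> U22 set" where "Kg k w = KS (\<lambda>j a. j < k \<and> a \<in> UMi (w - int j * int p))"

lemma K_sub: "U.subspace (K k)" and Kg_sub: "U.subspace (Kg k w)" by (simp_all add: K_def Kg_def KS_sub)
lemma N_K: "N \<subseteq> K k" and N_Kg: "N \<subseteq> Kg k w" by (simp_all add: K_def Kg_def KS_N)
lemma K_mono: "j \<le> k \<Longrightarrow> K j \<subseteq> K k" unfolding K_def by (rule KS_mono) auto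
lemma Kg_mono: "j \<le> k \<Longrightarrow> Kg j w \<subseteq> Kg k w" unfolding Kg_def by (rule KS_mono) auto
lemma Kg_K: "Kg k w \<subseteq> K k" unfolding K_def Kg_def by (rule KS_mono) (auto simp: UMi_MT)
lemma K_base: "j < k \<Longrightarrow> a \<in> MT \<Longrightarrow> a * TT0 ^ j \<in> K k" unfolding K_def by (rule KS_base) auto
lemma Kg_base: "j < k \<Longrightarrow> a \<in> UMi (w - int j * int p) \<Longrightarrow> a * TT0 ^ j \<in> Kg k w" unfolding Kg_def by (rule KS_base) auto

lemma Kg_0: "Kg 0 w = N" "K 0 = N"
  by (simp_all add: Kg_def K_def KS_def N_sub U.span_eq_iff)

lemma UMi_Kg: "a \<in> UMi v \<Longrightarrow> x \<in> Kg k w \<Longrightarrow> a * x \<in> Kg k (w + v)"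
  unfolding Kg_def[of k w]
proof (erule KS_mult)
  fix n assume "n \<in> N" then show "a * n \<in> Kg k (w + v)" using left_ideal_mult[OF N_left] N_Kg by blast
next
  fix j b assume a: "a \<in> UMi v" and "j < k \<and> b \<in> UMi (w - int j * int p)"
  then have "a * b \<in> UMi (v + (w - int j * int p))" "j < k" by (auto intro: UMi_mult)
  then have "(a * b) * TT0 ^ j \<in> Kg k (w + v)" by (intro Kg_base) (simp_all add: algebra_simps)
  then show "a * (b * TT0 ^ j) \<in> Kg k (w + v)" by (simp add: mult.assoc)
qed (rule Kg_sub)

lemma MT_K: "a \<in> MT \<Longrightarrow> x \<in> K k \<Longrightarrow> a * x \<in> K k"
  unfolding K_def[of k]
proof (erule KS_mult)
  fix n assume "n \<in> N" then show "a * n \<in> KS (\<lambda>j a. j < k \<and> a \<in> MT)" using left_ideal_mult[OF N_left] KS_N by blast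
next
  fix j b assume "a \<in> MT" and "j < k \<and> b \<in> MT"
  then have "(a * b) * TT0 ^ j \<in> K k" by (intro K_base MS_mult[of a _ b]) auto
  then show "a * (b * TT0 ^ j) \<in> KS (\<lambda>j a. j < k \<and> a \<in> MT)" by (simp add: mult.assoc K_def)
qed (rule KS_sub)

lemma T_Kg: "x \<in> Kg k w \<Longrightarrow> TT0 * x \<in> Kg (Suc k) (w + int p)"
  unfolding Kg_def[of k w]
proof (erule KS_mult)
  fix n assume "n \<in> N" then show "TT0 * n \<in> Kg (Suc k) (w + int p)" using left_ideal_mult[OF N_left] N_Kg by blast
next
  fix j a assume a: "j < k \<and> a \<in> UMi (w - int j * int p)"
  have "TT0 * (a * TT0 ^ j) = a * TT0 ^ Suc j + (TT0 * a - a * TT0) * TT0 ^ j" by (simp add: algebra_simps)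
  moreover have "a * TT0 ^ Suc j \<in> Kg (Suc k) (w + int p)" using a by (intro Kg_base) (simp_all add: algebra_simps)
  moreover have "(TT0 * a - a * TT0) * TT0 ^ j \<in> Kg (Suc k) (w + int p)"
  proof (rule Kg_base)
    have "TT0 * a - a * TT0 \<in> UMi (w - int j * int p + int p)" using a by (intro T_comm) auto
    then show "TT0 * a - a * TT0 \<in> UMi (w + int p - int j * int p)" by (simp add: algebra_simps)
  qed (use a in auto)
  ultimately show "TT0 * (a * TT0 ^ j) \<in> Kg (Suc k) (w + int p)" using U.subspace_add[OF Kg_sub] by simp
qed (rule Kg_sub)

lemma T_K: "x \<in> K k \<Longrightarrow> TT0 * x \<in> K (Suc k)"
  unfolding K_def[of k]
proof (erule KS_mult)
  fix n assume "n \<in> N" then show "TT0 * n \<in> K (Suc k)" using left_ideal_mult[OF N_left] N_K by blast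
next
  fix j a assume a: "j < k \<and> a \<in> MT"
  have "TT0 * (a * TT0 ^ j) = a * TT0 ^ Suc j + (TT0 * a - a * TT0) * TT0 ^ j" by (simp add: algebra_simps)
  moreover have "a * TT0 ^ Suc j \<in> K (Suc k)" using a by (intro K_base) auto
  moreover have "(TT0 * a - a * TT0) * TT0 ^ j \<in> K (Suc k)" using a T_comm_MT by (intro K_base) auto
  ultimately show "TT0 * (a * TT0 ^ j) \<in> K (Suc k)" using U.subspace_add[OF K_sub] by simp
qed (rule K_sub)

lemma mvac_MT_Tpow: "a \<in> MT \<Longrightarrow> mvac N (a * TT0 ^ j)"
  by (rule mvac_MS[OF left_ideal_Mstable[OF N_left] mvac_Tpow])

lemma M_K: "x \<in> K k \<Longrightarrow> mvac N x"
  unfolding K_def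
proof (induction rule: KS_induct)
  case (N n)
  then have "u * n \<approx>\<^bsub>N\<^esub> 0" for u using left_ideal_mult[OF N_left] by (blast intro: eqm_base0)
  then show ?case unfolding mvac_def by (meson eqm_sym eqm_trans)
next
  case (add x y)
  then show ?case unfolding mvac_def distrib_left using eqm_add[of _ N 0 _ 0] eqm_add[of "M 0 * x"] eqm_add[of "CM * x"] by simp
next
  case (scal c x)
  then show ?case unfolding mvac_def scal_left_commute[of "M n" for n] scal_left_commute[of CM] scal_left_commute[of "scal hM"] scal_left_commute[of "scal cM"]
    using eqm_scal[of _ N 0 c] eqm_scal[of "M 0 * x" N "scal hM * x" c] eqm_scal[of "CM * x" N "scal cM * x" c] by (simp add: mult.commute)
qed (auto intro: mvac_MT_Tpow)

lemma L_Tpow: "n \<ge> 1 \<Longrightarrow> L n * TT0 ^ j \<in> Kg j (int j * int p - n)"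
proof (induction j arbitrary: n)
  case 0
  then show ?case using VI_gens(1)[of n hL] I_N by (auto simp: Kg_0)
next
  case (Suc j)
  let ?W = "int (Suc j) * int p - n"
  have "L n * (TT sT * TT0 ^ j) \<approx>\<^bsub>N\<^esub> TT sT * (L n * TT0 ^ j) + scal (2 * of_int n * (hL + of_nat j * of_nat p - hp)) * (G (int p - n) * TT0 ^ j)
     + (\<Sum>i\<in>{1..int p}. if i < n then scal (of_int (n + i)) * (G (int p - i) * (L (n - i) * TT0 ^ j)) else 0)"
    by (rule L_TT[OF N_left mvac_Tpow Tpow_L0 central_eqm(1)[OF I_N N_left] Suc.prems])
  then have e: "L n * (TT0 * TT0 ^ j) \<approx>\<^bsub>Kg (Suc j) ?W\<^esub> TT0 * (L n * TT0 ^ j) + scal (2 * of_int n * (hL + of_nat j * of_nat p - hp)) * (G (int p - n) * TT0 ^ j)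
     + (\<Sum>i\<in>{1..int p}. if i < n then scal (of_int (n + i)) * (G (int p - i) * (L (n - i) * TT0 ^ j)) else 0)"
    unfolding TT0_def by (rule eqm_mono[OF _ N_Kg[unfolded TT0_def]])
  have 1: "TT0 * (L n * TT0 ^ j) \<in> Kg (Suc j) ?W"
    using T_Kg[OF Suc.IH[OF Suc.prems]] by (simp add: algebra_simps)
  have 2: "G (int p - n) * TT0 ^ j \<in> Kg (Suc j) ?W"
    using G_UMi[of "int p - n"] by (intro Kg_base) (simp_all add: algebra_simps)
  have 3: "G (int p - i) * (L (n - i) * TT0 ^ j) \<in> Kg (Suc j) ?W" if "i < n" for i
  proof -
    have "L (n - i) * TT0 ^ j \<in> Kg j (int j * int p - (n - i))" using that by (intro Suc.IH) auto
    then have "G (int p - i) * (L (n - i) * TT0 ^ j) \<in> Kg j (int j * int p - (n - i) + (int p - i))" by (rule UMi_Kg[OF G_UMi])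
    moreover have "int j * int p - (n - i) + (int p - i) = ?W" by (simp add: algebra_simps)
    ultimately show ?thesis using Kg_mono[of j "Suc j" ?W] by auto
  qed
  have 4: "(if i < n then scal (of_int (n + i)) * (G (int p - i) * (L (n - i) * TT0 ^ j)) else 0) \<in> Kg (Suc j) ?W" for i
    using U.subspace_scale[OF Kg_sub 3, of i "of_int (n + i)"] U.subspace_0[OF Kg_sub] by (cases "i < n") simp_all
  have "L n * (TT0 * TT0 ^ j) \<in> Kg (Suc j) ?W"
    by (rule eqm_mem[OF Kg_sub e])
      (rule U.subspace_add[OF Kg_sub U.subspace_add[OF Kg_sub 1 U.subspace_scale[OF Kg_sub 2]] U.subspace_sum[OF Kg_sub 4]])
  then show ?case by simp
qed

lemma L_Kg: "n \<ge> 1 \<Longrightarrow> x \<in> Kg k w \<Longrightarrow> L n * x \<in> Kg k (w - n)"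
  unfolding Kg_def[of k w]
proof (erule KS_mult)
  fix m assume "m \<in> N" then show "L n * m \<in> Kg k (w - n)" using left_ideal_mult[OF N_left] N_Kg by blast
next
  fix j a assume n: "n \<ge> 1" and a: "j < k \<and> a \<in> UMi (w - int j * int p)"
  obtain b where b: "b \<in> UMi (w - int j * int p - n)" "Ed n a b" using Ed_UMi a by blast
  have "L n * (a * TT0 ^ j) \<approx>\<^bsub>N\<^esub> a * (L n * TT0 ^ j) + b * TT0 ^ j"
    by (rule EdD[OF b(2) left_ideal_Mstable[OF N_left] mvac_Tpow])
  then have "L n * (a * TT0 ^ j) \<approx>\<^bsub>Kg k (w - n)\<^esub> a * (L n * TT0 ^ j) + b * TT0 ^ j" by (rule eqm_mono[OF _ N_Kg])
  moreover have "a * (L n * TT0 ^ j) \<in> Kg j (int j * int p - n + (w - int j * int p))"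
    using a by (intro UMi_Kg L_Tpow n) auto
  then have "a * (L n * TT0 ^ j) \<in> Kg k (w - n)" using Kg_mono[of j k "w - n"] a by (auto simp: algebra_simps)
  moreover have "b * TT0 ^ j \<in> Kg k (w - n)" using a b by (intro Kg_base) (auto simp: algebra_simps)
  ultimately show "L n * (a * TT0 ^ j) \<in> Kg k (w - n)"
    using eqm_mem[OF Kg_sub] U.subspace_add[OF Kg_sub] by blast
qed (rule Kg_sub)

lemma L_K: "n \<ge> 1 \<Longrightarrow> x \<in> K k \<Longrightarrow> L n * x \<in> K k"
  unfolding K_def[of k]
proof (erule KS_mult)
  fix m assume "m \<in> N" then show "L n * m \<in> KS (\<lambda>j a. j < k \<and> a \<in> MT)" using left_ideal_mult[OF N_left] KS_N by blast
next
  fix j a assume n: "n \<ge> 1" and a: "j < k \<and> a \<in> MT"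
  obtain b where b: "b \<in> MT" "Ed n a b" using Ed_MT a by blast
  have "L n * (a * TT0 ^ j) \<approx>\<^bsub>N\<^esub> a * (L n * TT0 ^ j) + b * TT0 ^ j"
    by (rule EdD[OF b(2) left_ideal_Mstable[OF N_left] mvac_Tpow])
  then have "L n * (a * TT0 ^ j) \<approx>\<^bsub>K k\<^esub> a * (L n * TT0 ^ j) + b * TT0 ^ j" by (rule eqm_mono[OF _ N_K])
  moreover have "L n * TT0 ^ j \<in> K k" using L_Tpow[OF n] Kg_K K_mono[of j k] a by (meson less_imp_le subsetD)
  then have "a * (L n * TT0 ^ j) \<in> K k" using a MT_K by blast
  moreover have "b * TT0 ^ j \<in> K k" using a b by (intro K_base) auto
  ultimately show "L n * (a * TT0 ^ j) \<in> KS (\<lambda>j a. j < k \<and> a \<in> MT)"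
    using eqm_mem[OF K_sub] U.subspace_add[OF K_sub] unfolding K_def by blast
qed (rule KS_sub)

lemma K_Pstable: "Pstable (K k)"
  unfolding Pstable_def Mstable_def using K_sub L_K MT_K M_in_MS by auto

text \<open>
  The leading vector of the next layer is a highest weight vector modulo \<open>K k\<close>, so the pairing applies to it.
\<close>

lemma K_pvac: "pvac (K k) (TT0 ^ k)"
proof -
  have "mvac (K k) (TT0 ^ k)" using mvac_Tpow[of k] eqm_mono[OF _ N_K] by (auto simp: mvac_def)
  moreover have "L n * TT0 ^ k \<approx>\<^bsub>K k\<^esub> 0" if "n > 0" for n
    using L_Tpow[of n k] Kg_K that by (intro eqm_base0) auto
  ultimately show ?thesis by (simp add: pvac_def)
qed

lemma lead_K: "x \<in> K k \<Longrightarrow> lead k x = 0"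
  unfolding K_def
  by (induction rule: KS_induct) (auto simp: lead_N lead_add lead_scal lead_MST)

lemma Tpow_notin_K: "TT0 ^ k \<notin> K k"
  using lead_K[of "TT0 ^ k" k] lead_Tpow[of k k] by auto

text \<open>
  The scalar by which \<open>L\<^sub>p\<close> lowers \<open>T\<^sup>k\<close>; the factor of \<open>k\<close> that depends on \<open>h\<^sub>L\<close> vanishes for one value of \<open>h\<^sub>L\<close>.
\<close>

definition Lpc :: "nat \<Rightarrow> complex" where
  "Lpc k = 2 * of_nat p * of_nat k * (hL - hp) + of_nat p ^ 2 * of_nat k * (of_nat k - 1)"

text \<open>
  Each of the \<open>k\<close> factors contributes \<open>2 p (\<mu> - h'\<^bsub>p,1\<^esub>)\<close> by \<open>L_TT\<close> with \<open>n = p\<close> and \<open>g\<^sub>0 = 1\<close>, where the weight \<open>\<mu>\<close>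
  of the vector on the right grows by \<open>p\<close> from one factor to the next.
\<close>

lemma Lp_Tpow: "L (int p) * TT0 ^ Suc k \<approx>\<^bsub>K k\<^esub> scal (Lpc (Suc k)) * TT0 ^ k"
proof (induction k)
  have G0: "G (int p - int p) = 1" by (simp add: G_def)
  have main: "L (int p) * TT0 ^ Suc k \<approx>\<^bsub>K k\<^esub> TT0 * (L (int p) * TT0 ^ k) + scal (2 * of_nat p * (hL + of_nat k * of_nat p - hp)) * TT0 ^ k" for k
  proof -
    have "L (int p) * (TT sT * TT0 ^ k) \<approx>\<^bsub>N\<^esub> TT sT * (L (int p) * TT0 ^ k) + scal (2 * of_int (int p) * (hL + of_nat k * of_nat p - hp)) * (G (int p - int p) * TT0 ^ k)
     + (\<Sum>i\<in>{1..int p}. if i < int p then scal (of_int (int p + i)) * (G (int p - i) * (L (int p - i) * TT0 ^ k)) else 0)"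
      using p1 by (intro L_TT[OF N_left mvac_Tpow Tpow_L0 central_eqm(1)[OF I_N N_left]]) auto
    then have "L (int p) * (TT0 * TT0 ^ k) \<approx>\<^bsub>K k\<^esub> TT0 * (L (int p) * TT0 ^ k) + scal (2 * of_nat p * (hL + of_nat k * of_nat p - hp)) * TT0 ^ k
     + (\<Sum>i\<in>{1..int p}. if i < int p then scal (of_int (int p + i)) * (G (int p - i) * (L (int p - i) * TT0 ^ k)) else 0)"
      using eqm_mono[OF _ N_K[of k]] G0 unfolding TT0_def by simp
    also have "\<dots> \<approx>\<^bsub>K k\<^esub> TT0 * (L (int p) * TT0 ^ k) + scal (2 * of_nat p * (hL + of_nat k * of_nat p - hp)) * TT0 ^ k + (\<Sum>i\<in>{1..int p}. 0)"
    proof (intro eqm_add eqm_sum eqm_refl)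
      fix i
      have "G (int p - i) * (L (int p - i) * TT0 ^ k) \<in> K k" if "i < int p"
        using L_Tpow[of "int p - i" k] Kg_K that by (intro MT_K[OF G_MS]) auto
      then show "(if i < int p then scal (of_int (int p + i)) * (G (int p - i) * (L (int p - i) * TT0 ^ k)) else 0) \<approx>\<^bsub>K k\<^esub> 0"
        using U.subspace_scale[OF K_sub] by (auto intro!: eqm_base0)
    qed
    finally show ?thesis by simp
  qed
  {
    case 0
    have "L (int p) \<in> N" using VI_gens(1)[of "int p" hL] p1 I_N by auto
    then have "TT0 * L (int p) \<in> N" by (rule left_ideal_mult[OF N_left])
    then have "TT0 * (L (int p) * TT0 ^ 0) \<approx>\<^bsub>K 0\<^esub> 0" by (intro eqm_base0) (simp add: Kg_0)
    from eqm_add[OF this eqm_refl] have "TT0 * (L (int p) * TT0 ^ 0) + scal (2 * of_nat p * (hL + of_nat 0 * of_nat p - hp)) * TT0 ^ 0 \<approx>\<^bsub>K 0\<^esub> scal (Lpc (Suc 0)) * TT0 ^ 0"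
      by (simp add: Lpc_def)
    with main[of 0] show ?case by (rule eqm_trans)
  next
    case (Suc k)
    have "L (int p) * TT0 ^ Suc k - scal (Lpc (Suc k)) * TT0 ^ k \<in> K k" using Suc eqm_iff[OF K_sub] by simp
    then have "TT0 * (L (int p) * TT0 ^ Suc k - scal (Lpc (Suc k)) * TT0 ^ k) \<in> K (Suc k)" by (rule T_K)
    then have "TT0 * (L (int p) * TT0 ^ Suc k) \<approx>\<^bsub>K (Suc k)\<^esub> scal (Lpc (Suc k)) * TT0 ^ Suc k"
      by (intro eqm_base) (simp add: right_diff_distrib scal_left_commute[of TT0])
    from eqm_add[OF this eqm_refl]
    have "TT0 * (L (int p) * TT0 ^ Suc k) + scal (2 * of_nat p * (hL + of_nat (Suc k) * of_nat p - hp)) * TT0 ^ Suc k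
       \<approx>\<^bsub>K (Suc k)\<^esub> scal (Lpc (Suc k)) * TT0 ^ Suc k + scal (2 * of_nat p * (hL + of_nat (Suc k) * of_nat p - hp)) * TT0 ^ Suc k" .
    also have "scal (Lpc (Suc k)) * TT0 ^ Suc k + scal (2 * of_nat p * (hL + of_nat (Suc k) * of_nat p - hp)) * TT0 ^ Suc k
        = scal (Lpc (Suc k) + 2 * of_nat p * (hL + of_nat (Suc k) * of_nat p - hp)) * TT0 ^ Suc k"
      by (rule U.scale_left_distrib[symmetric])
    also have "Lpc (Suc k) + 2 * of_nat p * (hL + of_nat (Suc k) * of_nat p - hp) = Lpc (Suc (Suc k))"
      by (simp add: Lpc_def algebra_simps power2_eq_square)
    finally show ?case by (rule eqm_trans[OF main])
  }
qed

lemma Lpc_zero: "hL = h' p r cL \<Longrightarrow> Lpc k = of_nat p ^ 2 * of_nat k * (of_nat k - of_nat r)"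
proof -
  assume "hL = h' p r cL"
  then have d: "hL - hp = (1 - of_nat r) * of_nat p / 2" by (simp add: h'_def)
  show ?thesis unfolding Lpc_def d by (simp add: field_simps power2_eq_square)
qed

text \<open>
  The only scalar that \<open>L\<^sub>p\<close> could produce from \<open>U(M\<^sub>-)\<^sub>p\<close> is \<open>phi p = 0\<close>.
\<close>

lemma Lp_UM: "a \<in> UM p \<Longrightarrow> L (int p) * (a * TT0 ^ k) \<in> K k"
  unfolding UM_eq_MS
proof (induction rule: MS_induct)
  case (add x y)
  then show ?case by (simp add: distrib_left distrib_right U.subspace_add[OF K_sub])
next
  case (scal c x)
  then show ?case by (simp add: mult.assoc L_scal U.subspace_scale[OF K_sub])
next
  case (part \<nu>)
  from L_M_part[OF K_Pstable K_pvac p1 part(1), of k] obtain b where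
    b: "L (int p) * (M_part \<nu> * TT0 ^ k) \<approx>\<^bsub>K k\<^esub> scal (of_nat (count_list \<nu> p) * phi (int p)) * (M_part (remove1 p \<nu>) * TT0 ^ k) + b * TT0 ^ k"
    "b \<in> MSl 0 (length \<nu>)" using part(2) by auto
  obtain l where "length \<nu> = Suc l" using part p1 by (cases \<nu>) auto
  then have "b = 0" using b(2) MSl_zero[of b l] by (simp only:)
  moreover have "phi (int p) = 0" by (simp add: phi_def)
  ultimately show ?case using b(1) by (simp add: eqm_0_iff[OF K_sub])
qed (simp add: U.subspace_0[OF K_sub])

lemma Lp_Kg: "x \<in> Kg (Suc k) (int (Suc k) * int p) \<Longrightarrow> L (int p) * x \<in> K k"
  unfolding Kg_def
proof (erule KS_mult)
  fix n assume "n \<in> N" then show "L (int p) * n \<in> K k" using left_ideal_mult[OF N_left] N_K by blast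
next
  fix j a assume a: "j < Suc k \<and> a \<in> UMi (int (Suc k) * int p - int j * int p)"
  show "L (int p) * (a * TT0 ^ j) \<in> K k"
  proof (cases "j = k")
    case True
    then have "a \<in> UM p" using a by (simp add: UMi_def algebra_simps)
    then show ?thesis using True Lp_UM by simp
  next
    case False
    then show ?thesis using a p1 UMi_MT by (intro L_K K_base) auto
  qed
qed (rule K_sub)

lemma Kg_top: "x \<in> Kg (Suc k) w \<Longrightarrow> \<exists>b\<in>UMi (w - int k * int p). x - b * TT0 ^ k \<in> Kg k w"
  unfolding Kg_def[of "Suc k"]
proof (induction rule: KS_induct)
  case (N n)
  then show ?case using N_Kg by (intro bexI[of _ 0]) (auto simp: U.subspace_0[OF UMi_sub])
next
  case (base j a)
  show ?case
  proof (cases "j = k")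
    case True
    then show ?thesis using base by (intro bexI[of _ a]) (auto simp: U.subspace_0[OF Kg_sub])
  next
    case False
    then show ?thesis using base by (intro bexI[of _ 0]) (auto simp: U.subspace_0[OF UMi_sub] intro!: Kg_base)
  qed
next
  case (add x y)
  then obtain b c where "b \<in> UMi (w - int k * int p)" "x - b * TT0 ^ k \<in> Kg k w" "c \<in> UMi (w - int k * int p)" "y - c * TT0 ^ k \<in> Kg k w" by blast
  then show ?case using U.subspace_add[OF UMi_sub, of b _ c] U.subspace_add[OF Kg_sub, of "x - b * TT0 ^ k" k w "y - c * TT0 ^ k"]
    by (intro bexI[of _ "b + c"]) (simp_all add: algebra_simps)
next
  case (scal c x)
  then obtain b where "b \<in> UMi (w - int k * int p)" "x - b * TT0 ^ k \<in> Kg k w" by blast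
  then show ?case using U.subspace_scale[OF UMi_sub, of b _ c] U.subspace_scale[OF Kg_sub, of "x - b * TT0 ^ k" k w c]
    by (intro bexI[of _ "scal c * b"]) (simp_all add: right_diff_distrib mult.assoc)
qed

lemma reduce_Tpow: "b \<in> UM w \<Longrightarrow> \<exists>c. b * TT0 ^ k - ev w c * TT0 ^ k \<in> N"
proof -
  assume "b \<in> UM w"
  then obtain x c where "b = x * Sv + ev w c" using reduce_Sv by blast
  then have "b * TT0 ^ k - ev w c * TT0 ^ k = x * (Sv * TT0 ^ k)" by (simp add: distrib_right mult.assoc)
  then show ?thesis using left_ideal_mult[OF N_left Sv_Tpow] by metis
qed

text \<open>
  The leading coefficient can be taken without \<open>M\<^sub>-\<^sub>p\<close> by \<open>reduce_Tpow\<close>, and the pairing then shows that it is zero.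
\<close>

lemma Kg_drop:
  assumes x: "x \<in> Kg (Suc k) w"
    and h: "\<And>\<alpha>. int k * int p \<le> w \<Longrightarrow> \<alpha> \<in> pfree (nat (w - int k * int p)) \<Longrightarrow> Lr \<alpha> * x \<in> K k"
  shows "x \<in> Kg k w"
proof -
  let ?v = "nat (w - int k * int p)"
  obtain b where b: "b \<in> UMi (w - int k * int p)" "x - b * TT0 ^ k \<in> Kg k w" using Kg_top[OF x] by blast
  have "b * TT0 ^ k \<in> N"
  proof (cases "w < int k * int p")
    case True
    then show ?thesis using b by (simp add: UMi_def U.subspace_0[OF N_sub])
  next
    case False
    then have "b \<in> UM ?v" using b by (simp add: UMi_def)
    then obtain c where c: "b * TT0 ^ k - ev ?v c * TT0 ^ k \<in> N" using reduce_Tpow by blast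
    have "\<forall>\<nu>\<in>pfree ?v. c \<nu> = 0"
    proof (rule ev_zero[OF K_Pstable K_pvac Tpow_notin_K])
      fix \<alpha> assume a: "\<alpha> \<in> pfree ?v"
      have "(x - b * TT0 ^ k) + (b * TT0 ^ k - ev ?v c * TT0 ^ k) \<in> K k"
        using b(2) c Kg_K[of k w] N_K[of k] by (intro U.subspace_add[OF K_sub]) blast+
      then have "Lr \<alpha> * (x - ev ?v c * TT0 ^ k) \<in> K k"
        using Pstable_Lr[OF K_Pstable, of \<alpha>] pfreeD[OF a] by simp
      moreover have "Lr \<alpha> * x \<in> K k" using h a False by auto
      ultimately have "Lr \<alpha> * x - Lr \<alpha> * (x - ev ?v c * TT0 ^ k) \<in> K k" by (intro U.subspace_diff[OF K_sub])
      then show "Lr \<alpha> * (ev ?v c * TT0 ^ k) \<approx>\<^bsub>K k\<^esub> 0" by (intro eqm_base0) (simp add: right_diff_distrib)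
    qed
    then show ?thesis using c by (simp add: ev_zero_eq)
  qed
  then show ?thesis using b(2) N_Kg U.subspace_add[OF Kg_sub, of "x - b * TT0 ^ k" k w "b * TT0 ^ k"] by auto
qed

section \<open>Vectors of the filtration annihilated by all positive \<open>L\<close>\<close>

lemma Lr_Kg: "pos \<alpha> \<Longrightarrow> x \<in> Kg k w \<Longrightarrow> Lr \<alpha> * x \<in> Kg k (w - int (sum_list \<alpha>))"
proof (induction \<alpha> arbitrary: x w)
  case (Cons n \<alpha>)
  then have "L (int n) * x \<in> Kg k (w - int n)" by (intro L_Kg) auto
  then have "Lr \<alpha> * (L (int n) * x) \<in> Kg k (w - int n - int (sum_list \<alpha>))" using Cons by auto
  then show ?case by (simp add: mult.assoc algebra_simps)
qed simp

text \<open>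
  The induction runs downwards from \<open>k = r\<close>, where \<open>T\<^sup>r\<close> itself will do, to \<open>k = 0\<close>. To get from \<open>k + 1\<close> to \<open>k\<close> one
  subtracts \<open>a T\<^sup>k\<close> with \<open>a \<in> U(M\<^sub>-)\<close> of weight \<open>(r - k) p\<close> chosen so that all products \<open>L\<^sub>\<alpha>\<close>, \<open>p \<notin> \<alpha>\<close>, of this weight map the
  vector into \<open>K k\<close>. The products containing \<open>L\<^sub>p\<close> then do so automatically, and by \<open>Kg_drop\<close> each \<open>L\<^sub>n\<close> maps the vector into \<open>K k\<close>.
\<close>

lemma ex_subsingular:
  assumes hr: "hL = h' p r cL" and r: "r \<ge> 1"
  shows "k \<le> r \<Longrightarrow> \<exists>y. y - TT0 ^ r \<in> Kg r (int r * int p) \<and> (\<forall>n\<ge>1. L n * y \<in> Kg k (int r * int p - n))"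
proof (induction "r - k" arbitrary: k)
  case 0
  then have "k = r" by simp
  then show ?case using L_Tpow by (intro exI[of _ "TT0 ^ r"]) (simp add: U.subspace_0[OF Kg_sub])
next
  case (Suc d)
  let ?R = "int r * int p"
  have k: "k < r" "Suc k \<le> r" "d = r - Suc k" using Suc by auto
  from Suc.hyps(1)[OF k(3,2)] obtain y where
    y: "y - TT0 ^ r \<in> Kg r ?R" "\<And>n. n \<ge> 1 \<Longrightarrow> L n * y \<in> Kg (Suc k) (?R - n)" by blast
  define m where "m = (r - k) * p"
  have m: "int m = ?R - int k * int p" using k by (simp add: m_def left_diff_distrib of_nat_diff)
  have "1 \<le> r - k" using k by auto
  then have m1: "m \<ge> p" using mult_le_mono1[of 1 "r - k" p] by (simp add: m_def)
  have Lry: "Lr \<alpha> * y \<in> Kg (Suc k) (?R - int (sum_list \<alpha>))" if pos: "pos \<alpha>" and ne: "\<alpha> \<noteq> []" for \<alpha>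
  proof -
    obtain n \<beta> where ab: "\<alpha> = n # \<beta>" using ne by (cases \<alpha>) auto
    have "Lr \<beta> * (L (int n) * y) \<in> Kg (Suc k) (?R - int n - int (sum_list \<beta>))"
      using pos ab by (intro Lr_Kg y) auto
    then show ?thesis by (simp add: ab mult.assoc algebra_simps)
  qed
  have "\<exists>s. Lr \<alpha> * y \<approx>\<^bsub>K k\<^esub> scal s * TT0 ^ k" if a: "\<alpha> \<in> pfree m" for \<alpha>
  proof -
    have "\<alpha> \<noteq> []" using pfreeD[OF a] m1 p1 by auto
    then have "Lr \<alpha> * y \<in> Kg (Suc k) (int k * int p)" using Lry[of \<alpha>] pfreeD[OF a] m by simp
    then obtain b where b: "b \<in> UMi (int k * int p - int k * int p)" "Lr \<alpha> * y - b * TT0 ^ k \<in> Kg k (int k * int p)"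
      using Kg_top by blast
    then obtain s where "b = scal s" using UMi_0 by auto
    then show ?thesis using b(2) Kg_K by (intro exI[of _ s] eqm_base) auto
  qed
  then obtain f where f: "\<And>\<alpha>. \<alpha> \<in> pfree m \<Longrightarrow> Lr \<alpha> * y \<approx>\<^bsub>K k\<^esub> scal (f \<alpha>) * TT0 ^ k" by metis
  \<comment> \<open>The values of the products of \<open>L\<^sub>n\<close> on \<open>y\<close> are scalar multiples of \<open>T\<^sup>k\<close>; match them
     by the values on a suitable \<open>a T\<^sup>k\<close>.\<close>
  obtain c where c: "\<And>\<alpha>. \<alpha> \<in> pfree m \<Longrightarrow> Lr \<alpha> * (ev m c * TT0 ^ k) \<approx>\<^bsub>K k\<^esub> scal (f \<alpha>) * TT0 ^ k"
    using ev_solve[OF K_Pstable K_pvac, where w = m and f = f] by blast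
  define z where "z = ev m c * TT0 ^ k"
  define y' where "y' = y - z"
  have z: "z \<in> Kg (Suc k) ?R" unfolding z_def using UM_UMi[OF ev_UM, of m c] m by (intro Kg_base) auto
  have zr: "z \<in> Kg r ?R" using z Kg_mono[of "Suc k" r] k by blast
  have Lz: "L n * z \<in> Kg (Suc k) (?R - n)" if "n \<ge> 1" for n using L_Kg[OF that z] .
  have y'1: "y' - TT0 ^ r \<in> Kg r ?R"
    using U.subspace_diff[OF Kg_sub y(1) zr] by (simp add: y'_def algebra_simps)
  have y'2: "L n * y' \<in> Kg (Suc k) (?R - n)" if "n \<ge> 1" for n
    unfolding y'_def right_diff_distrib by (rule U.subspace_diff[OF Kg_sub y(2)[OF that] Lz[OF that]])
  have free: "Lr \<alpha> * y' \<in> K k" if "\<alpha> \<in> pfree m" for \<alpha>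
  proof -
    have "Lr \<alpha> * y - Lr \<alpha> * z \<approx>\<^bsub>K k\<^esub> scal (f \<alpha>) * TT0 ^ k - scal (f \<alpha>) * TT0 ^ k"
      unfolding z_def by (intro eqm_diff f c that)
    then show ?thesis by (simp add: y'_def right_diff_distrib eqm_0_iff[OF K_sub])
  qed
  \<comment> \<open>If \<open>\<mu>\<close> is nonempty, the vector is in a layer whose leading coefficients lie in \<open>U(M\<^sub>-)\<^sub>p\<close>, which
     \<open>L\<^sub>p\<close> annihilates. If \<open>\<mu>\<close> is empty, then \<open>k = r - 1\<close>, and the scalar \<open>p\<^sup>2 r (r - r)\<close> enters.\<close>
  have Lpw: "L (int p) * (Lr \<mu> * y') \<in> K k" if mu: "pos \<mu>" "sum_list \<mu> + p = m" for \<mu>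
  proof (cases "\<mu> = []")
    case False
    then obtain n \<beta> where ab: "\<mu> = n # \<beta>" by (cases \<mu>) auto
    have "Lr \<beta> * (L (int n) * y') \<in> Kg (Suc k) (?R - int n - int (sum_list \<beta>))"
      using mu ab by (intro Lr_Kg y'2) auto
    moreover have "?R - int n - int (sum_list \<beta>) = int (Suc k) * int p"
      using mu m ab by (simp add: algebra_simps)
    ultimately have "Lr \<mu> * y' \<in> Kg (Suc k) (int (Suc k) * int p)" by (simp add: ab mult.assoc)
    then show ?thesis by (rule Lp_Kg)
  next
    case True
    then have "p = (r - k) * p" using mu(2) unfolding m_def by simp
    then have "r - k = 1" using p1 by auto
    then have rk: "r = Suc k" using k by simp
    have "L (int p) * TT0 ^ r \<approx>\<^bsub>K k\<^esub> scal (Lpc r) * TT0 ^ k" using Lp_Tpow[of k] rk by simp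
    then have "L (int p) * TT0 ^ r \<in> K k" using Lpc_zero[OF hr, of r] by (simp add: eqm_0_iff[OF K_sub])
    moreover have "L (int p) * (y' - TT0 ^ r) \<in> K k" using y'1 unfolding rk by (rule Lp_Kg)
    ultimately have "L (int p) * (y' - TT0 ^ r) + L (int p) * TT0 ^ r \<in> K k" by (intro U.subspace_add[OF K_sub])
    then show ?thesis using True by (simp add: right_diff_distrib)
  qed
  have all: "Lr \<alpha> * y' \<in> K k" if "pos \<alpha>" "sum_list \<alpha> = m" for \<alpha>
    by (rule Lr_generated[OF K_sub free Lpw that])
  have "L n * y' \<in> Kg k (?R - n)" if n: "n \<ge> 1" for n
  proof (rule Kg_drop[OF y'2[OF n]])
    fix \<alpha> assume le: "int k * int p \<le> ?R - n" and a: "\<alpha> \<in> pfree (nat (?R - n - int k * int p))"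
    have "sum_list (nat n # \<alpha>) = m" using pfreeD[OF a] le n m by auto
    moreover have "pos (nat n # \<alpha>)" using pfreeD[OF a] n by auto
    ultimately have "Lr (nat n # \<alpha>) * y' \<in> K k" using all by blast
    then show "Lr \<alpha> * (L n * y') \<in> K k" using n by (simp add: mult.assoc)
  qed
  then show ?case using y'1 by blast
qed

text \<open>
  A leading coefficient of positive weight is excluded by the pairing, so the leading coefficient is a scalar, which fixes the weight.
\<close>

lemma singular_in_K:
  assumes L: "\<And>n. n \<ge> 1 \<Longrightarrow> L n * w \<in> N"
  shows "w \<in> Kg k m \<Longrightarrow> w \<in> N \<or> (\<exists>j c. j < k \<and> c \<noteq> 0 \<and> m = int j * int p \<and> w - scal c * TT0 ^ j \<in> Kg j m)"
proof (induction k)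
  case 0
  then show ?case by (simp add: Kg_0)
next
  case (Suc k)
  show ?case
  proof (cases "m = int k * int p")
    case False
    have "w \<in> Kg k m"
    proof (rule Kg_drop[OF Suc.prems])
      fix \<alpha> assume le: "int k * int p \<le> m" and a: "\<alpha> \<in> pfree (nat (m - int k * int p))"
      have "sum_list \<alpha> > 0" using pfreeD[OF a] le False by auto
      then obtain n \<beta> where ab: "\<alpha> = n # \<beta>" by (cases \<alpha>) auto
      have "Lr \<beta> * (L (int n) * w) \<in> N" using pfreeD[OF a] ab by (intro left_ideal_mult[OF N_left] L) auto
      then show "Lr \<alpha> * w \<in> K k" using N_K by (auto simp: ab mult.assoc)
    qed
    then show ?thesis using Suc.IH less_Suc_eq by blast
  next
    case True
    obtain b where b: "b \<in> UMi (m - int k * int p)" "w - b * TT0 ^ k \<in> Kg k m" using Kg_top[OF Suc.prems] by blast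
    then obtain c where c: "b = scal c" using True UMi_0 by auto
    show ?thesis
    proof (cases "c = 0")
      case True
      then have "w \<in> Kg k m" using b c by simp
      then show ?thesis using Suc.IH less_Suc_eq by blast
    next
      case False
      then show ?thesis using b c True by auto
    qed
  qed
qed

text \<open>
  \<open>L\<^sub>p\<close> maps the vector to the multiple \<open>c p\<^sup>2 j (j - r)\<close> of \<open>T\<close> to the power \<open>j - 1\<close>, modulo lower terms.
\<close>

lemma singular_degree:
  assumes hr: "hL = h' p r cL" and L: "\<And>n. n \<ge> 1 \<Longrightarrow> L n * w \<in> N"
    and c: "c \<noteq> 0" and w: "w - scal c * TT0 ^ j \<in> Kg j (int j * int p)" and j: "j \<ge> 1"
  shows "j = r"
proof (rule ccontr)
  assume jr: "j \<noteq> r"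
  obtain k where k: "j = Suc k" using j by (cases j) auto
  have "L (int p) * (w - scal c * TT0 ^ j) \<in> K k" using w unfolding k by (rule Lp_Kg)
  moreover have "L (int p) * w \<in> K k" using L[of "int p"] p1 N_K by auto
  ultimately have "L (int p) * w - L (int p) * (w - scal c * TT0 ^ j) \<in> K k" by (intro U.subspace_diff[OF K_sub])
  then have "scal c * (L (int p) * TT0 ^ j) \<approx>\<^bsub>K k\<^esub> 0" by (intro eqm_base0) (simp add: right_diff_distrib L_scal)
  moreover have "scal c * (L (int p) * TT0 ^ j) \<approx>\<^bsub>K k\<^esub> scal c * (scal (Lpc j) * TT0 ^ k)"
    unfolding k by (intro eqm_scal Lp_Tpow)
  ultimately have "scal c * (scal (Lpc j) * TT0 ^ k) \<approx>\<^bsub>K k\<^esub> 0" by (rule eqm_trans[OF eqm_sym, rotated])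
  then have in_K: "scal (c * Lpc j) * TT0 ^ k \<in> K k" by (simp add: eqm_0_iff[OF K_sub])
  define q where "q = c * Lpc j"
  have "q \<noteq> 0" using c Lpc_zero[OF hr, of j] p1 jr j by (simp add: q_def)
  moreover have "scal (inverse q) * (scal q * TT0 ^ k) \<in> K k"
    using in_K U.subspace_scale[OF K_sub] unfolding q_def by blast
  ultimately show False using Tpow_notin_K[of k] by simp
qed

section \<open>Vectors annihilated by all positive \<open>M\<close>\<close>

text \<open>
  The vectors that will be shown to be all those annihilated by the positive \<open>M\<close> modulo \<open>N\<close>.
\<close>

definition Kinf :: "U22 set" where "Kinf = {x. \<exists>k. x \<in> K k}"

lemma K_Kinf: "x \<in> K k \<Longrightarrow> x \<in> Kinf" by (auto simp: Kinf_def)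

lemma N_Kinf: "x \<in> N \<Longrightarrow> x \<in> Kinf" using N_K K_Kinf by blast

lemma Kinf_sub: "U.subspace Kinf"
proof (rule U.subspaceI)
  show "0 \<in> Kinf" using U.subspace_0[OF K_sub] K_Kinf by blast
  fix x y assume "x \<in> Kinf" "y \<in> Kinf"
  then obtain j k where jk: "x \<in> K j" "y \<in> K k" by (auto simp: Kinf_def)
  have "x \<in> K (max j k)" "y \<in> K (max j k)" using jk K_mono[of j "max j k"] K_mono[of k "max j k"] by auto
  then show "x + y \<in> Kinf" using U.subspace_add[OF K_sub] K_Kinf by blast
next
  fix c x assume "x \<in> Kinf"
  then show "scal c * x \<in> Kinf" using U.subspace_scale[OF K_sub] by (auto simp: Kinf_def)
qed

lemma Kinf_mvac: "x \<in> Kinf \<Longrightarrow> mvac N x" by (auto simp: Kinf_def M_K)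

lemma Kinf_eqm: "y \<approx>\<^bsub>N\<^esub> x \<Longrightarrow> x \<in> Kinf \<Longrightarrow> y \<in> Kinf"
  using U.subspace_add[OF Kinf_sub, of "y - x" x] N_Kinf by (simp add: eqm_iff[OF N_sub])

lemma Kinf_MT: "a \<in> MT \<Longrightarrow> x \<in> Kinf \<Longrightarrow> a * x \<in> Kinf" unfolding Kinf_def using MT_K by blast
lemma Kinf_T: "x \<in> Kinf \<Longrightarrow> TT0 * x \<in> Kinf" unfolding Kinf_def using T_K by blast

lemma Kinf_L0: "x \<in> Kinf \<Longrightarrow> L 0 * x \<in> Kinf"
proof -
  have "L 0 * x \<in> K k" if "x \<in> K k" for k
    using that unfolding K_def[of k]
  proof (rule KS_mult[OF _ KS_sub])
    fix n assume "n \<in> N" then show "L 0 * n \<in> KS (\<lambda>j a. j < k \<and> a \<in> MT)" using left_ideal_mult[OF N_left] KS_N by blast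
  next
    fix j a assume a: "j < k \<and> a \<in> MT"
    then have "a \<in> MT" "j < k" by auto
    then show "L 0 * (a * TT0 ^ j) \<in> KS (\<lambda>j a. j < k \<and> a \<in> MT)"
      unfolding K_def[symmetric]
    proof (induction rule: MS_induct)
      case zero
      then show ?case by (simp add: U.subspace_0[OF K_sub])
    next
      case (add x y)
      then show ?case by (simp add: distrib_right distrib_left U.subspace_add[OF K_sub])
    next
      case (scal c x)
      then show ?case by (simp add: mult.assoc L_scal U.subspace_scale[OF K_sub])
    next
      case (part \<nu>)
      have "wt (int (sum_list \<nu>) + int j * int p) (M_part \<nu> * TT0 ^ j)" by (rule wt_mult[OF wt_M_part wt_Tpow])
      from wt_eigen_N[OF this]
      have e: "L 0 * (M_part \<nu> * TT0 ^ j) \<approx>\<^bsub>K k\<^esub> scal (hL + of_int (int (sum_list \<nu>) + int j * int p)) * (M_part \<nu> * TT0 ^ j)"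
        by (rule eqm_mono[OF _ N_K])
      have "M_part \<nu> * TT0 ^ j \<in> K k" using part by (intro K_base MS_part) auto
      then show ?case by (intro eqm_mem[OF K_sub e] U.subspace_scale[OF K_sub])
    qed
  qed
  then show "x \<in> Kinf \<Longrightarrow> L 0 * x \<in> Kinf" by (auto simp: Kinf_def)
qed

lemma Kinf_gen: "x \<in> Kinf \<Longrightarrow> (\<And>n. g = Lg n \<Longrightarrow> n \<ge> 0) \<Longrightarrow> gen g * x \<in> Kinf"
proof (cases g)
  case (Lg n)
  assume x: "x \<in> Kinf" and "\<And>n. g = Lg n \<Longrightarrow> n \<ge> 0"
  then have n: "n \<ge> 0" using Lg by simp
  show ?thesis
  proof (cases "n = 0")
    case True
    then show ?thesis using Kinf_L0[OF x] Lg by (simp add: gen_simps)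
  next
    case False
    then have "n \<ge> 1" using n by simp
    then show ?thesis using x L_K Lg by (auto simp: Kinf_def gen_simps)
  qed
next
  case (Mg n)
  assume x: "x \<in> Kinf"
  note mv = Kinf_mvac[OF x]
  consider "n > 0" | "n = 0" | "n < 0" by linarith
  then show ?thesis
  proof cases
    case 1
    then have "M n * x \<approx>\<^bsub>N\<^esub> 0" using mv by (simp add: mvac_def)
    then show ?thesis using N_Kinf Mg by (simp add: gen_simps eqm_0_iff[OF N_sub])
  next
    case 2
    then have "M n * x \<approx>\<^bsub>N\<^esub> scal hM * x" using mv by (simp add: mvac_def)
    then have "M n * x \<in> Kinf" by (rule Kinf_eqm[OF _ U.subspace_scale[OF Kinf_sub x]])
    then show ?thesis using Mg by (simp add: gen_simps)
  next
    case 3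
    then show ?thesis using Kinf_MT[OF M_in_MS[of "- n"] x] Mg by (simp add: gen_simps)
  qed
next
  case CLg
  assume x: "x \<in> Kinf"
  show ?thesis unfolding CLg gen_simps
    by (rule Kinf_eqm[OF central_eqm(1)[OF I_N N_left] U.subspace_scale[OF Kinf_sub x]])
next
  case CMg
  assume x: "x \<in> Kinf"
  show ?thesis unfolding CMg gen_simps
    by (rule Kinf_eqm[OF central_eqm(2)[OF I_N N_left] U.subspace_scale[OF Kinf_sub x]])
qed

fun Ln :: "nat list \<Rightarrow> U22" where
  "Ln [] = 1"
| "Ln (i # \<alpha>) = L (- int i) * Ln \<alpha>"

lemma Ln_append: "Ln (xs @ ys) = Ln xs * Ln ys"
  by (induction xs) (simp_all add: mult.assoc)

text \<open>
  The span of \<open>L\<^sub>-\<^sub>\<alpha> x\<close> with \<open>x\<close> in the union of the \<open>K k\<close>, with at most \<open>l\<close> factors \<open>L\<^sub>-\<^sub>n\<close>, none of them \<open>L\<^sub>-\<^sub>p\<close>.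
\<close>

definition LK :: "nat \<Rightarrow> U22 set" where
  "LK l = U.span {Ln \<alpha> * x | \<alpha> x w. \<alpha> \<in> pfree w \<and> length \<alpha> \<le> l \<and> x \<in> Kinf}"

lemma LK_sub: "U.subspace (LK l)" by (simp add: LK_def)
lemma LK_mono: "l \<le> m \<Longrightarrow> LK l \<subseteq> LK m" unfolding LK_def by (rule U.span_mono) (auto intro: order_trans)
lemma LK_base: "\<alpha> \<in> pfree w \<Longrightarrow> length \<alpha> \<le> l \<Longrightarrow> x \<in> Kinf \<Longrightarrow> Ln \<alpha> * x \<in> LK l"
  unfolding LK_def by (rule U.span_base) blast

text \<open>
  The definition of \<open>T\<close> solved for \<open>L\<^sub>-\<^sub>p\<close>.
\<close>

lemma Lp_expand: "L (- int p) * x = TT0 * x - (\<Sum>i=1..p-1. L (- int i) * (G (int p - int i) * x)) - (scal bT * Qv + scal sT * Sv) * x"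
proof -
  have "TT0 = L (- int p) + (\<Sum>i=1..p-1. L (- int i) * G (int p - int i)) + (scal bT * Qv + scal sT * Sv)"
    unfolding TT0_def TT_def sum_GL by (simp add: G_def add.assoc)
  then show ?thesis by (simp add: distrib_right sum_distrib_right mult.assoc)
qed

text \<open>
  Reordering the \<open>L\<^sub>-\<^sub>n\<close> produces only shorter products. So an \<open>L\<^sub>-\<^sub>p\<close> may be moved to the right, where \<open>Lp_expand\<close> replaces it
  by \<open>T\<close>, which is absorbed into \<open>x\<close>, and by \<open>L\<^sub>-\<^sub>i\<close> with \<open>i < p\<close>.
\<close>

lemma Ln_LK: "pos \<alpha> \<Longrightarrow> x \<in> Kinf \<Longrightarrow> Ln \<alpha> * x \<in> LK (length \<alpha>)"
proof (induction "length \<alpha>" arbitrary: \<alpha> x rule: less_induct)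
  case less
  let ?l = "length \<alpha>"
  have IH: "Ln \<beta> * y \<in> LK ?l" if "length \<beta> < ?l" "pos \<beta>" "y \<in> Kinf" for \<beta> y
    using less.hyps[OF that] LK_mono[of "length \<beta>" ?l] that(1) by auto
  have swap: "(pos (xs @ j # i # ys) \<and> length (xs @ j # i # ys) = ?l) \<and> (Ln (xs @ j # i # ys) * y \<in> LK ?l \<longrightarrow> Ln \<beta> * y \<in> LK ?l)"
    if h: "(pos (xs @ i # j # ys) \<and> length (xs @ i # j # ys) = ?l) \<and> (Ln (xs @ i # j # ys) * y \<in> LK ?l \<longrightarrow> Ln \<beta> * y \<in> LK ?l)"
      and y: "y \<in> Kinf" for xs i j ys y \<beta>
  proof -
    let ?u = "Ln ys * y"
    have e: "L (- int i) * (L (- int j) * ?u) = L (- int j) * (L (- int i) * ?u) + scal (of_int (- int i - - int j)) * (L (- int (i + j)) * ?u)"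
      using LL_app[of "- int i" "- int j" ?u] h by auto
    have "Ln (xs @ i # j # ys) * y = Ln xs * (L (- int i) * (L (- int j) * ?u))" by (simp add: Ln_append mult.assoc)
    also have "\<dots> = Ln (xs @ j # i # ys) * y + scal (of_int (- int i - - int j)) * (Ln (xs @ (i + j) # ys) * y)"
      unfolding e distrib_left scal_left_commute[of "Ln xs"] Ln_append Ln.simps mult.assoc ..
    finally have e2: "Ln (xs @ i # j # ys) * y = Ln (xs @ j # i # ys) * y + scal (of_int (- int i - - int j)) * (Ln (xs @ (i + j) # ys) * y)" .
    have "Ln (xs @ (i + j) # ys) * y \<in> LK ?l" using h y by (intro IH) auto
    then have "Ln (xs @ j # i # ys) * y \<in> LK ?l \<longrightarrow> Ln (xs @ i # j # ys) * y \<in> LK ?l"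
      unfolding e2 by (blast intro: U.subspace_add[OF LK_sub] U.subspace_scale[OF LK_sub])
    then show ?thesis using h by auto
  qed
  have perm: "Ln \<beta> * y \<in> LK ?l" if "mset \<beta> = mset \<gamma>" "Ln \<gamma> * y \<in> LK ?l" "pos \<beta>" "length \<beta> = ?l" "y \<in> Kinf" for \<beta> \<gamma> y
    using perm_swap_induct[of "\<lambda>\<gamma>. (pos \<gamma> \<and> length \<gamma> = ?l) \<and> (Ln \<gamma> * y \<in> LK ?l \<longrightarrow> Ln \<beta> * y \<in> LK ?l)" \<beta> \<gamma>, OF swap[OF _ that(5)] _ that(1)]
      that by blast
  have "Ln \<beta> * y \<in> LK ?l" if "count_list \<beta> p = c" "pos \<beta>" "length \<beta> = ?l" "y \<in> Kinf" for c \<beta> y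
    using that
  proof (induction c arbitrary: \<beta> y)
    case 0
    obtain \<gamma> where g: "\<gamma> \<in> partitions_of (sum_list \<beta>)" "mset \<gamma> = mset \<beta>" using ex_partition[OF 0(2)] by blast
    then have "set \<gamma> = set \<beta>" by (metis set_mset_mset)
    then have "\<gamma> \<in> pfree (sum_list \<beta>)" using g 0(1) by (simp add: pfree_def count_list_0_iff)
    moreover have "length \<gamma> = ?l" using g(2) 0(3) by (metis size_mset)
    ultimately have "Ln \<gamma> * y \<in> LK ?l" using 0 by (intro LK_base) auto
    then show ?case using g 0 by (intro perm[of \<beta> \<gamma>]) auto
  next
    case (Suc c)
    have pb: "p \<in> set \<beta>" using Suc.prems(1) count_list_0_iff[of \<beta> p] by auto
    define \<gamma> where "\<gamma> = remove1 p \<beta>"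
    have cnt: "count_list \<gamma> p = c"
    proof -
      have "count_list \<beta> p = Suc (count_list (remove1 p \<beta>) p)" using pb by (induction \<beta>) auto
      then show ?thesis using Suc.prems by (simp add: \<gamma>_def)
    qed
    have "length \<beta> > 0" using pb by (cases \<beta>) auto
    then have g2: "Suc (length \<gamma>) = ?l" unfolding \<gamma>_def Suc.prems(3)[symmetric] using pb by (simp add: length_remove1)
    have "pos \<gamma>" using Suc.prems(2) set_remove1_subset[of p \<beta>] unfolding \<gamma>_def by blast
    note g = this g2
    have 1: "Ln \<gamma> * (TT0 * y) \<in> LK ?l" using g by (intro IH Kinf_T Suc.prems) auto
    have "scal bT * Qv + scal sT * Sv \<in> MT"
      using Qv_UM Sv_UM unfolding UM_eq_MS by (intro MS_add MS_scal MS_MT)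
    then have 2: "Ln \<gamma> * ((scal bT * Qv + scal sT * Sv) * y) \<in> LK ?l" using g by (intro IH Kinf_MT Suc.prems) auto
    have 3: "Ln \<gamma> * (L (- int i) * (G (int p - int i) * y)) \<in> LK ?l" if i: "i \<in> {1..p-1}" for i
    proof -
      have "Ln (\<gamma> @ [i]) * (G (int p - int i) * y) \<in> LK ?l"
      proof (rule Suc.IH)
        show "count_list (\<gamma> @ [i]) p = c" using cnt i p1 by auto
        show "G (int p - int i) * y \<in> Kinf" by (rule Kinf_MT[OF G_MS Suc.prems(4)])
      qed (use g i in auto)
      then show ?thesis by (simp add: Ln_append mult.assoc)
    qed
    have "Ln (\<gamma> @ [p]) * y = Ln \<gamma> * (TT0 * y) - (\<Sum>i=1..p-1. Ln \<gamma> * (L (- int i) * (G (int p - int i) * y))) - Ln \<gamma> * ((scal bT * Qv + scal sT * Sv) * y)"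
      by (simp add: Ln_append mult.assoc Lp_expand[of y] right_diff_distrib sum_distrib_left)
    also have "\<dots> \<in> LK ?l"
      by (rule U.subspace_diff[OF LK_sub U.subspace_diff[OF LK_sub 1 U.subspace_sum[OF LK_sub 3]] 2])
    finally show ?case using Suc.prems pb by (intro perm[of \<beta> "\<gamma> @ [p]"]) (auto simp: \<gamma>_def)
  qed
  then show ?case using less.prems by blast
qed

definition LK_all :: "U22 set" where "LK_all = U.span {Ln \<alpha> * x | \<alpha> x. pos \<alpha> \<and> x \<in> Kinf}"

lemma LK_all_sub: "U.subspace LK_all" by (simp add: LK_all_def)
lemma LK_all_base: "pos \<alpha> \<Longrightarrow> x \<in> Kinf \<Longrightarrow> Ln \<alpha> * x \<in> LK_all" unfolding LK_all_def by (rule U.span_base) blast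

lemma LK_all_mult:
  assumes "\<And>\<alpha> x. pos \<alpha> \<Longrightarrow> x \<in> Kinf \<Longrightarrow> u * (Ln \<alpha> * x) \<in> LK_all" "y \<in> LK_all"
  shows "u * y \<in> LK_all"
  using assms(2) unfolding LK_all_def
proof (induction rule: U.span_induct_alt)
  case (step c z y)
  then show ?case using assms(1) U.subspace_add[OF LK_all_sub] U.subspace_scale[OF LK_all_sub]
    unfolding LK_all_def[symmetric] by (auto simp: distrib_left scal_left_commute[of u])
qed (simp add: U.span_zero)

lemma gen_LK_all: "pos \<alpha> \<Longrightarrow> x \<in> Kinf \<Longrightarrow> gen g * (Ln \<alpha> * x) \<in> LK_all"
proof (induction \<alpha> arbitrary: g)
  case Nil
  show ?case
  proof (cases "\<exists>n<0. g = Lg n")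
    case True
    then obtain n where n: "n < 0" "g = Lg n" by blast
    then have "Ln [nat (- n)] * x \<in> LK_all" using Nil by (intro LK_all_base) auto
    then show ?thesis using n by (simp add: gen_simps)
  next
    case False
    then have "gen g * x \<in> Kinf" using Nil by (intro Kinf_gen) (auto simp: not_less[symmetric])
    then show ?thesis using LK_all_base[of "[]"] by simp
  qed
next
  case (Cons i \<alpha>)
  let ?y = "Ln \<alpha> * x"
  have pos: "pos \<alpha>" "i \<ge> 1" using Cons.prems by auto
  obtain z c z' c' where e: "gen g * (gen (Lg (- int i)) * ?y) = gen (Lg (- int i)) * (gen g * ?y) + scal c * (gen z * ?y) + scal c' * (gen z' * ?y)"
    using gen_comm by blast
  have y: "gen h * ?y \<in> LK_all" for h by (rule Cons.IH[OF pos(1) Cons.prems(2)])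
  have "L (- int i) * (Ln \<beta> * x') \<in> LK_all" if "pos \<beta>" "x' \<in> Kinf" for \<beta> x'
    using LK_all_base[of "i # \<beta>" x'] that pos by (simp add: mult.assoc)
  then have "gen (Lg (- int i)) * (gen g * ?y) \<in> LK_all" unfolding gen_simps by (rule LK_all_mult[OF _ y])
  then have "gen g * (gen (Lg (- int i)) * ?y) \<in> LK_all"
    unfolding e by (intro U.subspace_add[OF LK_all_sub] U.subspace_scale[OF LK_all_sub] y)
  then show ?case by (simp add: gen_simps mult.assoc)
qed

lemma one_Kinf: "1 \<in> Kinf"
proof -
  have "(1::U22) * TT0 ^ 0 \<in> K 1" by (rule K_base) (simp_all add: MS_1)
  then show ?thesis using K_Kinf by simp
qed

text \<open>
  The span of all \<open>L\<^sub>-\<^sub>\<alpha> x\<close> contains \<open>1\<close> and is stable under the generators, because non-negative modes and the \<open>M\<^sub>-\<^sub>n\<close> can be moved to the right until they act on \<open>x\<close>.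
\<close>

lemma ex_LK: "\<exists>l. u \<in> LK l"
proof -
  have "u \<in> LK_all"
  proof (induction u rule: U22_induct)
    case zero show ?case by (rule U.subspace_0[OF LK_all_sub])
  next
    case (add x y) then show ?case by (rule U.subspace_add[OF LK_all_sub])
  next
    case (scal c)
    have "Ln [] * 1 \<in> LK_all" by (rule LK_all_base) (simp_all add: one_Kinf)
    then show ?case using U.subspace_scale[OF LK_all_sub, of 1 c] by simp
  next
    case (gen g x) then show ?case by (intro LK_all_mult[OF gen_LK_all])
  qed
  then show ?thesis unfolding LK_all_def
  proof (induction rule: U.span_induct_alt)
    case base show ?case using U.subspace_0[OF LK_sub] by blast
  next
    case (step c z y)
    then obtain \<alpha> x l where h: "z = Ln \<alpha> * x" "pos \<alpha>" "x \<in> Kinf" "y \<in> LK l" by blast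
    have "z \<in> LK (max (length \<alpha>) l)" "y \<in> LK (max (length \<alpha>) l)"
      using Ln_LK[OF h(2,3)] h LK_mono[of "length \<alpha>" "max (length \<alpha>) l"] LK_mono[of l "max (length \<alpha>) l"] by auto
    then show ?case using U.subspace_add[OF LK_sub] U.subspace_scale[OF LK_sub] by blast
  qed
qed

lemma LK_rep: "x \<in> LK l \<Longrightarrow> \<exists>A f. finite A \<and> A \<subseteq> (\<Union>w. pfree w) \<and> (\<forall>\<alpha>. f \<alpha> \<in> Kinf) \<and> x = (\<Sum>\<alpha>\<in>A. Ln \<alpha> * f \<alpha>)"
  unfolding LK_def
proof (induction rule: U.span_induct_alt)
  case base
  show ?case by (rule exI[of _ "{}"], rule exI[of _ "\<lambda>_. 0"]) (simp add: U.subspace_0[OF Kinf_sub])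
next
  case (step c z y)
  then obtain \<beta> k w A f where h: "z = Ln \<beta> * k" "\<beta> \<in> pfree w" "k \<in> Kinf" "finite A" "A \<subseteq> (\<Union>w. pfree w)"
    "\<And>\<alpha>. f \<alpha> \<in> Kinf" "y = (\<Sum>\<alpha>\<in>A. Ln \<alpha> * f \<alpha>)" by blast
  define g where "g \<alpha> = (if \<alpha> \<in> A then f \<alpha> else 0) + (if \<alpha> = \<beta> then scal c * k else 0)" for \<alpha>
  have "g \<alpha> \<in> Kinf" for \<alpha>
    using h U.subspace_0[OF Kinf_sub] U.subspace_scale[OF Kinf_sub] by (auto simp: g_def intro!: U.subspace_add[OF Kinf_sub])
  moreover have "(\<Sum>\<alpha>\<in>insert \<beta> A. Ln \<alpha> * g \<alpha>) = scal c * z + y"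
  proof -
    have "(\<Sum>\<alpha>\<in>insert \<beta> A. Ln \<alpha> * g \<alpha>) = (\<Sum>\<alpha>\<in>insert \<beta> A. Ln \<alpha> * (if \<alpha> \<in> A then f \<alpha> else 0)) + (\<Sum>\<alpha>\<in>insert \<beta> A. if \<alpha> = \<beta> then Ln \<beta> * (scal c * k) else 0)"
      unfolding sum.distrib[symmetric] by (rule sum.cong) (auto simp: g_def distrib_left)
    also have "(\<Sum>\<alpha>\<in>insert \<beta> A. Ln \<alpha> * (if \<alpha> \<in> A then f \<alpha> else 0)) = y"
      unfolding h(7) using h(4) by (intro sum.mono_neutral_cong_right) auto
    also have "(\<Sum>\<alpha>\<in>insert \<beta> A. if \<alpha> = \<beta> then Ln \<beta> * (scal c * k) else 0) = scal c * z"
      using h(4) by (simp add: h(1) scal_left_commute[of "Ln \<beta>"])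
    finally show ?thesis by (simp add: add.commute)
  qed
  ultimately show ?case using h by (intro exI[of _ "insert \<beta> A"] exI[of _ g]) auto
qed

text \<open>
  The dual counterpart of the products of positive \<open>L\<close>: here products of positive \<open>M\<close> are paired with \<open>L\<^sub>-\<^sub>\<alpha>\<close>.
\<close>

fun Mr :: "nat list \<Rightarrow> U22" where
  "Mr [] = 1"
| "Mr (n # \<mu>) = M (int n) * Mr \<mu>"

lemma Mr_M: "M k * (Mr \<mu> * z) = Mr \<mu> * (M k * z)"
proof (induction \<mu>)
  case (Cons n \<mu>)
  have "M k * (Mr (n # \<mu>) * z) = M (int n) * (M k * (Mr \<mu> * z))" by (simp add: mult.assoc MM_app[of k "int n"])
  then show ?case by (simp add: Cons mult.assoc)
qed simp

lemma Mr_perm: "mset \<mu> = mset \<nu> \<Longrightarrow> Mr \<mu> * z = Mr \<nu> * z"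
proof (induction \<mu> arbitrary: \<nu>)
  case (Cons i \<mu>)
  then have "i \<in> set \<nu>" by (metis list.set_intros(1) set_mset_mset)
  then obtain xs ys where m: "\<nu> = xs @ i # ys" by (meson split_list)
  have ap: "Mr (us @ vs) * z = Mr us * (Mr vs * z)" for us vs z by (induction us) (simp_all add: mult.assoc)
  have "Mr \<mu> * z = Mr (xs @ ys) * z" by (rule Cons.IH) (use Cons.prems m in simp)
  then have "Mr (i # \<mu>) * z = M (int i) * (Mr xs * (Mr ys * z))" by (simp add: mult.assoc ap)
  also have "\<dots> = Mr xs * (M (int i) * (Mr ys * z))" by (rule Mr_M)
  also have "\<dots> = Mr \<nu> * z" unfolding m ap by (simp add: mult.assoc)
  finally show ?case .
qed simp

text \<open>
  The commutator of \<open>M\<^sub>n\<close> with \<open>L\<^sub>-\<^sub>i\<close>, which commutes with all \<open>M\<close>.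
\<close>

definition comm_ML :: "nat \<Rightarrow> nat \<Rightarrow> U22" where
  "comm_ML n i = scal (of_int (int n + int i)) * M (int n - int i) + (if n = i then scal (cocyc (int n)) * CM else 0)"

definition del :: "nat \<Rightarrow> nat list \<Rightarrow> nat list" where "del j \<mu> = take j \<mu> @ drop (Suc j) \<mu>"

lemma M_comm_ML: "M k * (comm_ML n i * z) = comm_ML n i * (M k * z)"
proof -
  have "M k * (CM * z) = CM * (M k * z)" by (metis CM_comm mult.assoc)
  then show ?thesis by (simp add: comm_ML_def distrib_left distrib_right mult.assoc M_scal MM_app[of k "int n - int i"])
qed

lemma M_Lneg: "M (int n) * (L (- int i) * z) = L (- int i) * (M (int n) * z) + comm_ML n i * z"
  using M_L_app[of "int n" "- int i" z] by (simp add: comm_ML_def distrib_right mult.assoc)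

text \<open>
  Since the commutators commute with the \<open>M\<close>, moving \<open>L\<^sub>-\<^sub>i\<close> through a product of \<open>M\<close> uses up exactly one factor per term.
\<close>

lemma Mr_L: "Mr \<mu> * (L (- int i) * z) = L (- int i) * (Mr \<mu> * z) + (\<Sum>j<length \<mu>. comm_ML (\<mu> ! j) i * (Mr (del j \<mu>) * z))"
proof (induction \<mu>)
  case (Cons n \<mu>)
  have "Mr (n # \<mu>) * (L (- int i) * z) = M (int n) * (Mr \<mu> * (L (- int i) * z))" by (simp add: mult.assoc)
  also have "\<dots> = M (int n) * (L (- int i) * (Mr \<mu> * z)) + (\<Sum>j<length \<mu>. comm_ML (\<mu> ! j) i * (M (int n) * (Mr (del j \<mu>) * z)))"
    unfolding Cons by (simp add: distrib_left sum_distrib_left M_comm_ML)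
  also have "\<dots> = L (- int i) * (Mr (n # \<mu>) * z) + (comm_ML n i * (Mr \<mu> * z) + (\<Sum>j<length \<mu>. comm_ML (\<mu> ! j) i * (M (int n) * (Mr (del j \<mu>) * z))))"
    by (simp add: M_Lneg mult.assoc add.assoc)
  also have "comm_ML n i * (Mr \<mu> * z) + (\<Sum>j<length \<mu>. comm_ML (\<mu> ! j) i * (M (int n) * (Mr (del j \<mu>) * z)))
     = (\<Sum>j<length (n # \<mu>). comm_ML ((n # \<mu>) ! j) i * (Mr (del j (n # \<mu>)) * z))"
    by (simp add: sum.lessThan_Suc_shift del_def mult.assoc del: sum.lessThan_Suc)
  finally show ?case .
qed simp

lemma del_props:
  assumes "j < length \<mu>"
  shows "Suc (length (del j \<mu>)) = length \<mu>" "pos \<mu> \<Longrightarrow> pos (del j \<mu>)" "sum_list (del j \<mu>) + \<mu> ! j = sum_list \<mu>"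
    "mset (del j \<mu>) = mset (remove1 (\<mu> ! j) \<mu>)"
proof -
  have m: "\<mu> = take j \<mu> @ \<mu> ! j # drop (Suc j) \<mu>" using assms by (rule id_take_nth_drop)
  show "Suc (length (del j \<mu>)) = length \<mu>" using assms by (simp add: del_def)
  show "pos \<mu> \<Longrightarrow> pos (del j \<mu>)" by (auto simp: del_def dest: in_set_takeD in_set_dropD)
  show "sum_list (del j \<mu>) + \<mu> ! j = sum_list \<mu>" using arg_cong[OF m, of sum_list] by (simp add: del_def)
  show "mset (del j \<mu>) = mset (remove1 (\<mu> ! j) \<mu>)" using arg_cong[OF m, of mset] by (simp add: del_def)
qed

text \<open>
  Each \<open>L\<^sub>-\<^sub>i\<close> uses up at most one \<open>M\<close>, so a positive \<open>M\<close> is left over and reaches \<open>x\<close>.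
\<close>

lemma Mr_many: "pos \<mu> \<Longrightarrow> x \<in> Kinf \<Longrightarrow> length \<alpha> < length \<mu> \<Longrightarrow> Mr \<mu> * (Ln \<alpha> * x) \<in> N"
proof (induction \<alpha> arbitrary: \<mu>)
  case Nil
  then obtain n \<mu>' where m: "\<mu> = n # \<mu>'" by (cases \<mu>) auto
  have "M (int n) * x \<approx>\<^bsub>N\<^esub> 0" using Kinf_mvac[OF Nil(2)] Nil(1) m by (simp add: mvac_def)
  then have "M (int n) * x \<in> N" by (simp add: eqm_0_iff[OF N_sub])
  then have "Mr \<mu>' * (M (int n) * x) \<in> N" by (rule left_ideal_mult[OF N_left])
  then show ?case by (simp add: m mult.assoc Mr_M)
next
  case (Cons i \<alpha>)
  have 1: "L (- int i) * (Mr \<mu> * (Ln \<alpha> * x)) \<in> N" using Cons by (intro left_ideal_mult[OF N_left] Cons.IH) auto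
  have 2: "comm_ML (\<mu> ! j) i * (Mr (del j \<mu>) * (Ln \<alpha> * x)) \<in> N" if "j \<in> {..<length \<mu>}" for j
    using del_props[of j \<mu>] Cons.prems that by (intro left_ideal_mult[OF N_left] Cons.IH) auto
  have "Mr \<mu> * (L (- int i) * (Ln \<alpha> * x)) \<in> N"
    unfolding Mr_L by (rule U.subspace_add[OF N_sub 1 U.subspace_sum[OF N_sub 2]])
  then show ?case by (simp add: mult.assoc)
qed

lemma sum_count: "(\<Sum>j<length \<mu>. if \<mu> ! j = i then y else 0) = scal (of_nat (count_list \<mu> i)) * y"
proof (induction \<mu>)
  case (Cons n \<mu>)
  then show ?case by (simp add: sum.lessThan_Suc_shift scal_add distrib_right del: sum.lessThan_Suc)
qed simp

text \<open>
  Each \<open>L\<^sub>-\<^sub>i\<close> must meet its own \<open>M\<^sub>n\<close>. Meeting one with \<open>n > i\<close> leaves a positive mode \<open>M\<^bsub>n-i\<^esub>\<close>, which gives zero; meeting one with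
  \<open>n < i\<close> leaves a list with too large a sum. So nothing survives unless the two lists agree up to order, and then the value
  is a product of numbers \<open>phi i\<close>, up to a nonzero multiplicity.
\<close>

lemma Mr_pair:
  "pos \<mu> \<Longrightarrow> pos \<alpha> \<Longrightarrow> length \<mu> = length \<alpha> \<Longrightarrow> sum_list \<alpha> \<le> sum_list \<mu> \<Longrightarrow>
    \<exists>s. (\<forall>x\<in>Kinf. Mr \<mu> * (Ln \<alpha> * x) \<approx>\<^bsub>N\<^esub> scal s * x) \<and> (mset \<mu> \<noteq> mset \<alpha> \<longrightarrow> s = 0) \<and> (mset \<mu> = mset \<alpha> \<and> p \<notin> set \<alpha> \<longrightarrow> s \<noteq> 0)"
proof (induction \<alpha> arbitrary: \<mu>)
  case Nil
  then show ?case by (intro exI[of _ 1]) simp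
next
  case (Cons i \<alpha>)
  have i: "i \<ge> 1" "pos \<alpha>" using Cons.prems by auto
  let ?\<mu>' = "remove1 i \<mu>"
  have "\<exists>s'. i \<in> set \<mu> \<longrightarrow> (\<forall>x\<in>Kinf. Mr ?\<mu>' * (Ln \<alpha> * x) \<approx>\<^bsub>N\<^esub> scal s' * x) \<and> (mset ?\<mu>' \<noteq> mset \<alpha> \<longrightarrow> s' = 0) \<and> (mset ?\<mu>' = mset \<alpha> \<and> p \<notin> set \<alpha> \<longrightarrow> s' \<noteq> 0)"
  proof (cases "i \<in> set \<mu>")
    case True
    have "pos ?\<mu>'" using Cons.prems(1) set_remove1_subset[of i \<mu>] by blast
    moreover have "length ?\<mu>' = length \<alpha>" using Cons.prems True by (simp add: length_remove1)
    moreover have "sum_list \<alpha> \<le> sum_list ?\<mu>'" using Cons.prems sum_list_map_remove1[OF True, of "\<lambda>x. x"] by simp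
    ultimately have "\<exists>s. (\<forall>x\<in>Kinf. Mr ?\<mu>' * (Ln \<alpha> * x) \<approx>\<^bsub>N\<^esub> scal s * x) \<and> (mset ?\<mu>' \<noteq> mset \<alpha> \<longrightarrow> s = 0) \<and> (mset ?\<mu>' = mset \<alpha> \<and> p \<notin> set \<alpha> \<longrightarrow> s \<noteq> 0)"
      by (intro Cons.IH i)
    then show ?thesis using True by (simp only: simp_thms)
  qed simp
  then obtain s' where s': "i \<in> set \<mu> \<Longrightarrow> \<forall>x\<in>Kinf. Mr ?\<mu>' * (Ln \<alpha> * x) \<approx>\<^bsub>N\<^esub> scal s' * x"
    "i \<in> set \<mu> \<Longrightarrow> mset ?\<mu>' \<noteq> mset \<alpha> \<Longrightarrow> s' = 0" "i \<in> set \<mu> \<Longrightarrow> mset ?\<mu>' = mset \<alpha> \<Longrightarrow> p \<notin> set \<alpha> \<Longrightarrow> s' \<noteq> 0"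
    by (elim exE) (use that in iprover)
  define s where "s = of_nat (count_list \<mu> i) * (s' * phi (int i))"
  have "Mr \<mu> * (Ln (i # \<alpha>) * x) \<approx>\<^bsub>N\<^esub> scal s * x" if x: "x \<in> Kinf" for x
  proof -
    let ?z = "Ln \<alpha> * x"
    have summand: "comm_ML (\<mu> ! j) i * (Mr (del j \<mu>) * ?z) \<approx>\<^bsub>N\<^esub> (if \<mu> ! j = i then scal (s' * phi (int i)) * x else 0)" if j: "j \<in> {..<length \<mu>}" for j
    proof -
      have jl: "j < length \<mu>" using j by simp
      note d = del_props[OF jl]
      have ld: "length (del j \<mu>) = length \<alpha>" and pd: "pos (del j \<mu>)" using d Cons.prems by auto
      \<comment> \<open>The three possible encounters of \<open>L\<^sub>-\<^sub>i\<close> with the factor at position \<open>j\<close>.\<close>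
      consider (gt) "\<mu> ! j > i" | (eq) "\<mu> ! j = i" | (lt) "\<mu> ! j < i" by linarith
      then show ?thesis
      proof cases
        case gt
        have "Mr ((\<mu> ! j - i) # del j \<mu>) * ?z \<in> N" using gt pd ld x by (intro Mr_many) auto
        then have "M (int (\<mu> ! j) - int i) * (Mr (del j \<mu>) * ?z) \<in> N" using gt by (simp add: mult.assoc of_nat_diff)
        then have "scal (of_int (int (\<mu> ! j) + int i)) * (M (int (\<mu> ! j) - int i) * (Mr (del j \<mu>) * ?z)) \<in> N" by (rule U.subspace_scale[OF N_sub])
        moreover have "comm_ML (\<mu> ! j) i * (Mr (del j \<mu>) * ?z) = scal (of_int (int (\<mu> ! j) + int i)) * (M (int (\<mu> ! j) - int i) * (Mr (del j \<mu>) * ?z))"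
          using gt by (simp add: comm_ML_def mult.assoc)
        ultimately have "comm_ML (\<mu> ! j) i * (Mr (del j \<mu>) * ?z) \<in> N" by (simp only:)
        then have "comm_ML (\<mu> ! j) i * (Mr (del j \<mu>) * ?z) \<approx>\<^bsub>N\<^esub> 0" by (rule eqm_base0)
        then show ?thesis using gt by simp
      next
        case eq
        have im: "i \<in> set \<mu>" using eq jl nth_mem by metis
        have "Mr (del j \<mu>) * ?z = Mr ?\<mu>' * ?z" using d(4) eq by (intro Mr_perm) simp
        also have "\<dots> \<approx>\<^bsub>N\<^esub> scal s' * x" by (rule bspec[OF s'(1)[OF im] x])
        finally have "comm_ML i i * (Mr (del j \<mu>) * ?z) \<approx>\<^bsub>N\<^esub> comm_ML i i * (scal s' * x)" by (rule eqm_lmult[OF N_left])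
        also have "\<dots> = scal s' * (scal (of_int (int i + int i)) * (M (int i - int i) * x) + (if int i = int i then scal (cocyc (int i)) * (CM * x) else 0))"
          unfolding scal_left_commute[of "comm_ML i i"] by (simp add: comm_ML_def distrib_right mult.assoc)
        also have "\<dots> \<approx>\<^bsub>N\<^esub> scal s' * (EM (int i) (int i) * x)"
          using i by (intro eqm_scal commute_M_mvac[OF N_sub Kinf_mvac[OF x]]) auto
        also have "\<dots> = scal (s' * phi (int i)) * x" by (simp add: EM_def)
        finally show ?thesis using eq by simp
      next
        case lt
        have "sum_list \<alpha> < sum_list (del j \<mu>)" using d(3) lt Cons.prems(4) by simp
        then have ms: "mset (del j \<mu>) \<noteq> mset \<alpha>" and le': "sum_list \<alpha> \<le> sum_list (del j \<mu>)"
          by (auto dest: arg_cong[of _ _ sum_mset] simp: sum_mset_sum_list)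
        obtain t where t: "\<forall>x\<in>Kinf. Mr (del j \<mu>) * (Ln \<alpha> * x) \<approx>\<^bsub>N\<^esub> scal t * x" "mset (del j \<mu>) \<noteq> mset \<alpha> \<longrightarrow> t = 0"
          using Cons.IH[OF pd i(2) ld le'] by (elim exE conjE)
        have "t = 0" using t(2) ms by (rule mp)
        then have "Mr (del j \<mu>) * ?z \<approx>\<^bsub>N\<^esub> scal 0 * x" using bspec[OF t(1) x] by (simp only:)
        then have "comm_ML (\<mu> ! j) i * (Mr (del j \<mu>) * ?z) \<approx>\<^bsub>N\<^esub> comm_ML (\<mu> ! j) i * (scal 0 * x)" by (rule eqm_lmult[OF N_left])
        then show ?thesis using lt by simp
      qed
    qed
    have "Mr \<mu> * ?z \<in> N" using Cons.prems x by (intro Mr_many) auto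
    then have 1: "L (- int i) * (Mr \<mu> * ?z) \<approx>\<^bsub>N\<^esub> 0" by (rule eqm_base0[OF left_ideal_mult[OF N_left]])
    have "Mr \<mu> * (Ln (i # \<alpha>) * x) = L (- int i) * (Mr \<mu> * ?z) + (\<Sum>j<length \<mu>. comm_ML (\<mu> ! j) i * (Mr (del j \<mu>) * ?z))"
      using Mr_L[of \<mu> i ?z] by (simp add: mult.assoc)
    also have "\<dots> \<approx>\<^bsub>N\<^esub> 0 + (\<Sum>j<length \<mu>. if \<mu> ! j = i then scal (s' * phi (int i)) * x else 0)"
      by (intro eqm_add 1 eqm_sum summand)
    also have "\<dots> = scal s * x" unfolding sum_count s_def by simp
    finally show ?thesis .
  qed
  moreover have "s = 0" if "mset \<mu> \<noteq> mset (i # \<alpha>)"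
  proof (cases "i \<in> set \<mu>")
    case True
    then have "mset ?\<mu>' \<noteq> mset \<alpha>" using that by (metis in_multiset_in_set insert_DiffM mset.simps(2) mset_remove1)
    then show ?thesis using s'(2)[OF True] by (simp add: s_def)
  qed (simp add: s_def)
  moreover have "s \<noteq> 0" if m: "mset \<mu> = mset (i # \<alpha>)" "p \<notin> set (i # \<alpha>)"
  proof -
    have im: "i \<in> set \<mu>" using m(1) by (metis list.set_intros(1) set_mset_mset)
    have "mset ?\<mu>' = mset \<alpha>" using m(1) by simp
    then have "s' \<noteq> 0" using s'(3)[OF im] m by simp
    moreover have "count_list \<mu> i \<noteq> 0" using im by (simp add: count_list_0_iff)
    moreover have "phi (int i) \<noteq> 0" using i m by (intro phi_nz) auto
    ultimately show ?thesis by (simp add: s_def)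
  qed
  ultimately have "(\<forall>x\<in>Kinf. Mr \<mu> * (Ln (i # \<alpha>) * x) \<approx>\<^bsub>N\<^esub> scal s * x) \<and> (mset \<mu> \<noteq> mset (i # \<alpha>) \<longrightarrow> s = 0) \<and> (mset \<mu> = mset (i # \<alpha>) \<and> p \<notin> set (i # \<alpha>) \<longrightarrow> s \<noteq> 0)"
    by (intro conjI ballI impI) (simp_all only: simp_thms)
  then show ?case by (rule exI)
qed

text \<open>
  If \<open>w\<close> had a term \<open>L\<^sub>-\<^sub>\<mu> f\<^sub>\<mu>\<close> with nonempty \<open>\<mu>\<close>, choose \<open>\<mu>\<close> of maximal length and, among those, of maximal sum. The product
  \<open>M\<^sub>\<mu>\<close> annihilates \<open>w\<close> and all other terms, so \<open>f\<^sub>\<mu> \<in> N\<close> and the term can be removed.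
\<close>

lemma M_singular_sum:
  "finite A \<Longrightarrow> A \<subseteq> (\<Union>w. pfree w) \<Longrightarrow> \<forall>\<alpha>. f \<alpha> \<in> Kinf \<Longrightarrow> w = (\<Sum>\<alpha>\<in>A. Ln \<alpha> * f \<alpha>) \<Longrightarrow>
   \<forall>n\<ge>1. M n * w \<in> N \<Longrightarrow> w \<in> Kinf"
proof (induction "card A" arbitrary: A w rule: less_induct)
  case less
  show ?case
  proof (cases "A \<subseteq> {[]}")
    case True
    then have "A = {} \<or> A = {[]}" by auto
    then show ?thesis using less.prems U.subspace_0[OF Kinf_sub] by auto
  next
    case False
    define l where "l = Max (length ` A)"
    define A' where "A' = {\<alpha> \<in> A. length \<alpha> = l}"
    have fA: "finite A" and fA': "finite A'" using less.prems by (auto simp: A'_def)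
    have "l \<in> length ` A" unfolding l_def using fA False by (intro Max_in) auto
    then have "A' \<noteq> {}" by (auto simp: A'_def)
    then have "Max (sum_list ` A') \<in> sum_list ` A'" using fA' by (intro Max_in) auto
    then obtain \<mu> where mu: "\<mu> \<in> A'" "sum_list \<mu> = Max (sum_list ` A')" by auto
    have muA: "\<mu> \<in> A" "length \<mu> = l" using mu by (auto simp: A'_def)
    have le: "length \<alpha> \<le> length \<mu>" if "\<alpha> \<in> A" for \<alpha> using that fA muA by (simp add: l_def)
    have sle: "sum_list \<alpha> \<le> sum_list \<mu>" if "\<alpha> \<in> A" "length \<alpha> = length \<mu>" for \<alpha>
      unfolding mu(2) using that fA' muA by (intro Max_ge) (auto simp: A'_def)
    obtain w0 where w0: "\<mu> \<in> pfree w0" using muA less.prems by blast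
    obtain \<beta> where b: "\<beta> \<in> A" "\<beta> \<noteq> []" using False by auto
    then have "length \<mu> \<ge> 1" using le[of \<beta>] by (cases \<beta>) auto
    then obtain n \<mu>' where m: "\<mu> = n # \<mu>'" by (cases \<mu>) auto
    have "M (int n) * w \<in> N" using less.prems(5) pfreeD[OF w0] m by auto
    then have "Mr \<mu>' * (M (int n) * w) \<in> N" by (rule left_ideal_mult[OF N_left])
    then have Nw: "Mr \<mu> * w \<in> N" by (simp add: m mult.assoc Mr_M)
    \<comment> \<open>\<open>s \<noteq> 0\<close> because \<open>\<mu>\<close> has no part \<open>p\<close>.\<close>
    obtain s where s: "\<And>x. x \<in> Kinf \<Longrightarrow> Mr \<mu> * (Ln \<mu> * x) \<approx>\<^bsub>N\<^esub> scal s * x" "s \<noteq> 0"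
      using Mr_pair[of \<mu> \<mu>] pfreeD[OF w0] by auto
    have summand: "Mr \<mu> * (Ln \<alpha> * f \<alpha>) \<approx>\<^bsub>N\<^esub> (if \<alpha> = \<mu> then scal s * f \<mu> else 0)" if a: "\<alpha> \<in> A" for \<alpha>
    proof -
      obtain w1 where w1: "\<alpha> \<in> pfree w1" using a less.prems by blast
      consider "\<alpha> = \<mu>" | "\<alpha> \<noteq> \<mu>" "length \<alpha> < length \<mu>" | "\<alpha> \<noteq> \<mu>" "length \<alpha> = length \<mu>" using le[OF a] by linarith
      then show ?thesis
      proof cases
        case 1
        then show ?thesis using s(1) less.prems by simp
      next
        case 2
        then have "Mr \<mu> * (Ln \<alpha> * f \<alpha>) \<in> N" using pfreeD[OF w0] less.prems by (intro Mr_many) auto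
        then show ?thesis using 2 by (simp add: eqm_base0)
      next
        case 3
        have ms: "mset \<mu> \<noteq> mset \<alpha>" using pfree_mset[OF w0 w1] 3 by auto
        have pos2: "pos \<mu>" "pos \<alpha>" using pfreeD[OF w0] pfreeD[OF w1] by auto
        obtain t where t: "\<forall>x\<in>Kinf. Mr \<mu> * (Ln \<alpha> * x) \<approx>\<^bsub>N\<^esub> scal t * x" "mset \<mu> \<noteq> mset \<alpha> \<longrightarrow> t = 0"
          using Mr_pair[OF pos2 3(2)[symmetric] sle[OF a 3(2)]] by (elim exE conjE)
        have "t = 0" using t(2) ms by (rule mp)
        then have "Mr \<mu> * (Ln \<alpha> * f \<alpha>) \<approx>\<^bsub>N\<^esub> scal 0 * f \<alpha>"
          using bspec[OF t(1) spec[OF less.prems(3)], of \<alpha>] by (simp only:)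
        then show ?thesis using 3 by simp
      qed
    qed
    have "Mr \<mu> * w = (\<Sum>\<alpha>\<in>A. Mr \<mu> * (Ln \<alpha> * f \<alpha>))" by (simp add: less.prems(4) sum_distrib_left)
    also have "\<dots> \<approx>\<^bsub>N\<^esub> (\<Sum>\<alpha>\<in>A. if \<alpha> = \<mu> then scal s * f \<mu> else 0)" by (rule eqm_sum[OF summand])
    also have "\<dots> = scal s * f \<mu>" using fA muA by simp
    finally have "scal s * f \<mu> \<in> N" using Nw eqm_mem[OF N_sub eqm_sym] by blast
    then have "scal (inverse s) * (scal s * f \<mu>) \<in> N" by (rule U.subspace_scale[OF N_sub])
    then have fN: "Ln \<mu> * f \<mu> \<in> N" using s(2) by (intro left_ideal_mult[OF N_left]) simp
    define w' where "w' = (\<Sum>\<alpha>\<in>A - {\<mu>}. Ln \<alpha> * f \<alpha>)"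
    have w': "w = Ln \<mu> * f \<mu> + w'" using less.prems(4) fA muA by (simp add: w'_def sum.remove)
    have "w' \<in> Kinf"
    proof (rule less.hyps[OF _ _ _ less.prems(3) w'_def])
      show "card (A - {\<mu>}) < card A" using fA muA(1) by (rule card_Diff1_less)
      show "\<forall>n\<ge>1. M n * w' \<in> N"
      proof (intro allI impI)
        fix n :: int assume "n \<ge> 1"
        then have "M n * w - M n * (Ln \<mu> * f \<mu>) \<in> N"
          using less.prems(5) fN by (intro U.subspace_diff[OF N_sub] left_ideal_mult[OF N_left fN]) auto
        then show "M n * w' \<in> N" by (simp add: w' distrib_left)
      qed
    qed (use fA less.prems in auto)
    then show ?thesis unfolding w' using N_Kinf[OF fN] by (intro U.subspace_add[OF Kinf_sub])
  qed
qed

lemma M_singular: "\<forall>n\<ge>1. M n * w \<in> N \<Longrightarrow> \<exists>k. w \<in> K k"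
proof -
  assume h: "\<forall>n\<ge>1. M n * w \<in> N"
  obtain l where "w \<in> LK l" using ex_LK by blast
  then obtain A f where "finite A" "A \<subseteq> (\<Union>w. pfree w)" "\<forall>\<alpha>. f \<alpha> \<in> Kinf" "w = (\<Sum>\<alpha>\<in>A. Ln \<alpha> * f \<alpha>)" using LK_rep by blast
  then have "w \<in> Kinf" by (rule M_singular_sum[OF _ _ _ _ h])
  then show ?thesis by (simp add: Kinf_def)
qed

end

section \<open>Weight decompositions\<close>

text \<open>
  Apply \<open>L\<^sub>0 - (h + n)\<close> to remove the component of index \<open>n\<close>, as in the proof that eigenvectors for distinct eigenvalues are independent.
\<close>

lemma weight_components:
  assumes X: "left_ideal X"
  shows "finite A \<Longrightarrow> (\<And>m. L 0 * v m \<approx>\<^bsub>X\<^esub> scal (h + of_int m) * v m) \<Longrightarrow> sum v A \<approx>\<^bsub>X\<^esub> 0 \<Longrightarrow> m \<in> A \<Longrightarrow> v m \<approx>\<^bsub>X\<^esub> 0"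
proof (induction A arbitrary: v m rule: finite_induct)
  case (insert n A)
  let ?x = "sum v (insert n A)" and ?e = "h + of_int n"
  have x: "?x = v n + sum v A" using insert.hyps by simp
  have 1: "L 0 * ?x \<approx>\<^bsub>X\<^esub> L 0 * 0" by (rule eqm_lmult[OF X insert.prems(2)])
  have 2: "scal ?e * ?x \<approx>\<^bsub>X\<^esub> scal ?e * 0" by (rule eqm_scal[OF insert.prems(2)])
  have 3: "L 0 * ?x \<approx>\<^bsub>X\<^esub> scal ?e * v n + (\<Sum>m\<in>A. scal (h + of_int m) * v m)"
    unfolding x distrib_left sum_distrib_left by (rule eqm_add[OF insert.prems(1) eqm_sum[OF insert.prems(1)]])
  have 4: "scal (of_int (m - n)) * v m = scal (h + of_int m) * v m - scal ?e * v m" for m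
    by (simp flip: U.scale_left_diff_distrib)
  have "(\<Sum>m\<in>A. scal (of_int (m - n)) * v m) = (scal ?e * v n + (\<Sum>m\<in>A. scal (h + of_int m) * v m)) - scal ?e * ?x"
    unfolding x 4 by (simp add: distrib_left sum_distrib_left sum_subtractf)
  also have "\<dots> \<approx>\<^bsub>X\<^esub> L 0 * ?x - scal ?e * 0" by (rule eqm_diff[OF eqm_sym[OF 3] 2])
  also have "\<dots> \<approx>\<^bsub>X\<^esub> L 0 * 0 - scal ?e * 0" by (rule eqm_diff[OF 1 eqm_refl])
  finally have s: "(\<Sum>m\<in>A. scal (of_int (m - n)) * v m) \<approx>\<^bsub>X\<^esub> 0" by simp
  have e: "L 0 * (scal (of_int (m - n)) * v m) \<approx>\<^bsub>X\<^esub> scal (h + of_int m) * (scal (of_int (m - n)) * v m)" for m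
    using eqm_scal[OF insert.prems(1)[of m], of "of_int (m - n)"] by (simp only: L_scal scal_left_commute[of "scal (h + of_int m)"])
  have A0: "v m \<approx>\<^bsub>X\<^esub> 0" if "m \<in> A" for m
  proof -
    have mn: "m \<noteq> n" using that insert.hyps by auto
    have "scal (of_int (m - n)) * v m \<approx>\<^bsub>X\<^esub> 0" using e s that by (rule insert.IH)
    then have "scal (1 / of_int (m - n)) * (scal (of_int (m - n)) * v m) \<approx>\<^bsub>X\<^esub> scal (1 / of_int (m - n)) * 0" by (rule eqm_scal)
    then show ?thesis using mn by (simp del: of_int_diff)
  qed
  have "?x - sum v A \<approx>\<^bsub>X\<^esub> 0 - (\<Sum>m\<in>A. 0)" by (rule eqm_diff[OF insert.prems(2) eqm_sum[OF A0]])
  then have "v n \<approx>\<^bsub>X\<^esub> 0" using x by simp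
  then show ?case using A0 insert.prems(3) by blast
qed simp

lemma graded_span:
  assumes B: "\<And>m. U.subspace (B m)"
  shows "x \<in> U.span (\<Union>m. B m) \<Longrightarrow> \<exists>A v. finite A \<and> (\<forall>m. v m \<in> B m) \<and> x = sum v A"
proof (induction rule: U.span_induct_alt)
  case base
  show ?case using U.subspace_0[OF B] by (intro exI[of _ "{}"] exI[of _ "\<lambda>_. 0"]) simp
next
  case (step c b y)
  then obtain A v n where v: "finite A" "\<forall>m. v m \<in> B m" "y = sum v A" and b: "b \<in> B n" by auto
  define v' where "v' = v(n := (if n \<in> A then v n else 0) + scal c * b)"
  have "sum v' (insert n A) = v' n + sum v' (A - {n})" using v(1) by (simp add: sum.insert_remove)
  also have "sum v' (A - {n}) = sum v (A - {n})" by (rule sum.cong) (auto simp: v'_def)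
  also have "v' n + sum v (A - {n}) = scal c * b + y" using v(1) by (simp add: v'_def v(3) sum.remove)
  finally have "scal c * b + y = sum v' (insert n A)" by (rule sym)
  moreover have "v' m \<in> B m" for m
    using v(2) b U.subspace_0[OF B] by (auto simp: v'_def intro!: U.subspace_add[OF B] U.subspace_scale[OF B])
  ultimately show ?case using v(1) by (intro exI[of _ "insert n A"] exI[of _ v']) simp
qed

text \<open>
  Applying \<open>L\<^sub>0 - a\<close> to the decomposition of \<open>x\<close> shows that every component of another eigenvalue vanishes modulo \<open>X\<close>.
\<close>

lemma eigenvector_homogeneous:
  assumes X: "left_ideal X" and B: "\<And>m. U.subspace (B m)"
    and e: "\<And>m y. y \<in> B m \<Longrightarrow> L 0 * y \<approx>\<^bsub>X\<^esub> scal (h + of_int m) * y"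
    and x: "x \<approx>\<^bsub>X\<^esub> x'" "x' \<in> U.span (\<Union>m. B m)" and a: "L 0 * x \<approx>\<^bsub>X\<^esub> scal a * x"
  shows "x \<approx>\<^bsub>X\<^esub> 0 \<or> (\<exists>m y. a = h + of_int m \<and> y \<in> B m \<and> x \<approx>\<^bsub>X\<^esub> y)"
proof -
  obtain A v where v: "finite A" "\<forall>m. v m \<in> B m" "x' = sum v A" using graded_span[OF B x(2)] by blast
  have ev: "L 0 * v m \<approx>\<^bsub>X\<^esub> scal (h + of_int m) * v m" for m using e v(2) by blast
  let ?w = "\<lambda>m. scal (h + of_int m - a) * v m"
  have e': "L 0 * ?w m \<approx>\<^bsub>X\<^esub> scal (h + of_int m) * ?w m" for m
    using eqm_scal[OF ev[of m], of "h + of_int m - a"] by (simp only: L_scal scal_left_commute[of "scal (h + of_int m)"])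
  have "sum ?w A = (\<Sum>m\<in>A. scal (h + of_int m) * v m) - scal a * x'"
    by (simp add: v(3) sum_distrib_left U.scale_left_diff_distrib flip: sum_subtractf)
  also have "\<dots> \<approx>\<^bsub>X\<^esub> (\<Sum>m\<in>A. L 0 * v m) - scal a * x"
    by (rule eqm_diff[OF eqm_sum[OF eqm_sym[OF ev]] eqm_scal[OF eqm_sym[OF x(1)]]])
  also have "\<dots> = L 0 * x' - scal a * x" by (simp add: v(3) sum_distrib_left)
  also have "\<dots> \<approx>\<^bsub>X\<^esub> L 0 * x - scal a * x" by (rule eqm_diff[OF eqm_lmult[OF X eqm_sym[OF x(1)]] eqm_refl])
  also have "\<dots> \<approx>\<^bsub>X\<^esub> scal a * x - scal a * x" by (rule eqm_diff[OF a eqm_refl])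
  finally have s: "sum ?w A \<approx>\<^bsub>X\<^esub> 0" by simp
  have z: "v m \<approx>\<^bsub>X\<^esub> 0" if "m \<in> A" "a \<noteq> h + of_int m" for m
  proof -
    have "?w m \<approx>\<^bsub>X\<^esub> 0" using weight_components[OF X v(1) e' s that(1)] .
    then have "scal (1 / (h + of_int m - a)) * ?w m \<approx>\<^bsub>X\<^esub> scal (1 / (h + of_int m - a)) * 0" by (rule eqm_scal)
    then show ?thesis using that(2) by simp
  qed
  show ?thesis
  proof (cases "\<exists>n\<in>A. a = h + of_int n")
    case True
    then obtain n where n: "n \<in> A" "a = h + of_int n" by blast
    have "x' = v n + sum v (A - {n})" using v n by (simp add: sum.remove)
    also have "\<dots> \<approx>\<^bsub>X\<^esub> v n + (\<Sum>m\<in>A - {n}. 0)" using n(2) by (intro eqm_add[OF eqm_refl] eqm_sum z) auto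
    finally have "x' \<approx>\<^bsub>X\<^esub> v n" by simp
    then show ?thesis using n(2) v(2) eqm_trans[OF x(1)] by blast
  next
    case False
    then have "sum v A \<approx>\<^bsub>X\<^esub> (\<Sum>m\<in>A. 0)" by (intro eqm_sum z) auto
    then show ?thesis using eqm_trans[OF x(1)] v(3) by simp
  qed
qed

fun wg :: "w22_basis \<Rightarrow> int" where "wg (Lg n) = - n" | "wg (Mg n) = - n" | "wg _ = 0"

text \<open>
  The part of weight \<open>m\<close> of the enveloping algebra of the negative part.
\<close>

definition Bw :: "int \<Rightarrow> U22 set" where
  "Bw m = U.span {prod_list (map gen ws) | ws. (\<forall>g\<in>set ws. neg g) \<and> sum_list (map wg ws) = m}"

lemma Bw_sub: "U.subspace (Bw m)" by (simp add: Bw_def)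

lemma wg_neg: "\<forall>g\<in>set ws. neg g \<Longrightarrow> int (length ws) \<le> sum_list (map wg ws)"
proof (induction ws)
  case (Cons g ws)
  then show ?case by (cases g) auto
qed simp

lemma Bw_0: "y \<in> Bw 0 \<Longrightarrow> \<exists>a. y = scal a"
  unfolding Bw_def
proof (induction rule: U.span_induct_alt)
  case base
  show ?case by (intro exI[of _ 0]) simp
next
  case (step c b y)
  then obtain ws where ws: "b = prod_list (map gen ws)" "\<forall>g\<in>set ws. neg g" "sum_list (map wg ws) = 0" by auto
  have "ws = []" using wg_neg[OF ws(2)] ws(3) by simp
  then have "b = 1" using ws(1) by simp
  moreover obtain a where "y = scal a" using step by blast
  ultimately have "scal c * b + y = scal (c + a)" by (simp add: scal_add)
  then show ?case by (rule exI)
qed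

context w22_atypical
begin

lemma wt_gen: "neg g \<Longrightarrow> wt (wg g) (gen g)"
  by (cases g) (auto simp: gen_def wt_L wt_M)

lemma Bw_wt: "y \<in> Bw m \<Longrightarrow> wt m y"
  unfolding Bw_def
proof (induction rule: U.span_induct_alt)
  case (step c b y)
  then obtain ws where ws: "b = prod_list (map gen ws)" "\<forall>g\<in>set ws. neg g" "sum_list (map wg ws) = m" by auto
  have "wt (sum_list (map wg ws)) (prod_list (map gen ws))" using ws(2)
    by (induction ws) (auto intro: wt_1 wt_mult wt_gen)
  then show ?case using ws step by (auto intro: wt_add wt_scal)
qed (rule wt_0)

lemma NW_Bw: "NW 0 \<subseteq> U.span (\<Union>m. Bw m)"
  unfolding NW_def by (rule U.span_mono) (auto simp: Bw_def intro: U.span_base)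

lemma U_eigen:
  assumes "L 0 * x \<approx>\<^bsub>I\<^esub> scal a * x"
  shows "x \<in> I \<or> (\<exists>m y. a = hL + of_int m \<and> y \<in> Bw m \<and> x \<approx>\<^bsub>I\<^esub> y)"
proof -
  obtain x' where x': "x' \<in> NW 0" "x * 1 \<approx>\<^bsub>I\<^esub> x' * 1"
    using highest_weight_span'[OF VI_left order_refl _ VI_mvac(2,1), of x] eqm_base0[OF VI_gens(1)] by auto
  have e: "L 0 * y \<approx>\<^bsub>I\<^esub> scal (hL + of_int m) * y" if "y \<in> Bw m" for m y
    using wt_eigen[OF VI_left Bw_wt[OF that] VI_mvac(2)] by simp
  have "x \<approx>\<^bsub>I\<^esub> 0 \<or> (\<exists>m y. a = hL + of_int m \<and> y \<in> Bw m \<and> x \<approx>\<^bsub>I\<^esub> y)"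
    using x' NW_Bw by (intro eigenvector_homogeneous[OF VI_left Bw_sub e _ _ assms]) auto
  then show ?thesis by (simp only: eqm_0_iff[OF left_ideal_subspace[OF VI_left]])
qed

text \<open>
  Negative words have positive weight, except for the empty one.
\<close>

lemma U_eigen_0: "L 0 * x \<approx>\<^bsub>I\<^esub> scal hL * x \<Longrightarrow> in_vacuum_line I x"
proof -
  assume "L 0 * x \<approx>\<^bsub>I\<^esub> scal hL * x"
  from U_eigen[OF this] show ?thesis
  proof
    assume "x \<in> I"
    then show ?thesis unfolding in_vacuum_line_def by (intro exI[of _ 0]) simp
  next
    assume "\<exists>m y. hL = hL + of_int m \<and> y \<in> Bw m \<and> x \<approx>\<^bsub>I\<^esub> y"
    then obtain y where y: "y \<in> Bw 0" "x \<approx>\<^bsub>I\<^esub> y" by auto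
    then obtain a where "y = scal a" using Bw_0 by blast
    then show ?thesis using y(2) unfolding in_vacuum_line_def eqm_iff[OF left_ideal_subspace[OF VI_left]] by blast
  qed
qed

lemma MT_graded: "a \<in> MT \<Longrightarrow> a * TT0 ^ j \<in> U.span (\<Union>m. {b * TT0 ^ j | b. b \<in> UMi m})"
proof (induction rule: MS_induct)
  case (part \<nu>)
  have "M_part \<nu> \<in> UM (sum_list \<nu>)" using part by (simp add: UM_eq_MS MS_part)
  then show ?case using UM_UMi by (intro U.span_base) blast
qed (auto simp: distrib_right mult.assoc intro: U.span_zero U.span_add U.span_scale)

lemma K_graded: "x \<in> K k \<Longrightarrow> x \<in> U.span (\<Union>m. Kg k m)"
  unfolding K_def
proof (induction rule: KS_induct)
  case (N n)
  then show ?case using N_Kg by (intro U.span_base) blast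
next
  case (base j a)
  have "b * TT0 ^ j \<in> Kg k (m + int j * int p)" if "b \<in> UMi m" for b m
    using that base by (intro Kg_base) auto
  then have "U.span (\<Union>m. {b * TT0 ^ j | b. b \<in> UMi m}) \<subseteq> U.span (\<Union>m. Kg k m)" by (intro U.span_mono) blast
  then show ?case using MT_graded base by blast
qed (auto intro: U.span_add U.span_scale)

lemma Kg_eigen: "x \<in> Kg k m \<Longrightarrow> L 0 * x \<approx>\<^bsub>N\<^esub> scal (hL + of_int m) * x"
  unfolding Kg_def
proof (induction rule: KS_induct)
  case (N n)
  then have "L 0 * n \<approx>\<^bsub>N\<^esub> 0" "scal (hL + of_int m) * n \<approx>\<^bsub>N\<^esub> 0" by (rule eqm_base0[OF left_ideal_mult[OF N_left]])+
  then show ?case by (rule eqm_trans[OF _ eqm_sym])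
next
  case (base j a)
  have "wt m (a * TT0 ^ j)"
  proof (cases "m - int j * int p < 0")
    case True
    then show ?thesis using base by (simp add: UMi_def wt_0)
  next
    case False
    then have "wt (m - int j * int p) a" using base wt_UM[of a "nat (m - int j * int p)"] by (simp add: UMi_def)
    from wt_mult[OF this wt_Tpow[of j]] show ?thesis by simp
  qed
  then show ?case by (rule wt_eigen_N)
next
  case (add x y)
  show ?case unfolding distrib_left by (rule eqm_add[OF add])
next
  case (scal c x)
  show ?case unfolding L_scal scal_left_commute[of "scal (hL + of_int m)"] by (rule eqm_scal[OF scal])
qed

lemma K_eigen:
  assumes x: "x \<in> K k" and a: "L 0 * x \<approx>\<^bsub>N\<^esub> scal a * x"
  shows "x \<in> N \<or> (\<exists>m. a = hL + of_int m \<and> x \<in> Kg k m)"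
proof -
  have "x \<approx>\<^bsub>N\<^esub> 0 \<or> (\<exists>m y. a = hL + of_int m \<and> y \<in> Kg k m \<and> x \<approx>\<^bsub>N\<^esub> y)"
    by (rule eigenvector_homogeneous[OF N_left Kg_sub Kg_eigen eqm_refl K_graded[OF x] a])
  then show ?thesis
  proof
    assume "x \<approx>\<^bsub>N\<^esub> 0"
    then have "x \<in> N" by (simp only: eqm_0_iff[OF N_sub])
    then show ?thesis by (rule disjI1)
  next
    assume "\<exists>m y. a = hL + of_int m \<and> y \<in> Kg k m \<and> x \<approx>\<^bsub>N\<^esub> y"
    then obtain m y where y: "a = hL + of_int m" "y \<in> Kg k m" "x \<approx>\<^bsub>N\<^esub> y" by blast
    have "x - y \<in> Kg k m" using y(3) N_Kg by (auto simp: eqm_iff[OF N_sub])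
    then have "x \<in> Kg k m" using U.subspace_add[OF Kg_sub _ y(2), of "x - y"] by simp
    then show ?thesis using y(1) by blast
  qed
qed

section \<open>The submodule generated by all singular vectors\<close>

lemma I_sub: "U.subspace I" by (rule left_ideal_subspace[OF VI_left])

lemma M0_TT0: "M 0 * TT0 \<approx>\<^bsub>I\<^esub> scal hM * TT0 + Sv"
proof -
  have "M 0 * TT0 = M 0 * (TT sT * 1)" by (simp add: TT0_def)
  also have "\<dots> \<approx>\<^bsub>I\<^esub> TT sT * (M 0 * 1) + (if (0::int) = 0 then Sv * 1 else 0)" by (rule M_TT[OF VI_left VI_mvac(1)]) simp
  also have "\<dots> = TT0 * (M 0 * 1) + Sv" by (simp add: TT0_def)
  also have "\<dots> \<approx>\<^bsub>I\<^esub> TT0 * (scal hM * 1) + Sv"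
    using VI_mvac(1) by (intro eqm_add[OF eqm_lmult[OF VI_left] eqm_refl]) (simp add: mvac_def)
  finally show ?thesis by (simp add: scal_commute)
qed

text \<open>
  Otherwise \<open>T\<close> would be an eigenvector of \<open>M\<^sub>0\<close> in the Verma module, because \<open>M\<^sub>0 T = h\<^sub>M T + Sv\<close>.
\<close>

lemma Sv_notin_I: "Sv \<notin> I"
proof
  assume S: "Sv \<in> I"
  have "M 0 * TT0 \<approx>\<^bsub>I\<^esub> scal hM * TT0 + 0" by (rule eqm_trans[OF M0_TT0 eqm_add[OF eqm_refl eqm_base0[OF S]]])
  then have m: "M 0 * TT0 \<approx>\<^bsub>I\<^esub> scal hM * TT0" by simp
  have w: "TT0 \<approx>\<^bsub>I\<^esub> scal 1 * L (- int p) ^ 1 + (TT0 - L (- int p))" by simp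
  show False by (rule M0_not_semisimple[OF order_refl one_neq_zero T_NW w m])
qed

lemma scal_in_ideal: "left_ideal X \<Longrightarrow> 1 \<notin> X \<Longrightarrow> scal c \<in> X \<Longrightarrow> c = 0"
  using left_ideal_mult[of X "scal c" "scal (1 / c)"] by (cases "c = 0") (auto simp flip: scal_mult)

lemma Sv_not_vacuum: "\<not> in_vacuum_line I Sv"
proof
  assume "in_vacuum_line I Sv"
  then obtain a where a: "Sv \<approx>\<^bsub>I\<^esub> scal a" unfolding in_vacuum_line_def eqm_iff[OF I_sub, symmetric] by blast
  \<comment> \<open>Compare the eigenvalues \<open>h\<^sub>L + p\<close> and \<open>h\<^sub>L\<close> of \<open>L\<^sub>0\<close>.\<close>
  have "L 0 * Sv \<approx>\<^bsub>I\<^esub> L 0 * scal a" by (rule eqm_lmult[OF VI_left a])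
  also have "\<dots> = scal a * (L 0 * 1)" by (simp add: scal_commute)
  also have "\<dots> \<approx>\<^bsub>I\<^esub> scal a * (scal hL * 1)" by (rule eqm_scal[OF VI_mvac(2)])
  finally have 1: "L 0 * Sv \<approx>\<^bsub>I\<^esub> scal a * (scal hL * 1)" .
  have "scal (hL + of_nat p) * scal a \<approx>\<^bsub>I\<^esub> scal (hL + of_nat p) * Sv" by (rule eqm_scal[OF eqm_sym[OF a]])
  also have "\<dots> \<approx>\<^bsub>I\<^esub> L 0 * Sv" by (rule eqm_sym[OF Sv_hw(2)])
  also note 1
  finally have "scal (hL + of_nat p) * scal a - scal a * (scal hL * 1) \<in> I" by (simp only: eqm_iff[OF I_sub])
  then have "scal ((hL + of_nat p) * a - a * hL) \<in> I" by (simp add: scal_diff scal_mult)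
  then have "(hL + of_nat p) * a - a * hL = 0" by (rule scal_in_ideal[OF VI_left VI_1])
  then have "a = 0" using p1 by (simp add: algebra_simps)
  then show False using a Sv_notin_I by (simp add: eqm_0_iff[OF I_sub])
qed

lemma Sv_singular: "singular_mod I Sv"
proof -
  have e: "x * Sv - scal a * Sv \<in> I" if "x * Sv \<approx>\<^bsub>I\<^esub> scal a * Sv" for x a using that by (simp only: eqm_iff[OF I_sub])
  have z: "x * Sv \<in> I" if "x * Sv \<approx>\<^bsub>I\<^esub> 0" for x using that by (simp only: eqm_0_iff[OF I_sub])
  have m: "M 0 * Sv \<approx>\<^bsub>I\<^esub> scal hM * Sv" "\<And>n. n > 0 \<Longrightarrow> M n * Sv \<approx>\<^bsub>I\<^esub> 0" using Sv_hw(3) by (auto simp: mvac_def)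
  show ?thesis unfolding singular_mod_def eigenvector_mod_def
    using Sv_notin_I e[OF Sv_hw(2)] e[OF m(1)] e[OF central_eqm(1)[OF order_refl VI_left]] e[OF central_eqm(2)[OF order_refl VI_left]]
      z[OF Sv_hw(1)] z[OF m(2)] by blast
qed

text \<open>
  The coefficients have positive weight here, so they contain a factor \<open>M\<close>.
\<close>

lemma Kg_NW:
  assumes "x \<in> Kg j (int j * int p)"
  shows "\<exists>g\<in>NW 1. x \<approx>\<^bsub>I\<^esub> g"
  using assms unfolding Kg_def
proof (induction rule: KS_induct)
  case (N n)
  then show ?case by (rule N_NW)
next
  case (base i a)
  then have i: "i < j" and a: "a \<in> UMi ((int j - int i) * int p)" by (auto simp: left_diff_distrib)
  have pos: "(int j - int i) * int p > 0" using i p1 by simp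
  then have "a \<in> UM (nat ((int j - int i) * int p))" using a by (simp add: UMi_def)
  then have "a \<in> NW 1" by (rule UM_NW) (use pos in linarith)
  then have "a * TT0 ^ i \<in> NW (1 + 0)" by (rule NW_mult[OF _ Tpow_NW(2)])
  then show ?case by (intro bexI[of _ "a * TT0 ^ i"]) simp_all
next
  case (add x y)
  then obtain g h where "g \<in> NW 1" "x \<approx>\<^bsub>I\<^esub> g" "h \<in> NW 1" "y \<approx>\<^bsub>I\<^esub> h" by blast
  then show ?case by (intro bexI[of _ "g + h"] eqm_add U.subspace_add[OF NW_sub])
next
  case (scal c x)
  then obtain g where "g \<in> NW 1" "x \<approx>\<^bsub>I\<^esub> g" by blast
  then show ?case by (intro bexI[of _ "scal c * g"] eqm_scal U.subspace_scale[OF NW_sub])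
qed

text \<open>
  \<open>M_singular\<close> places \<open>w\<close> in the filtration, its eigenvalue places it in a single weight, and \<open>singular_in_K\<close> yields the leading term.
\<close>

lemma singular_shape:
  assumes n: "\<And>n. n > 0 \<Longrightarrow> L n * w \<in> N" "\<And>n. n > 0 \<Longrightarrow> M n * w \<in> N" and a: "L 0 * w \<approx>\<^bsub>N\<^esub> scal a * w"
  shows "w \<in> N \<or> (\<exists>j c. c \<noteq> 0 \<and> a = hL + of_nat (j * p) \<and> w - scal c * TT0 ^ j \<in> Kg j (int j * int p))"
proof -
  obtain k where k: "w \<in> K k" using M_singular[of w] n by auto
  show ?thesis
  proof (cases "w \<in> N")
    case False
    then obtain m where m: "a = hL + of_int m" "w \<in> Kg k m" using K_eigen[OF k a] by blast
    have "L n * w \<in> N" if "n \<ge> 1" for n using n(1)[of n] that by simp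
    from singular_in_K[OF this m(2)] False obtain j c where "c \<noteq> 0" "m = int j * int p" "w - scal c * TT0 ^ j \<in> Kg j m" by blast
    then show ?thesis using m(1) by (intro disjI2 exI[of _ j] exI[of _ c]) simp
  qed (rule disjI1)
qed

text \<open>
  The case \<open>j = 0\<close> of \<open>singular_shape\<close> is the highest weight vector itself, and \<open>j \<ge> 1\<close> contradicts the eigenvalue equation for \<open>M\<^sub>0\<close>.
\<close>

lemma singular_in_N:
  assumes s: "singular_mod I w" and v: "\<not> in_vacuum_line I w"
  shows "w \<in> N"
proof (rule ccontr)
  assume nN: "w \<notin> N"
  have n: "\<And>n. n > 0 \<Longrightarrow> L n * w \<in> N" "\<And>n. n > 0 \<Longrightarrow> M n * w \<in> N" using s I_N by (auto simp: singular_mod_def)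
  obtain a b where ab: "L 0 * w \<approx>\<^bsub>I\<^esub> scal a * w" "M 0 * w \<approx>\<^bsub>I\<^esub> scal b * w"
    using s unfolding singular_mod_def eigenvector_mod_def eqm_iff[OF I_sub] by blast
  from singular_shape[OF n eqm_mono[OF ab(1) I_N]] nN
  obtain j c where jc: "c \<noteq> 0" "a = hL + of_nat (j * p)" "w - scal c * TT0 ^ j \<in> Kg j (int j * int p)" by blast
  have "j \<noteq> 0" using v U_eigen_0[of w] ab(1) jc(2) by (cases "j = 0") auto
  then have j: "j \<ge> 1" by simp
  obtain g where g: "g \<in> NW 1" "w - scal c * TT0 ^ j \<approx>\<^bsub>I\<^esub> g" using Kg_NW[OF jc(3)] by blast
  \<comment> \<open>\<open>T\<^sup>j\<close> and \<open>L\<^sub>-\<^sub>p\<^sup>j\<close> differ by words that contain an \<open>M\<close>.\<close>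
  let ?g = "g + scal c * (TT0 ^ j - L (- int p) ^ j)"
  have "(w - scal c * TT0 ^ j) + scal c * TT0 ^ j \<approx>\<^bsub>I\<^esub> g + scal c * TT0 ^ j" by (rule eqm_add[OF g(2) eqm_refl])
  also have "\<dots> = scal c * L (- int p) ^ j + ?g" by (simp add: right_diff_distrib)
  finally have w: "w \<approx>\<^bsub>I\<^esub> scal c * L (- int p) ^ j + ?g" by simp
  have "?g \<in> NW 1" by (rule U.subspace_add[OF NW_sub g(1) U.subspace_scale[OF NW_sub Tpow_NW(1)]])
  from M0_not_semisimple[OF j jc(1) this w ab(2)] show False .
qed

lemma J_eq_N: "J' hL hM cL cM = N"
proof -
  have "left_ideal hull (I \<union> {u. singular_mod I u \<and> \<not> in_vacuum_line I u}) = N"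
  proof
    show "left_ideal hull (I \<union> {u. singular_mod I u \<and> \<not> in_vacuum_line I u}) \<subseteq> N"
      using I_N singular_in_N N_left by (intro hull_minimal) auto
    have "I \<union> {Sv} \<subseteq> left_ideal hull (I \<union> {u. singular_mod I u \<and> \<not> in_vacuum_line I u})"
      using Sv_singular Sv_not_vacuum by (intro order_trans[OF _ hull_subset]) auto
    then show "N \<subseteq> left_ideal hull (I \<union> {u. singular_mod I u \<and> \<not> in_vacuum_line I u})"
      unfolding N_def by (intro hull_minimal left_ideal_hull)
  qed
  then show ?thesis by (simp add: J'_def Let_def)
qed

section \<open>Existence and uniqueness of the subsingular vector\<close>

lemma Kg_coefficients: "x \<in> Kg k w \<Longrightarrow> \<exists>a. (\<forall>j<k. a j \<in> UMi (w - int j * int p)) \<and> x - (\<Sum>j<k. a j * TT0 ^ j) \<in> N"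
proof (induction k arbitrary: x)
  case 0
  then show ?case by (simp add: Kg_0)
next
  case (Suc k)
  obtain b where b: "b \<in> UMi (w - int k * int p)" "x - b * TT0 ^ k \<in> Kg k w" using Kg_top[OF Suc.prems] by blast
  obtain a where a: "\<forall>j<k. a j \<in> UMi (w - int j * int p)" "x - b * TT0 ^ k - (\<Sum>j<k. a j * TT0 ^ j) \<in> N" using Suc.IH[OF b(2)] by blast
  have "(\<Sum>j<k. (a(k := b)) j * TT0 ^ j) = (\<Sum>j<k. a j * TT0 ^ j)" by (rule sum.cong) auto
  then have "x - (\<Sum>j<Suc k. (a(k := b)) j * TT0 ^ j) = x - b * TT0 ^ k - (\<Sum>j<k. a j * TT0 ^ j)" by simp
  then have "x - (\<Sum>j<Suc k. (a(k := b)) j * TT0 ^ j) \<in> N" using a(2) by (simp only:)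
  moreover have "\<forall>j<Suc k. (a(k := b)) j \<in> UMi (w - int j * int p)" using a(1) b(1) by (auto simp: less_Suc_eq)
  ultimately show ?case by blast
qed

text \<open>
  A solution \<open>y\<close> of \<open>ex_subsingular\<close> with \<open>k = 0\<close> is changed by an element of \<open>N\<close> to the element \<open>u\<close> of the required form. The latter is exactly,
  not only modulo \<open>N\<close>, of weight \<open>r p\<close>, and so it is an eigenvector of \<open>L\<^sub>0\<close> in the Verma module itself.
\<close>

lemma subsingular_vector:
  assumes hr: "hL = h' p r cL" and r: "r \<ge> 1"
  shows "\<exists>v. (\<forall>i\<in>{1..r}. v i \<in> UM (i * p))
    \<and> (let u' = T p cL cM ^ r + (\<Sum>i=1..r. v i * T p cL cM ^ (r - i))
       in subsingular hL hM cL cM u'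
          \<and> (\<forall>w. subsingular hL hM cL cM w
                \<longrightarrow> (\<exists>a. w - scal a * u' \<in> J' hL hM cL cM)))"
proof -
  obtain y where y: "y - TT0 ^ r \<in> Kg r (int r * int p)" "\<And>n. n \<ge> 1 \<Longrightarrow> L n * y \<in> N"
    using ex_subsingular[OF hr r, of 0] by (auto simp: Kg_0)
  obtain a where a: "\<forall>j<r. a j \<in> UMi (int r * int p - int j * int p)" "y - TT0 ^ r - (\<Sum>j<r. a j * TT0 ^ j) \<in> N"
    using Kg_coefficients[OF y(1)] by blast
  define v where "v i = a (r - i)" for i
  define u where "u = TT0 ^ r + (\<Sum>i=1..r. v i * TT0 ^ (r - i))"
  have vU: "v i \<in> UM (i * p)" if i: "i \<in> {1..r}" for i
  proof -
    have "v i \<in> UMi (int r * int p - int (r - i) * int p)" using a(1) i unfolding v_def by (elim allE[of _ "r - i"] impE) auto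
    also have "int r * int p - int (r - i) * int p = int (i * p)" using i by (simp add: of_nat_diff left_diff_distrib)
    finally show ?thesis by (simp add: UMi_def del: of_nat_mult)
  qed
  have "(\<Sum>i=1..r. v i * TT0 ^ (r - i)) = (\<Sum>j<r. a j * TT0 ^ j)"
    by (rule sum.reindex_bij_witness[of _ "\<lambda>j. r - j" "\<lambda>i. r - i"]) (auto simp: v_def)
  then have yu: "y - u \<in> N" using a(2) by (simp add: u_def diff_diff_eq)
  have "y - u + (u - TT0 ^ r) = y - TT0 ^ r" by simp
  then have ur: "u - TT0 ^ r \<in> Kg r (int r * int p)"
    using U.subspace_diff[OF Kg_sub y(1) subsetD[OF N_Kg yu]] by simp
  have Lu: "L n * u \<in> N" if "n \<ge> 1" for n
    using U.subspace_diff[OF N_sub y(2)[OF that] left_ideal_mult[OF N_left yu, of "L n"]] by (simp add: right_diff_distrib)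
  have Kd: "u - TT0 ^ r \<in> K r" using ur Kg_K by blast
  have uK: "u \<notin> K r"
  proof
    assume "u \<in> K r"
    then have "u - (u - TT0 ^ r) \<in> K r" by (rule U.subspace_diff[OF K_sub _ Kd])
    then show False using Tpow_notin_K by simp
  qed
  have uN: "u \<notin> N" using uK N_K by blast
  have uv: "\<not> in_vacuum_line N u"
  proof
    assume "in_vacuum_line N u"
    then obtain c where c: "u - scal c \<in> N" by (auto simp: in_vacuum_line_def)
    \<comment> \<open>Scalars lie in the layer \<open>j = 0\<close>, which is below \<open>T\<^sup>r\<close> as \<open>r \<ge> 1\<close>.\<close>
    have "scal c * TT0 ^ 0 \<in> K r" by (rule K_base) (use r U.subspace_scale[OF MS_subspace MS_1, of "\<lambda>_. True" c] in auto)
    then have "(u - scal c) + scal c * TT0 ^ 0 \<in> K r" by (rule U.subspace_add[OF K_sub subsetD[OF N_K c]])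
    then show False using uK by simp
  qed
  have "TT0 ^ r + (u - TT0 ^ r) \<in> K (Suc r)"
    using K_base[of r "Suc r" 1] MS_1[of "\<lambda>_. True"] subsetD[OF K_mono Kd, of "Suc r"] by (intro U.subspace_add[OF K_sub]) auto
  then have uKS: "u \<in> K (Suc r)" by simp
  have uM: "mvac N u" by (rule M_K[OF uKS])
  have "wt (int r * int p) (v i * TT0 ^ (r - i))" if "i \<in> {1..r}" for i
  proof -
    have "wt (int (i * p) + int (r - i) * int p) (v i * TT0 ^ (r - i))" by (rule wt_mult[OF wt_UM[OF vU[OF that]] wt_Tpow])
    moreover have "int (i * p) + int (r - i) * int p = int r * int p" using that by (simp add: of_nat_diff left_diff_distrib)
    ultimately show ?thesis by (simp only:)
  qed
  then have uw: "wt (int r * int p) u" unfolding u_def by (intro wt_add wt_Tpow wt_sum)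
  have uI: "L 0 * u \<approx>\<^bsub>I\<^esub> scal (hL + of_int (int r * int p)) * u"
    using wt_eigen[OF VI_left uw VI_mvac(2)] by simp
  have e: "x * u - scal b * u \<in> N" if "x * u \<approx>\<^bsub>N\<^esub> scal b * u" for x b using that by (simp only: eqm_iff[OF N_sub])
  have uI': "L 0 * u - scal (hL + of_int (int r * int p)) * u \<in> I" using uI by (simp only: eqm_iff[OF I_sub])
  have m: "M 0 * u \<approx>\<^bsub>N\<^esub> scal hM * u" "\<And>n. n > 0 \<Longrightarrow> M n * u \<approx>\<^bsub>N\<^esub> 0" using uM by (auto simp: mvac_def)
  have mN: "M n * u \<in> N" if "n > 0" for n using m(2)[OF that] by (simp only: eqm_0_iff[OF N_sub])
  have lN: "L n * u \<in> N" if "n > 0" for n using Lu[of n] that by simp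
  have sing: "singular_mod N u" unfolding singular_mod_def eigenvector_mod_def
    using uN subsetD[OF I_N uI'] e[OF m(1)] e[OF central_eqm(1)[OF I_N N_left]] e[OF central_eqm(2)[OF I_N N_left]] mN lN by blast
  have sub: "subsingular hL hM cL cM u"
    using sing uv uI' uN I_N unfolding subsingular_def eigenvector_mod_def J_eq_N by blast
  have uniq: "\<exists>b. w - scal b * u \<in> N" if ws: "subsingular hL hM cL cM w" for w
  proof -
    have s: "singular_mod N w" and nv: "\<not> in_vacuum_line N w" using ws by (simp_all add: subsingular_def J_eq_N)
    have n: "\<And>n. n > 0 \<Longrightarrow> L n * w \<in> N" "\<And>n. n > 0 \<Longrightarrow> M n * w \<in> N" and wN: "w \<notin> N"
      using s by (auto simp: singular_mod_def eigenvector_mod_def)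
    obtain b where b: "L 0 * w \<approx>\<^bsub>N\<^esub> scal b * w" using s unfolding singular_mod_def eigenvector_mod_def eqm_iff[OF N_sub] by blast
    from singular_shape[OF n b] wN obtain j c where jc: "c \<noteq> 0" "w - scal c * TT0 ^ j \<in> Kg j (int j * int p)" by blast
    have Lw: "L n * w \<in> N" if "n \<ge> 1" for n using n(1)[of n] that by simp
    have "j \<noteq> 0"
    proof
      assume "j = 0"
      then have "w - scal c \<in> N" using jc(2) by (simp add: Kg_0)
      then show False using nv by (auto simp: in_vacuum_line_def)
    qed
    then have j: "j = r" by (intro singular_degree[OF hr Lw jc]) simp_all
    let ?d = "w - scal c * u"
    have "(w - scal c * TT0 ^ r) - scal c * (u - TT0 ^ r) \<in> Kg r (int r * int p)"
      using jc(2) unfolding j by (rule U.subspace_diff[OF Kg_sub _ U.subspace_scale[OF Kg_sub ur]])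
    then have d: "?d \<in> Kg r (int r * int p)" by (simp add: right_diff_distrib)
    have Ld: "L n * ?d \<in> N" if "n \<ge> 1" for n
      using U.subspace_diff[OF N_sub Lw[OF that] U.subspace_scale[OF N_sub Lu[OF that], of c]] by (simp add: right_diff_distrib L_scal)
    \<comment> \<open>The difference has no component along \<open>T\<^sup>r\<close>, and its weight \<open>r p\<close> excludes the other leading terms.\<close>
    have "int r * int p \<noteq> int i * int p" if "i < r" for i using that p1 by simp
    then have "?d \<in> N" using singular_in_K[OF Ld d] by blast
    then show ?thesis by (rule exI)
  qed
  show ?thesis unfolding T_TT0 J_eq_N Let_def
    by (rule exI[of _ v]) (use vU sub uniq in \<open>auto simp: u_def\<close>)
qed

end

theorem corollary4p22:
  fixes cL cM hL hM :: complex and p r :: nat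
  assumes "cM \<noteq> 0"
    and "p \<ge> 1" and "2 * hM + (of_nat p ^ 2 - 1) / 12 * cM = 0"
    and "r \<ge> 1" and "hL = h' p r cL"
  shows "\<exists>v. (\<forall>i\<in>{1..r}. v i \<in> UM (i * p))
    \<and> (let u' = T p cL cM ^ r + (\<Sum>i=1..r. v i * T p cL cM ^ (r - i))
       in subsingular hL hM cL cM u'
          \<and> (\<forall>w. subsingular hL hM cL cM w
                \<longrightarrow> (\<exists>a. w - scal a * u' \<in> J' hL hM cL cM)))"
proof -
  interpret w22_atypical p cL cM hL using assms(1,2) by unfold_locales
  have "hM = w22_atypical.hM p cM"
    using assms(3) by (simp add: w22_atypical.hM_def[OF w22_atypical_axioms] field_simps add_eq_0_iff)
  then show ?thesis using subsingular_vector[OF assms(5,4)] by (simp only:)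
qed

end
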